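(* Let $k$ be an algebraically closed field, let $A$ be a $g$-tame finite-dimensional $k$-algebra and let $B$ be a quotient algebra of $A$. If the $\tau$-tilting graph $\mathcal{H}(\tau\text{-tilt}\,A)$ of $A$ is connected, then so is the $\tau$-tilting graph $\mathcal{H}(\tau\text{-tilt}\,B)$ of $B$.
   Context: Conventions: all algebras are basic and finite-dimensional over the algebraically closed field $k$; $\operatorname{mod} A$ is the category of finitely generated right $A$-modules; $|M|$ is the number of pairwise non-isomorphic indecomposable direct summands of $M$. $\tau$-tilting graph. Let $\tau$ be the Auslander-Reiten translation of $\operatorname{mod}A$. A module $M$ is $\tau$-rigid if $\operatorname{Hom}_A(M,\tau M)=0$. A $\tau$-rigid pair is a pair $(M,P)$ with $M$ $\tau$-rigid, $P$ finitely generated projective and $\operatorname{Hom}_A(P,M)=0$; it is indecomposable if $|M|+|P|=1$, and it is a $\tau$-tilting pair if $|M|+|P|=|A|$. $\tau\text{-tilt}\,A$ is the set of (isomorphism classes of) basic $\tau$-tilting pairs. Direct summands are taken componentwise. Every basic $\tau$-rigid pair with $|A|-1$ indecomposable summands is a direct summand of exactly two basic $\tau$-tilting pairs, which are called mutations of each other. The $\tau$-tilting graph $\mathcal{H}(\tau\text{-tilt}\,A)$ has vertex set $\tau\text{-tilt}\,A$, with an edge between two pairs if and only if they are mutations of each other. $g$-tameness. Let $n=|A|$ and let $P(1),\dots,P(n)$ be the indecomposable projective $A$-modules. For a $\tau$-rigid pair $(M,P)$ with $P=\bigoplus_i P(i)^{c_i}$ and minimal projective presentation $\bigoplus_i P(i)^{b_i}\to\bigoplus_i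 P(i)^{a_i}\to M\to 0$, the $g$-vector is $g_{(M,P)}=(a_i-b_i-c_i)_{i=1}^n\in\mathbb{Z}^n$. For a basic $\tau$-tilting pair $(M,P)=\bigoplus_{i=1}^n(M_i,P_i)$ with indecomposable summands $(M_i,P_i)$, put $C_{(M,P)}=\{\sum_{i=1}^n k_i g_{(M_i,P_i)} : k_i\in\mathbb{R}_{\ge 0}\}\subseteq\mathbb{R}^n$. The algebra $A$ is $g$-tame if the closure of $\bigcup_{(M,P)\in\tau\text{-tilt}\,A}C_{(M,P)}$ in $\mathbb{R}^n$ is all of $\mathbb{R}^n$. *)

theory Defs
  imports
    "HOL-Analysis.Abstract_Euclidean_Space"
    "Graph_Theory.Digraph_Component"
    "HOL-Algebra.QuotRing"
    "HOL-Algebra.Algebraic_Closure"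
begin

section \<open>Algebras and right modules\<close>

text \<open>
  A \<open>K\<close>-algebra is stored in the record type \<^typ>\<open>('k, 'a) module\<close>: its ring fields carry the
  ring structure of \<open>A\<close> and \<open>smult\<close> the action of \<open>K\<close>. (The locale \<open>algebra\<close> of HOL-Algebra is
  restricted to commutative \<open>A\<close>.)

  The same record type is used for modules over an algebra, where \<open>a \<odot>\<^bsub>M\<^esub> x\<close> denotes the right
  action \<open>x \<cdot> a\<close>. As usual in HOL-Algebra, the fields \<open>mult\<close> and \<open>one\<close> of a module are irrelevant.
\<close>

definition fin_gen :: "('r, 'm) ring_scheme \<Rightarrow> ('r, 'v, 'n) module_scheme \<Rightarrow> bool" where
  "fin_gen R M \<longleftrightarrow>
    (\<exists>S. finite S \<and> S \<subseteq> carrier M \<and> (\<forall>N. submodule N R M \<and> S \<subseteq> N \<longrightarrow> N = carrier M))"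

locale fd_algebra =
  K?: algebraically_closed K + A?: ring A + Module.module K A
  for K :: "'k ring" and A :: "('k, 'a) module" +
  assumes smult_mult_left: "\<lbrakk>c \<in> carrier K; x \<in> carrier A; y \<in> carrier A\<rbrakk> \<Longrightarrow>
      (c \<odot>\<^bsub>A\<^esub> x) \<otimes>\<^bsub>A\<^esub> y = c \<odot>\<^bsub>A\<^esub> (x \<otimes>\<^bsub>A\<^esub> y)"
    and smult_mult_right: "\<lbrakk>c \<in> carrier K; x \<in> carrier A; y \<in> carrier A\<rbrakk> \<Longrightarrow>
      x \<otimes>\<^bsub>A\<^esub> (c \<odot>\<^bsub>A\<^esub> y) = c \<odot>\<^bsub>A\<^esub> (x \<otimes>\<^bsub>A\<^esub> y)"
    and finite_dimensional: "fin_gen K A"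

locale right_module = A?: ring A + M?: abelian_group M
  for A :: "('k, 'a) module" and M :: "('a, 'v) module" +
  assumes act_closed: "\<lbrakk>a \<in> carrier A; x \<in> carrier M\<rbrakk> \<Longrightarrow> a \<odot>\<^bsub>M\<^esub> x \<in> carrier M"
    and act_add_left: "\<lbrakk>a \<in> carrier A; b \<in> carrier A; x \<in> carrier M\<rbrakk> \<Longrightarrow>
      (a \<oplus>\<^bsub>A\<^esub> b) \<odot>\<^bsub>M\<^esub> x = (a \<odot>\<^bsub>M\<^esub> x) \<oplus>\<^bsub>M\<^esub> (b \<odot>\<^bsub>M\<^esub> x)"
    and act_add_right: "\<lbrakk>a \<in> carrier A; x \<in> carrier M; y \<in> carrier M\<rbrakk> \<Longrightarrow>
      a \<odot>\<^bsub>M\<^esub> (x \<oplus>\<^bsub>M\<^esub> y) = (a \<odot>\<^bsub>M\<^esub> x) \<oplus>\<^bsub>M\<^esub> (a \<odot>\<^bsub>M\<^esub> y)"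
    and act_mult: "\<lbrakk>a \<in> carrier A; b \<in> carrier A; x \<in> carrier M\<rbrakk> \<Longrightarrow>
      (a \<otimes>\<^bsub>A\<^esub> b) \<odot>\<^bsub>M\<^esub> x = b \<odot>\<^bsub>M\<^esub> (a \<odot>\<^bsub>M\<^esub> x)"
    and act_one: "x \<in> carrier M \<Longrightarrow> \<one>\<^bsub>A\<^esub> \<odot>\<^bsub>M\<^esub> x = x"

text \<open>
  Every finite-dimensional \<open>K\<close>-space has a copy with carrier inside \<^typ>\<open>nat \<Rightarrow> 'k\<close>, so this carrier
  type provides a representative of every isomorphism class of finitely generated modules.
\<close>

type_synonym ('k, 'a) fmod = "('a, nat \<Rightarrow> 'k) module"

definition fmods :: "('k, 'a) module \<Rightarrow> ('k, 'a) fmod set" where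
  "fmods A = {M. right_module A M \<and> fin_gen A M}"

definition quot_module :: "('r, 'v) module \<Rightarrow> 'v set \<Rightarrow> ('r, 'v set) module" where
  "quot_module M N =
    \<lparr>carrier = a_rcosets\<^bsub>M\<^esub> N, mult = undefined, one = undefined, zero = N, add = set_add M,
     smult = (\<lambda>a Z. \<Union>x\<in>Z. N +>\<^bsub>M\<^esub> (a \<odot>\<^bsub>M\<^esub> x))\<rparr>"

definition quot_algebra :: "('k, 'a) module \<Rightarrow> 'a set \<Rightarrow> ('k, 'a set) module" where
  "quot_algebra A I =
    \<lparr>carrier = carrier (A Quot I), mult = mult (A Quot I), one = one (A Quot I),
     zero = zero (A Quot I), add = add (A Quot I),
     smult = (\<lambda>c Z. \<Union>x\<in>Z. I +>\<^bsub>A\<^esub> (c \<odot>\<^bsub>A\<^esub> x))\<rparr>"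

text \<open>Left \<open>A\<close>-modules are treated as right modules over the opposite algebra.\<close>

definition opp :: "('k, 'a) module \<Rightarrow> ('k, 'a) module" where
  "opp A = A\<lparr>mult := \<lambda>x y. y \<otimes>\<^bsub>A\<^esub> x\<rparr>"

definition regular :: "('k, 'a) module \<Rightarrow> ('a, 'a) module" where
  "regular A =
    \<lparr>carrier = carrier A, mult = undefined, one = undefined, zero = \<zero>\<^bsub>A\<^esub>, add = add A,
     smult = (\<lambda>a x. x \<otimes>\<^bsub>A\<^esub> a)\<rparr>"

definition restr :: "('r, 'v) module \<Rightarrow> 'v set \<Rightarrow> ('r, 'v) module" where
  "restr M N = M\<lparr>carrier := N\<rparr>"

text \<open>
  Homomorphisms are extensional, so that a homomorphism is determined by its values on the carrier.
\<close>

definition Hom :: "('k, 'a) module \<Rightarrow> ('a, 'v) module \<Rightarrow> ('a, 'w) module \<Rightarrow> ('v \<Rightarrow> 'w) set" where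
  "Hom A M N = {f \<in> carrier M \<rightarrow>\<^sub>E carrier N.
    (\<forall>x\<in>carrier M. \<forall>y\<in>carrier M. f (x \<oplus>\<^bsub>M\<^esub> y) = f x \<oplus>\<^bsub>N\<^esub> f y) \<and>
    (\<forall>a\<in>carrier A. \<forall>x\<in>carrier M. f (a \<odot>\<^bsub>M\<^esub> x) = a \<odot>\<^bsub>N\<^esub> f x)}"

definition Hom_zero :: "('k, 'a) module \<Rightarrow> ('a, 'v) module \<Rightarrow> ('a, 'w) module \<Rightarrow> bool" where
  "Hom_zero A M N \<longleftrightarrow> Hom A M N = {\<lambda>x\<in>carrier M. \<zero>\<^bsub>N\<^esub>}"

definition mod_iso :: "('k, 'a) module \<Rightarrow> ('a, 'v) module \<Rightarrow> ('a, 'w) module \<Rightarrow> bool" where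
  "mod_iso A M N \<longleftrightarrow> (\<exists>f\<in>Hom A M N. bij_betw f (carrier M) (carrier N))"

definition direct_sum :: "'i set \<Rightarrow> ('i \<Rightarrow> ('a, 'v) module) \<Rightarrow> ('a, 'i \<Rightarrow> 'v) module" where
  \<comment> \<open>only used for finite \<open>I\<close>, where it agrees with the direct product\<close>
  "direct_sum I M =
    \<lparr>carrier = (\<Pi>\<^sub>E i\<in>I. carrier (M i)), mult = undefined, one = undefined,
     zero = (\<lambda>i\<in>I. \<zero>\<^bsub>M i\<^esub>), add = (\<lambda>x y. \<lambda>i\<in>I. x i \<oplus>\<^bsub>M i\<^esub> y i),
     smult = (\<lambda>a x. \<lambda>i\<in>I. a \<odot>\<^bsub>M i\<^esub> x i)\<rparr>"


section \<open>Direct summands\<close>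

definition decomposes ::
    "('k, 'a) module \<Rightarrow> ('a, 'v) module \<Rightarrow> 'v set \<Rightarrow> 'v set \<Rightarrow> bool" where
  "decomposes A M N N' \<longleftrightarrow> submodule N A M \<and> submodule N' A M \<and>
    N \<inter> N' = {\<zero>\<^bsub>M\<^esub>} \<and> N <+>\<^bsub>M\<^esub> N' = carrier M"

definition indecomposable :: "('k, 'a) module \<Rightarrow> ('a, 'v) module \<Rightarrow> bool" where
  "indecomposable A M \<longleftrightarrow> carrier M \<noteq> {\<zero>\<^bsub>M\<^esub>} \<and>
    (\<forall>N N'. decomposes A M N N' \<longrightarrow> N = {\<zero>\<^bsub>M\<^esub>} \<or> N' = {\<zero>\<^bsub>M\<^esub>})"

definition indec_summands :: "('k, 'a) module \<Rightarrow> ('a, 'v) module \<Rightarrow> 'v set set" where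
  "indec_summands A M = {N. (\<exists>N'. decomposes A M N N') \<and> indecomposable A (restr M N)}"

definition num_summands :: "('k, 'a) module \<Rightarrow> ('a, 'v) module \<Rightarrow> nat" where
  "num_summands A M = card (indec_summands A M //
    {(N, L). N \<in> indec_summands A M \<and> L \<in> indec_summands A M \<and>
             mod_iso A (restr M N) (restr M L)})"

definition is_summand :: "('k, 'a) module \<Rightarrow> ('a, 'w) module \<Rightarrow> ('a, 'v) module \<Rightarrow> bool" where
  "is_summand A Z M \<longleftrightarrow> (\<exists>N N'. decomposes A M N N' \<and> mod_iso A Z (restr M N))"

definition basic :: "('k, 'a) module \<Rightarrow> ('a, 'v) module \<Rightarrow> bool" where
  "basic A M \<longleftrightarrow> (\<forall>N N'. decomposes A M N N' \<and> indecomposable A (restr M N) \<longrightarrow>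
    \<not> is_summand A (restr M N) (restr M N'))"

definition algebra_rank :: "('k, 'a) module \<Rightarrow> nat" where
  "algebra_rank A = num_summands A (regular A)"


section \<open>Projective presentations and the Auslander--Reiten translation\<close>

definition projective :: "('k, 'a) module \<Rightarrow> ('k, 'a) fmod \<Rightarrow> bool" where
  "projective A P \<longleftrightarrow> P \<in> fmods A \<and>
    (\<forall>Z\<in>fmods A. \<forall>Y\<in>fmods A. \<forall>g\<in>Hom A Z Y. \<forall>h\<in>Hom A P Y.
      g ` carrier Z = carrier Y \<longrightarrow> (\<exists>h'\<in>Hom A P Z. \<forall>x\<in>carrier P. g (h' x) = h x))"

definition projective_cover ::
    "('k, 'a) module \<Rightarrow> ('k, 'a) fmod \<Rightarrow> ((nat \<Rightarrow> 'k) \<Rightarrow> (nat \<Rightarrow> 'k)) \<Rightarrow> ('k, 'a) fmod \<Rightarrow> bool" where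
  "projective_cover A P p M \<longleftrightarrow> projective A P \<and> p \<in> Hom A P M \<and> p ` carrier P = carrier M \<and>
    (\<forall>N. submodule N A P \<and> N <+>\<^bsub>P\<^esub> a_kernel P M p = carrier P \<longrightarrow> N = carrier P)"

text \<open>\<open>P1 \<rightarrow> P0 \<rightarrow> M \<rightarrow> 0\<close> with maps \<open>f\<close> and \<open>p\<close>, both of them projective covers onto their images.\<close>

definition min_proj_presentation ::
    "('k, 'a) module \<Rightarrow> ('k, 'a) fmod \<Rightarrow> ((nat \<Rightarrow> 'k) \<Rightarrow> (nat \<Rightarrow> 'k)) \<Rightarrow>
     ('k, 'a) fmod \<Rightarrow> ((nat \<Rightarrow> 'k) \<Rightarrow> (nat \<Rightarrow> 'k)) \<Rightarrow> ('k, 'a) fmod \<Rightarrow> bool" where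
  "min_proj_presentation A P1 f P0 p M \<longleftrightarrow>
    projective_cover A P0 p M \<and> projective_cover A P1 f (restr P0 (a_kernel P0 M p))"

text \<open>\<open>Hom\<^sub>A(M, A)\<close>, with the left action \<open>(a \<cdot> f)(x) = a f(x)\<close>: a right module over \<open>opp A\<close>.\<close>

definition A_dual :: "('k, 'a) module \<Rightarrow> ('a, 'v) module \<Rightarrow> ('a, 'v \<Rightarrow> 'a) module" where
  "A_dual A M =
    \<lparr>carrier = Hom A M (regular A), mult = undefined, one = undefined,
     zero = (\<lambda>x\<in>carrier M. \<zero>\<^bsub>A\<^esub>), add = (\<lambda>f g. \<lambda>x\<in>carrier M. f x \<oplus>\<^bsub>A\<^esub> g x),
     smult = (\<lambda>a f. \<lambda>x\<in>carrier M. a \<otimes>\<^bsub>A\<^esub> f x)\<rparr>"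

text \<open>
  \<open>D M = Hom\<^sub>K(M, K)\<close> for a right \<open>R\<close>-module \<open>M\<close>, with the left action \<open>(a \<cdot> h)(x) = h(x \<cdot> a)\<close>: a right
  module over \<open>opp R\<close>. The action of a scalar \<open>c\<close> on \<open>M\<close> is that of \<open>c \<cdot> 1\<close> in \<open>R\<close>.
\<close>

definition K_dual ::
    "'k ring \<Rightarrow> ('k, 'a) module \<Rightarrow> ('a, 'v) module \<Rightarrow> ('a, 'v \<Rightarrow> 'k) module" where
  "K_dual K R M =
    \<lparr>carrier = {h \<in> carrier M \<rightarrow>\<^sub>E carrier K.
       (\<forall>x\<in>carrier M. \<forall>y\<in>carrier M. h (x \<oplus>\<^bsub>M\<^esub> y) = h x \<oplus>\<^bsub>K\<^esub> h y) \<and>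
       (\<forall>c\<in>carrier K. \<forall>x\<in>carrier M. h ((c \<odot>\<^bsub>R\<^esub> \<one>\<^bsub>R\<^esub>) \<odot>\<^bsub>M\<^esub> x) = c \<otimes>\<^bsub>K\<^esub> h x)},
     mult = undefined, one = undefined,
     zero = (\<lambda>x\<in>carrier M. \<zero>\<^bsub>K\<^esub>), add = (\<lambda>h h'. \<lambda>x\<in>carrier M. h x \<oplus>\<^bsub>K\<^esub> h' x),
     smult = (\<lambda>a h. \<lambda>x\<in>carrier M. h (a \<odot>\<^bsub>M\<^esub> x))\<rparr>"

text \<open>
  The cokernel of \<open>Hom\<^sub>A(f, A) : Hom\<^sub>A(P0, A) \<rightarrow> Hom\<^sub>A(P1, A)\<close> for some minimal projective presentation;
  well-defined up to isomorphism.
\<close>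

definition Tr ::
    "('k, 'a) module \<Rightarrow> ('k, 'a) fmod \<Rightarrow> ('a, ((nat \<Rightarrow> 'k) \<Rightarrow> 'a) set) module" where
  "Tr A M = (case (SOME (P1, f, P0, p). min_proj_presentation A P1 f P0 p M) of
    (P1, f, P0, p) \<Rightarrow>
      quot_module (A_dual A P1) ((\<lambda>h. compose (carrier P1) h f) ` carrier (A_dual A P0)))"

definition tau ::
    "'k ring \<Rightarrow> ('k, 'a) module \<Rightarrow> ('k, 'a) fmod \<Rightarrow>
     ('a, ((nat \<Rightarrow> 'k) \<Rightarrow> 'a) set \<Rightarrow> 'k) module" where
  "tau K A M = K_dual K (opp A) (Tr A M)"


section \<open>The \<open>\<tau>\<close>-tilting graph\<close>

type_synonym ('k, 'a) fpair = "('k, 'a) fmod \<times> ('k, 'a) fmod"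

definition tau_rigid :: "'k ring \<Rightarrow> ('k, 'a) module \<Rightarrow> ('k, 'a) fmod \<Rightarrow> bool" where
  "tau_rigid K A M \<longleftrightarrow> M \<in> fmods A \<and> Hom_zero A M (tau K A M)"

fun tau_rigid_pair :: "'k ring \<Rightarrow> ('k, 'a) module \<Rightarrow> ('k, 'a) fpair \<Rightarrow> bool" where
  "tau_rigid_pair K A (M, P) \<longleftrightarrow> tau_rigid K A M \<and> projective A P \<and> Hom_zero A P M"

fun pair_size :: "('k, 'a) module \<Rightarrow> ('k, 'a) fpair \<Rightarrow> nat" where
  "pair_size A (M, P) = num_summands A M + num_summands A P"

fun basic_pair :: "('k, 'a) module \<Rightarrow> ('k, 'a) fpair \<Rightarrow> bool" where
  "basic_pair A (M, P) \<longleftrightarrow> basic A M \<and> basic A P"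

fun pair_summand :: "('k, 'a) module \<Rightarrow> ('k, 'a) fpair \<Rightarrow> ('k, 'a) fpair \<Rightarrow> bool" where
  "pair_summand A (N, Q) (M, P) \<longleftrightarrow> is_summand A N M \<and> is_summand A Q P"

definition indec_tau_rigid_pair :: "'k ring \<Rightarrow> ('k, 'a) module \<Rightarrow> ('k, 'a) fpair \<Rightarrow> bool" where
  "indec_tau_rigid_pair K A Z \<longleftrightarrow> tau_rigid_pair K A Z \<and> pair_size A Z = 1"

definition tau_tilting_pairs :: "'k ring \<Rightarrow> ('k, 'a) module \<Rightarrow> ('k, 'a) fpair set" where
  "tau_tilting_pairs K A =
    {Z. tau_rigid_pair K A Z \<and> basic_pair A Z \<and> pair_size A Z = algebra_rank A}"

definition tau_tilting_iso ::
    "'k ring \<Rightarrow> ('k, 'a) module \<Rightarrow> (('k, 'a) fpair \<times> ('k, 'a) fpair) set" where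
  "tau_tilting_iso K A = {(Z, Y). Z \<in> tau_tilting_pairs K A \<and> Y \<in> tau_tilting_pairs K A \<and>
    mod_iso A (fst Z) (fst Y) \<and> mod_iso A (snd Z) (snd Y)}"

definition mutation ::
    "'k ring \<Rightarrow> ('k, 'a) module \<Rightarrow> ('k, 'a) fpair \<Rightarrow> ('k, 'a) fpair \<Rightarrow> bool" where
  "mutation K A Z Y \<longleftrightarrow> Z \<in> tau_tilting_pairs K A \<and> Y \<in> tau_tilting_pairs K A \<and>
    (Z, Y) \<notin> tau_tilting_iso K A \<and>
    (\<exists>U. tau_rigid_pair K A U \<and> basic_pair A U \<and> pair_size A U + 1 = algebra_rank A \<and>
         pair_summand A U Z \<and> pair_summand A U Y)"

text \<open>The undirected graph, as a symmetric digraph on isomorphism classes.\<close>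

definition tau_tilting_graph ::
    "'k ring \<Rightarrow> ('k, 'a) module \<Rightarrow> ('k, 'a) fpair set pair_pre_digraph" where
  "tau_tilting_graph K A =
    \<lparr>pverts = tau_tilting_pairs K A // tau_tilting_iso K A,
     parcs = {(tau_tilting_iso K A `` {Z}, tau_tilting_iso K A `` {Y}) | Z Y. mutation K A Z Y}\<rparr>"


section \<open>\<open>g\<close>-vectors and \<open>g\<close>-tameness\<close>

text \<open>Indices run through \<open>0, \<dots>, n - 1\<close>; vectors of length \<open>n\<close> are extended by \<open>0\<close>.\<close>

definition indec_projectives ::
    "('k, 'a) module \<Rightarrow> (nat \<Rightarrow> ('k, 'a) fmod) \<Rightarrow> bool" where
  "indec_projectives A P \<longleftrightarrow>
    (\<forall>i<algebra_rank A. projective A (P i) \<and> indecomposable A (P i)) \<and>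
    (\<forall>i<algebra_rank A. \<forall>j<algebra_rank A. mod_iso A (P i) (P j) \<longrightarrow> i = j) \<and>
    (\<forall>Q. projective A Q \<and> indecomposable A Q \<longrightarrow> (\<exists>i<algebra_rank A. mod_iso A Q (P i)))"

definition proj_sum ::
    "nat \<Rightarrow> (nat \<Rightarrow> ('k, 'a) fmod) \<Rightarrow> (nat \<Rightarrow> nat) \<Rightarrow> ('a, nat \<times> nat \<Rightarrow> nat \<Rightarrow> 'k) module" where
  "proj_sum n P a = direct_sum (SIGMA i:{..<n}. {..<a i}) (\<lambda>(i, j). P i)"

definition g_vector ::
    "('k, 'a) module \<Rightarrow> (nat \<Rightarrow> ('k, 'a) fmod) \<Rightarrow> ('k, 'a) fpair \<Rightarrow> nat \<Rightarrow> int" where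
  "g_vector A P Z = (THE g. \<exists>a b c P1 f P0 p.
    min_proj_presentation A P1 f P0 p (fst Z) \<and>
    mod_iso A P0 (proj_sum (algebra_rank A) P a) \<and>
    mod_iso A P1 (proj_sum (algebra_rank A) P b) \<and>
    mod_iso A (snd Z) (proj_sum (algebra_rank A) P c) \<and>
    g = (\<lambda>i. if i < algebra_rank A then int (a i) - int (b i) - int (c i) else 0))"

definition g_cone ::
    "'k ring \<Rightarrow> ('k, 'a) module \<Rightarrow> (nat \<Rightarrow> ('k, 'a) fmod) \<Rightarrow> ('k, 'a) fpair \<Rightarrow> (nat \<Rightarrow> real) set" where
  "g_cone K A P T = {v. \<exists>Z k.
    (\<forall>i<algebra_rank A. indec_tau_rigid_pair K A (Z i) \<and> 0 \<le> k i) \<and>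
    mod_iso A (fst T) (direct_sum {..<algebra_rank A} (\<lambda>i. fst (Z i))) \<and>
    mod_iso A (snd T) (direct_sum {..<algebra_rank A} (\<lambda>i. snd (Z i))) \<and>
    v = (\<lambda>j. \<Sum>i<algebra_rank A. k i * real_of_int (g_vector A P (Z i) j))}"

definition g_tame :: "'k ring \<Rightarrow> ('k, 'a) module \<Rightarrow> bool" where
  "g_tame K A \<longleftrightarrow> (\<exists>P. indec_projectives A P \<and>
    Euclidean_space (algebra_rank A) closure_of (\<Union>T\<in>tau_tilting_pairs K A. g_cone K A P T)
      = topspace (Euclidean_space (algebra_rank A)))"

end

theory Submission
  imports Defs "HOL-Library.Function_Algebras"
begin

\<comment> \<open>For a module M with minimal projective presentation P1 -> P0 -> M put theta^M(Y) =
  dim Hom(P0,Y) - dim Hom(P1,Y); this is the g-vector of M paired with the numbers dim Hom(P(i),Y).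
  The kernel of Hom(P0,Y) -> Hom(P1,Y) is Hom(M,Y), and this map is onto exactly when Hom(Y, tau M)
  = 0 (\<open>tau_hom_zero_iff\<close>). Hence theta^M(Y) <= dim Hom(M,Y), with equality exactly
  when Hom(Y, tau M) = 0 (\<open>theta_le\<close>).

  Let t be a positive combination of the theta^M for M in U minus a positive combination of the dim
  Hom(Q,-) for Q in P, where (U,P) is a tau-rigid collection. Then t knows the torsion class of all
  Y with Hom(Y, tau M) = 0 and Hom(Q,Y) = 0: it consists of the modules all of whose quotients have
  t >= 0 (\<open>tors_iff_theta\<close>). It also knows the indecomposables in U
  (\<open>compat_determines\<close>). In particular, two different cones never share a relatively
  interior point, which gives linear independence of the functions belonging to a tau-rigid pair
  (\<open>theta_independent\<close>). From then on tau-tilting pairs are handled by counting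
  dimensions in a space of real functions on mod A: the functions of a tau-tilting pair are a basis
  of the span of the dim Hom(P(i),-).

  For the passage to the quotient B, a tau-tilting pair T = (M,P) over A is sent to the pair over B
  whose module part has the same indecomposable summands as the induced module of M, that is M
  tensored with B (\<open>Phi\<close>). On torsion classes this is intersection with mod B.
  Restricted to B-modules, theta^M becomes theta of the induced module minus dim Hom(Z,-) for a
  projective Z that has no maps to the B-modules in question (\<open>bar_theta\<close>). Since
  restriction maps the span for A onto the span for B, rank counting shows that the image is again
  tau-tilting (\<open>Phi_exists\<close>), and that the common almost complete summand of two
  mutations T, T' yields a tau-rigid pair of corank at most one inside both images, so these are
  equal or mutations of each other (\<open>Phi_mutation\<close>).

  Surjectivity of \<open>Phi\<close> is where g-tameness enters (\<open>Phi_surj\<close>). Given S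
  over B, the interior of its cone pulls back under the linear restriction map to a nonempty open
  set of g-vectors for A. By density this set meets the cone of some T. The resulting functional
  lies in the interior of the cone of S and also comes from the induced summands of T, so
  \<open>compat_determines\<close> identifies S as the image of T (\<open>Phi_surj_core\<close>).
  Finally, two pairs over B have preimages over A; a path between these maps to a path, possibly
  with repetitions (\<open>Phi_reachable\<close>).\<close>
syntax "_index" :: "logic => index" ("\<^sub>_" [1000] 1000)

abbreviation (input) car :: "('a, 'b) partial_object_scheme => 'a set" where "car == carrier"

text \<open>Unlike \<open>Hom\<close>, no extensionality is demanded, so sums and composites of
  homomorphisms are plain lambda terms. \<open>HomI\<close> and \<open>HomD\<close> mediate between
  the two.\<close>

definition is_hom :: "('k, 'a) module => ('a, 'v) module => ('a, 'w) module => ('v => 'w) => bool" where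
 "is_hom A M N f \<longleftrightarrow> f : car M \<rightarrow> car N &
  (ALL x: car M. ALL y: car M. f (x \<oplus>\<^sub>M y) = f x \<oplus>\<^sub>N f y) &
  (ALL a: car A. ALL x: car M. f (a \<odot>\<^sub>M x) = a \<odot>\<^sub>N f x)"

lemma is_homI:
 assumes "!!x. x : car M ==> f x : car N"
  and "!!x y. x : car M ==> y : car M ==> f (x \<oplus>\<^sub>M y) = f x \<oplus>\<^sub>N f y"
  and "!!a x. a : car A ==> x : car M ==> f (a \<odot>\<^sub>M x) = a \<odot>\<^sub>N f x"
 shows "is_hom A M N f"
 using assms unfolding is_hom_def by auto

lemma hom_closed: "is_hom A M N f ==> x : car M ==> f x : car N"
 and hom_add: "is_hom A M N f ==> x : car M ==> y : car M ==> f (x \<oplus>\<^sub>M y) = f x \<oplus>\<^sub>N f y"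
 and hom_act: "is_hom A M N f ==> a : car A ==> x : car M ==> f (a \<odot>\<^sub>M x) = a \<odot>\<^sub>N f x"
 unfolding is_hom_def by auto

section \<open>Right modules, submodules and homomorphisms\<close>

context right_module
begin

lemma act_zero_right [simp]: "a : car A ==> a \<odot>\<^sub>M \<zero>\<^sub>M = \<zero>\<^sub>M"
 using act_add_right[of a "\<zero>\<^sub>M" "\<zero>\<^sub>M"] act_closed[of a "\<zero>\<^sub>M"]
 by (metis M.add.r_cancel_one' M.zero_closed M.l_zero)

lemma act_zero_left [simp]: "x : car M ==> \<zero>\<^sub>A \<odot>\<^sub>M x = \<zero>\<^sub>M"
 using act_add_left[of "\<zero>\<^sub>A" "\<zero>\<^sub>A" x] act_closed[of "\<zero>\<^sub>A" x]
 by (metis M.add.r_cancel_one' A.zero_closed A.l_zero)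

lemma act_minus_right: "a : car A ==> x : car M ==> a \<odot>\<^sub>M (\<ominus>\<^sub>M x) = \<ominus>\<^sub>M (a \<odot>\<^sub>M x)"
 using act_add_right[of a "\<ominus>\<^sub>M x" x] act_closed
 by (metis M.a_inv_closed M.l_neg M.minus_equality act_zero_right)

lemma act_minus_left: "a : car A ==> x : car M ==> (\<ominus>\<^sub>A a) \<odot>\<^sub>M x = \<ominus>\<^sub>M (a \<odot>\<^sub>M x)"
 using act_add_left[of "\<ominus>\<^sub>A a" a x] act_closed
 by (metis A.a_inv_closed A.l_neg M.minus_equality act_zero_left)

lemma submoduleI:
 assumes "H <= car M" "\<zero>\<^sub>M : H"
  and "!!x y. x : H ==> y : H ==> x \<oplus>\<^sub>M y : H"
  and "!!a x. a : car A ==> x : H ==> a \<odot>\<^sub>M x : H"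
 shows "submodule H A M"
proof -
 have "\<ominus>\<^sub>M x : H" if "x : H" for x
  using assms(4)[of "\<ominus>\<^sub>A \<one>\<^sub>A" x] that assms(1) act_minus_left[of "\<one>\<^sub>A" x] act_one[of x] by auto
 thus ?thesis
  using assms by (intro submodule.intro subgroup.intro) (auto simp: a_inv_def submodule_axioms_def)
qed

lemma submoduleD:
 assumes "submodule H A M"
 shows "H <= car M" "\<zero>\<^sub>M : H" "!!x y. x : H ==> y : H ==> x \<oplus>\<^sub>M y : H"
  "!!x. x : H ==> \<ominus>\<^sub>M x : H" "!!x y. x : H ==> y : H ==> x \<ominus>\<^sub>M y : H"
  "!!a x. a : car A ==> x : H ==> a \<odot>\<^sub>M x : H"
proof -
 interpret H: submodule H A M by fact
 show "H <= car M" "\<zero>\<^sub>M : H" using H.subset H.one_closed by auto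
 show 1: "x \<oplus>\<^sub>M y : H" if "x : H" "y : H" for x y using H.m_closed that by auto
 show 2: "\<ominus>\<^sub>M x : H" if "x : H" for x using H.m_inv_closed that by (simp add: a_inv_def)
 show "x \<ominus>\<^sub>M y : H" if "x : H" "y : H" for x y using 1 2 that by (simp add: a_minus_def)
 show "a \<odot>\<^sub>M x : H" if "a : car A" "x : H" for a x using H.smult_closed that by auto
qed

lemma submodule_carrier: "submodule (car M) A M"
 by (rule submoduleI) (auto intro: act_closed)

lemma submodule_zero: "submodule {\<zero>\<^sub>M} A M"
 by (rule submoduleI) auto

lemma submodule_Int: "submodule N A M ==> submodule L A M ==> submodule (N \<inter> L) A M"
 by (rule submoduleI) (auto dest: submoduleD)

lemma set_add_eq: "N <+>\<^sub>M L = {x \<oplus>\<^sub>M y | x y. x : N & y : L}"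
 by (auto simp: set_add_def')

lemma submodule_set_add:
 assumes "submodule N A M" "submodule L A M"
 shows "submodule (N <+>\<^sub>M L) A M"
proof (rule submoduleI)
 note N = submoduleD[OF assms(1)] and L = submoduleD[OF assms(2)]
 show "N <+>\<^sub>M L <= car M" using N(1) L(1) by (auto simp: set_add_eq)
 show "\<zero>\<^sub>M : N <+>\<^sub>M L" using N(2) L(2) M.l_zero[OF M.zero_closed] by (force simp: set_add_eq)
next
 note N = submoduleD[OF assms(1)] and L = submoduleD[OF assms(2)]
 fix x y assume "x : N <+>\<^sub>M L" "y : N <+>\<^sub>M L"
 then obtain a b c d where *: "x = a \<oplus>\<^sub>M b" "y = c \<oplus>\<^sub>M d" "a : N" "c : N" "b : L" "d : L"
  by (auto simp: set_add_eq)
 hence "x \<oplus>\<^sub>M y = (a \<oplus>\<^sub>M c) \<oplus>\<^sub>M (b \<oplus>\<^sub>M d)"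
  using N(1) L(1) by (auto simp: subset_iff M.a_ac)
 with N(3)[OF *(3,4)] L(3)[OF *(5,6)] show "x \<oplus>\<^sub>M y : N <+>\<^sub>M L" by (auto simp: set_add_eq)
next
 note N = submoduleD[OF assms(1)] and L = submoduleD[OF assms(2)]
 fix a x assume "a : car A" "x : N <+>\<^sub>M L"
 thus "a \<odot>\<^sub>M x : N <+>\<^sub>M L"
  using N L by (auto simp: set_add_eq subset_iff) (metis act_add_right)
qed

lemma set_add_mono1: "N <= car M ==> submodule L A M ==> N <= N <+>\<^sub>M L"
 using submoduleD(2) M.r_zero by (force simp: set_add_eq)

lemma diff_eq_zero: "x : car M ==> y : car M ==> x \<ominus>\<^sub>M y = \<zero>\<^sub>M \<longleftrightarrow> x = y"
 by (metis M.a_inv_closed M.add.inv_solve_right' M.l_zero M.minus_eq M.r_neg M.zero_closed)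

lemma add_diff_cancel: "x : car M ==> y : car M ==> y \<oplus>\<^sub>M (x \<ominus>\<^sub>M y) = x"
 by (metis M.a_comm M.a_inv_closed M.add.inv_solve_right' M.minus_closed M.minus_eq)

lemma diff_add_cancel: "x : car M ==> y : car M ==> (x \<oplus>\<^sub>M y) \<ominus>\<^sub>M y = x"
 by (simp add: M.add.inv_solve_right M.minus_eq M.a_assoc M.r_neg)

lemma diff_swap:
 assumes "a : car M" "b : car M" "c : car M" "d : car M" "a \<oplus>\<^sub>M b = c \<oplus>\<^sub>M d"
 shows "a \<ominus>\<^sub>M c = d \<ominus>\<^sub>M b"
proof -
 have "a = (c \<oplus>\<^sub>M d) \<ominus>\<^sub>M b" using diff_add_cancel[of a b] assms by simp
 also have "... = (d \<ominus>\<^sub>M b) \<oplus>\<^sub>M c" using assms by (simp add: M.minus_eq M.a_ac)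
 finally have "a \<ominus>\<^sub>M c = ((d \<ominus>\<^sub>M b) \<oplus>\<^sub>M c) \<ominus>\<^sub>M c" by simp
 thus ?thesis using diff_add_cancel[of "d \<ominus>\<^sub>M b" c] assms by simp
qed

end

lemma right_moduleI:
 assumes "ring A"
  and "!!x y. x : car M ==> y : car M ==> x \<oplus>\<^sub>M y : car M"
  and "\<zero>\<^sub>M : car M"
  and "!!x y z. x : car M ==> y : car M ==> z : car M ==>
   (x \<oplus>\<^sub>M y) \<oplus>\<^sub>M z = x \<oplus>\<^sub>M (y \<oplus>\<^sub>M z)"
  and "!!x y. x : car M ==> y : car M ==> x \<oplus>\<^sub>M y = y \<oplus>\<^sub>M x"
  and "!!x. x : car M ==> \<zero>\<^sub>M \<oplus>\<^sub>M x = x"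
  and "!!x. x : car M ==> EX y: car M. y \<oplus>\<^sub>M x = \<zero>\<^sub>M"
  and "!!a x. a : car A ==> x : car M ==> a \<odot>\<^sub>M x : car M"
  and "!!a b x. a : car A ==> b : car A ==> x : car M ==>
   (a \<oplus>\<^sub>A b) \<odot>\<^sub>M x = (a \<odot>\<^sub>M x) \<oplus>\<^sub>M (b \<odot>\<^sub>M x)"
  and "!!a x y. a : car A ==> x : car M ==> y : car M ==>
   a \<odot>\<^sub>M (x \<oplus>\<^sub>M y) = (a \<odot>\<^sub>M x) \<oplus>\<^sub>M (a \<odot>\<^sub>M y)"
  and "!!a b x. a : car A ==> b : car A ==> x : car M ==>
   (a \<otimes>\<^sub>A b) \<odot>\<^sub>M x = b \<odot>\<^sub>M (a \<odot>\<^sub>M x)"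
  and "!!x. x : car M ==> \<one>\<^sub>A \<odot>\<^sub>M x = x"
 shows "right_module A M"
 by (intro right_module.intro right_module_axioms.intro abelian_groupI assms)

text \<open>Module structures are transported along surjections that respect the operations.\<close>

lemma right_module_image:
 assumes V: "right_module A V" and c: "car Y = f ` car V"
  and z: "f (zero V) = zero Y"
  and a: "!!x y. x : car V ==> y : car V ==> f x \<oplus>\<^sub>Y f y = f (x \<oplus>\<^sub>V y)"
  and s: "!!b x. b : car A ==> x : car V ==> b \<odot>\<^sub>Y f x = f (b \<odot>\<^sub>V x)"
 shows "right_module A Y" and "is_hom A V Y f"
proof -
 interpret V: right_module A V by fact
 have z': "\<zero>\<^sub>Y = f \<zero>\<^sub>V" using z by simp
 have neg: "EX y: car V. f (y \<oplus>\<^sub>V x) = f \<zero>\<^sub>V" if "x : car V" for x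
  using V.M.l_neg[OF that] V.M.a_inv_closed[OF that] by metis
 show "right_module A Y"
 proof (rule right_moduleI)
  show "ring A" by (rule V.A.ring_axioms)
  fix u assume "u : car Y"
  then obtain x where x: "u = f x" "x : car V" using c by auto
  show "\<zero>\<^sub>Y \<oplus>\<^sub>Y u = u" by (simp add: x z' a)
  show "EX y: car Y. y \<oplus>\<^sub>Y u = \<zero>\<^sub>Y" using neg[OF x(2)] x a z' c by auto
  show "b \<odot>\<^sub>Y u : car Y" if "b : car A" for b using that x by (simp add: s c V.act_closed)
  show "\<one>\<^sub>A \<odot>\<^sub>Y u = u" using x by (simp add: s V.act_one)
  show "(b \<oplus>\<^sub>A d) \<odot>\<^sub>Y u = (b \<odot>\<^sub>Y u) \<oplus>\<^sub>Y (d \<odot>\<^sub>Y u)" if "b : car A" "d : car A" for b d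
   using that x by (simp add: s a V.act_closed V.act_add_left)
  show "(b \<otimes>\<^sub>A d) \<odot>\<^sub>Y u = d \<odot>\<^sub>Y (b \<odot>\<^sub>Y u)" if "b : car A" "d : car A" for b d
   using that x by (simp add: s V.act_closed V.act_mult)
  fix v assume "v : car Y"
  then obtain y where y: "v = f y" "y : car V" using c by auto
  show "u \<oplus>\<^sub>Y v : car Y" using x y by (simp add: a c)
  show "u \<oplus>\<^sub>Y v = v \<oplus>\<^sub>Y u" using x y by (simp add: a V.M.a_comm)
  show "b \<odot>\<^sub>Y (u \<oplus>\<^sub>Y v) = (b \<odot>\<^sub>Y u) \<oplus>\<^sub>Y (b \<odot>\<^sub>Y v)" if "b : car A" for b
   using that x y by (simp add: s a V.act_closed V.act_add_right)
  fix w assume "w : car Y"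
  then obtain t where t: "w = f t" "t : car V" using c by auto
  show "(u \<oplus>\<^sub>Y v) \<oplus>\<^sub>Y w = u \<oplus>\<^sub>Y (v \<oplus>\<^sub>Y w)" using x y t by (simp add: a V.M.a_assoc)
 qed (simp add: z' c)
 show "is_hom A V Y f" by (rule is_homI) (auto simp: c a s)
qed

lemma hom_zero:
 assumes "right_module A M" "right_module A N" "is_hom A M N f" shows "f \<zero>\<^sub>M = \<zero>\<^sub>N"
proof -
 interpret M: right_module A M by fact
 interpret N: right_module A N by fact
 have "f (\<zero>\<^sub>A \<odot>\<^sub>M \<zero>\<^sub>M) = \<zero>\<^sub>A \<odot>\<^sub>N f \<zero>\<^sub>M" using assms(3) by (intro hom_act) auto
 thus ?thesis using hom_closed[OF assms(3)] by simp
qed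

lemma hom_neg:
 assumes "right_module A M" "right_module A N" "is_hom A M N f" "x : car M"
 shows "f (\<ominus>\<^sub>M x) = \<ominus>\<^sub>N f x"
proof -
 interpret M: right_module A M by fact
 interpret N: right_module A N by fact
 have "f (\<ominus>\<^sub>M x) \<oplus>\<^sub>N f x = \<zero>\<^sub>N"
  using hom_add[OF assms(3), of "\<ominus>\<^sub>M x" x] hom_zero[OF assms(1-3)] assms(4) by (simp add: M.M.l_neg)
 thus ?thesis using N.M.minus_equality hom_closed[OF assms(3)] assms(4) by simp
qed

lemma hom_diff:
 assumes "right_module A M" "right_module A N" "is_hom A M N f" "x : car M" "y : car M"
 shows "f (x \<ominus>\<^sub>M y) = f x \<ominus>\<^sub>N f y"
proof -
 interpret M: right_module A M by fact
 show ?thesis using assms by (simp add: a_minus_def hom_add hom_neg)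
qed

lemma hom_comp: "is_hom A M N f ==> is_hom A N L g ==> is_hom A M L (%x. g (f x))"
 unfolding is_hom_def by (auto simp: Pi_iff)

lemma hom_comp_o: "is_hom A M N f ==> is_hom A N L g ==> is_hom A M L (g \<circ> f)"
 unfolding is_hom_def by (auto simp: Pi_iff)

lemma hom_id: "is_hom A M M (%x. x)"
 unfolding is_hom_def by auto

lemma hom_zero_fun: "right_module A N ==> is_hom A M N (%x. \<zero>\<^sub>N)"
proof -
 assume "right_module A N"
 then interpret N: right_module A N .
 show ?thesis by (rule is_homI) auto
qed

lemma hom_plus:
 assumes "right_module A N" "is_hom A M N f" "is_hom A M N g"
 shows "is_hom A M N (%x. f x \<oplus>\<^sub>N g x)"
proof -
 interpret N: right_module A N by fact
 show ?thesis
  by (rule is_homI)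
   (auto simp: hom_closed[OF assms(2)] hom_closed[OF assms(3)] hom_add[OF assms(2)] hom_add[OF assms(3)]
    hom_act[OF assms(2)] hom_act[OF assms(3)] N.M.a_ac N.act_add_right)
qed

lemma hom_uminus:
 assumes "right_module A N" "is_hom A M N f" shows "is_hom A M N (%x. \<ominus>\<^sub>N f x)"
proof -
 interpret N: right_module A N by fact
 show ?thesis
  by (rule is_homI) (auto simp: hom_closed[OF assms(2)] hom_add[OF assms(2)]
    hom_act[OF assms(2)] N.act_minus_right N.M.minus_add)
qed

lemma hom_minus:
 assumes "right_module A N" "is_hom A M N f" "is_hom A M N g"
 shows "is_hom A M N (%x. f x \<ominus>\<^sub>N g x)"
 using hom_plus[OF assms(1,2) hom_uminus[OF assms(1,3)]] by (simp add: a_minus_def)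

lemma HomI: "right_module A M ==> is_hom A M N f ==> restrict f (car M) : Hom A M N"
proof -
 assume "right_module A M" and f: "is_hom A M N f"
 then interpret M: right_module A M by simp
 show ?thesis using f unfolding is_hom_def Hom_def by (auto simp: M.act_closed)
qed

lemma HomD: "f : Hom A M N ==> is_hom A M N f"
 unfolding is_hom_def Hom_def by auto

text \<open>About the target only this much is assumed: the zero map into it is a homomorphism. In
  this form the lemma applies directly to \<open>tau K A M\<close>.\<close>

lemma Hom_zero_iff:
 assumes "right_module A M" "is_hom A M N (%_. \<zero>\<^sub>N)"
 shows "Hom_zero A M N \<longleftrightarrow> (ALL f. is_hom A M N f --> (ALL x: car M. f x = \<zero>\<^sub>N))"
proof
 assume l: "Hom_zero A M N"
 show "ALL f. is_hom A M N f --> (ALL x: car M. f x = \<zero>\<^sub>N)"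
 proof (intro allI impI ballI)
  fix f x assume "is_hom A M N f" "x : car M"
  hence "restrict f (car M) = (\<lambda>x\<in> car M. \<zero>\<^sub>N)"
   using HomI[OF assms(1)] l unfolding Hom_zero_def by blast
  with \<open>x : car M\<close> show "f x = \<zero>\<^sub>N" by (metis restrict_apply')
 qed
next
 assume r: "ALL f. is_hom A M N f --> (ALL x: car M. f x = \<zero>\<^sub>N)"
 have "f = (\<lambda>x\<in> car M. \<zero>\<^sub>N)" if "f : Hom A M N" for f
  using r HomD[OF that] that by (auto simp: Hom_def PiE_iff extensional_def fun_eq_iff)
 moreover have "(\<lambda>x\<in> car M. \<zero>\<^sub>N) : Hom A M N"
  by (rule HomI[OF assms])
 ultimately show "Hom_zero A M N" unfolding Hom_zero_def by blast
qed

lemma a_kernel_eq: "a_kernel M N f = {x : car M. f x = \<zero>\<^sub>N}"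
 by (simp add: a_kernel_def' a_kernel_def kernel_def)

lemma submodule_kernel:
 assumes "right_module A M" "right_module A N" "is_hom A M N f"
 shows "submodule (a_kernel M N f) A M"
proof -
 interpret M: right_module A M by fact
 interpret N: right_module A N by fact
 show ?thesis
  by (rule M.submoduleI) (auto simp: a_kernel_eq hom_zero[OF assms] hom_add[OF assms(3)] hom_act[OF assms(3)] M.act_closed)
qed

lemma submodule_image:
 assumes "right_module A M" "right_module A N" "is_hom A M N f" "submodule L A M"
 shows "submodule (f ` L) A N"
proof -
 interpret M: right_module A M by fact
 interpret N: right_module A N by fact
 note L = M.submoduleD[OF assms(4)]
 show ?thesis
 proof (rule N.submoduleI)
  show "f ` L <= car N" using L(1) hom_closed[OF assms(3)] by auto
  show "\<zero>\<^sub>N : f ` L" using L(2) hom_zero[OF assms(1-3)] by force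
  fix x y assume "x : f ` L" "y : f ` L"
  thus "x \<oplus>\<^sub>N y : f ` L" using L(1,3) hom_add[OF assms(3)] by (smt (verit) image_iff subsetD)
 next
  fix a x assume "a : car A" "x : f ` L"
  thus "a \<odot>\<^sub>N x : f ` L" using L(1,6) hom_act[OF assms(3)] by (smt (verit) image_iff subsetD)
 qed
qed

lemma submodule_vimage:
 assumes "right_module A M" "right_module A N" "is_hom A M N f" "submodule L A N"
 shows "submodule {x : car M. f x : L} A M"
proof -
 interpret M: right_module A M by fact
 interpret N: right_module A N by fact
 note L = N.submoduleD[OF assms(4)]
 show ?thesis
  by (rule M.submoduleI) (auto simp: hom_zero[OF assms(1-3)] hom_add[OF assms(3)] hom_act[OF assms(3)] M.act_closed L)
qed

lemma restr_simps [simp]: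
 "car (restr M N) = N" "zero (restr M N) = zero M" "add (restr M N) = add M"
 "smult (restr M N) = smult M" "restr M (car M) = M" "restr (restr M N) L = restr M L"
 by (simp_all add: restr_def)

lemma right_module_restr:
 assumes "right_module A M" "submodule N A M" shows "right_module A (restr M N)"
proof -
 interpret M: right_module A M by fact
 note N = M.submoduleD[OF assms(2)]
 have N1: "x : N ==> x : car M" for x using N(1) by auto
 have neg: "EX y:N. y \<oplus>\<^sub>M x = \<zero>\<^sub>M" if "x : N" for x
  using N(4)[OF that] N1[OF that] M.M.l_neg by blast
 show ?thesis
  by (rule right_moduleI)
   (auto simp: N N1 M.M.a_assoc M.act_mult M.act_one M.act_add_left M.act_add_right
    M.A.ring_axioms neg intro: M.M.a_comm)
qed

lemma restr_set_add [simp]: "S <+>\<^sub>(restr M N) T = S <+>\<^sub>M T"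
 by (simp add: set_add_def' )

lemma submodule_restr_iff:
 assumes "right_module A M" "submodule N A M"
 shows "submodule L A (restr M N) \<longleftrightarrow> submodule L A M & L <= N"
proof -
 interpret M: right_module A M by fact
 interpret R: right_module A "restr M N" using right_module_restr assms by blast
 note N = M.submoduleD[OF assms(2)]
 show ?thesis
 proof
  assume "submodule L A (restr M N)"
  note L = R.submoduleD[OF this]
  show "submodule L A M & L <= N"
   using L N by (auto intro!: M.submoduleI)
 next
  assume *: "submodule L A M & L <= N"
  hence "submodule L A M" by simp
  note L = M.submoduleD[OF this]
  show "submodule L A (restr M N)"
   using L N * by (auto intro!: R.submoduleI)
 qed
qed

lemma hom_restr_cod: "is_hom A V M f ==> f ` car V <= N ==> is_hom A V (restr M N) f"
 unfolding is_hom_def by auto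

lemma hom_restr_cod_D: "is_hom A V (restr M N) f ==> N <= car M ==> is_hom A V M f"
 unfolding is_hom_def by auto

lemma hom_restr_dom: "is_hom A M V f ==> N <= car M ==> is_hom A (restr M N) V f"
 unfolding is_hom_def by (auto simp: Pi_iff subset_iff)

lemma hom_incl: "N <= car M ==> is_hom A (restr M N) M (%x. x)"
 unfolding is_hom_def by auto

lemma hom_to_image: "is_hom A V M f ==> is_hom A V (restr M (f ` car V)) f"
 by (rule hom_restr_cod) auto

lemma inj_on_hom_iff:
 assumes "right_module A M" "right_module A N" "is_hom A M N f"
 shows "inj_on f (car M) \<longleftrightarrow> (ALL x: car M. f x = \<zero>\<^sub>N --> x = \<zero>\<^sub>M)"
proof -
 interpret M: right_module A M by fact
 interpret N: right_module A N by fact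
 show ?thesis
 proof
  assume "inj_on f (car M)"
  thus "ALL x: car M. f x = \<zero>\<^sub>N --> x = \<zero>\<^sub>M"
   using hom_zero[OF assms] by (metis M.M.zero_closed inj_onD)
 next
  assume *: "ALL x: car M. f x = \<zero>\<^sub>N --> x = \<zero>\<^sub>M"
  show "inj_on f (car M)"
  proof (rule inj_onI)
   fix x y assume xy: "x : car M" "y : car M" "f x = f y"
   hence "f (x \<ominus>\<^sub>M y) = \<zero>\<^sub>N"
    using hom_diff[OF assms] hom_closed[OF assms(3)] by (simp add: N.diff_eq_zero)
   hence "x \<ominus>\<^sub>M y = \<zero>\<^sub>M" using * xy by simp
   thus "x = y" using xy by (simp add: M.diff_eq_zero)
  qed
 qed
qed

lemma hom_inverse:
 assumes M: "right_module A M" and f: "is_hom A M N f" "bij_betw f (car M) (car N)"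
 shows "is_hom A N M (inv_into (car M) f)"
proof -
 interpret M: right_module A M by fact
 let ?g = "inv_into (car M) f"
 have g: "?g x : car M" "f (?g x) = x" if "x : car N" for x
  using that f(2) by (auto simp: bij_betw_def inv_into_into f_inv_into_f)
 have gf: "?g (f x) = x" if "x : car M" for x
  using that f(2) by (simp add: bij_betw_def)
 show ?thesis
 proof (rule is_homI)
  show "?g x : car M" if "x : car N" for x using g that by auto
  fix x y assume xy: "x : car N" "y : car N"
  have "x \<oplus>\<^sub>N y = f (?g x \<oplus>\<^sub>M ?g y)" using hom_add[OF f(1)] g xy by simp
  thus "?g (x \<oplus>\<^sub>N y) = ?g x \<oplus>\<^sub>M ?g y" using gf g xy by simp
 next
  fix a x assume xy: "a : car A" "x : car N"
  have "a \<odot>\<^sub>N x = f (a \<odot>\<^sub>M ?g x)" using hom_act[OF f(1)] g xy by simp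
  thus "?g (a \<odot>\<^sub>N x) = a \<odot>\<^sub>M ?g x" using gf g xy M.act_closed by simp
 qed
qed

lemma mod_iso_iff:
 assumes "right_module A M"
 shows "mod_iso A M N \<longleftrightarrow> (EX f. is_hom A M N f & bij_betw f (car M) (car N))"
proof
 assume "mod_iso A M N" thus "EX f. is_hom A M N f & bij_betw f (car M) (car N)"
  unfolding mod_iso_def using HomD by blast
next
 assume "EX f. is_hom A M N f & bij_betw f (car M) (car N)"
 then obtain f where "is_hom A M N f" "bij_betw f (car M) (car N)" by auto
 thus "mod_iso A M N" unfolding mod_iso_def
  by (intro bexI[of _ "restrict f (car M)"]) (auto simp: bij_betw_restrict_eq HomI[OF assms])
qed

lemma mod_iso_refl: "right_module A M ==> mod_iso A M M"
 by (subst mod_iso_iff) (auto intro!: exI[of _ "%x. x"] hom_id simp: bij_betw_def)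

lemma mod_iso_sym: "right_module A M ==> right_module A N ==> mod_iso A M N ==> mod_iso A N M"
 by (auto simp: mod_iso_iff intro: hom_inverse bij_betw_inv_into)

lemma mod_iso_trans:
 "right_module A M ==> right_module A N ==> mod_iso A M N ==> mod_iso A N L ==> mod_iso A M L"
 apply (simp add: mod_iso_iff)
 using hom_comp_o bij_betw_trans by blast

section \<open>Retracts, biproducts and internal decompositions\<close>

definition retract :: "('k, 'a) module => ('a, 'v) module => ('a, 'w) module => bool" where
 "retract A N M \<longleftrightarrow> (EX s r. is_hom A N M s & is_hom A M N r & (ALL x: car N. r (s x) = x))"

lemma retract_refl: "retract A M M"
 unfolding retract_def using hom_id by blast

lemma retract_trans: "retract A L N ==> retract A N M ==> retract A L M"
proof -
 assume "retract A L N" "retract A N M"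
 then obtain s r s' r' where *: "is_hom A L N s" "is_hom A N L r" "ALL x: car L. r (s x) = x"
  "is_hom A N M s'" "is_hom A M N r'" "ALL x: car N. r' (s' x) = x"
  unfolding retract_def by blast
 thus ?thesis unfolding retract_def
  by (intro exI[of _ "%x. s' (s x)"] exI[of _ "%x. r (r' x)"])
   (auto intro: hom_comp simp: hom_closed[OF *(1)])
qed

lemma mod_iso_retract:
 assumes "right_module A M" "mod_iso A M N" shows "retract A M N" "retract A N M"
proof -
 obtain f where f: "is_hom A M N f" "bij_betw f (car M) (car N)" using assms by (auto simp: mod_iso_iff)
 note g = hom_inverse[OF assms(1) f]
 show "retract A M N" unfolding retract_def
  using f g by (intro exI[of _ f] exI[of _ "inv_into (car M) f"]) (auto simp: bij_betw_def)
 show "retract A N M" unfolding retract_def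
  using f g by (intro exI[of _ f] exI[of _ "inv_into (car M) f"]) (auto simp: bij_betw_def f_inv_into_f)
qed

text \<open>The direct sum is given by its injections and projections, so \<open>D\<close> may live
  on any carrier type and internal decompositions and external sums are treated alike.\<close>

definition biprod :: "('k, 'a) module => ('a, 'd) module => ('a, 'v) module => ('a, 'w) module =>
  ('v => 'd) => ('w => 'd) => ('d => 'v) => ('d => 'w) => bool" where
 "biprod A D V Y i j p q \<longleftrightarrow> is_hom A V D i & is_hom A Y D j & is_hom A D V p & is_hom A D Y q &
  (ALL x: car V. p (i x) = x & q (i x) = \<zero>\<^sub>Y) & (ALL y: car Y. q (j y) = y & p (j y) = \<zero>\<^sub>V) &
  (ALL d: car D. d = i (p d) \<oplus>\<^sub>D j (q d))"

lemma biprodD: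
 assumes "biprod A D V Y i j p q"
 shows "is_hom A V D i" "is_hom A Y D j" "is_hom A D V p" "is_hom A D Y q"
  "!!x. x : car V ==> p (i x) = x" "!!x. x : car V ==> q (i x) = \<zero>\<^sub>Y"
  "!!y. y : car Y ==> q (j y) = y" "!!y. y : car Y ==> p (j y) = \<zero>\<^sub>V"
  "!!d. d : car D ==> i (p d) \<oplus>\<^sub>D j (q d) = d"
 using assms unfolding biprod_def by auto

lemma biprod_retract: "biprod A D V Y i j p q ==> retract A V D" "biprod A D V Y i j p q ==> retract A Y D"
 unfolding biprod_def retract_def by blast+

lemma decomposes_biprod:
 assumes "right_module A M" "decomposes A M N L"
 obtains p q where "biprod A M (restr M N) (restr M L) (%x. x) (%x. x) p q"
proof -
 interpret M: right_module A M by fact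
 have N: "submodule N A M" and L: "submodule L A M" and NL: "N \<inter> L = {\<zero>\<^sub>M}" "N <+>\<^sub>M L = car M"
  using assms(2) by (auto simp: decomposes_def)
 note Nd = M.submoduleD[OF N] and Ld = M.submoduleD[OF L]
 have Nc: "x : N ==> x : car M" and Lc: "x : L ==> x : car M" for x using Nd(1) Ld(1) by auto
 have ex: "EX a b. a : N & b : L & d = a \<oplus>\<^sub>M b" if "d : car M" for d
  using that NL(2) by (auto simp: M.set_add_eq)
 then obtain p q where pq: "!!d. d : car M ==> p d : N & q d : L & d = p d \<oplus>\<^sub>M q d" by metis
 \<comment> \<open>The difference a - a' = b' - b lies in both summands, hence is zero. This
   uniqueness makes the components additive and linear.\<close>
 have un: "a = a' & b = b'" if "a : N" "a' : N" "b : L" "b' : L" "a \<oplus>\<^sub>M b = a' \<oplus>\<^sub>M b'" for a a' b b'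
 proof -
  have "a \<ominus>\<^sub>M a' = b' \<ominus>\<^sub>M b"
   using that(5) Lc[OF that(3)] Lc[OF that(4)] Nc[OF that(1)] Nc[OF that(2)] M.diff_swap by blast
  hence "a \<ominus>\<^sub>M a' : N \<inter> L" using Nd(5)[OF that(1,2)] Ld(5)[OF that(4,3)] by auto
  hence "a = a'" using NL(1) that Nc by (simp add: M.diff_eq_zero)
  thus ?thesis using that Nc Lc by (metis M.M.add.l_cancel)
 qed
 have pqe: "p d = a & q d = b" if "d = a \<oplus>\<^sub>M b" "a : N" "b : L" for d a b
  using un[of "p d" a "q d" b] pq[of d] that Nc Lc by auto
 have addpq: "p (x \<oplus>\<^sub>M y) = p x \<oplus>\<^sub>M p y & q (x \<oplus>\<^sub>M y) = q x \<oplus>\<^sub>M q y"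
  if "x : car M" "y : car M" for x y
 proof (rule pqe)
  have c: "p x : car M" "q x : car M" "p y : car M" "q y : car M" using pq that Nc Lc by auto
  have "x \<oplus>\<^sub>M y = (p x \<oplus>\<^sub>M q x) \<oplus>\<^sub>M (p y \<oplus>\<^sub>M q y)" using pq that by metis
  also have "... = p x \<oplus>\<^sub>M p y \<oplus>\<^sub>M (q x \<oplus>\<^sub>M q y)" using c by (simp add: M.M.a_ac)
  finally show "x \<oplus>\<^sub>M y = p x \<oplus>\<^sub>M p y \<oplus>\<^sub>M (q x \<oplus>\<^sub>M q y)" .
 qed (use pq that Nd(3) Ld(3) in auto)
 have actpq: "p (a \<odot>\<^sub>M x) = a \<odot>\<^sub>M p x & q (a \<odot>\<^sub>M x) = a \<odot>\<^sub>M q x"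
  if "a : car A" "x : car M" for a x
 proof (rule pqe)
  have "a \<odot>\<^sub>M x = a \<odot>\<^sub>M (p x \<oplus>\<^sub>M q x)" using pq that by metis
  thus "a \<odot>\<^sub>M x = a \<odot>\<^sub>M p x \<oplus>\<^sub>M a \<odot>\<^sub>M q x" using M.act_add_right pq that Nc Lc by metis
 qed (use pq that Nd(6) Ld(6) in auto)
 have "biprod A M (restr M N) (restr M L) (%x. x) (%x. x) p q"
  unfolding biprod_def
 proof (intro conjI ballI)
  show "is_hom A M (restr M N) p" "is_hom A M (restr M L) q"
   using pq addpq actpq by (auto intro!: is_homI)
  show "is_hom A (restr M N) M (%x. x)" "is_hom A (restr M L) M (%x. x)" using Nd(1) Ld(1) by (auto intro: hom_incl)
  show "d = p d \<oplus>\<^sub>M q d" if "d : car M" for d using pq that by auto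
  show "p x = x" "q x = \<zero>\<^sub>(restr M L)" if "x : car (restr M N)" for x
   using pqe[of x x "\<zero>\<^sub>M"] that Nc Ld(2) by auto
  show "q x = x" "p x = \<zero>\<^sub>(restr M N)" if "x : car (restr M L)" for x
   using pqe[of x "\<zero>\<^sub>M" x] that Lc Nd(2) by auto
 qed
 thus thesis by (rule that)
qed

lemma decomposes_swap: "right_module A M ==> decomposes A M N L ==> decomposes A M L N"
proof -
 assume "right_module A M" and d: "decomposes A M N L"
 then interpret M: right_module A M by simp
 have "N <= car M" "L <= car M" using d M.submoduleD(1) by (auto simp: decomposes_def)
 hence "N <+>\<^sub>M L = L <+>\<^sub>M N" using M.M.a_comm by (auto simp: M.set_add_eq subset_iff) metis+
 thus ?thesis using d by (auto simp: decomposes_def)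
qed

lemma retract_decomposes:
 assumes M: "right_module A M" and N: "right_module A N"
  and s: "is_hom A N M s" and r: "is_hom A M N r" and rs: "!!x. x : car N ==> r (s x) = x"
 shows "decomposes A M (s ` car N) (a_kernel M N r)"
  and "is_hom A N (restr M (s ` car N)) s" "bij_betw s (car N) (s ` car N)"
proof -
 interpret M: right_module A M by fact
 interpret N: right_module A N by fact
 note rc = hom_closed[OF r] and sc = hom_closed[OF s]
 have "x : s ` car N <+>\<^sub>M a_kernel M N r" if "x : car M" for x
 proof -
  have "r (x \<ominus>\<^sub>M s (r x)) = \<zero>\<^sub>N"
   using that rc sc rs by (subst hom_diff[OF M N r]) (auto simp: N.diff_eq_zero)
  moreover have "x = s (r x) \<oplus>\<^sub>M (x \<ominus>\<^sub>M s (r x))" using that rc sc by (simp add: M.add_diff_cancel)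
  ultimately show ?thesis using that rc sc unfolding M.set_add_eq a_kernel_eq by blast
 qed
 moreover have "s ` car N <+>\<^sub>M a_kernel M N r <= car M"
  using sc by (auto simp: M.set_add_eq a_kernel_eq)
 moreover have "s ` car N \<inter> a_kernel M N r = {\<zero>\<^sub>M}"
  using rs hom_zero[OF N M s] hom_zero[OF M N r] by (auto simp: a_kernel_eq image_iff) (metis N.M.zero_closed)
 ultimately show "decomposes A M (s ` car N) (a_kernel M N r)"
  unfolding decomposes_def
  using submodule_image[OF N M s N.submodule_carrier] submodule_kernel[OF M N r] by blast
 show "is_hom A N (restr M (s ` car N)) s" by (rule hom_to_image[OF s])
 show "bij_betw s (car N) (s ` car N)" using rs by (metis inj_on_imp_bij_betw inj_on_inverseI)
qed

text \<open>The complement of the image of the section is the kernel of the retraction. Retracts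
  compose by composing maps, which is why they replace internal summands from here on.\<close>

lemma is_summand_iff_retract:
 assumes M: "right_module A M" and N: "right_module A N"
 shows "is_summand A N M \<longleftrightarrow> retract A N M"
proof
 assume "is_summand A N M"
 then obtain V L where *: "decomposes A M V L" "mod_iso A N (restr M V)" unfolding is_summand_def by auto
 have "retract A N (restr M V)" by (rule mod_iso_retract[OF N *(2)])
 moreover have "retract A (restr M V) M" using decomposes_biprod[OF M *(1)] biprod_retract by metis
 ultimately show "retract A N M" by (rule retract_trans)
next
 assume "retract A N M"
 then obtain s r where *: "is_hom A N M s" "is_hom A M N r" "!!x. x : car N ==> r (s x) = x"
  unfolding retract_def by auto
 show "is_summand A N M" unfolding is_summand_def
  using retract_decomposes[OF M N *] by (auto simp: mod_iso_iff[OF N])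
qed

section \<open>Quotient modules\<close>

lemma quot_module_simps [simp]: "car (quot_module M N) = a_rcosets\<^bsub>M\<^esub> N" "zero (quot_module M N) = N" "add (quot_module M N) = set_add M"
 "smult (quot_module M N) = (%a Z. \<Union>x\<in>Z. N +>\<^sub>M (a \<odot>\<^sub>M x))"
 by (simp_all add: quot_module_def)

context right_module
begin

lemma rcos_mem: "z : N +>\<^sub>M x \<longleftrightarrow> (EX n:N. z = n \<oplus>\<^sub>M x)"
 by (auto simp: a_r_coset_def')

lemma rcos_eq:
 assumes N: "submodule N A M" and x: "x : car M" and y: "y : car M"
 shows "N +>\<^sub>M x = N +>\<^sub>M y \<longleftrightarrow> x \<ominus>\<^sub>M y : N"
proof
 note Nd = submoduleD[OF N]
 assume e: "N +>\<^sub>M x = N +>\<^sub>M y"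
 have "x : N +>\<^sub>M x" unfolding rcos_mem using Nd(2) x by (intro bexI[of _ "\<zero>\<^sub>M"]) auto
 then obtain n where "n : N" "x = n \<oplus>\<^sub>M y" using e rcos_mem by auto
 thus "x \<ominus>\<^sub>M y : N" using diff_add_cancel[of n y] Nd(1) y by auto
next
 note Nd = submoduleD[OF N]
 have sub: "N +>\<^sub>M u <= N +>\<^sub>M v" if "u : car M" "v : car M" "u \<ominus>\<^sub>M v : N" for u v
 proof
  fix z assume "z : N +>\<^sub>M u"
  then obtain n where n: "n : N" "z = n \<oplus>\<^sub>M u" using rcos_mem by auto
  have "z = (n \<oplus>\<^sub>M (u \<ominus>\<^sub>M v)) \<oplus>\<^sub>M v"
   unfolding n(2) using n(1) Nd(1) that(1,2) by (simp add: M.a_assoc M.minus_eq M.l_neg subset_iff)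
  thus "z : N +>\<^sub>M v" using Nd(3)[OF n(1) that(3)] rcos_mem by auto
 qed
 assume d: "x \<ominus>\<^sub>M y : N"
 have "y \<ominus>\<^sub>M x : N" using Nd(4)[OF d] x y by (simp add: M.minus_eq M.minus_add M.a_comm)
 thus "N +>\<^sub>M x = N +>\<^sub>M y" using sub d x y by blast
qed

lemma quot_module_right_module:
 assumes N: "submodule N A M"
 shows "right_module A (quot_module M N)" "is_hom A M (quot_module M N) (%x. N +>\<^sub>M x)"
  "car (quot_module M N) = (%x. N +>\<^sub>M x) ` car M" "a_kernel M (quot_module M N) (%x. N +>\<^sub>M x) = N"
proof -
 note Nd = submoduleD[OF N]
 show c: "car (quot_module M N) = (%x. N +>\<^sub>M x) ` car M" by (auto simp: A_RCOSETS_def')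
 have z: "N +>\<^sub>M \<zero>\<^sub>M = N" using Nd(1) by (auto simp: rcos_mem subset_iff)
 have a: "(N +>\<^sub>M x) \<oplus>\<^sub>(quot_module M N) (N +>\<^sub>M y) = N +>\<^sub>M (x \<oplus>\<^sub>M y)" if "x : car M" "y : car M" for x y
 proof (rule equalityI; rule subsetI)
  fix w assume "w : (N +>\<^sub>M x) \<oplus>\<^sub>(quot_module M N) (N +>\<^sub>M y)"
  then obtain n m where nm: "n : N" "m : N" "w = (n \<oplus>\<^sub>M x) \<oplus>\<^sub>M (m \<oplus>\<^sub>M y)" by (auto simp: set_add_eq rcos_mem)
  hence "w = (n \<oplus>\<^sub>M m) \<oplus>\<^sub>M (x \<oplus>\<^sub>M y)" using that Nd(1) by (simp add: M.a_ac subset_iff)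
  thus "w : N +>\<^sub>M (x \<oplus>\<^sub>M y)" using Nd(3)[OF nm(1,2)] by (auto simp: rcos_mem)
 next
  fix w assume "w : N +>\<^sub>M (x \<oplus>\<^sub>M y)"
  then obtain n where n: "n : N" "w = n \<oplus>\<^sub>M (x \<oplus>\<^sub>M y)" by (auto simp: rcos_mem)
  hence "w = (n \<oplus>\<^sub>M x) \<oplus>\<^sub>M (\<zero>\<^sub>M \<oplus>\<^sub>M y)" using that Nd(1) by (simp add: M.a_ac subset_iff)
  moreover have "n \<oplus>\<^sub>M x : N +>\<^sub>M x" "\<zero>\<^sub>M \<oplus>\<^sub>M y : N +>\<^sub>M y" using n(1) Nd(2) unfolding rcos_mem by blast+
  ultimately show "w : (N +>\<^sub>M x) \<oplus>\<^sub>(quot_module M N) (N +>\<^sub>M y)" unfolding quot_module_simps set_add_eq by blast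
 qed
 have s: "b \<odot>\<^sub>(quot_module M N) (N +>\<^sub>M x) = N +>\<^sub>M (b \<odot>\<^sub>M x)" if b: "b : car A" and x: "x : car M" for b x
 proof -
  have "N +>\<^sub>M (b \<odot>\<^sub>M z) = N +>\<^sub>M (b \<odot>\<^sub>M x)" if "z : N +>\<^sub>M x" for z
  proof -
   obtain n where n: "n : N" "z = n \<oplus>\<^sub>M x" using \<open>z : N +>\<^sub>M x\<close> rcos_mem by auto
   have nc: "n : car M" using n(1) Nd(1) by auto
   have "b \<odot>\<^sub>M z \<ominus>\<^sub>M b \<odot>\<^sub>M x = b \<odot>\<^sub>M n"
    using n(2) nc x b act_closed diff_add_cancel by (simp add: act_add_right)
   hence "b \<odot>\<^sub>M z \<ominus>\<^sub>M b \<odot>\<^sub>M x : N" using Nd(6)[OF b n(1)] by simp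
   thus ?thesis using rcos_eq[OF N] n(2) nc x b act_closed by simp
  qed
  hence "(\<Union>z\<in>N +>\<^sub>M x. N +>\<^sub>M (b \<odot>\<^sub>M z)) = (\<Union>z\<in>N +>\<^sub>M x. N +>\<^sub>M (b \<odot>\<^sub>M x))"
   by (rule SUP_cong[OF refl])
  moreover have "x : N +>\<^sub>M x" unfolding rcos_mem using Nd(2) x by (intro bexI[of _ "\<zero>\<^sub>M"]) auto
  hence "(\<Union>z\<in>N +>\<^sub>M x. N +>\<^sub>M (b \<odot>\<^sub>M x)) = N +>\<^sub>M (b \<odot>\<^sub>M x)" by blast
  ultimately show ?thesis unfolding quot_module_simps by simp
 qed
 have z': "N +>\<^sub>M \<zero>\<^sub>M = zero (quot_module M N)" using z by simp
 show "right_module A (quot_module M N)" "is_hom A M (quot_module M N) (%x. N +>\<^sub>M x)"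
  using right_module_image[OF right_module_axioms c z' a s] by auto
 show "a_kernel M (quot_module M N) (%x. N +>\<^sub>M x) = N"
 proof -
  have m0: "\<ominus>\<^sub>M \<zero>\<^sub>M = \<zero>\<^sub>M" by (metis M.l_zero M.minus_equality M.zero_closed)
  have "N +>\<^sub>M x = N \<longleftrightarrow> x : N" if "x : car M" for x
   using rcos_eq[OF N that M.zero_closed] z that by (simp add: M.minus_eq m0)
  thus ?thesis using Nd(1) by (auto simp: a_kernel_eq)
 qed
qed

end

text \<open>Each coset is replaced by a chosen representative, so the quotient stays on the carrier
  type of \<open>V\<close>; quotients of modules of type \<open>fmod\<close> are then again of that
  type.\<close>

lemma quotient_exists:
 fixes V :: "('a, 'v) module"
 assumes V: "right_module A V" and N: "submodule N A V"
 obtains Q :: "('a, 'v) module" and q where "right_module A Q" "is_hom A V Q q" "q ` car V = car Q"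
  "a_kernel V Q q = N"
proof -
 interpret V: right_module A V by fact
 let ?W = "quot_module V N" and ?c = "%x. N +>\<^sub>V x"
 note W = V.quot_module_right_module[OF N]
 define q where "q = (%x. SOME y. y : car V & ?c y = ?c x)"
 define Q where "Q = (\<lparr>carrier = q ` car V, mult = undefined, one = undefined, zero = q \<zero>\<^sub>V,
  add = (%u v. q (u \<oplus>\<^sub>V v)), smult = (%a u. q (a \<odot>\<^sub>V u))\<rparr> :: ('a, 'v) module)"
 have qq: "q x : car V" "?c (q x) = ?c x" if "x : car V" for x
  unfolding q_def using someI[of "%y. y : car V & ?c y = ?c x" x] that by auto
 have qeq: "q x = q y" if "?c x = ?c y" for x y unfolding q_def that ..
 have 1: "right_module A Q" and 2: "is_hom A V Q q"
  by (rule right_module_image[OF V, of Q q];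
   auto simp: Q_def qq hom_add[OF W(2)] hom_act[OF W(2)] V.act_closed simp del: quot_module_simps intro!: qeq)+
 have "q x = q \<zero>\<^sub>V \<longleftrightarrow> x : N" if "x : car V" for x
 proof -
  have "q x = q \<zero>\<^sub>V \<longleftrightarrow> ?c x = ?c \<zero>\<^sub>V" using qeq qq(2)[OF that] qq(2)[OF V.M.zero_closed] by metis
  also have "... \<longleftrightarrow> ?c x = \<zero>\<^sub>?W" by (simp only: hom_zero[OF V W(1,2)])
  also have "... \<longleftrightarrow> x : N" using W(4) that unfolding a_kernel_eq by blast
  finally show ?thesis .
 qed
 hence "a_kernel V Q q = N" using V.submoduleD(1)[OF N] by (auto simp: a_kernel_eq Q_def)
 thus thesis using that[OF 1 2] by (auto simp: Q_def)
qed

section \<open>Length of modules by chains of submodules\<close>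

definition haschain :: "('k, 'a) module => ('a, 'v) module => nat => bool" where
 "haschain R V n \<longleftrightarrow> (EX C. (ALL i<=n. submodule (C i) R V) & (ALL i<n. C i < C (Suc i)))"

definition flen :: "('k, 'a) module => ('a, 'v) module => bool" where
 "flen R V \<longleftrightarrow> (EX b. ALL n. haschain R V n --> n <= b)"

text \<open>\<open>GREATEST\<close> has its intended meaning under \<open>flen\<close>. Over the
  field \<open>Ka K\<close> the length is the vector space dimension, and no bases have to be
  handled.\<close>

definition len :: "('k, 'a) module => ('a, 'v) module => nat" where
 "len R V = (GREATEST n. haschain R V n)"

lemma haschain_0: "right_module R V ==> haschain R V 0"
 unfolding haschain_def using right_module.submodule_carrier by fastforce

lemma len_chain: "right_module R V ==> flen R V ==> haschain R V (len R V)"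
 unfolding len_def flen_def by (metis GreatestI_nat haschain_0)

lemma le_len: "flen R V ==> haschain R V n ==> n <= len R V"
 unfolding len_def flen_def by (metis Greatest_le_nat)

text \<open>Dropping the repetitions from a weakly increasing chain leaves as many strict steps as
  counted. This serves for the traces and images of a chain, where strictness may be lost.\<close>

lemma haschain_weak:
 assumes "!!i. i <= n ==> submodule (C i) R V" "!!i. i < n ==> C i <= C (Suc i)"
 shows "haschain R V (card {i. i < n & C i ~= C (Suc i)})"
proof -
 have "EX D. (ALL i<=card {i. i < m & C i ~= C (Suc i)}. submodule (D i) R V) &
  (ALL i<card {i. i < m & C i ~= C (Suc i)}. D i < D (Suc i)) & D (card {i. i < m & C i ~= C (Suc i)}) = C m"
  if "m <= n" for m
  using that
 proof (induction m)
  case 0 thus ?case by (auto intro!: exI[of _ "%_. C 0"] assms)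
 next
  case (Suc m)
  let ?k = "card {i. i < m & C i ~= C (Suc i)}"
  obtain D where D: "ALL i<=?k. submodule (D i) R V" "ALL i<?k. D i < D (Suc i)" "D ?k = C m"
   using Suc by auto
  show ?case
  proof (cases "C m = C (Suc m)")
   case True
   hence "{i. i < Suc m & C i ~= C (Suc i)} = {i. i < m & C i ~= C (Suc i)}" using less_Suc_eq by auto
   thus ?thesis using D True by auto
  next
   case False
   hence *: "{i. i < Suc m & C i ~= C (Suc i)} = insert m {i. i < m & C i ~= C (Suc i)}" using less_Suc_eq by auto
   have **: "card {i. i < Suc m & C i ~= C (Suc i)} = Suc ?k" unfolding * by simp
   have ss: "C m < C (Suc m)" using assms(2)[of m] False Suc.prems by auto
   let ?E = "%i. if i <= ?k then D i else C (Suc m)"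
   have "submodule (?E i) R V" for i using D(1) assms(1)[OF Suc.prems] by simp
   moreover have "?E i < ?E (Suc i)" if "i < Suc ?k" for i
    using D(2,3) ss that by (cases "i = ?k") auto
   ultimately show ?thesis unfolding ** by (intro exI[of _ ?E]) simp
  qed
 qed
 from this[of n] show ?thesis unfolding haschain_def by auto
qed

lemma a_kernel_subset: "a_kernel V W f <= car V"
 by (auto simp: a_kernel_eq)

text \<open>A chain inside the kernel is continued by the preimages of a chain in \<open>W\<close>.
  The junction from index a to a + 1 is strict because the kernel is contained in every
  preimage.\<close>

lemma haschain_exact_ge:
 assumes V: "right_module R V" and W: "right_module R W" and f: "is_hom R V W f" "f ` car V = car W"
  and a: "haschain R (restr V (a_kernel V W f)) a" and b: "haschain R W b"
 shows "haschain R V (a + b)"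
proof -
 let ?K = "a_kernel V W f"
 note kk = submodule_kernel[OF V W f(1)]
 obtain C where C: "!!i. i <= a ==> submodule (C i) R (restr V ?K)" "!!i. i < a ==> C i < C (Suc i)"
  using a unfolding haschain_def by auto
 obtain D where D: "!!i. i <= b ==> submodule (D i) R W" "!!i. i < b ==> D i < D (Suc i)"
  using b unfolding haschain_def by auto
 have C': "submodule (C i) R V" "C i <= ?K" if "i <= a" for i
  using C(1)[OF that] submodule_restr_iff[OF V kk] by auto
 interpret W: right_module R W by fact
 let ?E = "%i. {x : car V. f x : D i}"
 have E: "submodule (?E i) R V" "?K <= ?E i" if "i <= b" for i
  using submodule_vimage[OF V W f(1) D(1)[OF that]] W.submoduleD(2)[OF D(1)[OF that]] by (auto simp: a_kernel_eq)
 have E2: "?E i < ?E (Suc i)" if ib: "i < b" for i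
 proof -
  obtain y where y: "y : D (Suc i)" "y ~: D i" using D(2)[OF ib] by blast
  hence "y : car W" using W.submoduleD(1)[OF D(1)[of "Suc i"]] ib by auto
  then obtain x where x: "x : car V" "y = f x" using f(2) by blast
  with y have "x : ?E (Suc i)" "x ~: ?E i" by auto
  thus ?thesis using D(2)[OF ib] by blast
 qed
 define F where "F = (%i. if i <= a then C i else ?E (i - a))"
 show ?thesis unfolding haschain_def
 proof (intro exI[of _ F] conjI allI impI)
  fix i assume "i <= a + b" thus "submodule (F i) R V"
   unfolding F_def using C'(1) E(1)[of "i - a"] by auto
 next
  fix i assume i: "i < a + b"
  consider "i < a" | "i = a" "b > 0" | "i > a" using i by linarith
  thus "F i < F (Suc i)"
  proof cases
   case 1 thus ?thesis using C(2) by (simp add: F_def)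
  next
   case 2 thus ?thesis using C'(2)[of a] E(2)[of 0] E2[of 0] by (auto simp: F_def)
  next
   case 3 thus ?thesis using E2[of "i - a"] i by (simp add: F_def Suc_diff_le)
  qed
 qed
qed

text \<open>By the modular law, two nested submodules with the same intersection with the kernel and
  the same image coincide. So every strict step survives in the kernel or in the image.\<close>

lemma haschain_exact_le:
 assumes V: "right_module R V" and W: "right_module R W" and f: "is_hom R V W f" "f ` car V = car W"
  and n: "haschain R V n"
 obtains a b where "n <= a + b" "haschain R (restr V (a_kernel V W f)) a" "haschain R W b"
proof -
 interpret V: right_module R V by fact
 interpret W: right_module R W by fact
 let ?K = "a_kernel V W f"
 note kk = submodule_kernel[OF V W f(1)]
 obtain C where C: "!!i. i <= n ==> submodule (C i) R V" "!!i. i < n ==> C i < C (Suc i)"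
  using n unfolding haschain_def by auto
 let ?a = "{i. i < n & C i \<inter> ?K ~= C (Suc i) \<inter> ?K}" and ?b = "{i. i < n & f ` C i ~= f ` C (Suc i)}"
 have "haschain R (restr V ?K) (card ?a)"
  by (rule haschain_weak) (use C kk in \<open>auto simp: submodule_restr_iff[OF V kk] intro: V.submodule_Int\<close>)
 moreover have "haschain R W (card ?b)"
  by (rule haschain_weak) (use C in \<open>auto intro: submodule_image[OF V W f(1)]\<close>)
 moreover have "{..<n} <= ?a \<union> ?b"
 proof
  fix i assume i: "i : {..<n}"
  show "i : ?a \<union> ?b"
  proof (rule ccontr)
   assume "i ~: ?a \<union> ?b"
   hence e: "C i \<inter> ?K = C (Suc i) \<inter> ?K" "f ` C i = f ` C (Suc i)" using i by auto
   note c0 = V.submoduleD[OF C(1)[of i]] and c1 = V.submoduleD[OF C(1)[of "Suc i"]]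
   have "C (Suc i) <= C i"
   proof
    fix x assume x: "x : C (Suc i)"
    then obtain y where y: "y : C i" "f x = f y" using e(2) by auto
    have xc: "x : car V" "y : car V" using c0(1) c1(1) x y i by auto
    have "y : C (Suc i)" using y C(2)[of i] i by auto
    hence "x \<ominus>\<^sub>V y : C (Suc i)" using c1(5) x i by auto
    moreover have "x \<ominus>\<^sub>V y : ?K" using xc y hom_closed[OF f(1)]
     by (auto simp: a_kernel_eq hom_diff[OF V W f(1)] W.diff_eq_zero)
    ultimately have "x \<ominus>\<^sub>V y : C i" using e by auto
    hence "y \<oplus>\<^sub>V (x \<ominus>\<^sub>V y) : C i" using c0(3) y i by auto
    thus "x : C i" using xc by (simp add: V.add_diff_cancel)
   qed
   thus False using C(2)[of i] i by auto
  qed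
 qed
 hence "card {..<n} <= card (?a \<union> ?b)" by (intro card_mono) auto
 hence "n <= card ?a + card ?b" using card_Un_le[of ?a ?b] by simp
 ultimately show thesis by (intro that)
qed

lemma
 assumes V: "right_module R V" and W: "right_module R W" and f: "is_hom R V W f" "f ` car V = car W"
 shows flen_exact: "flen R V \<longleftrightarrow> flen R (restr V (a_kernel V W f)) & flen R W"
  and len_exact: "flen R V ==> len R V = len R (restr V (a_kernel V W f)) + len R W"
proof -
 let ?U = "restr V (a_kernel V W f)"
 have U: "right_module R ?U" by (rule right_module_restr[OF V submodule_kernel[OF V W f(1)]])
 note ge = haschain_exact_ge[OF V W f] and le = haschain_exact_le[OF V W f]
 show fl: "flen R V \<longleftrightarrow> flen R ?U & flen R W"
 proof
  assume fV: "flen R V"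
  have "flen R ?U" using ge[OF _ haschain_0[OF W]] fV unfolding flen_def by auto
  moreover have "flen R W" using ge[OF haschain_0[OF U]] fV unfolding flen_def by auto
  ultimately show "flen R ?U & flen R W" by simp
 next
  assume *: "flen R ?U & flen R W"
  have "n <= len R ?U + len R W" if n: "haschain R V n" for n
  proof -
   obtain a b where "n <= a + b" "haschain R ?U a" "haschain R W b" by (rule le[OF n])
   thus ?thesis using le_len[of R ?U a] le_len[of R W b] * by linarith
  qed
  thus "flen R V" unfolding flen_def by auto
 qed
 assume fV: "flen R V"
 hence *: "flen R ?U" "flen R W" using fl by auto
 obtain a b where ab: "len R V <= a + b" "haschain R ?U a" "haschain R W b" by (rule le[OF len_chain[OF V fV]])
 hence "len R V <= len R ?U + len R W" using le_len[of R ?U a] le_len[of R W b] * by linarith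
 moreover have "len R ?U + len R W <= len R V"
  using le_len[OF fV ge[OF len_chain[OF U *(1)] len_chain[OF W *(2)]]] .
 ultimately show "len R V = len R ?U + len R W" by simp
qed

lemma
 assumes V: "right_module R V" and z: "car V = {\<zero>\<^sub>V}"
 shows flen_zero: "flen R V" and len_zero: "len R V = 0"
proof -
 have z0: "n = 0" if "haschain R V n" for n
 proof (rule ccontr)
  assume "n ~= 0"
  obtain C where "ALL i<=n. submodule (C i) R V" "ALL i<n. C i < C (Suc i)"
   using \<open>haschain R V n\<close> unfolding haschain_def by auto
  with \<open>n ~= 0\<close> have C: "submodule (C 0) R V" "submodule (C 1) R V" "C 0 < C 1"
   by (simp_all add: Suc_le_eq)
  thus False using right_module.submoduleD(1,2)[OF V C(1)] right_module.submoduleD(1,2)[OF V C(2)] z by auto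
 qed
 show f: "flen R V" unfolding flen_def using z0 by blast
 show "len R V = 0" using len_chain[OF V f] z0 by auto
qed

lemma
 assumes V: "right_module R V" and W: "right_module R W" and f: "is_hom R V W f" "bij_betw f (car V) (car W)"
 shows flen_iso: "flen R V \<longleftrightarrow> flen R W" and len_iso: "flen R V ==> len R V = len R W"
proof -
 interpret V: right_module R V by fact
 have s: "f ` car V = car W" using f(2) by (simp add: bij_betw_def)
 have k: "a_kernel V W f = {\<zero>\<^sub>V}"
  using inj_on_hom_iff[OF V W f(1)] hom_zero[OF V W f(1)] f(2) by (auto simp: a_kernel_eq bij_betw_def)
 have r: "right_module R (restr V {\<zero>\<^sub>V})" by (rule right_module_restr[OF V V.submodule_zero])
 show "flen R V \<longleftrightarrow> flen R W" using flen_exact[OF V W f(1) s] flen_zero[OF r] by (simp add: k)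
 show "flen R V ==> len R V = len R W" using len_exact[OF V W f(1) s] len_zero[OF r] by (simp add: k)
qed

lemma
 fixes V :: "('a, 'v) module"
 assumes V: "right_module R V" and N: "submodule N R V" and fV: "flen R V"
 shows flen_restr: "flen R (restr V N)" and len_restr_le: "len R (restr V N) <= len R V"
  and len_restr_less: "N ~= car V ==> len R (restr V N) < len R V"
proof -
 interpret V: right_module R V by fact
 have r: "right_module R (restr V N)" by (rule right_module_restr[OF V N])
 obtain Q :: "('a, 'v) module" and q where q: "right_module R Q" "is_hom R V Q q" "q ` car V = car Q" "a_kernel V Q q = N"
  by (rule quotient_exists[OF V N])
 show fr: "flen R (restr V N)" using flen_exact[OF V q(1,2,3)] fV q(4) by auto
 show "len R (restr V N) <= len R V" using len_exact[OF V q(1,2,3) fV] q(4) by auto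
 assume ne: "N ~= car V"
 obtain C where C: "!!i. i <= len R (restr V N) ==> submodule (C i) R (restr V N)" "!!i. i < len R (restr V N) ==> C i < C (Suc i)"
  using len_chain[OF r fr] unfolding haschain_def by auto
 \<comment> \<open>A longest chain inside \<open>N\<close> is prolonged by \<open>V\<close>
   itself.\<close>
 have "haschain R V (Suc (len R (restr V N)))" unfolding haschain_def
 proof (intro exI[of _ "%i. if i <= len R (restr V N) then C i else car V"] conjI allI impI)
  fix i assume "i < Suc (len R (restr V N))"
  thus "(if i <= len R (restr V N) then C i else car V) < (if Suc i <= len R (restr V N) then C (Suc i) else car V)"
   using C(2)[of i] C(1)[of i] submodule_restr_iff[OF V N] ne V.submoduleD(1)[OF N] by auto
 qed (use C(1) submodule_restr_iff[OF V N] V.submodule_carrier in auto)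
 thus "len R (restr V N) < len R V" using le_len[OF fV] by fastforce
qed

lemma len_restr_mono:
 assumes V: "right_module R V" and fV: "flen R V" and N: "submodule N R V" "submodule L R V" "N < L"
 shows "len R (restr V N) < len R (restr V L)"
 using len_restr_less[OF right_module_restr[OF V N(2)], of N] submodule_restr_iff[OF V N(2)] flen_restr[OF V N(2) fV] N
 by auto

lemma len_eq_0_iff:
 assumes V: "right_module R V" and fV: "flen R V"
 shows "len R V = 0 \<longleftrightarrow> car V = {\<zero>\<^sub>V}"
 using len_zero[OF V] len_restr_less[OF V right_module.submodule_zero[OF V] fV] by (metis not_less_zero)

lemma
 assumes V: "right_module R V" and W: "right_module R W" and f: "is_hom R V W f" and fV: "flen R V" "flen R W"
 shows inj_len_le: "inj_on f (car V) ==> len R V <= len R W"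
  and surj_len_le: "f ` car V = car W ==> len R W <= len R V"
  and inj_imp_surj: "inj_on f (car V) ==> len R W <= len R V ==> f ` car V = car W"
  and surj_imp_inj: "f ` car V = car W ==> len R V <= len R W ==> inj_on f (car V)"
proof -
 interpret V: right_module R V by fact
 have im: "submodule (f ` car V) R W" by (rule submodule_image[OF V W f V.submodule_carrier])
 { assume inj: "inj_on f (car V)"
  have e: "len R V = len R (restr W (f ` car V))"
   by (rule len_iso[OF V right_module_restr[OF W im] hom_to_image[OF f]])
    (use inj fV in \<open>auto simp: bij_betw_def\<close>)
  thus "len R V <= len R W" using len_restr_le[OF W im fV(2)] by simp
  assume "len R W <= len R V"
  thus "f ` car V = car W" using len_restr_less[OF W im fV(2)] e by fastforce }
 { assume s: "f ` car V = car W"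
  let ?U = "restr V (a_kernel V W f)"
  note kk = submodule_kernel[OF V W f]
  have e: "len R V = len R ?U + len R W" by (rule len_exact[OF V W f s fV(1)])
  thus "len R W <= len R V" by simp
  assume "len R V <= len R W"
  hence "len R ?U = 0" using e by simp
  hence "a_kernel V W f = {\<zero>\<^sub>V}"
   using len_eq_0_iff[OF right_module_restr[OF V kk] flen_restr[OF V kk fV(1)]] by simp
  thus "inj_on f (car V)" unfolding inj_on_hom_iff[OF V W f] by (auto simp: a_kernel_eq) }
qed

text \<open>Modulo \<open>N\<close> the sum is an image of \<open>U\<close>, so additivity of length
  applies.\<close>

lemma flen_sum:
 fixes V :: "('a, 'v) module"
 assumes V: "right_module R V" and N: "submodule N R V" "flen R (restr V N)"
  and U: "right_module R U" "flen R U" and f: "is_hom R U V f"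
 shows "flen R (restr V (N <+>\<^sub>V f ` car U))"
proof -
 interpret V: right_module R V by fact
 interpret U: right_module R U by fact
 have im: "submodule (f ` car U) R V" by (rule submodule_image[OF U(1) V f U.submodule_carrier])
 let ?S = "N <+>\<^sub>V f ` car U"
 have S: "submodule ?S R V" by (rule V.submodule_set_add[OF N(1) im])
 have NS: "N <= ?S" by (rule V.set_add_mono1[OF V.submoduleD(1)[OF N(1)] im])
 have fS: "f ` car U <= ?S"
  using V.submoduleD(2)[OF N(1)] hom_closed[OF f] by (force simp: V.set_add_eq)
 let ?W = "restr V ?S"
 have W: "right_module R ?W" by (rule right_module_restr[OF V S])
 have N': "submodule N R ?W" using submodule_restr_iff[OF V S] NS N by auto
 obtain Q :: "('a, 'v) module" and q where q: "right_module R Q" "is_hom R ?W Q q" "q ` car ?W = car Q" "a_kernel ?W Q q = N"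
  by (rule quotient_exists[OF W N'])
 have qf: "is_hom R U Q (%x. q (f x))" by (rule hom_comp[OF hom_restr_cod[OF f fS] q(2)])
 have "(%x. q (f x)) ` car U = car Q"
 proof
  show "(%x. q (f x)) ` car U <= car Q" using hom_closed[OF qf] by auto
  show "car Q <= (%x. q (f x)) ` car U"
  proof
   fix z assume "z : car Q"
   then obtain y where y: "y : ?S" "z = q y" using q(3) by auto
   then obtain n u where nu: "n : N" "u : car U" "y = n \<oplus>\<^sub>V f u" by (auto simp: V.set_add_eq)
   have "q y = q n \<oplus>\<^sub>Q q (f u)"
    unfolding nu(3) using hom_add[OF q(2), of n "f u"] nu NS fS by auto
   moreover have "q n = \<zero>\<^sub>Q" using nu(1) q(4) by (auto simp: a_kernel_eq)
   ultimately have "z = q (f u)" using y(2) hom_closed[OF qf nu(2)]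
    using abelian_group.axioms(1) abelian_monoid.l_zero q(1) right_module_def by fastforce
   thus "z : (%x. q (f x)) ` car U" using nu by auto
  qed
 qed
 hence "flen R Q" using flen_exact[OF U(1) q(1) qf] U(2) by auto
 thus ?thesis using flen_exact[OF W q(1-3)] N(2) q(4) by simp
qed

text \<open>The submodule obtained is the sum of the images, recorded by its minimality. It converts
  finite generation into finite length.\<close>

lemma finite_sum_exists:
 assumes V: "right_module R V" and U: "right_module R U" "flen R U" and S: "finite S"
  and f: "!!s. s : S ==> is_hom R U V (f s)"
 obtains N where "submodule N R V" "flen R (restr V N)" "!!s. s : S ==> f s ` car U <= N"
  "!!L. submodule L R V ==> (!!s. s : S ==> f s ` car U <= L) ==> N <= L"
proof -
 interpret V: right_module R V by fact
 interpret U: right_module R U by fact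
 have "EX N. submodule N R V & flen R (restr V N) & (ALL s:S. f s ` car U <= N) &
  (ALL L. submodule L R V --> (ALL s:S. f s ` car U <= L) --> N <= L)"
  using S f
 proof (induction S)
  case empty
  thus ?case
   using V.submodule_zero flen_zero[OF right_module_restr[OF V V.submodule_zero]] V.submoduleD(2)
   by (intro exI[of _ "{\<zero>\<^sub>V}"]) auto
 next
  case (insert s S)
  then obtain N where N: "submodule N R V" "flen R (restr V N)" "ALL s:S. f s ` car U <= N"
   "ALL L. submodule L R V --> (ALL s:S. f s ` car U <= L) --> N <= L" by auto
  have fs: "is_hom R U V (f s)" using insert by auto
  have im: "submodule (f s ` car U) R V" by (rule submodule_image[OF U(1) V fs U.submodule_carrier])
  let ?N = "N <+>\<^sub>V f s ` car U"
  have "N <= ?N" by (rule V.set_add_mono1[OF V.submoduleD(1)[OF N(1)] im])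
  moreover have "f s ` car U <= ?N"
   using V.submoduleD(2)[OF N(1)] hom_closed[OF fs] by (force simp: V.set_add_eq)
  moreover have "?N <= L" if "submodule L R V" "ALL t:insert s S. f t ` car U <= L" for L
  proof -
   have "N <= L" "f s ` car U <= L" using N(4) that by auto
   thus ?thesis using V.submoduleD(3)[OF that(1)] by (auto simp: V.set_add_eq)
  qed
  ultimately show ?case
   using V.submodule_set_add[OF N(1) im] flen_sum[OF V N(1,2) U fs] N(3) by (intro exI[of _ ?N]) blast
 qed
 then obtain N where "submodule N R V" "flen R (restr V N)" "ALL s:S. f s ` car U <= N"
   "ALL L. submodule L R V --> (ALL s:S. f s ` car U <= L) --> N <= L" by auto
 thus thesis by (intro that[of N]) auto
qed

text \<open>The factored map takes at y the value of \<open>g\<close> at any preimage of y; two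
  preimages differ by an element that \<open>p\<close>, and hence \<open>g\<close>, kills.\<close>

lemma hom_factor:
 assumes U: "right_module A U" and M: "right_module A M" and N: "right_module A N"
  and p: "is_hom A U M p" "p ` car U = car M" and g: "is_hom A U N g"
  and k: "!!x. x : car U ==> p x = \<zero>\<^sub>M ==> g x = \<zero>\<^sub>N"
 obtains h where "is_hom A M N h" "!!x. x : car U ==> h (p x) = g x"
proof -
 interpret U: right_module A U by fact
 interpret MM: right_module A M by fact
 interpret N: right_module A N by fact
 note pc = hom_closed[OF p(1)] and gc = hom_closed[OF g]
 have wd: "g x = g y" if "x : car U" "y : car U" "p x = p y" for x y
 proof -
  have "p (x \<ominus>\<^sub>U y) = \<zero>\<^sub>M"
   using that pc MM.diff_eq_zero[of "p x" "p y"] by (simp add: hom_diff[OF U M p(1)])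
  hence "g (x \<ominus>\<^sub>U y) = \<zero>\<^sub>N" using k that by simp
  thus ?thesis using that gc by (simp add: hom_diff[OF U N g] N.diff_eq_zero)
 qed
 define h where "h = (%y. g (SOME x. x : car U & p x = y))"
 have hp: "h (p x) = g x" if "x : car U" for x
 proof -
  have "(SOME z. z : car U & p z = p x) : car U & p (SOME z. z : car U & p z = p x) = p x"
   by (rule someI[of _ x]) (use that in simp)
  thus ?thesis unfolding h_def using wd[OF _ that] by blast
 qed
 have "is_hom A M N h"
 proof (rule is_homI)
  fix y assume "y : car M"
  then obtain x where x: "x : car U" "y = p x" using p(2) by blast
  show "h y : car N" using x hp gc by simp
  show "h (a \<odot>\<^sub>M y) = a \<odot>\<^sub>N h y" if "a : car A" for a
   using hp[of "a \<odot>\<^sub>U x"] that x hp[of x] by (simp add: U.act_closed hom_act[OF p(1)] hom_act[OF g])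
  fix z assume "z : car M"
  then obtain w where w: "w : car U" "z = p w" using p(2) by blast
  show "h (y \<oplus>\<^sub>M z) = h y \<oplus>\<^sub>N h z"
   using hp[of "x \<oplus>\<^sub>U w"] x w hp[of x] hp[of w] by (simp add: hom_add[OF p(1)] hom_add[OF g])
 qed
 thus thesis using hp that by blast
qed

section \<open>Restriction of scalars to the field, and dimensions of Hom spaces\<close>

definition Ka :: "'k ring => ('k, 'k) module" where
 "Ka K = \<lparr>carrier = car K, mult = mult K, one = one K, zero = zero K, add = add K, smult = mult K\<rparr>"

text \<open>A scalar c acts on an A-module through the central element c times 1 of
  \<open>A\<close>, as in \<open>K_dual\<close>. The underlying vector space becomes a module over
  \<open>Ka K\<close>, to which the length theory applies.\<close>

definition Kr :: "('k, 'a) module => ('a, 'v) module => ('k, 'v) module" where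
 "Kr A M = \<lparr>carrier = car M, mult = undefined, one = undefined, zero = zero M, add = add M,
  smult = (%c x. (c \<odot>\<^sub>A \<one>\<^sub>A) \<odot>\<^sub>M x)\<rparr>"

definition fdm :: "'k ring => ('k, 'a) module => ('a, 'v) module => bool" where
 "fdm K A M \<longleftrightarrow> right_module A M & flen (Ka K) (Kr A M)"

definition dm :: "'k ring => ('k, 'a) module => ('a, 'v) module => nat" where
 "dm K A M = len (Ka K) (Kr A M)"

definition HK :: "('k, 'a) module => ('a, 'v) module => ('a, 'w) module => ('k, 'v => 'w) module" where
 "HK A M N = \<lparr>carrier = Hom A M N, mult = undefined, one = undefined, zero = (\<lambda>x\<in> car M. \<zero>\<^sub>N),
  add = (%f g. \<lambda>x\<in> car M. f x \<oplus>\<^sub>N g x),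
  smult = (%c f. \<lambda>x\<in> car M. (c \<odot>\<^sub>A \<one>\<^sub>A) \<odot>\<^sub>N f x)\<rparr>"

definition hdim :: "'k ring => ('k, 'a) module => ('a, 'v) module => ('a, 'w) module => nat" where
 "hdim K A M N = len (Ka K) (HK A M N)"

text \<open>Surjectivity of Hom(d,Y). For a minimal projective presentation d of M this will be the
  condition Hom(Y, tau M) = 0.\<close>

definition extl :: "('k, 'a) module => ('a, 'u) module => ('u => 'v) => ('a, 'v) module => ('a, 'w) module => bool" where
 "extl A U1 d U0 Y \<longleftrightarrow> (ALL u. is_hom A U1 Y u --> (EX v. is_hom A U0 Y v & (ALL x: car U1. v (d x) = u x)))"

lemma Ka_simps [simp]: "car (Ka K) = car K" "mult (Ka K) = mult K" "one (Ka K) = one K"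
 "zero (Ka K) = zero K" "add (Ka K) = add K" "smult (Ka K) = mult K"
 by (simp_all add: Ka_def)

lemma Kr_simps [simp]: "car (Kr A M) = car M" "zero (Kr A M) = zero M" "add (Kr A M) = add M"
 "smult (Kr A M) = (%c x. (c \<odot>\<^sub>A \<one>\<^sub>A) \<odot>\<^sub>M x)"
 by (simp_all add: Kr_def)

lemma HK_simps [simp]: "car (HK A M N) = Hom A M N" "zero (HK A M N) = (\<lambda>x\<in> car M. \<zero>\<^sub>N)"
 "add (HK A M N) = (%f g. \<lambda>x\<in> car M. f x \<oplus>\<^sub>N g x)"
 "smult (HK A M N) = (%c f. \<lambda>x\<in> car M. (c \<odot>\<^sub>A \<one>\<^sub>A) \<odot>\<^sub>N f x)"
 by (simp_all add: HK_def)

lemma Kr_restr: "Kr A (restr M N) = restr (Kr A M) N"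
 by (simp add: Kr_def restr_def)

lemma a_kernel_Kr: "a_kernel (Kr A M) (Kr A N) f = a_kernel M N f"
 by (simp add: a_kernel_eq)

lemma regular_simps [simp]: "car (regular A) = car A" "zero (regular A) = zero A" "add (regular A) = add A"
 "smult (regular A) = (%a x. x \<otimes>\<^sub>A a)"
 by (simp_all add: regular_def)

lemma right_module_regular: "ring A ==> right_module A (regular A)"
proof -
 assume "ring A"
 then interpret ring A .
 show ?thesis
  by (rule right_moduleI) (auto simp: a_ac m_assoc l_distr r_distr \<open>ring A\<close> intro: bexI[of _ "\<ominus>\<^sub>A x" for x] l_neg)
qed

lemma Hom_ext: "f : Hom A M N ==> g : Hom A M N ==> (!!x. x : car M ==> f x = g x) ==> f = g"
 unfolding Hom_def by (blast intro: PiE_ext)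

context fd_algebra
begin

lemma ring_A: "ring A" by (rule A.ring_axioms)

lemma ring_Ka: "ring (Ka K)"
 using K.ring_axioms unfolding Ka_def
 by (auto intro!: ringI abelian_groupI monoidI K.a_assoc K.m_assoc K.a_comm K.l_distr K.r_distr
   intro: bexI[of _ "\<ominus>\<^sub>K x" for x] K.l_neg)

lemma kap_closed: "c : car K ==> c \<odot>\<^sub>A \<one>\<^sub>A : car A" by auto

lemma kap_left: "c : car K ==> a : car A ==> (c \<odot>\<^sub>A \<one>\<^sub>A) \<otimes>\<^sub>A a = c \<odot>\<^sub>A a"
 by (simp add: smult_mult_left)

lemma kap_right: "c : car K ==> a : car A ==> a \<otimes>\<^sub>A (c \<odot>\<^sub>A \<one>\<^sub>A) = c \<odot>\<^sub>A a"
 by (simp add: smult_mult_right)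

lemma kap_mult: "c : car K ==> d : car K ==>
  (c \<otimes>\<^sub>K d) \<odot>\<^sub>A \<one>\<^sub>A = (c \<odot>\<^sub>A \<one>\<^sub>A) \<otimes>\<^sub>A (d \<odot>\<^sub>A \<one>\<^sub>A)"
 by (simp add: kap_left smult_assoc1)

lemma kap_add: "c : car K ==> d : car K ==>
  (c \<oplus>\<^sub>K d) \<odot>\<^sub>A \<one>\<^sub>A = (c \<odot>\<^sub>A \<one>\<^sub>A) \<oplus>\<^sub>A (d \<odot>\<^sub>A \<one>\<^sub>A)"
 by (simp add: smult_l_distr)

lemma kap_one: "\<one>\<^sub>K \<odot>\<^sub>A \<one>\<^sub>A = \<one>\<^sub>A" by simp

lemma right_module_Kr:
 assumes "right_module A M" shows "right_module (Ka K) (Kr A M)"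
proof -
 interpret MM: right_module A M by fact
 show ?thesis
 proof (rule right_moduleI)
  show "EX y: car (Kr A M). y \<oplus>\<^sub>(Kr A M) x = \<zero>\<^sub>(Kr A M)" if "x : car (Kr A M)" for x
   using that MM.M.l_neg[of x] by (auto intro: bexI[of _ "\<ominus>\<^sub>M x"])
 qed (auto simp: ring_Ka MM.M.a_assoc MM.act_closed kap_add kap_mult kap_one MM.act_one MM.act_add_left
   MM.act_add_right MM.act_mult kap_closed intro: MM.M.a_comm)
qed

lemma hom_Kr: "is_hom A M N f ==> is_hom (Ka K) (Kr A M) (Kr A N) f"
 by (rule is_homI) (auto simp: hom_closed hom_add hom_act kap_closed)

lemma submodule_Kr:
 assumes "right_module A M" "submodule N A M" shows "submodule N (Ka K) (Kr A M)"
proof -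
 interpret MM: right_module A M by fact
 interpret V: right_module "Ka K" "Kr A M" by (rule right_module_Kr[OF assms(1)])
 note N = MM.submoduleD[OF assms(2)]
 show ?thesis by (rule V.submoduleI) (use N kap_closed in auto)
qed

lemma kap_hom:
 assumes N: "right_module A N" and f: "is_hom A M N f" and c: "c : car K"
 shows "is_hom A M N (%x. (c \<odot>\<^sub>A \<one>\<^sub>A) \<odot>\<^sub>N f x)"
proof -
 interpret N: right_module A N by fact
 note k = kap_closed[OF c]
 show ?thesis
 proof (rule is_homI)
  fix a x assume *: "a : car A" "x : car M"
  have "(c \<odot>\<^sub>A \<one>\<^sub>A) \<odot>\<^sub>N (a \<odot>\<^sub>N f x) = a \<odot>\<^sub>N ((c \<odot>\<^sub>A \<one>\<^sub>A) \<odot>\<^sub>N f x)"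
   using * k hom_closed[OF f] N.act_mult[of a "c \<odot>\<^sub>A \<one>\<^sub>A" "f x"] N.act_mult[of "c \<odot>\<^sub>A \<one>\<^sub>A" a "f x"]
   by (simp add: kap_left kap_right c)
  thus "(c \<odot>\<^sub>A \<one>\<^sub>A) \<odot>\<^sub>N f (a \<odot>\<^sub>M x) = a \<odot>\<^sub>N ((c \<odot>\<^sub>A \<one>\<^sub>A) \<odot>\<^sub>N f x)"
   using * by (simp add: hom_act[OF f])
 qed (auto simp: hom_closed[OF f] hom_add[OF f] k N.act_closed N.act_add_right)
qed

lemma flen_Ka: "flen (Ka K) (regular (Ka K))"
proof -
 interpret V: right_module "Ka K" "regular (Ka K)" by (rule right_module_regular[OF ring_Ka])
 have full: "N = car K" if N: "submodule N (Ka K) (regular (Ka K))" and x: "x : N" "x ~= \<zero>\<^sub>K" for N x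
 proof -
  note Nd = V.submoduleD[OF N]
  have xK: "x : car K" using Nd(1) x by auto
  have "y : N" if y: "y : car K" for y
  proof -
   have "x \<otimes>\<^sub>K (inv\<^bsub>K\<^esub> x \<otimes>\<^sub>K y) = y"
    using xK x(2) y K.field_Units by (simp add: K.m_assoc[symmetric] K.Units_r_inv)
   moreover have "inv\<^bsub>K\<^esub> x \<otimes>\<^sub>K y : car K" using xK x(2) y K.field_Units by auto
   ultimately show ?thesis using Nd(6)[of "inv\<^bsub>K\<^esub> x \<otimes>\<^sub>K y" x] x(1) by simp
  qed
  thus ?thesis using Nd(1) by auto
 qed
 have "n <= 1" if "haschain (Ka K) (regular (Ka K)) n" for n
 proof (rule ccontr)
  assume n: "~ n <= 1"
  obtain C where C: "ALL i<=n. submodule (C i) (Ka K) (regular (Ka K))" "ALL i<n. C i < C (Suc i)"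
   using \<open>haschain _ _ n\<close> unfolding haschain_def by auto
  have c: "submodule (C 0) (Ka K) (regular (Ka K))" "submodule (C 1) (Ka K) (regular (Ka K))"
   "submodule (C 2) (Ka K) (regular (Ka K))" "C 0 < C 1" "C 1 < C 2"
   using C n by (simp_all add: numeral_2_eq_2 Suc_le_eq)
  obtain x where x: "x : C 1" "x ~: C 0" using c(4) by blast
  hence "x ~= \<zero>\<^sub>K" using V.submoduleD(2)[OF c(1)] by auto
  hence "C 1 = car K" using full[OF c(2)] x by auto
  thus False using V.submoduleD(1)[OF c(3)] c(5) by auto
 qed
 thus ?thesis unfolding flen_def by auto
qed

lemma act_hom:
 assumes "right_module A M" "x : car M" shows "is_hom A (regular A) M (%a. a \<odot>\<^sub>M x)"
proof -
 interpret MM: right_module A M by fact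
 show ?thesis by (rule is_homI) (use assms(2) in \<open>auto simp: MM.act_closed MM.act_add_left MM.act_mult\<close>)
qed

text \<open>The algebra is the sum of the images of finitely many maps K -> A, each of length at
  most one.\<close>

lemma fdm_regular: "fdm K A (regular A)"
proof -
 interpret V: right_module "Ka K" "Kr A (regular A)" by (rule right_module_Kr[OF right_module_regular[OF ring_A]])
 obtain S where S: "finite S" "S <= car A" "!!N. submodule N K A ==> S <= N ==> N = car A"
  using finite_dimensional unfolding fin_gen_def by auto
 let ?f = "%s c. c \<odot>\<^sub>A s"
 have f: "is_hom (Ka K) (regular (Ka K)) (Kr A (regular A)) (?f s)" if "s : S" for s
 proof -
  have s: "s : car A" using that S(2) by auto
  show ?thesis by (rule is_homI) (use s in \<open>auto simp: smult_l_distr kap_right smult_assoc1[symmetric] K.m_comm\<close>)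
 qed
 obtain N where N: "submodule N (Ka K) (Kr A (regular A))" "flen (Ka K) (restr (Kr A (regular A)) N)"
  "!!s. s : S ==> ?f s ` car (regular (Ka K)) <= N"
  using finite_sum_exists[OF V.right_module_axioms right_module_regular[OF ring_Ka] flen_Ka S(1), of ?f] f by metis
 note Nd = V.submoduleD[OF N(1)]
 have "submodule N K A"
 proof (rule submoduleI)
  show "\<ominus>\<^sub>A a : N" if "a : N" for a
  proof -
   have "a : car A" using that Nd(1) by auto
   hence "\<ominus>\<^sub>A a = (\<ominus>\<^sub>K \<one>\<^sub>K) \<odot>\<^sub>A a" by (simp add: smult_l_minus)
   thus ?thesis using Nd(6)[of "\<ominus>\<^sub>K \<one>\<^sub>K" a] that \<open>a : car A\<close> by (simp add: kap_right)
  qed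
  show "c \<odot>\<^sub>A x : N" if "c : car K" "x : N" for c x
   using Nd(6)[of c x] Nd(1) that by (auto simp: kap_right subset_iff)
 qed (use Nd(1-3) in auto)
 moreover have "S <= N"
 proof
  fix s assume s: "s : S"
  hence "?f s \<one>\<^sub>K : N" using N(3)[OF s] by auto
  thus "s : N" using s S(2) by (auto simp: subset_iff)
 qed
 ultimately have "N = car A" using S(3) by auto
 hence "restr (Kr A (regular A)) N = Kr A (regular A)" by (metis Kr_simps(1) regular_simps(1) restr_simps(5))
 thus ?thesis using N(2) right_module_regular[OF ring_A] by (simp add: fdm_def)
qed

lemma fdmD: "fdm K A M ==> right_module A M" "fdm K A M ==> flen (Ka K) (Kr A M)"
 "fdm K A M ==> right_module (Ka K) (Kr A M)"
 by (auto simp: fdm_def right_module_Kr)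

text \<open>The sum of the images of A -> M, one for each generator, is finite-dimensional. It
  remains to see that this subspace is stable under \<open>A\<close>.\<close>

lemma fin_gen_imp_fdm:
 assumes M: "right_module A M" and "fin_gen A M" shows "fdm K A M"
proof -
 interpret MM: right_module A M by fact
 interpret V: right_module "Ka K" "Kr A M" by (rule right_module_Kr[OF M])
 obtain S where S: "finite S" "S <= car M" "!!N. submodule N A M ==> S <= N ==> N = car M"
  using assms(2) unfolding fin_gen_def by auto
 let ?f = "%s a. a \<odot>\<^sub>M s"
 have f: "is_hom (Ka K) (Kr A (regular A)) (Kr A M) (?f s)" if "s : S" for s
  using hom_Kr[OF act_hom[OF M]] S(2) that by auto
 obtain N where N: "submodule N (Ka K) (Kr A M)" "flen (Ka K) (restr (Kr A M) N)"
  "!!s. s : S ==> ?f s ` car (Kr A (regular A)) <= N"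
  "!!L. submodule L (Ka K) (Kr A M) ==> (!!s. s : S ==> ?f s ` car (Kr A (regular A)) <= L) ==> N <= L"
  by (rule finite_sum_exists[OF V.right_module_axioms fdmD(3,2)[OF fdm_regular] S(1), of ?f]) (use f in auto)
 note Nd = V.submoduleD[OF N(1)]
 have act: "b \<odot>\<^sub>M x : N" if b: "b : car A" and x: "x : N" for b x
 proof -
  \<comment> \<open>The elements of \<open>N\<close> that b keeps inside \<open>N\<close>. This
    subspace contains all the images in question, so minimality of \<open>N\<close> forces it to be
    all of \<open>N\<close>.\<close>
  let ?L = "{x : N. b \<odot>\<^sub>M x : N}"
  have "submodule ?L (Ka K) (Kr A M)"
  proof (rule V.submoduleI)
   show "?L <= car (Kr A M)" "\<zero>\<^sub>(Kr A M) : ?L" using Nd(1,2) b by auto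
   show "x \<oplus>\<^sub>(Kr A M) y : ?L" if "x : ?L" "y : ?L" for x y
    using that Nd(1,3) b by (auto simp: MM.act_add_right subset_iff)
   fix c x assume c: "c : car (Ka K)" and x: "x : ?L"
   hence xc: "x : car M" using Nd(1) by auto
   note k = kap_closed[of c]
   have "b \<odot>\<^sub>M ((c \<odot>\<^sub>A \<one>\<^sub>A) \<odot>\<^sub>M x) = (c \<odot>\<^sub>A \<one>\<^sub>A) \<odot>\<^sub>M (b \<odot>\<^sub>M x)"
    using c xc b MM.act_mult[of b "c \<odot>\<^sub>A \<one>\<^sub>A" x] MM.act_mult[of "c \<odot>\<^sub>A \<one>\<^sub>A" b x] k
    by (simp add: kap_left kap_right)
   thus "c \<odot>\<^sub>(Kr A M) x : ?L" using Nd(6)[of c] c x by auto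
  qed
  moreover have "?f s ` car (Kr A (regular A)) <= ?L" if s: "s : S" for s
  proof -
   have "a \<odot>\<^sub>M s : N" if "a : car A" for a using N(3)[OF s] that by auto
   thus ?thesis using S(2) s b by (auto simp: MM.act_mult[symmetric] subset_iff)
  qed
  ultimately have "N <= ?L" by (rule N(4))
  thus ?thesis using x by auto
 qed
 have "submodule N A M" by (rule MM.submoduleI) (use Nd(1-3) act in auto)
 moreover have "S <= N"
 proof
  fix s assume s: "s : S"
  hence "?f s \<one>\<^sub>A : N" using N(3)[OF s] by auto
  thus "s : N" using s S(2) MM.act_one by (auto simp: subset_iff)
 qed
 ultimately have "N = car M" using S(3) by auto
 hence "restr (Kr A M) N = Kr A M" by (metis Kr_simps(1) restr_simps(5))
 thus ?thesis using N(2) M by (simp add: fdm_def)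
qed

text \<open>Among the finite subsets take one whose generated submodule has the largest dimension. A
  further element outside that submodule would enlarge the dimension.\<close>

lemma fdm_imp_fin_gen:
 assumes M: "fdm K A M" shows "fin_gen A M"
proof -
 interpret MM: right_module A M by (rule fdmD(1)[OF M])
 note V = fdmD(3)[OF M] and fV = fdmD(2)[OF M]
 define G where "G = (%S. \<Inter>{N. submodule N A M & S <= N})"
 have Gs: "submodule (G S) A M" "S <= G S" if "S <= car M" for S
 proof -
  have c: "car M : {N. submodule N A M & S <= N}" using that MM.submodule_carrier by auto
  have d: "N : {N. submodule N A M & S <= N} ==> submodule N A M" for N by auto
  show "submodule (G S) A M"
  proof (rule MM.submoduleI)
   show "G S <= car M" using c unfolding G_def by blast
  qed (auto simp: G_def dest: MM.submoduleD(2,3,6))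
  show "S <= G S" unfolding G_def by auto
 qed
 define P where "P = (%S. finite S & S <= car M)"
 have "EX S. P S & (ALL T. P T --> len (Ka K) (restr (Kr A M) (G T)) <= len (Ka K) (restr (Kr A M) (G S)))"
 proof (rule ex_has_greatest_nat)
  show "P {}" by (simp add: P_def)
  show "ALL T. P T --> len (Ka K) (restr (Kr A M) (G T)) < Suc (len (Ka K) (Kr A M))"
   using len_restr_le[OF V submodule_Kr[OF MM.right_module_axioms Gs(1)] fV] by (simp add: P_def less_Suc_eq_le)
 qed
 then obtain S where S: "P S" "!!T. P T ==> len (Ka K) (restr (Kr A M) (G T)) <= len (Ka K) (restr (Kr A M) (G S))" by auto
 have Sc: "S <= car M" using S(1) by (simp add: P_def)
 have "G S = car M"
 proof (rule ccontr)
  assume "G S ~= car M"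
  then obtain x where x: "x : car M" "x ~: G S" using MM.submoduleD(1)[OF Gs(1)[OF Sc]] by auto
  let ?T = "insert x S"
  have T: "P ?T" "?T <= car M" using S(1) x by (auto simp: P_def)
  have "G S <= G ?T" unfolding G_def by auto
  hence "G S < G ?T" using x Gs(2)[OF T(2)] by auto
  hence "len (Ka K) (restr (Kr A M) (G S)) < len (Ka K) (restr (Kr A M) (G ?T))"
   using len_restr_mono[OF V fV submodule_Kr[OF MM.right_module_axioms Gs(1)[OF Sc]] submodule_Kr[OF MM.right_module_axioms Gs(1)[OF T(2)]]] by auto
  thus False using S(2)[OF T(1)] by simp
 qed
 hence "N = car M" if "submodule N A M" "S <= N" for N
  using that MM.submoduleD(1)[OF that(1)] unfolding G_def by auto
 thus ?thesis unfolding fin_gen_def using S(1) by (auto simp: P_def)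
qed

lemma fmods_iff: "M : fmods A \<longleftrightarrow> fdm K A M"
 unfolding fmods_def using fin_gen_imp_fdm fdm_imp_fin_gen fdmD(1) by blast

text \<open>A maximal proper subspace L above \<open>N\<close> has the line through any outside
  vector x as complement; the coordinate along x is the functional.\<close>

lemma functional_exists:
 fixes V :: "('k, 'v) module"
 assumes V: "right_module (Ka K) V" and fV: "flen (Ka K) V" and N: "submodule N (Ka K) V" "N ~= car V"
 obtains l u where "is_hom (Ka K) V (regular (Ka K)) l" "!!x. x : N ==> l x = \<zero>\<^sub>K" "u : car V" "l u = \<one>\<^sub>K"
proof -
 interpret V: right_module "Ka K" V by (rule V)
 define S where "S = (%L. submodule L (Ka K) V & N <= L & L ~= car V)"
 have "EX L. S L & (ALL T. S T --> len (Ka K) (restr V T) <= len (Ka K) (restr V L))"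
 proof (rule ex_has_greatest_nat)
  show "S N" using N by (simp add: S_def)
  show "ALL T. S T --> len (Ka K) (restr V T) < Suc (len (Ka K) V)"
   using len_restr_le[OF V _ fV] by (simp add: S_def less_Suc_eq_le)
 qed
 then obtain L where L: "S L" "!!T. S T ==> len (Ka K) (restr V T) <= len (Ka K) (restr V L)" by auto
 have Ls: "submodule L (Ka K) V" "N <= L" "L ~= car V" using L(1) by (auto simp: S_def)
 note Ld = V.submoduleD[OF Ls(1)]
 obtain x where x: "x : car V" "x ~: L" using Ls(3) Ld(1) by blast
 interpret U: right_module "Ka K" "regular (Ka K)" by (rule right_module_regular[OF ring_Ka])
 have f: "is_hom (Ka K) (regular (Ka K)) V (%c. c \<odot>\<^sub>V x)"
  by (rule is_homI) (use x V.act_closed V.act_add_left V.act_mult in auto)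
 let ?X = "(%c. c \<odot>\<^sub>V x) ` car (regular (Ka K))"
 have X: "submodule ?X (Ka K) V" by (rule submodule_image[OF U.right_module_axioms V f U.submodule_carrier])
 let ?T = "L <+>\<^sub>V ?X"
 have T: "submodule ?T (Ka K) V" "L <= ?T" using V.submodule_set_add[OF Ls(1) X] V.set_add_mono1[OF Ld(1) X] by auto
 have xX: "x : ?X" using V.act_one[OF x(1)] by (auto intro!: image_eqI[of _ _ "\<one>\<^sub>K"])
 hence "x : ?T" unfolding V.set_add_eq using Ld(2) V.M.l_zero[OF x(1)] by (metis (mono_tags, lifting) mem_Collect_eq)
 hence "L < ?T" using T(2) x(2) by auto
 hence "~ S ?T" using L(2)[of ?T] len_restr_mono[OF V fV Ls(1) T(1)] by auto
 hence full: "?T = car V" using T Ls(2) by (auto simp: S_def)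
 have kx: "c = \<zero>\<^sub>K" if c: "c : car K" "c \<odot>\<^sub>V x : L" for c
 proof (rule ccontr)
  assume "c ~= \<zero>\<^sub>K"
  hence i: "inv\<^bsub>K\<^esub> c : car K" "c \<otimes>\<^sub>K inv\<^bsub>K\<^esub> c = \<one>\<^sub>K" using c(1) K.field_Units by auto
  have "inv\<^bsub>K\<^esub> c \<odot>\<^sub>V (c \<odot>\<^sub>V x) = x" using V.act_mult[of c "inv\<^bsub>K\<^esub> c" x] c(1) i x(1) V.act_one by simp
  thus False using Ld(6)[of "inv\<^bsub>K\<^esub> c" "c \<odot>\<^sub>V x"] c(2) i(1) x(2) by simp
 qed
 have "v = \<zero>\<^sub>V" if "v : ?X" "v : L" for v using that kx V.act_zero_left[OF x(1)] by force
 hence "decomposes (Ka K) V L ?X"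
  unfolding decomposes_def using X Ls(1) V.submoduleD(2)[OF X] Ld(2) full by blast
 from decomposes_swap[OF V this] obtain p q where b: "biprod (Ka K) V (restr V ?X) (restr V L) (%x. x) (%x. x) p q" by (rule decomposes_biprod[OF V])
 note bd = biprodD[OF b]
 have rX: "right_module (Ka K) (restr V ?X)" by (rule right_module_restr[OF V X])
 have f': "is_hom (Ka K) (regular (Ka K)) (restr V ?X) (%c. c \<odot>\<^sub>V x)" by (rule hom_to_image[OF f])
 have "inj_on (%c. c \<odot>\<^sub>V x) (car (regular (Ka K)))"
  unfolding inj_on_hom_iff[OF U.right_module_axioms V f] using kx Ld(2) by auto
 hence bij: "bij_betw (%c. c \<odot>\<^sub>V x) (car (regular (Ka K))) (car (restr V ?X))" by (simp add: bij_betw_def)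
 let ?g = "inv_into (car (regular (Ka K))) (%c. c \<odot>\<^sub>V x)"
 have g: "is_hom (Ka K) (restr V ?X) (regular (Ka K)) ?g" by (rule hom_inverse[OF U.right_module_axioms f' bij])
 show thesis
 proof (rule that[OF hom_comp[OF bd(3) g] _ x(1)])
  show "?g (p y) = \<zero>\<^sub>K" if "y : N" for y
   using bd(8)[of y] that Ls(2) hom_zero[OF rX U.right_module_axioms g] by auto
  have "?g x = \<one>\<^sub>K"
   using bij_betw_inv_into_left[OF bij, of "\<one>\<^sub>K"] V.act_one[OF x(1)] by simp
  thus "?g (p x) = \<one>\<^sub>K" using bd(5)[of x] xX by simp
 qed
qed


text \<open>Splitting off the coordinate l with l(u) = 1 leaves v - l(v)u in the smaller kernel of
  l. Placing l(v) in front of the sequence of that remainder embeds the space into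
  \<open>nat => 'k\<close>, the carrier type of \<open>fmod\<close>.\<close>

lemma embed_exists:
 fixes V :: "('k, 'v) module"
 assumes "right_module (Ka K) V" "flen (Ka K) V"
 shows "EX j :: 'v => nat => 'k. inj_on j (car V)"
 using assms
proof (induction "len (Ka K) V" arbitrary: V rule: less_induct)
 case (less V)
 interpret V: right_module "Ka K" V by fact
 have R: "right_module (Ka K) (regular (Ka K))" by (rule right_module_regular[OF ring_Ka])
 show ?case
 proof (cases "{\<zero>\<^sub>V} = car V")
  case True thus ?thesis by (auto intro: inj_onI simp flip: True)
 next
  case False
  obtain l u where l: "is_hom (Ka K) V (regular (Ka K)) l" and u: "u : car V" "l u = \<one>\<^sub>K"
   using functional_exists[OF less(2,3) V.submodule_zero False] by metis
  let ?W = "a_kernel V (regular (Ka K)) l" and ?d = "%v. v \<ominus>\<^sub>V l v \<odot>\<^sub>V u"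
  note W = submodule_kernel[OF less(2) R l]
  have "u ~: ?W" using u by (simp add: a_kernel_eq)
  hence "len (Ka K) (restr V ?W) < len (Ka K) V" using len_restr_less[OF less(2) W less(3)] u(1) by blast
  then obtain j :: "'v => nat => 'k" where j: "inj_on j ?W"
   using less(1)[OF _ right_module_restr[OF less(2) W] flen_restr[OF less(2) W less(3)]] by auto
  have lK: "l v : car K" and lu: "l v \<odot>\<^sub>V u : car V" if "v : car V" for v
   using hom_closed[OF l that] V.act_closed u(1) by auto
  have d: "?d v : ?W" if "v : car V" for v
   using that lK[OF that] lu[OF that] u hom_act[OF l _ u(1)] right_module.diff_eq_zero[OF R, of "l v" "l v"]
   by (simp add: a_kernel_eq hom_diff[OF less(2) R l])
  have "inj_on (%v n. case n of 0 => l v | Suc m => j (?d v) m) (car V)"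
  proof (rule inj_onI)
   fix v w assume vw: "v : car V" "w : car V"
    and e: "(%n. case n of 0 => l v | Suc m => j (?d v) m) = (%n. case n of 0 => l w | Suc m => j (?d w) m)"
   have lw: "l v = l w" using fun_cong[OF e, of 0] by simp
   have "j (?d v) = j (?d w)" using fun_cong[OF e, of "Suc m" for m] by (simp add: fun_eq_iff)
   hence "?d v = ?d w" using j d vw by (auto dest: inj_onD)
   thus "v = w" using V.add_diff_cancel[OF vw(1) lu[OF vw(1)]] V.add_diff_cancel[OF vw(2) lu[OF vw(2)]] lw by metis
  qed
  thus ?thesis by blast
 qed
qed

lemma fdm_iso:
 assumes "fdm K A M" "right_module A N" "mod_iso A M N" shows "fdm K A N" "dm K A N = dm K A M"
proof -
 obtain f where f: "is_hom A M N f" "bij_betw f (car M) (car N)"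
  using assms mod_iso_iff[OF fdmD(1)[OF assms(1)]] by auto
 show "fdm K A N" "dm K A N = dm K A M"
  using flen_iso[OF fdmD(3)[OF assms(1)] right_module_Kr[OF assms(2)] hom_Kr[OF f(1)]]
   len_iso[OF fdmD(3)[OF assms(1)] right_module_Kr[OF assms(2)] hom_Kr[OF f(1)]] assms f
  by (auto simp: fdm_def dm_def)
qed

text \<open>Through this lemma modules built on other carrier types, such as products on pairs or
  the regular module, get representatives of type \<open>fmod\<close>.\<close>

lemma copy_exists:
 fixes M :: "('a, 'v) module"
 assumes M: "fdm K A M"
 obtains N :: "('k, 'a) fmod" where "N : fmods A" "mod_iso A M N"
proof -
 obtain j :: "'v => nat => 'k" where j: "inj_on j (car M)"
  using embed_exists[OF fdmD(3,2)[OF M]] by auto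
 interpret MM: right_module A M by (rule fdmD(1)[OF M])
 define N where "N = (\<lparr>carrier = j ` car M, mult = undefined, one = undefined, zero = j \<zero>\<^sub>M,
  add = (%u v. j (inv_into (car M) j u \<oplus>\<^sub>M inv_into (car M) j v)),
  smult = (%a u. j (a \<odot>\<^sub>M inv_into (car M) j u))\<rparr> :: ('a, nat => 'k) module)"
 have N: "right_module A N" "is_hom A M N j"
  by (rule right_module_image[OF fdmD(1)[OF M], of N j]; simp add: N_def j)+
 have iso: "mod_iso A M N" using N j by (auto simp: mod_iso_iff[OF fdmD(1)[OF M]] bij_betw_def N_def)
 thus thesis using that fdm_iso(1)[OF M N(1) iso] fmods_iff by blast
qed

lemma fdm_restr:
 assumes "fdm K A M" "submodule N A M"
 shows "fdm K A (restr M N)" "dm K A (restr M N) <= dm K A M" "N ~= car M ==> dm K A (restr M N) < dm K A M"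
 using right_module_restr[OF fdmD(1)[OF assms(1)] assms(2)]
  flen_restr[OF fdmD(3)[OF assms(1)] submodule_Kr[OF fdmD(1)[OF assms(1)] assms(2)] fdmD(2)[OF assms(1)]]
  len_restr_le[OF fdmD(3)[OF assms(1)] submodule_Kr[OF fdmD(1)[OF assms(1)] assms(2)] fdmD(2)[OF assms(1)]]
  len_restr_less[OF fdmD(3)[OF assms(1)] submodule_Kr[OF fdmD(1)[OF assms(1)] assms(2)] fdmD(2)[OF assms(1)]]
 by (auto simp: fdm_def dm_def Kr_restr)

lemma fdm_surj:
 assumes "fdm K A M" "right_module A N" "is_hom A M N f" "f ` car M = car N"
 shows "fdm K A N" "dm K A M = dm K A (restr M (a_kernel M N f)) + dm K A N"
 using flen_exact[OF fdmD(3)[OF assms(1)] right_module_Kr[OF assms(2)] hom_Kr[OF assms(3)]] fdmD(2)[OF assms(1)]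
  len_exact[OF fdmD(3)[OF assms(1)] right_module_Kr[OF assms(2)] hom_Kr[OF assms(3)]] assms(2,4)
 by (auto simp: fdm_def dm_def Kr_restr a_kernel_Kr)

lemma surj_endo_inj:
 assumes "fdm K A M" "is_hom A M M f" "f ` car M = car M" shows "bij_betw f (car M) (car M)"
 using surj_imp_inj[OF fdmD(3)[OF assms(1)] fdmD(3)[OF assms(1)] hom_Kr[OF assms(2)] fdmD(2)[OF assms(1)] fdmD(2)[OF assms(1)]] assms(3)
 by (auto simp: bij_betw_def)

lemma inj_endo_surj:
 assumes "fdm K A M" "is_hom A M M f" "inj_on f (car M)" shows "bij_betw f (car M) (car M)"
 using inj_imp_surj[OF fdmD(3)[OF assms(1)] fdmD(3)[OF assms(1)] hom_Kr[OF assms(2)] fdmD(2)[OF assms(1)] fdmD(2)[OF assms(1)]] assms(3)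
 by (auto simp: bij_betw_def)

lemma dm_eq_0_iff: "fdm K A M ==> dm K A M = 0 \<longleftrightarrow> car M = {\<zero>\<^sub>M}"
 using len_eq_0_iff[OF fdmD(3) fdmD(2)] by (simp add: dm_def)

lemma dm_retract_le:
 assumes "fdm K A M" "fdm K A N" "is_hom A N M f" "inj_on f (car N)" shows "dm K A N <= dm K A M"
 using inj_len_le[OF fdmD(3)[OF assms(2)] fdmD(3)[OF assms(1)] hom_Kr[OF assms(3)] fdmD(2)[OF assms(2)] fdmD(2)[OF assms(1)]] assms(4)
 by (auto simp: dm_def)

end

lemma
 assumes V: "right_module R V" and W: "right_module R W" and f: "is_hom R V W f" and fW: "flen R W"
 shows flen_into: "flen R (restr V (a_kernel V W f)) ==> flen R V"
  and len_into: "flen R V ==> len R V = len R (restr V (a_kernel V W f)) + len R (restr W (f ` car V))"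
proof -
 interpret V: right_module R V by fact
 have im: "submodule (f ` car V) R W" by (rule submodule_image[OF V W f V.submodule_carrier])
 let ?W = "restr W (f ` car V)"
 have k: "a_kernel V ?W f = a_kernel V W f" by (simp add: a_kernel_eq)
 note h = flen_exact[OF V right_module_restr[OF W im] hom_to_image[OF f]]
  len_exact[OF V right_module_restr[OF W im] hom_to_image[OF f]]
 show "flen R (restr V (a_kernel V W f)) ==> flen R V" using h(1) flen_restr[OF W im fW] by (simp add: k)
 show "flen R V ==> len R V = len R (restr V (a_kernel V W f)) + len R ?W" using h(2) by (simp add: k)
qed

lemma biprod_swap:
 assumes "right_module A D" "biprod A D V W i j p q" shows "biprod A D W V j i q p"
proof -
 interpret D: right_module A D by fact
 note b = biprodD[OF assms(2)]
 have "d = j (q d) \<oplus>\<^sub>D i (p d)" if "d : car D" for d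
  using that b(9)[of d] hom_closed[OF b(1)] hom_closed[OF b(2)] hom_closed[OF b(3)] hom_closed[OF b(4)]
  by (simp add: D.M.a_comm)
 thus ?thesis using b unfolding biprod_def by simp
qed

lemma biprod_ker_q:
 assumes D: "right_module A D" and V: "right_module A V" and b: "biprod A D V W i j p q" and W: "right_module A W"
 shows "a_kernel D W q = i ` car V"
proof -
 interpret D: right_module A D by fact
 note bd = biprodD[OF b]
 have "d = i (p d)" if "d : car D" "q d = \<zero>\<^sub>W" for d
  using bd(9)[OF that(1)] that hom_zero[OF W D bd(2)] hom_closed[OF bd(1)] hom_closed[OF bd(3)] by simp
 thus ?thesis using hom_closed[OF bd(1)] hom_closed[OF bd(3)] bd(6) by (auto simp: a_kernel_eq)
qed

lemma biprod_surj_q: "biprod A D V W i j p q ==> q ` car D = car W"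
 apply (intro equalityI subsetI)
 apply (auto dest: hom_closed[OF biprodD(4)])[1]
 by (metis biprodD(2) biprodD(7) hom_closed image_eqI)

lemma hom_pow: "is_hom A M M f ==> is_hom A M M (f ^^ n)"
proof (induction n)
 case 0 thus ?case using hom_id by (simp add: id_def)
next
 case (Suc n)
 have "is_hom A M M (f \<circ> f ^^ n)" by (rule hom_comp_o[OF Suc.IH[OF Suc.prems] Suc.prems])
 thus ?case by (simp only: funpow.simps)
qed

context fd_algebra
begin

lemma right_module_HK:
 assumes M: "right_module A M" and N: "right_module A N" shows "right_module (Ka K) (HK A M N)"
proof -
 interpret MM: right_module A M by fact
 interpret N: right_module A N by fact
 have c: "f x : car N" if "f : Hom A M N" "x : car M" for f x using hom_closed[OF HomD[OF that(1)] that(2)] .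
 have pl: "(\<lambda>x\<in> car M. f x \<oplus>\<^sub>N g x) : Hom A M N" if "f : Hom A M N" "g : Hom A M N" for f g
  by (rule HomI[OF M hom_plus[OF N HomD HomD]]) (use that in auto)
 have sc: "(\<lambda>x\<in> car M. (c \<odot>\<^sub>A \<one>\<^sub>A) \<odot>\<^sub>N f x) : Hom A M N" if "c : car K" "f : Hom A M N" for c f
  by (rule HomI[OF M kap_hom[OF N HomD]]) (use that in auto)
 have ze: "(\<lambda>x\<in> car M. \<zero>\<^sub>N) : Hom A M N" by (rule HomI[OF M hom_zero_fun[OF N]])
 have ng: "(\<lambda>x\<in> car M. \<ominus>\<^sub>N f x) : Hom A M N" if "f : Hom A M N" for f
  by (rule HomI[OF M hom_uminus[OF N HomD]]) (use that in auto)
 have und: "f x = undefined" if "f : Hom A M N" "x ~: car M" for f x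
  using that by (auto simp: Hom_def PiE_iff extensional_def)
 show ?thesis
 proof (rule right_moduleI)
  fix f assume f: "f : car (HK A M N)"
  show "EX y: car (HK A M N). y \<oplus>\<^sub>(HK A M N) f = \<zero>\<^sub>(HK A M N)"
   using f ng[of f] c[of f] by (intro bexI[of _ "\<lambda>x\<in> car M. \<ominus>\<^sub>N f x"]) (auto simp: N.M.l_neg fun_eq_iff)
  show "\<zero>\<^sub>(HK A M N) \<oplus>\<^sub>(HK A M N) f = f" using f c[of f] und[of f] by (auto simp: fun_eq_iff)
  show "\<one>\<^sub>(Ka K) \<odot>\<^sub>(HK A M N) f = f" using f c[of f] und[of f] by (auto simp: fun_eq_iff kap_one N.act_one)
  show "(a \<oplus>\<^sub>(Ka K) b) \<odot>\<^sub>(HK A M N) f = a \<odot>\<^sub>(HK A M N) f \<oplus>\<^sub>(HK A M N) b \<odot>\<^sub>(HK A M N) f"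
   if "a : car (Ka K)" "b : car (Ka K)" for a b
   using f c[of f] that by (auto simp: fun_eq_iff kap_add N.act_add_left kap_closed)
  show "(a \<otimes>\<^sub>(Ka K) b) \<odot>\<^sub>(HK A M N) f = b \<odot>\<^sub>(HK A M N) (a \<odot>\<^sub>(HK A M N) f)"
   if "a : car (Ka K)" "b : car (Ka K)" for a b
   using f c[of f] that by (auto simp: fun_eq_iff kap_mult N.act_mult kap_closed)
  fix g assume g: "g : car (HK A M N)"
  show "f \<oplus>\<^sub>(HK A M N) g = g \<oplus>\<^sub>(HK A M N) f" using f g c[of f] c[of g] by (auto simp: fun_eq_iff N.M.a_comm)
  show "a \<odot>\<^sub>(HK A M N) (f \<oplus>\<^sub>(HK A M N) g) = a \<odot>\<^sub>(HK A M N) f \<oplus>\<^sub>(HK A M N) a \<odot>\<^sub>(HK A M N) g"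
   if "a : car (Ka K)" for a
   using f g c[of f] c[of g] that by (auto simp: fun_eq_iff N.act_add_right kap_closed)
  fix h assume h: "h : car (HK A M N)"
  show "(f \<oplus>\<^sub>(HK A M N) g) \<oplus>\<^sub>(HK A M N) h = f \<oplus>\<^sub>(HK A M N) (g \<oplus>\<^sub>(HK A M N) h)"
   using f g h c[of f] c[of g] c[of h] by (auto simp: fun_eq_iff N.M.a_assoc)
 qed (use pl sc ze ring_Ka in auto)
qed

text \<open>A homomorphism is determined by its values on a finite generating set. Evaluating at one
  generator after the other, the spaces of homomorphisms vanishing on \<open>T\<close>
  (\<open>?Z T\<close>) are finite-dimensional, starting from the zero space
  \<open>?Z S\<close>.\<close>

lemma flen_HK:
 assumes M: "fdm K A M" and N: "fdm K A N" shows "flen (Ka K) (HK A M N)"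
proof -
 interpret MM: right_module A M by (rule fdmD(1)[OF M])
 interpret N: right_module A N by (rule fdmD(1)[OF N])
 let ?H = "HK A M N"
 have H: "right_module (Ka K) ?H" by (rule right_module_HK[OF MM.right_module_axioms N.right_module_axioms])
 interpret H: right_module "Ka K" ?H by (rule H)
 let ?Z = "%T. {f : Hom A M N. ALL s:T. f s = \<zero>\<^sub>N}"
 have Z: "submodule (?Z T) (Ka K) ?H" if "T <= car M" for T
 proof (rule H.submoduleI)
  show "x \<oplus>\<^sub>?H y : ?Z T" if "x : ?Z T" "y : ?Z T" for x y
   using H.M.a_closed[of x y] that \<open>T <= car M\<close> by (auto simp: subset_iff)
  show "a \<odot>\<^sub>?H x : ?Z T" if "a : car (Ka K)" "x : ?Z T" for a x
   using H.act_closed[of a x] that \<open>T <= car M\<close> kap_closed by (auto simp: subset_iff)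
  show "\<zero>\<^sub>?H : ?Z T" using H.M.zero_closed \<open>T <= car M\<close> by (auto simp: subset_iff)
 qed auto
 have step: "flen (Ka K) (restr ?H (?Z T))" if T: "insert s T <= car M" and fl: "flen (Ka K) (restr ?H (?Z (insert s T)))" for s T
 proof -
  have Tc: "T <= car M" "s : car M" using T by auto
  have e: "is_hom (Ka K) (restr ?H (?Z T)) (Kr A N) (%f. f s)"
   by (rule is_homI) (use Tc hom_closed[OF HomD] in auto)
  have k: "a_kernel (restr ?H (?Z T)) (Kr A N) (%f. f s) = ?Z (insert s T)" by (auto simp: a_kernel_eq)
  show ?thesis
   by (rule flen_into[OF right_module_restr[OF H Z[OF Tc(1)]] fdmD(3)[OF N] e fdmD(2)[OF N]])
    (use fl k in simp)
 qed
 obtain S where S: "finite S" "S <= car M" "!!L. submodule L A M ==> S <= L ==> L = car M"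
  using fdm_imp_fin_gen[OF M] unfolding fin_gen_def by auto
 have "ALL T. S \<union> T <= car M --> flen (Ka K) (restr ?H (?Z (S \<union> T))) --> flen (Ka K) (restr ?H (?Z T))"
  using S(1)
 proof (induction S)
  case (insert s S)
  show ?case
  proof (intro allI impI)
   fix T assume T: "insert s S \<union> T <= car M" "flen (Ka K) (restr ?H (?Z (insert s S \<union> T)))"
   have "flen (Ka K) (restr ?H (?Z (insert s T)))"
    using insert.IH[rule_format, of "insert s T"] T by (simp add: Un_insert_right)
   thus "flen (Ka K) (restr ?H (?Z T))" using step[of s T] T(1) by auto
  qed
 qed simp
 moreover have "flen (Ka K) (restr ?H (?Z S))"
 proof -
  have "f = \<zero>\<^sub>?H" if f: "f : ?Z S" for f
  proof -
   have fh: "is_hom A M N f" using f HomD by auto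
   have "a_kernel M N f = car M"
    by (rule S(3)[OF submodule_kernel[OF MM.right_module_axioms N.right_module_axioms fh]])
     (use f S(2) in \<open>auto simp: a_kernel_eq\<close>)
   hence "f x = \<zero>\<^sub>N" if "x : car M" for x using that by (auto simp: a_kernel_eq)
   thus ?thesis using Hom_ext[of f A M N "\<zero>\<^sub>?H"] H.M.zero_closed f by auto
  qed
  hence "?Z S = {\<zero>\<^sub>?H}" using H.submoduleD(2)[OF Z[OF S(2)]] by blast
  thus ?thesis using flen_zero[OF right_module_restr[OF H Z[OF S(2)]]] by simp
 qed
 ultimately have "flen (Ka K) (restr ?H (?Z {}))" using S(2) by (simp only: Un_empty_right)
 moreover have "?Z {} = car ?H" by auto
 ultimately show ?thesis by (metis restr_simps(5))
qed

lemma HK_hom_pre: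
 assumes U: "right_module A U" and M: "right_module A M" and N: "right_module A N" and d: "is_hom A U M d"
 shows "is_hom (Ka K) (HK A M N) (HK A U N) (%h. \<lambda>x\<in> car U. h (d x))"
 by (rule is_homI) (auto simp: HomI[OF U hom_comp[OF d HomD]] hom_closed[OF d] fun_eq_iff)

lemma HK_hom_post:
 assumes M: "right_module A M" and N: "right_module A N" and N': "right_module A N'" and g: "is_hom A N N' g"
 shows "is_hom (Ka K) (HK A M N) (HK A M N') (%h. \<lambda>x\<in> car M. g (h x))"
 by (rule is_homI)
  (auto simp: HomI[OF M hom_comp[OF HomD g]] hom_closed[OF HomD] fun_eq_iff hom_add[OF g] hom_act[OF g] kap_closed)

lemma hdim_retract_dom:
 assumes "fdm K A M" "fdm K A M'" "fdm K A N" "retract A M M'" shows "hdim K A M N <= hdim K A M' N"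
proof -
 note r = fdmD(1)[OF assms(1)] fdmD(1)[OF assms(2)] fdmD(1)[OF assms(3)]
 obtain s t where st: "is_hom A M M' s" "is_hom A M' M t" "!!x. x : car M ==> t (s x) = x"
  using assms(4) unfolding retract_def by auto
 have "inj_on (%h. \<lambda>x\<in> car M'. h (t x)) (car (HK A M N))"
 proof (rule inj_onI)
  fix f g assume fg: "f : car (HK A M N)" "g : car (HK A M N)"
   "(\<lambda>x\<in> car M'. f (t x)) = (\<lambda>x\<in> car M'. g (t x))"
  have "f x = g x" if "x : car M" for x
   using fun_cong[OF fg(3), of "s x"] that hom_closed[OF st(1)] st(3) by simp
  thus "f = g" using fg Hom_ext[of f A M N g] by simp
 qed
 thus ?thesis unfolding hdim_def
  using inj_len_le[OF right_module_HK[OF r(1,3)] right_module_HK[OF r(2,3)] HK_hom_pre[OF r(2,1,3) st(2)] flen_HK[OF assms(1,3)] flen_HK[OF assms(2,3)]]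
  by simp
qed

lemma hdim_retract_cod:
 assumes "fdm K A M" "fdm K A N" "fdm K A N'" "retract A N N'" shows "hdim K A M N <= hdim K A M N'"
proof -
 note r = fdmD(1)[OF assms(1)] fdmD(1)[OF assms(2)] fdmD(1)[OF assms(3)]
 obtain s t where st: "is_hom A N N' s" "is_hom A N' N t" "!!x. x : car N ==> t (s x) = x"
  using assms(4) unfolding retract_def by auto
 have "inj_on (%h. \<lambda>x\<in> car M. s (h x)) (car (HK A M N))"
 proof (rule inj_onI)
  fix f g assume fg: "f : car (HK A M N)" "g : car (HK A M N)"
   "(\<lambda>x\<in> car M. s (f x)) = (\<lambda>x\<in> car M. s (g x))"
  have "f x = g x" if "x : car M" for x
  proof -
   have "s (f x) = s (g x)" using fun_cong[OF fg(3), of x] that by simp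
   thus ?thesis using st(3)[of "f x"] st(3)[of "g x"] hom_closed[OF HomD] that fg by (metis HK_simps(1))
  qed
  thus "f = g" using fg Hom_ext[of f A M N g] by simp
 qed
 thus ?thesis unfolding hdim_def
  using inj_len_le[OF right_module_HK[OF r(1,2)] right_module_HK[OF r(1,3)] HK_hom_post[OF r(1,2,3) st(1)] flen_HK[OF assms(1,2)] flen_HK[OF assms(1,3)]]
  by simp
qed

lemma hdim_iso_dom: "fdm K A M ==> fdm K A M' ==> fdm K A N ==> mod_iso A M M' ==> hdim K A M N = hdim K A M' N"
 by (metis fdmD(1) hdim_retract_dom le_antisym mod_iso_retract)

lemma hdim_eq_0_iff:
 assumes "fdm K A M" "fdm K A N"
 shows "hdim K A M N = 0 \<longleftrightarrow> (ALL f. is_hom A M N f --> (ALL x: car M. f x = \<zero>\<^sub>N))"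
 using len_eq_0_iff[OF right_module_HK[OF fdmD(1)[OF assms(1)] fdmD(1)[OF assms(2)]] flen_HK[OF assms]]
  Hom_zero_iff[OF fdmD(1)[OF assms(1)] hom_zero_fun[OF fdmD(1)[OF assms(2)]]]
 by (simp add: hdim_def Hom_zero_def)

text \<open>Applying Hom(-,N) to the exact sequence U1 -> U0 -> M -> 0 gives a left exact sequence;
  the defect in the dimension count is the cokernel of its last map, which vanishes exactly under
  \<open>extl\<close>.\<close>

lemma hdim_pres:
 assumes U1: "fdm K A U1" and U0: "fdm K A U0" and M: "fdm K A M" and N: "fdm K A N"
  and d: "is_hom A U1 U0 d" and p: "is_hom A U0 M p" "p ` car U0 = car M"
  and k: "a_kernel U0 M p = d ` car U1"
 shows hdim_pres_le: "hdim K A U0 N <= hdim K A M N + hdim K A U1 N"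
  and hdim_pres_eq: "hdim K A U0 N = hdim K A M N + hdim K A U1 N \<longleftrightarrow> extl A U1 d U0 N"
proof -
 note r = fdmD(1)[OF U1] fdmD(1)[OF U0] fdmD(1)[OF M] fdmD(1)[OF N]
 let ?T = "%h. \<lambda>x\<in> car U1. h (d x)"
 let ?P = "%h. \<lambda>x\<in> car U0. h (p x)"
 have T: "is_hom (Ka K) (HK A U0 N) (HK A U1 N) ?T" by (rule HK_hom_pre[OF r(1,2,4) d])
 have P: "is_hom (Ka K) (HK A M N) (HK A U0 N) ?P" by (rule HK_hom_pre[OF r(2,3,4) p(1)])
 note H = right_module_HK[OF r(1,4)] right_module_HK[OF r(2,4)] right_module_HK[OF r(3,4)]
 note fl = flen_HK[OF U1 N] flen_HK[OF U0 N] flen_HK[OF M N]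
 let ?ker = "a_kernel (HK A U0 N) (HK A U1 N) ?T"
 have kers: "submodule ?ker (Ka K) (HK A U0 N)" by (rule submodule_kernel[OF H(2,1) T])
 have pd: "p (d x) = \<zero>\<^sub>M" if "x : car U1" for x
  using k that by (auto simp: a_kernel_eq)
 have kd: "h : ?ker \<longleftrightarrow> h : Hom A U0 N & (ALL x: car U1. h (d x) = \<zero>\<^sub>N)" for h
  by (auto simp: a_kernel_eq fun_eq_iff)
 have Pk: "?P ` car (HK A M N) = ?ker"
 proof
  show "?P ` car (HK A M N) <= ?ker"
  proof
   fix g assume "g : ?P ` car (HK A M N)"
   then obtain h where h: "h : Hom A M N" "g = ?P h" by auto
   thus "g : ?ker" unfolding kd
    using hom_closed[OF P, of h] hom_closed[OF d] pd hom_zero[OF r(3,4) HomD[OF h(1)]] by simp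
  qed
  show "?ker <= ?P ` car (HK A M N)"
  proof
   fix g assume g: "g : ?ker"
   hence gh: "is_hom A U0 N g" "g : Hom A U0 N" using HomD kd by auto
   obtain h where h: "is_hom A M N h" "!!x. x : car U0 ==> h (p x) = g x"
   proof (rule hom_factor[OF r(2,3,4) p gh(1)])
    fix x assume "x : car U0" "p x = \<zero>\<^sub>M"
    hence "x : d ` car U1" using k by (auto simp: a_kernel_eq)
    thus "g x = \<zero>\<^sub>N" using g kd by auto
   qed auto
   let ?h = "restrict h (car M)"
   have hH: "?h : Hom A M N" by (rule HomI[OF r(3) h(1)])
   have gP: "g = ?P ?h"
   proof (rule Hom_ext[OF gh(2)])
    show "?P ?h : Hom A U0 N" using hom_closed[OF P, of ?h] hH by simp
   qed (use h(2) hom_closed[OF p(1)] in auto)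
   show "g : ?P ` car (HK A M N)" unfolding HK_simps image_iff by (rule bexI[of _ ?h]) (fact gP, fact hH)
  qed
 qed
 have "inj_on ?P (car (HK A M N))"
 proof (rule inj_onI)
  fix f g assume fg: "f : car (HK A M N)" "g : car (HK A M N)" "?P f = ?P g"
  have "f y = g y" if y: "y : car M" for y
  proof -
   obtain x where "x : car U0" "y = p x" using p(2) y by blast
   thus ?thesis using fun_cong[OF fg(3), of x] by simp
  qed
  thus "f = g" using fg Hom_ext[of f A M N g] by simp
 qed
 hence "bij_betw ?P (car (HK A M N)) (car (restr (HK A U0 N) ?ker))"
  using Pk by (simp add: bij_betw_def)
 moreover have "is_hom (Ka K) (HK A M N) (restr (HK A U0 N) ?ker) ?P"
  by (rule hom_restr_cod[OF P]) (use Pk in auto)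
 ultimately have e1: "len (Ka K) (restr (HK A U0 N) ?ker) = hdim K A M N"
  using len_iso[OF H(3) right_module_restr[OF H(2) kers]] fl(3) by (simp add: hdim_def)
 interpret H0: right_module "Ka K" "HK A U0 N" by (rule H(2))
 have im: "submodule (?T ` car (HK A U0 N)) (Ka K) (HK A U1 N)"
  by (rule submodule_image[OF H(2,1) T H0.submodule_carrier])
 let ?I = "restr (HK A U1 N) (?T ` car (HK A U0 N))"
 have e2: "hdim K A U0 N = hdim K A M N + len (Ka K) ?I"
  using len_into[OF H(2,1) T fl(1,2)] e1 by (simp add: hdim_def)
 have e3: "len (Ka K) ?I <= hdim K A U1 N" unfolding hdim_def by (rule len_restr_le[OF H(1) im fl(1)])
 show "hdim K A U0 N <= hdim K A M N + hdim K A U1 N" using e2 e3 by simp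
 have sur: "len (Ka K) ?I = hdim K A U1 N \<longleftrightarrow> ?T ` car (HK A U0 N) = car (HK A U1 N)"
  using len_restr_less[OF H(1) im fl(1)] unfolding hdim_def by (metis less_irrefl restr_simps(5))
 have "?T ` car (HK A U0 N) = car (HK A U1 N) \<longleftrightarrow> extl A U1 d U0 N"
 proof
  assume s: "?T ` car (HK A U0 N) = car (HK A U1 N)"
  show "extl A U1 d U0 N" unfolding extl_def
  proof (intro allI impI)
   fix u assume u: "is_hom A U1 N u"
   have "restrict u (car U1) : ?T ` car (HK A U0 N)" using s HomI[OF r(1) u] by simp
   then obtain v where v: "v : Hom A U0 N" "restrict u (car U1) = ?T v" by auto
   have "v (d x) = u x" if "x : car U1" for x using fun_cong[OF v(2), of x] that by simp
   thus "EX v. is_hom A U0 N v & (ALL x: car U1. v (d x) = u x)" using HomD[OF v(1)] by auto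
  qed
 next
  assume s: "extl A U1 d U0 N"
  have "u : ?T ` car (HK A U0 N)" if u: "u : Hom A U1 N" for u
  proof -
   obtain v where v: "is_hom A U0 N v" "ALL x: car U1. v (d x) = u x"
    using s HomD[OF u] unfolding extl_def by blast
   let ?v = "restrict v (car U0)"
   have vH: "?v : Hom A U0 N" by (rule HomI[OF r(2) v(1)])
   have uT: "u = ?T ?v"
    by (rule Hom_ext[OF u]) (use hom_closed[OF T, of ?v] vH v(2) hom_closed[OF d] in auto)
   show ?thesis unfolding HK_simps image_iff by (rule bexI[of _ ?v]) (fact uT, fact vH)
  qed
  thus "?T ` car (HK A U0 N) = car (HK A U1 N)"
   using hom_closed[OF T] by auto
 qed
 thus "hdim K A U0 N = hdim K A M N + hdim K A U1 N \<longleftrightarrow> extl A U1 d U0 N"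
  using sur e2 by auto
qed

text \<open>The sequence V -> D -> W is a presentation of \<open>W\<close>, and every map on
  \<open>V\<close> extends to \<open>D\<close> along the projection, so \<open>hdim_pres_eq\<close>
  is an equality.\<close>

lemma hdim_biprod:
 assumes D: "fdm K A D" and V: "fdm K A V" and W: "fdm K A W" and N: "fdm K A N" and b: "biprod A D V W i j p q"
 shows "hdim K A D N = hdim K A V N + hdim K A W N"
proof -
 note bd = biprodD[OF b]
 have "extl A V i D N" unfolding extl_def
 proof (intro allI impI)
  fix u assume "is_hom A V N u"
  thus "EX v. is_hom A D N v & (ALL x: car V. v (i x) = u x)"
   using hom_comp[OF bd(3)] bd(5) by (intro exI[of _ "%x. u (p x)"]) auto
 qed
 thus ?thesis
  using hdim_pres_eq[OF V D W N bd(1) bd(4) biprod_surj_q[OF b] biprod_ker_q[OF fdmD(1)[OF D] fdmD(1)[OF V] b fdmD(1)[OF W]]]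
  by simp
qed

text \<open>Once the images of the powers of f have the least possible dimension, the power g
  satisfies g(g(M)) = g(M), so M is the sum of image and kernel of g, and g is injective on its
  image.\<close>

lemma fitting:
 assumes M: "fdm K A M" and f: "is_hom A M M f"
 obtains n where "decomposes A M ((f ^^ Suc n) ` car M) (a_kernel M M (f ^^ Suc n))"
proof -
 interpret MM: right_module A M by (rule fdmD(1)[OF M])
 note rM = MM.right_module_axioms
 have fp: "is_hom A M M (f ^^ n)" for n by (rule hom_pow[OF f])
 have im: "submodule ((f ^^ n) ` car M) A M" for n by (rule submodule_image[OF rM rM fp MM.submodule_carrier])
 \<comment> \<open>Only positive powers compete. The exponent Suc n later guarantees that
   injectivity of the power gives injectivity of f.\<close>
 obtain n where n: "!!m. dm K A (restr M ((f ^^ Suc n) ` car M)) <= dm K A (restr M ((f ^^ Suc m) ` car M))"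
  using ex_has_least_nat[of "%_. True" 0 "%m. dm K A (restr M ((f ^^ Suc m) ` car M))"] by auto
 let ?g = "f ^^ Suc n"
 have gg: "?g (?g x) = (f ^^ Suc (n + Suc n)) x" for x by (metis add_Suc comp_apply funpow_add)
 have sub: "(f ^^ Suc (n + Suc n)) ` car M <= ?g ` car M"
  unfolding gg[symmetric] using hom_closed[OF fp] by blast
 have "submodule ((f ^^ Suc (n + Suc n)) ` car M) A (restr M (?g ` car M))"
  using submodule_restr_iff[OF rM im] im sub by blast
 hence eq: "(f ^^ Suc (n + Suc n)) ` car M = ?g ` car M"
  using fdm_restr(3)[OF fdm_restr(1)[OF M im], of "(f ^^ Suc (n + Suc n)) ` car M"] n[of "n + Suc n"]
  unfolding restr_simps by (metis leD)
 note gc = hom_closed[OF fp[of "Suc n"]]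
 have lift: "EX y: car M. ?g x = ?g (?g y)" if "x : car M" for x
  using eq that unfolding gg by (metis imageE imageI)
 have sum: "?g ` car M <+>\<^sub>M a_kernel M M ?g = car M"
 proof
  show "?g ` car M <+>\<^sub>M a_kernel M M ?g <= car M"
   using gc by (auto simp: MM.set_add_eq a_kernel_eq simp del: funpow.simps)
  show "car M <= ?g ` car M <+>\<^sub>M a_kernel M M ?g"
  proof
   fix x assume x: "x : car M"
   obtain y where y: "y : car M" "?g x = ?g (?g y)" using lift[OF x] by auto
   have "?g (x \<ominus>\<^sub>M ?g y) = \<zero>\<^sub>M"
    using x y gc by (simp add: hom_diff[OF rM rM fp] MM.diff_eq_zero del: funpow.simps)
   hence "x \<ominus>\<^sub>M ?g y : a_kernel M M ?g" using x y gc by (simp add: a_kernel_eq del: funpow.simps)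
   moreover have "x = ?g y \<oplus>\<^sub>M (x \<ominus>\<^sub>M ?g y)" using x y gc by (simp add: MM.add_diff_cancel del: funpow.simps)
   ultimately show "x : ?g ` car M <+>\<^sub>M a_kernel M M ?g" unfolding MM.set_add_eq using y(1) by blast
  qed
 qed
 have inter: "?g ` car M \<inter> a_kernel M M ?g = {\<zero>\<^sub>M}"
 proof -
  let ?I = "restr M (?g ` car M)"
  have gI: "is_hom A ?I ?I ?g"
   by (rule hom_restr_cod[OF hom_restr_dom[OF fp]]) (use gc in \<open>auto simp del: funpow.simps\<close>)
  have "?g ` car ?I = car ?I"
   using eq unfolding gg[symmetric] by (simp add: image_image del: funpow.simps)
  hence "inj_on ?g (car ?I)" using surj_endo_inj[OF fdm_restr(1)[OF M im] gI] by (auto simp: bij_betw_def)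
  hence "ALL x:?g ` car M. ?g x = \<zero>\<^sub>M --> x = \<zero>\<^sub>M"
   using inj_on_hom_iff[OF right_module_restr[OF rM im] right_module_restr[OF rM im] gI] by (simp del: funpow.simps)
  thus ?thesis using MM.submoduleD(2)[OF im[of "Suc n"]] hom_zero[OF rM rM fp[of "Suc n"]]
   by (auto simp: a_kernel_eq simp del: funpow.simps)
 qed
 show thesis
  by (rule that[of n]) (use im[of "Suc n"] submodule_kernel[OF rM rM fp[of "Suc n"]] sum inter in \<open>simp add: decomposes_def del: funpow.simps\<close>)
qed

lemma indec_endo:
 assumes M: "fdm K A M" and i: "indecomposable A M" and f: "is_hom A M M f"
 shows "bij_betw f (car M) (car M) | (EX n. ALL x: car M. (f ^^ n) x = \<zero>\<^sub>M)"
proof -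
 note rM = fdmD(1)[OF M]
 obtain n where n: "decomposes A M ((f ^^ Suc n) ` car M) (a_kernel M M (f ^^ Suc n))" by (rule fitting[OF M f])
 from i n consider "(f ^^ Suc n) ` car M = {\<zero>\<^sub>M}" | "a_kernel M M (f ^^ Suc n) = {\<zero>\<^sub>M}"
  unfolding indecomposable_def by blast
 thus ?thesis
 proof cases
  case 1 thus ?thesis by blast
 next
  case 2
  have "x = \<zero>\<^sub>M" if x: "x : car M" "f x = \<zero>\<^sub>M" for x
  proof -
   have "(f ^^ Suc n) x = (f ^^ n) (f x)" by (simp add: funpow_swap1)
   hence "(f ^^ Suc n) x = \<zero>\<^sub>M" using x hom_zero[OF rM rM hom_pow[OF f]] by simp
   hence "x : a_kernel M M (f ^^ Suc n)" using x by (simp add: a_kernel_eq)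
   thus ?thesis using 2 by simp
  qed
  hence "inj_on f (car M)" using inj_on_hom_iff[OF rM rM f] by blast
  thus ?thesis using inj_endo_surj[OF M f] by simp
 qed
qed

text \<open>The endomorphism ring of an indecomposable is local. If g is nilpotent and f(x) = 0,
  then g(x) = x, so x = 0; thus f is injective.\<close>

lemma indec_sum_id:
 assumes M: "fdm K A M" and i: "indecomposable A M" and f: "is_hom A M M f" and g: "is_hom A M M g"
  and e: "!!x. x : car M ==> f x \<oplus>\<^sub>M g x = x"
 shows "bij_betw f (car M) (car M) | bij_betw g (car M) (car M)"
proof (rule disjCI)
 note rM = fdmD(1)[OF M]
 interpret MM: right_module A M by (rule rM)
 assume "~ bij_betw g (car M) (car M)"
 then obtain n where n: "ALL x: car M. (g ^^ n) x = \<zero>\<^sub>M" using indec_endo[OF M i g] by auto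
 have "x = \<zero>\<^sub>M" if x: "x : car M" "f x = \<zero>\<^sub>M" for x
 proof -
  have "g x = x" using e[OF x(1)] x hom_closed[OF g] by simp
  hence "(g ^^ n) x = x" by (induction n) auto
  thus ?thesis using n x by auto
 qed
 hence "inj_on f (car M)" using inj_on_hom_iff[OF rM rM f] by blast
 thus "bij_betw f (car M) (car M)" using inj_endo_surj[OF M f] by simp
qed

lemma retract_via:
 assumes N: "right_module A N" and s: "is_hom A N V s" and r: "is_hom A V N r"
  and b: "bij_betw (%x. r (s x)) (car N) (car N)"
 shows "retract A N V"
proof -
 have rs: "is_hom A N N (%x. r (s x))" by (rule hom_comp[OF s r])
 let ?g = "inv_into (car N) (%x. r (s x))"
 show ?thesis unfolding retract_def
  using s hom_comp[OF r hom_inverse[OF N rs b]] bij_betw_inv_into_left[OF b]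
  by (intro exI[of _ s] exI[of _ "%x. ?g (r x)"]) auto
qed

text \<open>The identity of \<open>N\<close> is the sum of its two components through
  \<open>V\<close> and \<open>W\<close>, and one of these is bijective by
  \<open>indec_sum_id\<close>. This is the exchange property behind all Krull-Schmidt arguments
  below.\<close>

lemma indec_retract_biprod:
 assumes N: "fdm K A N" and i: "indecomposable A N" and D: "right_module A D" and b: "biprod A D V W i' j p q"
  and r: "retract A N D"
 shows "retract A N V | retract A N W"
proof -
 note bd = biprodD[OF b] and rN = fdmD(1)[OF N]
 obtain s t where st: "is_hom A N D s" "is_hom A D N t" "!!x. x : car N ==> t (s x) = x"
  using r unfolding retract_def by auto
 have a: "is_hom A N V (%x. p (s x))" "is_hom A V N (%x. t (i' x))" "is_hom A N W (%x. q (s x))" "is_hom A W N (%x. t (j x))"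
  using hom_comp[OF st(1) bd(3)] hom_comp[OF bd(1) st(2)] hom_comp[OF st(1) bd(4)] hom_comp[OF bd(2) st(2)] by auto
 have "t (i' (p (s x))) \<oplus>\<^sub>N t (j (q (s x))) = x" if x: "x : car N" for x
 proof -
  have sx: "s x : car D" by (rule hom_closed[OF st(1) x])
  have "t (i' (p (s x))) \<oplus>\<^sub>N t (j (q (s x))) = t (i' (p (s x)) \<oplus>\<^sub>D j (q (s x)))"
   using sx hom_closed[OF bd(1)] hom_closed[OF bd(2)] hom_closed[OF bd(3)] hom_closed[OF bd(4)]
   by (simp add: hom_add[OF st(2)])
  thus ?thesis using bd(9)[OF sx] st(3)[OF x] by simp
 qed
 from indec_sum_id[OF N i hom_comp[OF a(1,2)] hom_comp[OF a(3,4)] this]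
 show ?thesis using retract_via[OF rN a(1,2)] retract_via[OF rN a(3,4)] by auto
qed

lemma retract_of_indec:
 assumes N: "right_module A N" and M: "right_module A M" and i: "indecomposable A M" and nz: "car N ~= {\<zero>\<^sub>N}"
  and r: "retract A N M"
 shows "mod_iso A N M"
proof -
 interpret MM: right_module A M by fact
 obtain s t where st: "is_hom A N M s" "is_hom A M N t" "!!x. x : car N ==> t (s x) = x"
  using r unfolding retract_def by auto
 note d = retract_decomposes[OF M N st]
 have "s ` car N ~= {\<zero>\<^sub>M}"
 proof
  assume z: "s ` car N = {\<zero>\<^sub>M}"
  have "x = \<zero>\<^sub>N" if "x : car N" for x
  proof -
   have "s x = \<zero>\<^sub>M" using z that by blast
   thus ?thesis using st(3)[OF that] hom_zero[OF M N st(2)] by simp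
  qed
  moreover interpret N: right_module A N by fact
  have "\<zero>\<^sub>N : car N" by simp
  ultimately show False using nz by blast
 qed
 hence "a_kernel M N t = {\<zero>\<^sub>M}" using i d(1) unfolding indecomposable_def by blast
 hence e: "{x \<oplus>\<^sub>M \<zero>\<^sub>M | x. x : s ` car N} = car M"
  using d(1) by (auto simp: decomposes_def MM.set_add_eq)
 have "car M = s ` car N" unfolding e[symmetric] using hom_closed[OF st(1)] by force
 thus ?thesis using d(2,3) st(1) by (auto simp: mod_iso_iff[OF N])
qed

lemma indec_nonzero: "indecomposable A M ==> car M ~= {\<zero>\<^sub>M}"
 by (simp add: indecomposable_def)

lemma indec_iso:
 assumes M: "right_module A M" and N: "right_module A N" and iso: "mod_iso A M N" and i: "indecomposable A M"
 shows "indecomposable A N"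
proof -
 interpret MM: right_module A M by fact
 interpret NN: right_module A N by fact
 obtain g where g: "is_hom A N M g" "bij_betw g (car N) (car M)"
  using mod_iso_sym[OF M N iso] by (auto simp: mod_iso_iff[OF N])
 have inj: "inj_on g (car N)" and sur: "g ` car N = car M" using g(2) by (auto simp: bij_betw_def)
 have gz: "g \<zero>\<^sub>N = \<zero>\<^sub>M" by (rule hom_zero[OF N M g(1)])
 have imz: "L = {\<zero>\<^sub>N}" if "g ` L = {\<zero>\<^sub>M}" "L <= car N" for L
 proof -
  have "x = \<zero>\<^sub>N" if x: "x : L" for x
  proof -
   have "g x : g ` L" using x by blast
   hence "g x = g \<zero>\<^sub>N" using \<open>g ` L = _\<close> gz by simp
   thus ?thesis using inj_onD[OF inj] x \<open>L <= _\<close> by auto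
  qed
  thus ?thesis using that by auto
 qed
 show ?thesis unfolding indecomposable_def
 proof (intro conjI allI impI)
  show "car N ~= {\<zero>\<^sub>N}" using indec_nonzero[OF i] sur gz by auto
  fix L L' assume d: "decomposes A N L L'"
  hence L: "submodule L A N" "submodule L' A N" "L \<inter> L' = {\<zero>\<^sub>N}" "L <+>\<^sub>N L' = car N"
   by (auto simp: decomposes_def)
  have Lc: "L <= car N" "L' <= car N" using NN.submoduleD(1) L by auto
  have "g ` L \<inter> g ` L' = {\<zero>\<^sub>M}" using inj_on_image_Int[OF inj Lc] L(3) gz by simp
  moreover have "g ` L <+>\<^sub>M g ` L' = car M"
  proof -
   have "g ` L <+>\<^sub>M g ` L' = g ` (L <+>\<^sub>N L')"
    unfolding MM.set_add_eq NN.set_add_eq using Lc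
    by (auto simp: hom_add[OF g(1)] subset_iff image_iff) (metis hom_add[OF g(1)])+
   thus ?thesis using L(4) sur by simp
  qed
  ultimately have "decomposes A M (g ` L) (g ` L')"
   unfolding decomposes_def using submodule_image[OF N M g(1)] L by auto
  hence "g ` L = {\<zero>\<^sub>M} | g ` L' = {\<zero>\<^sub>M}" using i unfolding indecomposable_def by blast
  thus "L = {\<zero>\<^sub>N} | L' = {\<zero>\<^sub>N}" using imz Lc by metis
 qed
qed

lemma decompose_step:
 assumes M: "fdm K A M" and nz: "car M ~= {\<zero>\<^sub>M}" and ni: "~ indecomposable A M"
 obtains N L p q where "decomposes A M N L" "biprod A M (restr M N) (restr M L) (%x. x) (%x. x) p q"
  "fdm K A (restr M N)" "fdm K A (restr M L)" "dm K A (restr M N) < dm K A M" "dm K A (restr M L) < dm K A M"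
proof -
 interpret MM: right_module A M by (rule fdmD(1)[OF M])
 obtain N L where d: "decomposes A M N L" "N ~= {\<zero>\<^sub>M}" "L ~= {\<zero>\<^sub>M}"
  using nz ni unfolding indecomposable_def by auto
 hence s: "submodule N A M" "submodule L A M" "N \<inter> L = {\<zero>\<^sub>M}" by (auto simp: decomposes_def)
 have "N ~= car M" "L ~= car M" using s(3) d(2,3) MM.submoduleD(1)[OF s(1)] MM.submoduleD(1)[OF s(2)] by auto
 moreover obtain p q where "biprod A M (restr M N) (restr M L) (%x. x) (%x. x) p q"
  by (rule decomposes_biprod[OF fdmD(1)[OF M] d(1)])
 ultimately show thesis using that d fdm_restr[OF M s(1)] fdm_restr[OF M s(2)] by blast
qed

text \<open>The product is formed on pairs and then copied to the type \<open>fmod\<close>, with the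
  injections and projections carried along.\<close>

lemma biprod_exists:
 fixes V W :: "('k, 'a) fmod"
 assumes V: "V : fmods A" and W: "W : fmods A"
 obtains D :: "('k, 'a) fmod" and i j p q where "D : fmods A" "biprod A D V W i j p q"
proof -
 have fV: "fdm K A V" and fW: "fdm K A W" using V W fmods_iff by auto
 interpret V: right_module A V by (rule fdmD(1)[OF fV])
 interpret W: right_module A W by (rule fdmD(1)[OF fW])
 define P where "P = (\<lparr>carrier = car V \<times> car W, mult = undefined, one = undefined, zero = (\<zero>\<^sub>V, \<zero>\<^sub>W),
  add = (%u v. (fst u \<oplus>\<^sub>V fst v, snd u \<oplus>\<^sub>W snd v)), smult = (%a u. (a \<odot>\<^sub>V fst u, a \<odot>\<^sub>W snd u))\<rparr>
   :: ('a, (nat => 'k) \<times> (nat => 'k)) module)"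
 have P: "right_module A P"
 proof (rule right_moduleI)
  show "EX y: car P. y \<oplus>\<^sub>P x = \<zero>\<^sub>P" if "x : car P" for x
   using that V.M.l_neg W.M.l_neg
   by (intro bexI[of _ "(\<ominus>\<^sub>V fst x, \<ominus>\<^sub>W snd x)"]) (auto simp: P_def)
 qed (auto simp: P_def ring_A V.M.a_ac W.M.a_ac V.act_closed W.act_closed V.act_add_left
   W.act_add_left V.act_add_right W.act_add_right V.act_mult W.act_mult V.act_one W.act_one)
 have b: "biprod A P V W (%v. (v, \<zero>\<^sub>W)) (%w. (\<zero>\<^sub>V, w)) fst snd"
  unfolding biprod_def by (intro conjI is_homI) (auto simp: P_def)
 note bd = biprodD[OF b]
 have k: "a_kernel P V fst = (%w. (\<zero>\<^sub>V, w)) ` car W"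
  by (rule biprod_ker_q[OF P W.right_module_axioms biprod_swap[OF P b] V.right_module_axioms])
 have kk: "submodule (a_kernel P V fst) A P" by (rule submodule_kernel[OF P V.right_module_axioms bd(3)])
 have "mod_iso A W (restr P (a_kernel P V fst))"
  unfolding mod_iso_iff[OF W.right_module_axioms]
  by (intro exI[of _ "%w. (\<zero>\<^sub>V, w)"] conjI hom_restr_cod[OF bd(2)]) (auto simp: k bij_betw_def inj_on_def)
 hence "fdm K A (restr P (a_kernel P V fst))" by (rule fdm_iso(1)[OF fW right_module_restr[OF P kk]])
 hence fP: "fdm K A P"
  using flen_into[OF right_module_Kr[OF P] fdmD(3)[OF fV] hom_Kr[OF bd(3)] fdmD(2)[OF fV]] P
  by (simp add: fdm_def Kr_restr a_kernel_Kr)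
 obtain D :: "('k, 'a) fmod" where D: "D : fmods A" "mod_iso A P D" by (rule copy_exists[OF fP])
 then obtain f where f: "is_hom A P D f" "bij_betw f (car P) (car D)" by (auto simp: mod_iso_iff[OF P])
 let ?g = "inv_into (car P) f"
 have g: "is_hom A D P ?g" by (rule hom_inverse[OF P f])
 have gf: "?g (f x) = x" if "x : car P" for x using f(2) that by (simp add: bij_betw_inv_into_left)
 have fg: "f (?g x) = x" if "x : car D" for x using f(2) that by (simp add: bij_betw_inv_into_right)
 have "biprod A D V W (%v. f (v, \<zero>\<^sub>W)) (%w. f (\<zero>\<^sub>V, w)) (%x. fst (?g x)) (%x. snd (?g x))"
  unfolding biprod_def
 proof (intro conjI ballI)
  show "d = f (fst (?g d), \<zero>\<^sub>W) \<oplus>\<^sub>D f (\<zero>\<^sub>V, snd (?g d))" if "d : car D" for d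
  proof -
   have gd: "?g d : car P" by (rule hom_closed[OF g that])
   have "f (fst (?g d), \<zero>\<^sub>W) \<oplus>\<^sub>D f (\<zero>\<^sub>V, snd (?g d)) = f ((fst (?g d), \<zero>\<^sub>W) \<oplus>\<^sub>P (\<zero>\<^sub>V, snd (?g d)))"
    using gd hom_closed[OF bd(1)] hom_closed[OF bd(2)] hom_closed[OF bd(3)] hom_closed[OF bd(4)]
    by (simp add: hom_add[OF f(1)])
   thus ?thesis using bd(9)[OF gd] fg[OF that] by simp
  qed
  show "fst (?g (f (x, \<zero>\<^sub>W))) = x" "snd (?g (f (x, \<zero>\<^sub>W))) = \<zero>\<^sub>W" if "x : car V" for x
   using gf[OF hom_closed[OF bd(1) that]] by auto
  show "snd (?g (f (\<zero>\<^sub>V, x))) = x" "fst (?g (f (\<zero>\<^sub>V, x))) = \<zero>\<^sub>V" if "x : car W" for x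
   using gf[OF hom_closed[OF bd(2) that]] by auto
 qed (use hom_comp[OF bd(1) f(1)] hom_comp[OF bd(2) f(1)] hom_comp[OF g bd(3)] hom_comp[OF g bd(4)] in auto)
 thus thesis using that D(1) by blast
qed

end

section \<open>Projective modules, projective covers and minimal presentations\<close>

definition pcov :: "('k, 'a) module => ('k, 'a) fmod => ((nat => 'k) => (nat => 'k)) => ('k, 'a) fmod => bool" where
 "pcov A P p M \<longleftrightarrow> projective A P & is_hom A P M p & p ` car P = car M &
  (ALL N. submodule N A P & p ` N = car M --> N = car P)"

definition mpres :: "('k, 'a) module => ('k, 'a) fmod => ((nat => 'k) => (nat => 'k)) =>
  ('k, 'a) fmod => ((nat => 'k) => (nat => 'k)) => ('k, 'a) fmod => bool" where
 "mpres A P1 f P0 p M \<longleftrightarrow> pcov A P0 p M & pcov A P1 f (restr P0 (a_kernel P0 M p))"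

definition pres :: "('k, 'a) module => ('k, 'a) fmod => ((nat => 'k) => (nat => 'k)) =>
  ('k, 'a) fmod => ((nat => 'k) => (nat => 'k)) => ('k, 'a) fmod => bool" where
 "pres A V1 d V0 q M \<longleftrightarrow> projective A V1 & projective A V0 & is_hom A V1 V0 d & is_hom A V0 M q &
  q ` car V0 = car M & a_kernel V0 M q = d ` car V1"

text \<open>By \<open>ext0_iff\<close> any minimal presentation may be used for the test, and by
  \<open>tau_hom_zero_iff\<close> the condition says Hom(Y, tau M) = 0. All later arguments use this
  form, in which tau does not occur.\<close>

definition ext0 :: "('k, 'a) module => ('k, 'a) fmod => ('a, 'w) module => bool" where
 "ext0 A M Y \<longleftrightarrow> (EX P1 f P0 p. mpres A P1 f P0 p M & extl A P1 f P0 Y)"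

text \<open>The pairing of the g-vector of M with the dimensions dim Hom(P(i),Y); by
  \<open>theta_eq\<close> it does not depend on the minimal presentation.\<close>

definition theta :: "'k ring => ('k, 'a) module => ('k, 'a) fmod => ('k, 'a) fmod => real" where
 "theta K A M Y = (SOME t. EX P1 f P0 p. mpres A P1 f P0 p M & t = real (hdim K A P0 Y) - real (hdim K A P1 Y))"

lemma decomposes_assoc:
 assumes V: "right_module A V" and d: "decomposes A V P Z" and e: "decomposes A (restr V P) L Y"
 shows "decomposes A V L (Y <+>\<^sub>V Z)"
proof -
 interpret V: right_module A V by fact
 have P: "submodule P A V" and Z: "submodule Z A V" and PZ: "P \<inter> Z = {\<zero>\<^sub>V}" "P <+>\<^sub>V Z = car V"
  using d by (auto simp: decomposes_def)
 have L: "submodule L A V" "L <= P" and Y: "submodule Y A V" "Y <= P" and LY: "L \<inter> Y = {\<zero>\<^sub>V}" "L <+>\<^sub>V Y = P"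
  using e submodule_restr_iff[OF V P] by (auto simp: decomposes_def)
 note Pd = V.submoduleD[OF P] and Zd = V.submoduleD[OF Z] and Ld = V.submoduleD[OF L(1)] and Yd = V.submoduleD[OF Y(1)]
 have YZ: "submodule (Y <+>\<^sub>V Z) A V" by (rule V.submodule_set_add[OF Y(1) Z])
 have "x = \<zero>\<^sub>V" if xL: "x : L" and xYZ: "x : Y <+>\<^sub>V Z" for x
 proof -
  obtain y z where yz: "y : Y" "z : Z" "x = y \<oplus>\<^sub>V z" using xYZ by (auto simp: V.set_add_eq)
  have c: "x : car V" "y : car V" "z : car V" using xL yz(1,2) Ld(1) Yd(1) Zd(1) by auto
  have "x \<ominus>\<^sub>V y = z" using yz(3) c V.diff_add_cancel[of z y] by (simp add: V.M.a_comm)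
  moreover have "x \<ominus>\<^sub>V y : P" using Pd(5) xL yz(1) L(2) Y(2) by blast
  ultimately have "x \<ominus>\<^sub>V y = \<zero>\<^sub>V" using PZ(1) yz(2) by blast
  hence "x = y" using c by (simp add: V.diff_eq_zero)
  thus ?thesis using LY(1) xL yz(1) by blast
 qed
 hence "L \<inter> (Y <+>\<^sub>V Z) = {\<zero>\<^sub>V}" using Ld(2) V.submoduleD(2)[OF YZ] by blast
 moreover have "car V <= L <+>\<^sub>V (Y <+>\<^sub>V Z)"
 proof
  fix x assume "x : car V"
  then obtain a z where "a : P" "z : Z" "x = a \<oplus>\<^sub>V z" using PZ(2) unfolding V.set_add_eq by blast
  moreover from \<open>a : P\<close> obtain l y where "l : L" "y : Y" "a = l \<oplus>\<^sub>V y" using LY(2) unfolding V.set_add_eq by blast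
  ultimately have "x = l \<oplus>\<^sub>V (y \<oplus>\<^sub>V z)" "l : L" "y \<oplus>\<^sub>V z : Y <+>\<^sub>V Z"
   using Ld(1) Yd(1) Zd(1) by (auto simp: V.M.a_assoc subset_iff V.set_add_eq)
  thus "x : L <+>\<^sub>V (Y <+>\<^sub>V Z)" unfolding V.set_add_eq[of L] by blast
 qed
 moreover have "L <+>\<^sub>V (Y <+>\<^sub>V Z) <= car V" using V.submoduleD(1)[OF V.submodule_set_add[OF L(1) YZ]] .
 ultimately show ?thesis using L(1) YZ by (auto simp: decomposes_def)
qed

context fd_algebra
begin

lemma fmD: "M : fmods A ==> fdm K A M" "M : fmods A ==> right_module A M"
 using fmods_iff fdmD(1) by auto

lemma fmods_restr: "M : fmods A ==> submodule N A M ==> restr M N : fmods A"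
 using fmods_iff fdm_restr(1) by blast

lemma fmods_image:
 assumes "M : fmods A" "N : fmods A" "is_hom A M N f"
 shows "submodule (f ` car M) A N" "restr N (f ` car M) : fmods A"
proof -
 interpret MM: right_module A M by (rule fmD(2)[OF assms(1)])
 show "submodule (f ` car M) A N"
  by (rule submodule_image[OF MM.right_module_axioms fmD(2)[OF assms(2)] assms(3) MM.submodule_carrier])
 thus "restr N (f ` car M) : fmods A" by (rule fmods_restr[OF assms(2)])
qed

lemma fmods_kernel:
 assumes "M : fmods A" "N : fmods A" "is_hom A M N f"
 shows "submodule (a_kernel M N f) A M" "restr M (a_kernel M N f) : fmods A"
 using submodule_kernel[OF fmD(2)[OF assms(1)] fmD(2)[OF assms(2)] assms(3)] fmods_restr[OF assms(1)] by auto

lemma fmods_quotient: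
 fixes M :: "('k, 'a) fmod"
 assumes M: "M : fmods A" and N: "submodule N A M"
 obtains Q :: "('k, 'a) fmod" and q where "Q : fmods A" "is_hom A M Q q" "q ` car M = car Q" "a_kernel M Q q = N"
proof -
 obtain Q :: "('k, 'a) fmod" and q where "right_module A Q" "is_hom A M Q q" "q ` car M = car Q" "a_kernel M Q q = N"
  by (rule quotient_exists[OF fmD(2)[OF M] N])
 thus thesis using that fdm_surj(1)[OF fmD(1)[OF M]] fmods_iff by blast
qed

lemma zero_fmod_exists: obtains Z :: "('k, 'a) fmod" where "Z : fmods A" "car Z = {\<zero>\<^sub>Z}"
proof -
 interpret R: right_module A "regular A" by (rule right_module_regular[OF ring_A])
 let ?Z = "restr (regular A) {\<zero>\<^sub>(regular A)}"
 obtain Z :: "('k, 'a) fmod" where Z: "Z : fmods A" "mod_iso A ?Z Z"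
  by (rule copy_exists[OF fdm_restr(1)[OF fdm_regular R.submodule_zero]])
 have "dm K A Z = dm K A ?Z" using fdm_iso(2)[OF fdm_restr(1)[OF fdm_regular R.submodule_zero] fmD(2)[OF Z(1)] Z(2)] .
 also have "... = 0" by (subst dm_eq_0_iff[OF fdm_restr(1)[OF fdm_regular R.submodule_zero]]) simp
 finally show thesis using that[OF Z(1)] dm_eq_0_iff[OF fmD(1)[OF Z(1)]] by simp
qed

lemma projD: "projective A P ==> P : fmods A" "projective A P ==> fdm K A P" "projective A P ==> right_module A P"
 using fmD by (auto simp: projective_def)

lemma proj_lift:
 assumes P: "projective A P" and Z: "Z : fmods A" and Y: "Y : fmods A" and g: "is_hom A Z Y g" "g ` car Z = car Y"
  and h: "is_hom A P Y h"
 obtains h' where "is_hom A P Z h'" "!!x. x : car P ==> g (h' x) = h x"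
proof -
 have 1: "restrict g (car Z) : Hom A Z Y" by (rule HomI[OF fmD(2)[OF Z] g(1)])
 have 2: "restrict h (car P) : Hom A P Y" by (rule HomI[OF projD(3)[OF P] h])
 have 3: "restrict g (car Z) ` car Z = car Y" using g(2) by simp
 have "EX h':Hom A P Z. ALL x: car P. restrict g (car Z) (h' x) = restrict h (car P) x"
  using P Z Y 1 2 3 unfolding projective_def by blast
 then obtain h' where h': "h' : Hom A P Z" "ALL x: car P. restrict g (car Z) (h' x) = restrict h (car P) x" by auto
 thus thesis using that[OF HomD[OF h'(1)]] hom_closed[OF HomD[OF h'(1)]] by auto
qed

text \<open>The target is replaced by the image of \<open>g\<close>, onto which \<open>g\<close> is
  surjective.\<close>

lemma proj_lift_im:
 assumes P: "projective A P" and Z: "Z : fmods A" and Y: "Y : fmods A" and g: "is_hom A Z Y g"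
  and h: "is_hom A P Y h" "!!x. x : car P ==> h x : g ` car Z"
 obtains h' where "is_hom A P Z h'" "!!x. x : car P ==> g (h' x) = h x"
proof (rule proj_lift[OF P Z fmods_image(2)[OF Z Y g] hom_to_image[OF g]])
 show "is_hom A P (restr Y (g ` car Z)) h" by (rule hom_restr_cod[OF h(1)]) (use h(2) in auto)
qed (use that in auto)

lemma projI:
 assumes P: "P : fmods A"
  and l: "!!(Z :: ('k, 'a) fmod) (Y :: ('k, 'a) fmod) g h. Z : fmods A ==> Y : fmods A ==> is_hom A Z Y g ==> g ` car Z = car Y ==>
   is_hom A P Y h ==> EX h'. is_hom A P Z h' & (ALL x: car P. g (h' x) = h x)"
 shows "projective A P"
 unfolding projective_def
proof (intro conjI ballI impI P)
 fix Z Y :: "('k, 'a) fmod" and g h assume *: "Z : fmods A" "Y : fmods A" "g : Hom A Z Y" "h : Hom A P Y" "g ` car Z = car Y"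
 obtain h' where "is_hom A P Z h'" "ALL x: car P. g (h' x) = h x"
  using l[OF *(1,2) HomD[OF *(3)] *(5) HomD[OF *(4)]] by auto
 thus "EX h':Hom A P Z. ALL x: car P. g (h' x) = h x"
  by (intro bexI[OF _ HomI[OF fmD(2)[OF P]]]) auto
qed

lemma proj_retract:
 assumes P: "projective A P" and Q: "Q : fmods A" and r: "retract A Q P" shows "projective A Q"
proof (rule projI[OF Q])
 fix Z Y :: "('k, 'a) fmod" and g h
 assume *: "Z : fmods A" "Y : fmods A" "is_hom A Z Y g" "g ` car Z = car Y" "is_hom A Q Y h"
 obtain s t where st: "is_hom A Q P s" "is_hom A P Q t" "!!x. x : car Q ==> t (s x) = x"
  using r unfolding retract_def by auto
 obtain h' where "is_hom A P Z h'" "!!x. x : car P ==> g (h' x) = h (t x)"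
  using proj_lift[OF P *(1-4) hom_comp[OF st(2) *(5)]] by metis
 thus "EX h'. is_hom A Q Z h' & (ALL x: car Q. g (h' x) = h x)"
  using hom_comp[OF st(1)] hom_closed[OF st(1)] st(3) by (intro exI[of _ "%x. h' (s x)"]) auto
qed

lemma hom_of_biprod:
 assumes D: "right_module A D" and b: "biprod A D V W i j p q" and N: "right_module A N"
  and f: "is_hom A V N f" and g: "is_hom A W N g"
 shows "is_hom A D N (%x. f (p x) \<oplus>\<^sub>N g (q x))"
 by (rule hom_plus[OF N hom_comp[OF biprodD(3)[OF b] f] hom_comp[OF biprodD(4)[OF b] g]])

lemma hom_to_biprod:
 assumes D: "right_module A D" and b: "biprod A D V W i j p q"
  and f: "is_hom A N V f" and g: "is_hom A N W g"
 shows "is_hom A N D (%x. i (f x) \<oplus>\<^sub>D j (g x))"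
 by (rule hom_plus[OF D hom_comp[OF f biprodD(1)[OF b]] hom_comp[OF g biprodD(2)[OF b]]])

lemma proj_biprod:
 assumes V: "projective A V" and W: "projective A W" and D: "D : fmods A" and b: "biprod A D V W i j p q"
 shows "projective A D"
proof (rule projI[OF D])
 fix Z Y :: "('k, 'a) fmod" and g h
 assume *: "Z : fmods A" "Y : fmods A" "is_hom A Z Y g" "g ` car Z = car Y" "is_hom A D Y h"
 note bd = biprodD[OF b]
 obtain a where a: "is_hom A V Z a" "!!x. x : car V ==> g (a x) = h (i x)"
  using proj_lift[OF V *(1-4) hom_comp[OF bd(1) *(5)]] by metis
 obtain c where c: "is_hom A W Z c" "!!x. x : car W ==> g (c x) = h (j x)"
  using proj_lift[OF W *(1-4) hom_comp[OF bd(2) *(5)]] by metis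
 have "g (a (p x) \<oplus>\<^sub>Z c (q x)) = h x" if x: "x : car D" for x
 proof -
  have m: "p x : car V" "q x : car W" using hom_closed[OF bd(3) x] hom_closed[OF bd(4) x] by auto
  have "g (a (p x) \<oplus>\<^sub>Z c (q x)) = h (i (p x)) \<oplus>\<^sub>Y h (j (q x))"
   using m hom_closed[OF a(1)] hom_closed[OF c(1)] by (simp add: hom_add[OF *(3)] a(2) c(2))
  also have "... = h (i (p x) \<oplus>\<^sub>D j (q x))"
   using m hom_closed[OF bd(1)] hom_closed[OF bd(2)] by (simp add: hom_add[OF *(5)])
  finally show ?thesis using bd(9)[OF x] by simp
 qed
 thus "EX h'. is_hom A D Z h' & (ALL x: car D. g (h' x) = h x)"
  using hom_of_biprod[OF fmD(2)[OF D] b fmD(2)[OF *(1)] a(1) c(1)] by blast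
qed

lemma proj_zero: "Z : fmods A ==> car Z = {\<zero>\<^sub>Z} ==> projective A Z"
proof (rule projI)
 fix Z' Y :: "('k, 'a) fmod" and g h
 assume *: "Z : fmods A" "car Z = {\<zero>\<^sub>Z}" "Z' : fmods A" "Y : fmods A" "is_hom A Z' Y g" "is_hom A Z Y h"
 have "g \<zero>\<^sub>Z' = \<zero>\<^sub>Y" "h \<zero>\<^sub>Z = \<zero>\<^sub>Y"
  using hom_zero[OF fmD(2)[OF *(3)] fmD(2)[OF *(4)] *(5)] hom_zero[OF fmD(2)[OF *(1)] fmD(2)[OF *(4)] *(6)] by auto
 thus "EX h'. is_hom A Z Z' h' & (ALL x: car Z. g (h' x) = h x)"
  using hom_zero_fun[OF fmD(2)[OF *(3)]] *(2) by (intro exI[of _ "%x. \<zero>\<^sub>Z'"]) auto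
qed

lemma regular_lift:
 assumes Z: "right_module A Z" and g: "is_hom A Z Y g" "g ` car Z = car Y" and h: "is_hom A (regular A) Y h"
 obtains h' where "is_hom A (regular A) Z h'" "!!x. x : car A ==> g (h' x) = h x"
proof -
 have "h \<one>\<^sub>A : car Y" using hom_closed[OF h] by simp
 then obtain z where z: "z : car Z" "g z = h \<one>\<^sub>A" using g(2) by (metis imageE)
 have "g (x \<odot>\<^sub>Z z) = h x" if "x : car A" for x
  using hom_act[OF h that, of "\<one>\<^sub>A"] hom_act[OF g(1) that z(1)] z(2) that by simp
 thus thesis using that act_hom[OF Z z(1)] by blast
qed

lemma regular_copy: obtains R :: "('k, 'a) fmod" where "projective A R" "mod_iso A (regular A) R"
proof -
 note rA = right_module_regular[OF ring_A]
 obtain R :: "('k, 'a) fmod" where R: "R : fmods A" "mod_iso A (regular A) R" by (rule copy_exists[OF fdm_regular])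
 obtain s t where st: "is_hom A R (regular A) s" "is_hom A (regular A) R t" "!!x. x : car R ==> t (s x) = x"
  using mod_iso_retract(2)[OF rA R(2)] unfolding retract_def by auto
 have "projective A R"
 proof (rule projI[OF R(1)])
  fix Z Y :: "('k, 'a) fmod" and g h
  assume *: "Z : fmods A" "Y : fmods A" "is_hom A Z Y g" "g ` car Z = car Y" "is_hom A R Y h"
  obtain h' where "is_hom A (regular A) Z h'" "!!x. x : car A ==> g (h' x) = h (t x)"
   using regular_lift[OF fmD(2)[OF *(1)] *(3,4) hom_comp[OF st(2) *(5)]] by metis
  thus "EX h'. is_hom A R Z h' & (ALL x: car R. g (h' x) = h x)"
   using hom_comp[OF st(1)] hom_closed[OF st(1)] st(3) by (intro exI[of _ "%x. h' (s x)"]) auto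
 qed
 thus thesis using that R(2) by blast
qed

text \<open>A finite direct sum of copies of the regular module maps onto M, one copy for each
  generator. The property \<open>S\<close> is passed along, so that anything stable under zero, the
  regular module and sums can be assumed of the source.\<close>

lemma surj_exists:
 fixes M :: "('k, 'a) fmod"
 assumes M: "M : fmods A"
  and zero: "!!Z. Z : fmods A ==> car Z = {\<zero>\<^sub>Z} ==> S Z"
  and reg: "!!R. projective A R ==> mod_iso A (regular A) R ==> S R"
  and bip: "!!D V W i j p q. S V ==> S W ==> V : fmods A ==> W : fmods A ==> D : fmods A ==> biprod A D V W i j p q ==> S D"
 obtains P :: "('k, 'a) fmod" and p where "P : fmods A" "S P" "is_hom A P M p" "p ` car P = car M"
proof -
 note rA = right_module_regular[OF ring_A]
 interpret MM: right_module A M by (rule fmD(2)[OF M])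
 obtain R :: "('k, 'a) fmod" where R: "projective A R" "mod_iso A (regular A) R" by (rule regular_copy)
 obtain s t where st: "is_hom A (regular A) R s" "is_hom A R (regular A) t" "!!x. x : car A ==> t (s x) = x"
  using mod_iso_retract(1)[OF rA R(2)] unfolding retract_def by auto
 obtain G where G: "finite G" "G <= car M" "!!L. submodule L A M ==> G <= L ==> L = car M"
  using fdm_imp_fin_gen[OF fmD(1)[OF M]] unfolding fin_gen_def by auto
 have "EX (P :: ('k, 'a) fmod) p. P : fmods A & S P & is_hom A P M p & G <= p ` car P"
  using G(1,2)
 proof (induction G)
  case empty
  obtain Z :: "('k, 'a) fmod" where "Z : fmods A" "car Z = {\<zero>\<^sub>Z}" by (rule zero_fmod_exists)
  thus ?case using zero hom_zero_fun[OF MM.right_module_axioms] by blast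
 next
  case (insert x G)
  then obtain P :: "('k, 'a) fmod" and p where P: "P : fmods A" "S P" "is_hom A P M p" "G <= p ` car P" by auto
  obtain D :: "('k, 'a) fmod" and i j a b where D: "D : fmods A" "biprod A D P R i j a b"
   by (rule biprod_exists[OF P(1) projD(1)[OF R(1)]])
  note bd = biprodD[OF D(2)]
  have x: "x : car M" using insert by auto
  let ?g = "%y. t y \<odot>\<^sub>M x"
  have g: "is_hom A R M ?g" by (rule hom_comp[OF st(2) act_hom[OF MM.right_module_axioms x]])
  let ?h = "%y. p (a y) \<oplus>\<^sub>M ?g (b y)"
  have h: "is_hom A D M ?h" by (rule hom_of_biprod[OF fmD(2)[OF D(1)] D(2) MM.right_module_axioms P(3) g])
  have hi: "?h (i y) = p y" if "y : car P" for y
   using that hom_closed[OF P(3)] hom_zero[OF projD(3)[OF R(1)] MM.right_module_axioms g] by (simp add: bd(5,6))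
  have hj: "?h (j y) = ?g y" if "y : car R" for y
   using that hom_closed[OF g] hom_zero[OF fmD(2)[OF P(1)] MM.right_module_axioms P(3)] by (simp add: bd(7,8))
  have "x : ?h ` car D"
  proof
   have so: "s \<one>\<^sub>A : car R" using hom_closed[OF st(1)] by simp
   thus "j (s \<one>\<^sub>A) : car D" using hom_closed[OF bd(2)] by simp
   show "x = ?h (j (s \<one>\<^sub>A))" using hj[OF so] st(3)[of "\<one>\<^sub>A"] x by (simp add: MM.act_one)
  qed
  moreover have "G <= ?h ` car D"
  proof
   fix y assume "y : G"
   then obtain z where z: "z : car P" "y = p z" using P(4) by auto
   hence "y = ?h (i z)" using hi by simp
   thus "y : ?h ` car D" using hom_closed[OF bd(1) z(1)] by (rule image_eqI)
  qed
  ultimately show ?case using bip[OF P(2) reg[OF R] P(1) projD(1)[OF R(1)] D] D(1) h by (intro exI[of _ D] exI[of _ ?h]) auto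
 qed
 then obtain P :: "('k, 'a) fmod" and p where P: "P : fmods A" "S P" "is_hom A P M p" "G <= p ` car P" by auto
 thus thesis using that[OF P(1-3)] G(3) fmods_image(1)[OF P(1) M P(3)] by blast
qed

lemma proj_surj_exists:
 fixes M :: "('k, 'a) fmod"
 assumes M: "M : fmods A"
 obtains P :: "('k, 'a) fmod" and p where "projective A P" "is_hom A P M p" "p ` car P = car M"
proof (rule surj_exists[OF M, of "projective A"])
 show "projective A D" if "projective A V" "projective A W" "V : fmods A" "W : fmods A" "D : fmods A" "biprod A D V W i j p q"
  for D V W i j p q by (rule proj_biprod[OF that(1,2,5,6)])
 fix P p assume "projective A P" "is_hom A P M p" "p ` car P = car M"
 thus thesis by (rule that)
qed (auto intro: proj_zero)

text \<open>Every projective module is a retract of a finite direct sum of copies of the regular module.\<close>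

lemma projective_induct:
 fixes P :: "('k, 'a) fmod"
 assumes P: "projective A P"
  and zero: "!!Z. Z : fmods A ==> car Z = {\<zero>\<^sub>Z} ==> S Z"
  and reg: "!!R. projective A R ==> mod_iso A (regular A) R ==> S R"
  and bip: "!!D V W i j p q. S V ==> S W ==> V : fmods A ==> W : fmods A ==> D : fmods A ==> biprod A D V W i j p q ==> S D"
  and ret: "!!V W. S W ==> V : fmods A ==> W : fmods A ==> retract A V W ==> S V"
 shows "S P"
proof -
 have "EX (F :: ('k, 'a) fmod) g. F : fmods A & S F & is_hom A F P g & g ` car F = car P"
  by (rule surj_exists[where S=S, OF projD(1)[OF P]]) (fact zero, fact reg, fact bip, blast)
 then obtain F :: "('k, 'a) fmod" and g where F: "F : fmods A" "S F" "is_hom A F P g" "g ` car F = car P" by auto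
 obtain s where "is_hom A P F s" "!!x. x : car P ==> g (s x) = x"
  using proj_lift[OF P F(1) projD(1)[OF P] F(3,4) hom_id] by metis
 hence "retract A P F" unfolding retract_def using F(3) by blast
 thus ?thesis using ret[OF F(2) projD(1)[OF P] F(1)] by blast
qed

lemma pcovD: "pcov A P p M ==> projective A P" "pcov A P p M ==> is_hom A P M p" "pcov A P p M ==> p ` car P = car M"
 "pcov A P p M ==> submodule N A P ==> p ` N = car M ==> N = car P"
 unfolding pcov_def by auto

text \<open>Every surjection from a projective is a projective cover on one summand and zero on a
  complement. This covers both the existence of projective covers and the comparison of arbitrary
  presentations with minimal ones.\<close>

lemma split_cover:
 fixes V :: "('k, 'a) fmod"
 assumes V: "projective A V" and L: "L : fmods A" and q: "is_hom A V L q" "q ` car V = car L"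
 obtains P Z where "decomposes A V P Z" "Z <= a_kernel V L q" "pcov A (restr V P) q L" "projective A (restr V Z)"
proof -
 note rV = projD(3)[OF V] and rL = fmD(2)[OF L]
 interpret V: right_module A V by (rule rV)
 interpret L: right_module A L by (rule rL)
 \<comment> \<open>Summands having a complement inside the kernel of q. The cover will be one of
   least dimension.\<close>
 define S where "S = (%P. EX Z. decomposes A V P Z & Z <= a_kernel V L q)"
 have "car V <+>\<^sub>V {\<zero>\<^sub>V} = car V" using V.M.r_zero by (force simp: V.set_add_eq)
 hence "decomposes A V (car V) {\<zero>\<^sub>V}"
  using V.submodule_carrier V.submodule_zero by (auto simp: decomposes_def)
 hence "S (car V)" unfolding S_def using hom_zero[OF rV rL q(1)] by (force simp: a_kernel_eq)
 then obtain P where P: "S P" "!!Q. S Q ==> dm K A (restr V P) <= dm K A (restr V Q)"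
  using ex_has_least_nat[of S "car V" "%P. dm K A (restr V P)"] by auto
 obtain Z where Z: "decomposes A V P Z" "Z <= a_kernel V L q" using P(1) unfolding S_def by auto
 have Ps: "submodule P A V" "submodule Z A V" using Z(1) by (auto simp: decomposes_def)
 obtain a b where ab: "biprod A V (restr V P) (restr V Z) (%x. x) (%x. x) a b" by (rule decomposes_biprod[OF rV Z(1)])
 have prP: "projective A (restr V P)" "projective A (restr V Z)"
  using proj_retract[OF V fmods_restr[OF projD(1)[OF V] Ps(1)] biprod_retract(1)[OF ab]]
   proj_retract[OF V fmods_restr[OF projD(1)[OF V] Ps(2)] biprod_retract(2)[OF ab]] by auto
 have Pc: "P <= car V" using V.submoduleD(1)[OF Ps(1)] .
 have qP: "is_hom A (restr V P) L q" by (rule hom_restr_dom[OF q(1) Pc])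
 have qa: "q (a x) = q x" if "x : car V" for x
 proof -
  have m: "a x : P" "b x : Z" using hom_closed[OF biprodD(3)[OF ab] that] hom_closed[OF biprodD(4)[OF ab] that] by auto
  have z: "q (b x) = \<zero>\<^sub>L" using m Z(2) by (auto simp: a_kernel_eq)
  have "q x = q (a x \<oplus>\<^sub>V b x)" using biprodD(9)[OF ab that] by simp
  also have "... = q (a x) \<oplus>\<^sub>L q (b x)" using m Pc V.submoduleD(1)[OF Ps(2)] by (intro hom_add[OF q(1)]) auto
  finally show ?thesis using z hom_closed[OF q(1)] m Pc by auto
 qed
 have surj: "q ` P = car L"
 proof
  show "q ` P <= car L" using hom_closed[OF q(1)] Pc by auto
  show "car L <= q ` P"
  proof
   fix y assume "y : car L"
   then obtain x where "x : car V" "y = q x" using q(2) by blast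
   thus "y : q ` P" using qa[of x] hom_closed[OF biprodD(3)[OF ab], of x] by (metis imageI restr_simps(1))
  qed
 qed
 have min: "N = P" if N: "submodule N A (restr V P)" "q ` N = car L" for N
 proof -
  have N': "submodule N A V" "N <= P" using N(1) submodule_restr_iff[OF rV Ps(1)] by auto
  have Nc: "N <= car V" using N'(2) Pc by auto
  obtain h where h: "is_hom A (restr V P) (restr V N) h" "!!x. x : P ==> q (h x) = q x"
   using proj_lift[OF prP(1) fmods_restr[OF projD(1)[OF V] N'(1)] L hom_restr_dom[OF q(1) Nc] _ qP] N(2) by auto
  have hN: "h x : N" if "x : P" for x using hom_closed[OF h(1), of x] that by simp
  have hP: "is_hom A (restr V P) (restr V P) h"
   using h(1) N'(2) unfolding is_hom_def by auto
  \<comment> \<open>The map h sends P into N and satisfies q h = q. The kernel of a power of h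
    therefore lies in the kernel of q, so the image of that power again belongs to \<open>S\<close>.
    Least dimension makes the image all of P, and it lies in N.\<close>
  obtain n where n: "decomposes A (restr V P) ((h ^^ Suc n) ` car (restr V P)) (a_kernel (restr V P) (restr V P) (h ^^ Suc n))"
   by (rule fitting[OF projD(2)[OF prP(1)] hP])
  let ?I = "(h ^^ Suc n) ` P" and ?Y = "a_kernel (restr V P) (restr V P) (h ^^ Suc n)"
  have qh: "q ((h ^^ m) x) = q x & (h ^^ m) x : P" if "x : P" for m x
   using that by (induction m) (use h(2) hN N'(2) in auto)
  have "decomposes A V ?I (?Y <+>\<^sub>V Z)" using decomposes_assoc[OF rV Z(1), of ?I ?Y] n by simp
  moreover have "?Y <+>\<^sub>V Z <= a_kernel V L q"
  proof
   fix w assume "w : ?Y <+>\<^sub>V Z"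
   then obtain y z where yz: "y : ?Y" "z : Z" "w = y \<oplus>\<^sub>V z" by (auto simp: V.set_add_eq)
   hence y: "y : P" "(h ^^ Suc n) y = \<zero>\<^sub>V" by (auto simp: a_kernel_eq simp del: funpow.simps)
   have "q y = \<zero>\<^sub>L" using qh[OF y(1), of "Suc n"] y(2) hom_zero[OF rV rL q(1)] by (simp del: funpow.simps)
   moreover have "q z = \<zero>\<^sub>L" "z : car V" using yz(2) Z(2) by (auto simp: a_kernel_eq)
   ultimately show "w : a_kernel V L q" using y(1) Pc by (auto simp: a_kernel_eq yz(3) hom_add[OF q(1)])
  qed
  ultimately have "S ?I" unfolding S_def by blast
  hence le: "dm K A (restr V P) <= dm K A (restr V ?I)" by (rule P(2))
  have Is: "submodule ?I A (restr V P)" using n by (simp add: decomposes_def del: funpow.simps)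
  have "?I = P"
  proof (rule ccontr)
   assume "?I ~= P"
   hence "dm K A (restr (restr V P) ?I) < dm K A (restr V P)"
    using fdm_restr(3)[OF projD(2)[OF prP(1)] Is] by simp
   thus False using le by simp
  qed
  moreover have "?I <= N" using hN qh by auto
  ultimately show "N = P" using N'(2) by auto
 qed
 have "pcov A (restr V P) q L" unfolding pcov_def using prP(1) qP surj min by simp
 thus thesis using that Z prP(2) by blast
qed

lemma pcov_exists:
 fixes M :: "('k, 'a) fmod"
 assumes M: "M : fmods A"
 obtains P p where "pcov A P p M"
proof -
 obtain V :: "('k, 'a) fmod" and q where V: "projective A V" "is_hom A V M q" "q ` car V = car M" by (rule proj_surj_exists[OF M])
 from split_cover[OF V(1) M V(2,3)] show thesis using that by metis
qed

lemma mpres_exists: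
 fixes M :: "('k, 'a) fmod"
 assumes M: "M : fmods A"
 obtains P1 f P0 p where "mpres A P1 f P0 p M"
proof -
 obtain P0 p where P0: "pcov A P0 p M" by (rule pcov_exists[OF M])
 obtain P1 f where "pcov A P1 f (restr P0 (a_kernel P0 M p))"
  by (rule pcov_exists[OF fmods_kernel(2)[OF projD(1)[OF pcovD(1)[OF P0]] M pcovD(2)[OF P0]]])
 thus thesis using that P0 unfolding mpres_def by blast
qed

lemma mpres_pres: "M : fmods A ==> mpres A P1 f P0 p M ==> pres A P1 f P0 p M"
 unfolding mpres_def pres_def using pcovD(1-3)
 by (metis a_kernel_subset hom_restr_cod_D restr_simps(1))

lemma presD:
 assumes "pres A V1 d V0 q M"
 shows "projective A V1" "projective A V0" "is_hom A V1 V0 d" "is_hom A V0 M q" "q ` car V0 = car M"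
  "a_kernel V0 M q = d ` car V1" "!!x. x : car V1 ==> q (d x) = \<zero>\<^sub>M"
  "!!x. x : car V0 ==> q x = \<zero>\<^sub>M ==> x : d ` car V1"
 using assms unfolding pres_def a_kernel_eq by auto

text \<open>Section and retraction lift to the presentations. The composite b0 a0 induces the
  identity on \<open>M\<close>, so its image maps onto \<open>M\<close> and is all of P0 because P0
  is a cover; surjective endomorphisms are bijective. The same argument is repeated for P1 over the
  kernel.\<close>

lemma mpres_retract:
 assumes m: "mpres A P1 f P0 p M" and v: "pres A V1 d V0 q M2" and M: "M : fmods A" and M2: "M2 : fmods A"
  and r: "retract A M M2"
 obtains a0 b0 a1 b1 where "is_hom A P0 V0 a0" "is_hom A V0 P0 b0" "is_hom A P1 V1 a1" "is_hom A V1 P1 b1"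
  "ALL x: car P1. d (a1 x) = a0 (f x)" "ALL x: car V1. f (b1 x) = b0 (d x)"
  "bij_betw (%x. b0 (a0 x)) (car P0) (car P0)" "bij_betw (%x. b1 (a1 x)) (car P1) (car P1)"
proof -
 have c0: "pcov A P0 p M" and c1: "pcov A P1 f (restr P0 (a_kernel P0 M p))" using m by (auto simp: mpres_def)
 note pd = presD[OF mpres_pres[OF M m]] and vd = presD[OF v]
 note F = projD[OF pd(1)] projD[OF pd(2)] projD[OF vd(1)] projD[OF vd(2)]
 obtain s t where st: "is_hom A M M2 s" "is_hom A M2 M t" "!!x. x : car M ==> t (s x) = x"
  using r unfolding retract_def by auto
 note rM = fmD(2)[OF M] fmD(2)[OF M2]
 obtain a0 where a0: "is_hom A P0 V0 a0" "!!x. x : car P0 ==> q (a0 x) = s (p x)"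
  using proj_lift[OF pd(2) projD(1)[OF vd(2)] M2 vd(4,5) hom_comp[OF pd(4) st(1)]] by metis
 obtain b0 where b0: "is_hom A V0 P0 b0" "!!x. x : car V0 ==> p (b0 x) = t (q x)"
  using proj_lift[OF vd(2) projD(1)[OF pd(2)] M pd(4,5) hom_comp[OF vd(4) st(2)]] by metis
 have e0: "is_hom A P0 P0 (%x. b0 (a0 x))" by (rule hom_comp[OF a0(1) b0(1)])
 have pe: "p (b0 (a0 x)) = p x" if "x : car P0" for x
  using that hom_closed[OF a0(1)] hom_closed[OF pd(4)] by (simp add: a0(2) b0(2) st(3))
 have "(%x. b0 (a0 x)) ` car P0 = car P0"
 proof (rule pcovD(4)[OF c0 fmods_image(1)[OF F(4) F(4) e0]])
  show "p ` (%x. b0 (a0 x)) ` car P0 = car M" using pd(5) pe by (simp add: image_image cong: image_cong)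
 qed
 hence bij0: "bij_betw (%x. b0 (a0 x)) (car P0) (car P0)" using surj_endo_inj[OF F(5) e0] by simp
 obtain a1 where a1: "is_hom A P1 V1 a1" "!!x. x : car P1 ==> d (a1 x) = a0 (f x)"
 proof (rule proj_lift_im[OF pd(1) projD(1)[OF vd(1)] projD(1)[OF vd(2)] vd(3) hom_comp[OF pd(3) a0(1)]])
  fix x assume x: "x : car P1"
  have fx: "f x : car P0" by (rule hom_closed[OF pd(3) x])
  show "a0 (f x) : d ` car V1"
   using vd(8)[OF hom_closed[OF a0(1) fx]] a0(2)[OF fx] pd(7)[OF x] hom_zero[OF rM st(1)] by simp
 qed auto
 obtain b1 where b1: "is_hom A V1 P1 b1" "!!x. x : car V1 ==> f (b1 x) = b0 (d x)"
 proof (rule proj_lift_im[OF vd(1) projD(1)[OF pd(1)] projD(1)[OF pd(2)] pd(3) hom_comp[OF vd(3) b0(1)]])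
  fix x assume x: "x : car V1"
  have dx: "d x : car V0" by (rule hom_closed[OF vd(3) x])
  show "b0 (d x) : f ` car P1"
   using pd(8)[OF hom_closed[OF b0(1) dx]] b0(2)[OF dx] vd(7)[OF x] hom_zero[OF rM(2,1) st(2)] by simp
 qed auto
 have e1: "is_hom A P1 P1 (%x. b1 (a1 x))" by (rule hom_comp[OF a1(1) b1(1)])
 have fe: "f (b1 (a1 x)) = b0 (a0 (f x))" if "x : car P1" for x
  using that hom_closed[OF a1(1)] by (simp add: b1(2) a1(2))
 have "f ` (%x. b1 (a1 x)) ` car P1 = a_kernel P0 M p"
 proof
  show "f ` (%x. b1 (a1 x)) ` car P1 <= a_kernel P0 M p"
   using pd(6) hom_closed[OF e1] by auto
  show "a_kernel P0 M p <= f ` (%x. b1 (a1 x)) ` car P1"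
  proof
   fix y assume y: "y : a_kernel P0 M p"
   then obtain z where z: "z : car P0" "y = b0 (a0 z)" using bij0 by (auto simp: bij_betw_def a_kernel_eq)
   hence "p z = \<zero>\<^sub>M" using y pe by (auto simp: a_kernel_eq)
   then obtain x where "x : car P1" "z = f x" using pd(8)[OF z(1)] by auto
   thus "y : f ` (%x. b1 (a1 x)) ` car P1" using fe z(2) by (auto simp: image_iff intro!: bexI[of _ x])
  qed
 qed
 hence "(%x. b1 (a1 x)) ` car P1 = car P1"
  using pcovD(4)[OF c1 fmods_image(1)[OF F(1) F(1) e1]] by simp
 hence bij1: "bij_betw (%x. b1 (a1 x)) (car P1) (car P1)" using surj_endo_inj[OF F(2) e1] by simp
 show thesis by (rule that[OF a0(1) b0(1) a1(1) b1(1) _ _ bij0 bij1]) (simp_all add: a1(2) b1(2))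
qed

text \<open>Extend the transported map over d, pull back along a0, and undo the automorphism b1 a1.
  The special case of the identity retract gives independence of \<open>ext0\<close> of the
  presentation.\<close>

lemma mpres_retract_extl:
 assumes m: "mpres A P1 f P0 p M" and v: "pres A V1 d V0 q M2" and M: "M : fmods A" and M2: "M2 : fmods A"
  and r: "retract A M M2" and e: "extl A V1 d V0 Y"
 shows "extl A P1 f P0 Y"
proof -
 obtain a0 b0 a1 b1 where h: "is_hom A P0 V0 a0" "is_hom A V0 P0 b0" "is_hom A P1 V1 a1" "is_hom A V1 P1 b1"
  "ALL x: car P1. d (a1 x) = a0 (f x)" "ALL x: car V1. f (b1 x) = b0 (d x)"
  "bij_betw (%x. b0 (a0 x)) (car P0) (car P0)" "bij_betw (%x. b1 (a1 x)) (car P1) (car P1)"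
  by (rule mpres_retract[OF m v M M2 r])
 let ?g = "inv_into (car P1) (%x. b1 (a1 x))"
 have g: "is_hom A P1 P1 ?g"
  by (rule hom_inverse[OF projD(3)[OF presD(1)[OF mpres_pres[OF M m]]] hom_comp[OF h(3,4)] h(8)])
 show ?thesis unfolding extl_def
 proof (intro allI impI)
  fix u assume u: "is_hom A P1 Y u"
  have "is_hom A V1 Y (%x. u (?g (b1 x)))" by (rule hom_comp[OF h(4) hom_comp[OF g u]])
  then obtain v where v: "is_hom A V0 Y v" "ALL x: car V1. v (d x) = u (?g (b1 x))"
   using e unfolding extl_def by blast
  have "v (a0 (f x)) = u x" if x: "x : car P1" for x
  proof -
   have "v (a0 (f x)) = u (?g (b1 (a1 x)))" using v(2) h(5) x hom_closed[OF h(3) x] by metis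
   thus ?thesis using bij_betw_inv_into_left[OF h(8) x] by simp
  qed
  thus "EX v. is_hom A P0 Y v & (ALL x: car P1. v (f x) = u x)" using hom_comp[OF h(1) v(1)] by blast
 qed
qed

lemma mpres_retract_retract:
 assumes m: "mpres A P1 f P0 p M" and v: "pres A V1 d V0 q M2" and M: "M : fmods A" and M2: "M2 : fmods A"
  and r: "retract A M M2"
 shows "retract A P0 V0" "retract A P1 V1"
proof -
 obtain a0 b0 a1 b1 where h: "is_hom A P0 V0 a0" "is_hom A V0 P0 b0" "is_hom A P1 V1 a1" "is_hom A V1 P1 b1"
  "ALL x: car P1. d (a1 x) = a0 (f x)" "ALL x: car V1. f (b1 x) = b0 (d x)"
  "bij_betw (%x. b0 (a0 x)) (car P0) (car P0)" "bij_betw (%x. b1 (a1 x)) (car P1) (car P1)"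
  by (rule mpres_retract[OF m v M M2 r])
 note pd = presD[OF mpres_pres[OF M m]]
 show "retract A P0 V0" by (rule retract_via[where s=a0 and r=b0, OF projD(3)[OF pd(2)] h(1,2,7)])
 show "retract A P1 V1" by (rule retract_via[where s=a1 and r=b1, OF projD(3)[OF pd(1)] h(3,4,8)])
qed

lemma ext0_iff:
 assumes M: "M : fmods A" and m: "mpres A P1 f P0 p M"
 shows "ext0 A M Y \<longleftrightarrow> extl A P1 f P0 Y"
 unfolding ext0_def using m mpres_retract_extl[OF m mpres_pres[OF M] M M retract_refl] by blast

lemma ext0_pres:
 assumes M: "M : fmods A" and M2: "M2 : fmods A" and r: "retract A M M2" and v: "pres A V1 d V0 q M2" and e: "extl A V1 d V0 Y"
 shows "ext0 A M Y"
proof -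
 obtain P1 f P0 p where m: "mpres A P1 f P0 p M" by (rule mpres_exists[OF M])
 show ?thesis using ext0_iff[OF M m, of Y] mpres_retract_extl[OF m v M M2 r e] by simp
qed

lemma ext0_retract: "M : fmods A ==> M2 : fmods A ==> retract A M M2 ==> ext0 A M2 Y ==> ext0 A M Y"
 using ext0_pres mpres_pres unfolding ext0_def[of A M2] by blast

lemma theta_eq:
 assumes M: "M : fmods A" and m: "mpres A P1 f P0 p M" and Y: "Y : fmods A"
 shows "theta K A M Y = real (hdim K A P0 Y) - real (hdim K A P1 Y)"
proof -
 have "t = real (hdim K A P0 Y) - real (hdim K A P1 Y)"
  if tt: "EX Q1 g Q0 q. mpres A Q1 g Q0 q M & t = real (hdim K A Q0 Y) - real (hdim K A Q1 Y)" for t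
 proof -
  obtain Q1 g Q0 q where n: "mpres A Q1 g Q0 q M" "t = real (hdim K A Q0 Y) - real (hdim K A Q1 Y)" using tt by blast
  note a = presD(1,2)[OF mpres_pres[OF M m]] presD(1,2)[OF mpres_pres[OF M n(1)]]
  note b = mpres_retract_retract[OF m mpres_pres[OF M n(1)] M M retract_refl]
   mpres_retract_retract[OF n(1) mpres_pres[OF M m] M M retract_refl]
  have "hdim K A P0 Y = hdim K A Q0 Y" "hdim K A P1 Y = hdim K A Q1 Y"
   using hdim_retract_dom[OF projD(2)[OF a(2)] projD(2)[OF a(4)] fmD(1)[OF Y] b(1)] hdim_retract_dom[OF projD(2)[OF a(4)] projD(2)[OF a(2)] fmD(1)[OF Y] b(3)]
    hdim_retract_dom[OF projD(2)[OF a(1)] projD(2)[OF a(3)] fmD(1)[OF Y] b(2)] hdim_retract_dom[OF projD(2)[OF a(3)] projD(2)[OF a(1)] fmD(1)[OF Y] b(4)]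
   by auto
  thus ?thesis using n(2) by simp
 qed
 moreover have "EX Q1 g Q0 q. mpres A Q1 g Q0 q M & theta K A M Y = real (hdim K A Q0 Y) - real (hdim K A Q1 Y)"
  unfolding theta_def by (rule someI_ex) (use m in blast)
 ultimately show ?thesis by blast
qed

text \<open>The dimension count of \<open>hdim_pres\<close> for a minimal presentation. The equality
  case links the numerical function to vanishing of Hom(Y, tau M), which is what makes positive
  combinations of such functions so informative.\<close>

lemma theta_le:
 assumes M: "M : fmods A" and Y: "Y : fmods A"
 shows "theta K A M Y <= real (hdim K A M Y)" "theta K A M Y = real (hdim K A M Y) \<longleftrightarrow> ext0 A M Y"
proof -
 obtain P1 f P0 p where m: "mpres A P1 f P0 p M" by (rule mpres_exists[OF M])
 note pd = presD[OF mpres_pres[OF M m]]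
 note h = hdim_pres_le[OF projD(2)[OF pd(1)] projD(2)[OF pd(2)] fmD(1)[OF M] fmD(1)[OF Y] pd(3-6)]
  hdim_pres_eq[OF projD(2)[OF pd(1)] projD(2)[OF pd(2)] fmD(1)[OF M] fmD(1)[OF Y] pd(3-6)]
 show "theta K A M Y <= real (hdim K A M Y)" using h(1) theta_eq[OF M m Y] by simp
 show "theta K A M Y = real (hdim K A M Y) \<longleftrightarrow> ext0 A M Y"
  using h(2) theta_eq[OF M m Y] ext0_iff[OF M m, of Y] by (auto simp: algebra_simps simp flip: of_nat_add)
qed

end

section \<open>Torsion classes of tau-rigid collections and closure properties\<close>

inductive addc :: "('k, 'a) module => ('k, 'a) fmod set => ('k, 'a) fmod => bool" for A U where
 zero: "D : fmods A ==> car D = {\<zero>\<^sub>D} ==> addc A U D"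
| step: "addc A U D ==> M : U ==> E : fmods A ==> biprod A E D M i j p q ==> addc A U E"

definition rigid_set :: "'k ring => ('k, 'a) module => ('k, 'a) fmod set => ('k, 'a) fmod set => bool" where
 "rigid_set K A U P \<longleftrightarrow> U <= fmods A & (ALL Q:P. projective A Q) & (ALL M:U. ALL N:U. ext0 A M N) &
  (ALL Q:P. ALL M:U. hdim K A Q M = 0)"

text \<open>The torsion class of all modules \<open>Y\<close> with \<open>Hom(Y, \<tau>M) = 0\<close> for \<open>M\<close> in \<open>U\<close> and \<open>Hom(Q, Y) = 0\<close>
 for \<open>Q\<close> in \<open>P\<close>.\<close>

definition tors :: "'k ring => ('k, 'a) module => ('k, 'a) fmod set => ('k, 'a) fmod set => ('k, 'a) fmod => bool" where
 "tors K A U P Y \<longleftrightarrow> (ALL M:U. ext0 A M Y) & (ALL Q:P. hdim K A Q Y = 0)"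

text \<open>Abstracts what a functional in the relative interior of the cone of (U,P) satisfies: it
  is nonnegative on the torsion class, strictly positive where \<open>U\<close> maps nontrivially,
  nonpositive on modules without maps from \<open>U\<close>, and zero on such a module only if it
  lies in the torsion class. \<open>compat_weighted\<close> provides the examples.\<close>

definition compat :: "'k ring => ('k, 'a) module => (('k, 'a) fmod => real) => ('k, 'a) fmod set => ('k, 'a) fmod set => bool" where
 "compat K A t U P \<longleftrightarrow> (ALL Y:fmods A.
  (tors K A U P Y --> t Y >= 0 & ((EX M:U. hdim K A M Y ~= 0) --> t Y > 0)) &
  ((ALL M:U. hdim K A M Y = 0) --> t Y <= 0 & (~ tors K A U P Y --> t Y < 0)))"

context fd_algebra
begin

lemma ext0E:
 assumes M: "M : fmods A"
 obtains P1 f P0 p where "mpres A P1 f P0 p M" "pres A P1 f P0 p M"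
 using mpres_exists[OF M] mpres_pres[OF M] by metis

lemma ext0_cod_surj:
 assumes M: "M : fmods A" and Y: "Y : fmods A" and Y': "Y' : fmods A" and g: "is_hom A Y Y' g" "g ` car Y = car Y'"
  and e: "ext0 A M Y"
 shows "ext0 A M Y'"
proof -
 obtain P1 f P0 p where m: "mpres A P1 f P0 p M" "pres A P1 f P0 p M" by (rule ext0E[OF M])
 note pd = presD[OF m(2)]
 have e': "extl A P1 f P0 Y" using e ext0_iff[OF M m(1), of Y] by simp
 have "extl A P1 f P0 Y'" unfolding extl_def
 proof (intro allI impI)
  fix u assume u: "is_hom A P1 Y' u"
  obtain u' where u': "is_hom A P1 Y u'" "!!x. x : car P1 ==> g (u' x) = u x"
   using proj_lift[OF pd(1) Y Y' g u] by metis
  obtain v where "is_hom A P0 Y v" "ALL x: car P1. v (f x) = u' x" using e' u'(1) unfolding extl_def by blast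
  thus "EX v. is_hom A P0 Y' v & (ALL x: car P1. v (f x) = u x)"
   using hom_comp[OF _ g(1)] u'(2) by (intro exI[of _ "%x. g (v x)"]) auto
 qed
 thus ?thesis using ext0_iff[OF M m(1), of Y'] by simp
qed

lemma proj_hdim_surj:
 assumes P: "projective A P" and Y: "Y : fmods A" and Y': "Y' : fmods A" and g: "is_hom A Y Y' g" "g ` car Y = car Y'"
  and e: "hdim K A P Y = 0"
 shows "hdim K A P Y' = 0"
 unfolding hdim_eq_0_iff[OF projD(2)[OF P] fmD(1)[OF Y']]
proof (intro allI impI ballI)
 fix u x assume u: "is_hom A P Y' u" and x: "x : car P"
 obtain u' where u': "is_hom A P Y u'" "!!x. x : car P ==> g (u' x) = u x"
  using proj_lift[OF P Y Y' g u] by metis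
 have "u' x = \<zero>\<^sub>Y" using e u'(1) x unfolding hdim_eq_0_iff[OF projD(2)[OF P] fmD(1)[OF Y]] by blast
 thus "u x = \<zero>\<^sub>Y'" using u'(2)[OF x] hom_zero[OF fmD(2)[OF Y] fmD(2)[OF Y'] g(1)] by simp
qed

lemma hdim_zero_sub:
 assumes M: "M : fmods A" and Y: "Y : fmods A" and N: "submodule N A Y" and e: "hdim K A M Y = 0"
 shows "hdim K A M (restr Y N) = 0"
proof -
 interpret Y: right_module A Y by (rule fmD(2)[OF Y])
 show ?thesis
  using e hom_restr_cod_D[OF _ Y.submoduleD(1)[OF N]]
  unfolding hdim_eq_0_iff[OF fmD(1)[OF M] fmD(1)[OF Y]] hdim_eq_0_iff[OF fmD(1)[OF M] fmD(1)[OF fmods_restr[OF Y N]]]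
  by auto
qed

lemma ext0_biprod_cod:
 assumes M: "M : fmods A" and D: "D : fmods A" and b: "biprod A D V W i j p q" and e: "ext0 A M V" "ext0 A M W"
 shows "ext0 A M D"
proof -
 obtain P1 f P0 r where m: "mpres A P1 f P0 r M" "pres A P1 f P0 r M" by (rule ext0E[OF M])
 note bd = biprodD[OF b]
 have e': "extl A P1 f P0 V" "extl A P1 f P0 W" using e ext0_iff[OF M m(1), of V] ext0_iff[OF M m(1), of W] by auto
 have "extl A P1 f P0 D" unfolding extl_def
 proof (intro allI impI)
  fix u assume u: "is_hom A P1 D u"
  obtain v where v: "is_hom A P0 V v" "ALL x: car P1. v (f x) = p (u x)"
   using e'(1) hom_comp[OF u bd(3)] unfolding extl_def by blast
  obtain w where w: "is_hom A P0 W w" "ALL x: car P1. w (f x) = q (u x)"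
   using e'(2) hom_comp[OF u bd(4)] unfolding extl_def by blast
  show "EX v. is_hom A P0 D v & (ALL x: car P1. v (f x) = u x)"
   using hom_to_biprod[OF fmD(2)[OF D] b v(1) w(1)] v(2) w(2) bd(9) hom_closed[OF u]
   by (intro exI[of _ "%x. i (v x) \<oplus>\<^sub>D j (w x)"]) auto
 qed
 thus ?thesis using ext0_iff[OF M m(1), of D] by simp
qed

lemma hdim_biprod_cod_zero:
 assumes M: "M : fmods A" and D: "D : fmods A" and V: "V : fmods A" and W: "W : fmods A" and b: "biprod A D V W i j p q"
  and e: "hdim K A M V = 0" "hdim K A M W = 0"
 shows "hdim K A M D = 0"
 unfolding hdim_eq_0_iff[OF fmD(1)[OF M] fmD(1)[OF D]]
proof (intro allI impI ballI)
 fix u x assume u: "is_hom A M D u" and x: "x : car M"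
 note bd = biprodD[OF b]
 interpret D: right_module A D by (rule fmD(2)[OF D])
 have "p (u x) = \<zero>\<^sub>V" "q (u x) = \<zero>\<^sub>W"
  using e hom_comp[OF u bd(3)] hom_comp[OF u bd(4)] x
  unfolding hdim_eq_0_iff[OF fmD(1)[OF M] fmD(1)[OF V]] hdim_eq_0_iff[OF fmD(1)[OF M] fmD(1)[OF W]] by blast+
 thus "u x = \<zero>\<^sub>D"
  using bd(9)[OF hom_closed[OF u x]] hom_zero[OF fmD(2)[OF V] fmD(2)[OF D] bd(1)] hom_zero[OF fmD(2)[OF W] fmD(2)[OF D] bd(2)]
  by simp
qed

text \<open>Extend q u over P0, lift the extension to \<open>E\<close>, and correct the remaining
  difference: it lands in the kernel of q, where it extends by assumption.\<close>

lemma ext0_extension: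
 assumes M: "M : fmods A" and E: "E : fmods A" and Q: "Q : fmods A" and q: "is_hom A E Q q" "q ` car E = car Q"
  and e: "ext0 A M (restr E (a_kernel E Q q))" "ext0 A M Q"
 shows "ext0 A M E"
proof -
 obtain P1 f P0 p where m: "mpres A P1 f P0 p M" "pres A P1 f P0 p M" by (rule ext0E[OF M])
 note pd = presD[OF m(2)] and rE = fmD(2)[OF E] and rQ = fmD(2)[OF Q]
 interpret E: right_module A E by (rule rE)
 interpret Q: right_module A Q by (rule rQ)
 let ?N = "restr E (a_kernel E Q q)"
 have e': "extl A P1 f P0 ?N" "extl A P1 f P0 Q" using e ext0_iff[OF M m(1), of ?N] ext0_iff[OF M m(1), of Q] by auto
 have "extl A P1 f P0 E" unfolding extl_def
 proof (intro allI impI)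
  fix u assume u: "is_hom A P1 E u"
  obtain v where v: "is_hom A P0 Q v" "ALL x: car P1. v (f x) = q (u x)"
   using e'(2) hom_comp[OF u q(1)] unfolding extl_def by blast
  obtain v' where v': "is_hom A P0 E v'" "!!x. x : car P0 ==> q (v' x) = v x"
   using proj_lift[OF pd(2) E Q q v(1)] by metis
  have v'f: "is_hom A P1 E (%x. v' (f x))" by (rule hom_comp[OF pd(3) v'(1)])
  have "is_hom A P1 ?N (%x. u x \<ominus>\<^sub>E v' (f x))"
  proof (rule hom_restr_cod[OF hom_minus[OF rE u v'f]])
   show "(%x. u x \<ominus>\<^sub>E v' (f x)) ` car P1 <= a_kernel E Q q"
    using hom_closed[OF u] hom_closed[OF v'f] v(2) v'(2) hom_closed[OF pd(3)] hom_closed[OF q(1)]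
    by (auto simp: a_kernel_eq hom_diff[OF rE rQ q(1)] Q.diff_eq_zero)
  qed
  then obtain w where w: "is_hom A P0 ?N w" "ALL x: car P1. w (f x) = u x \<ominus>\<^sub>E v' (f x)"
   using e'(1) unfolding extl_def by blast
  have wE: "is_hom A P0 E w" by (rule hom_restr_cod_D[OF w(1) a_kernel_subset])
  show "EX v. is_hom A P0 E v & (ALL x: car P1. v (f x) = u x)"
   using hom_plus[OF rE v'(1) wE] w(2) hom_closed[OF u] hom_closed[OF v'f]
   by (intro exI[of _ "%x. v' x \<oplus>\<^sub>E w x"]) (auto simp: E.add_diff_cancel)
 qed
 thus ?thesis using ext0_iff[OF M m(1), of E] by simp
qed

text \<open>A projective is presented by 0 -> P -> P.\<close>

lemma ext0_projective:
 assumes P: "projective A P" and Y: "right_module A Y" shows "ext0 A P Y"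
proof -
 obtain Z :: "('k, 'a) fmod" where Z: "Z : fmods A" "car Z = {\<zero>\<^sub>Z}" by (rule zero_fmod_exists)
 interpret P: right_module A P by (rule projD(3)[OF P])
 have p: "pres A Z (%_. \<zero>\<^sub>P) P (%x. x) P"
  unfolding pres_def using P proj_zero[OF Z] Z hom_zero_fun[OF P.right_module_axioms] hom_id by (auto simp: a_kernel_eq)
 have "extl A Z (%_. \<zero>\<^sub>P) P Y"
  unfolding extl_def
 proof (intro allI impI)
  fix u assume u: "is_hom A Z Y u"
  have "u \<zero>\<^sub>Z = \<zero>\<^sub>Y" by (rule hom_zero[OF fmD(2)[OF Z(1)] Y u])
  thus "EX v. is_hom A P Y v & (ALL x: car Z. v \<zero>\<^sub>P = u x)"
   using hom_zero_fun[OF Y] Z(2) by (intro exI[of _ "%_. \<zero>\<^sub>Y"]) auto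
 qed
 thus ?thesis by (rule ext0_pres[OF projD(1)[OF P] projD(1)[OF P] retract_refl p])
qed

lemma theta_projective: "projective A P ==> Y : fmods A ==> theta K A P Y = real (hdim K A P Y)"
 using theta_le(2)[OF projD(1)] ext0_projective fmD(2) by blast

text \<open>An arbitrary projective presentation is the minimal one plus an identity map R = R, plus
  a summand Z of V1 on which d vanishes. The identity part cancels in the dimension count, leaving
  only Hom(Z,Y).\<close>

lemma presentation_excess:
 assumes N: "N : fmods A" and v: "pres A V1 d V0 q N"
 obtains Z where "projective A Z"
  "!!Y. Y : fmods A ==> real (hdim K A V0 Y) - real (hdim K A V1 Y) = theta K A N Y - real (hdim K A Z Y)"
  "!!Y. Y : fmods A ==> extl A V1 d V0 Y ==> hdim K A Z Y = 0"
proof -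
 note vd = presD[OF v] and rN = fmD(2)[OF N]
 note rV1 = projD(3)[OF vd(1)] and rV0 = projD(3)[OF vd(2)]
 interpret V0: right_module A V0 by (rule rV0)
 interpret V1: right_module A V1 by (rule rV1)
 obtain P0 R where s0: "decomposes A V0 P0 R" "R <= a_kernel V0 N q" "pcov A (restr V0 P0) q N" "projective A (restr V0 R)"
  by (rule split_cover[OF vd(2) N vd(4,5)])
 obtain a \<pi> where bi0: "biprod A V0 (restr V0 P0) (restr V0 R) (%x. x) (%x. x) a \<pi>" by (rule decomposes_biprod[OF rV0 s0(1)])
 note b0 = biprodD[OF bi0]
 have sub0: "submodule P0 A V0" "submodule R A V0" using s0(1) by (auto simp: decomposes_def)
 let ?g = "%x. \<pi> (d x)"
 have g: "is_hom A V1 (restr V0 R) ?g" by (rule hom_comp[OF vd(3) b0(4)])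
 \<comment> \<open>R lies in the kernel of q, hence in the image of d, so the R-component of d is
   onto and splits because R is projective.\<close>
 have gs: "?g ` car V1 = car (restr V0 R)"
 proof
  show "?g ` car V1 <= car (restr V0 R)" using hom_closed[OF g] by blast
  show "car (restr V0 R) <= ?g ` car V1"
  proof
   fix r assume r: "r : car (restr V0 R)"
   hence "r : d ` car V1" using s0(2) vd(6) by auto
   thus "r : ?g ` car V1" using b0(7)[OF r] by force
  qed
 qed
 obtain \<sigma> where sg: "is_hom A (restr V0 R) V1 \<sigma>" "!!x. x : car (restr V0 R) ==> ?g (\<sigma> x) = x"
  using proj_lift[OF s0(4) projD(1)[OF vd(1)] projD(1)[OF s0(4)] g gs hom_id] by metis
 let ?W = "a_kernel V1 (restr V0 R) ?g"
 note dc = retract_decomposes[where s=\<sigma> and r="?g", OF rV1 projD(3)[OF s0(4)] sg(1) g sg(2)]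
 have W: "submodule ?W A V1" by (rule fmods_kernel(1)[OF projD(1)[OF vd(1)] projD(1)[OF s0(4)] g])
 obtain a1 b1 where bi1: "biprod A V1 (restr V1 (\<sigma> ` car (restr V0 R))) (restr V1 ?W) (%x. x) (%x. x) a1 b1"
  by (rule decomposes_biprod[OF rV1 dc(1)])
 have isR: "mod_iso A (restr V0 R) (restr V1 (\<sigma> ` car (restr V0 R)))"
  using dc(2,3) unfolding mod_iso_iff[OF projD(3)[OF s0(4)]] by auto
 have sub1: "submodule (\<sigma> ` car (restr V0 R)) A V1" using dc(1) by (simp add: decomposes_def)
 have W': "projective A (restr V1 ?W)"
  by (rule proj_retract[OF vd(1) fmods_restr[OF projD(1)[OF vd(1)] W] biprod_retract(2)[OF bi1]])
 let ?L = "a_kernel (restr V0 P0) N q"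
 have qP0: "is_hom A (restr V0 P0) N q" by (rule pcovD(2)[OF s0(3)])
 have P0f: "restr V0 P0 : fmods A" by (rule fmods_restr[OF projD(1)[OF vd(2)] sub0(1)])
 have Lsub: "submodule ?L A (restr V0 P0)" by (rule fmods_kernel(1)[OF P0f N qP0])
 have dW: "d x : ?L" if x: "x : ?W" for x
 proof -
  have "x : car V1" "\<pi> (d x) = \<zero>\<^sub>V0" using x by (auto simp: a_kernel_eq)
  hence "d x = a (d x)" using b0(9)[of "d x"] hom_closed[OF vd(3)] hom_closed[OF b0(3), of "d x"] V0.submoduleD(1)[OF sub0(1)]
   by (auto simp: subset_iff)
  hence "d x : P0" using hom_closed[OF b0(3) hom_closed[OF vd(3) \<open>x : car V1\<close>]] by simp
  thus ?thesis using vd(7)[OF \<open>x : car V1\<close>] by (simp add: a_kernel_eq)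
 qed
 have dWhom: "is_hom A (restr V1 ?W) (restr (restr V0 P0) ?L) d"
  using hom_restr_cod[OF hom_restr_dom[OF vd(3) a_kernel_subset[of V1 "restr V0 R" "?g"]], of ?L] dW by (auto simp: image_subset_iff)
 have dWs: "d ` car (restr V1 ?W) = car (restr (restr V0 P0) ?L)"
 proof
  show "d ` car (restr V1 ?W) <= car (restr (restr V0 P0) ?L)" using dW by auto
  show "car (restr (restr V0 P0) ?L) <= d ` car (restr V1 ?W)"
  proof
   fix y assume "y : car (restr (restr V0 P0) ?L)"
   hence y: "y : P0" "q y = \<zero>\<^sub>N" by (auto simp: a_kernel_eq)
   have yc: "y : car V0" using y(1) V0.submoduleD(1)[OF sub0(1)] by auto
   obtain x where x: "x : car V1" "y = d x" using vd(8)[OF yc y(2)] by auto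
   have "\<pi> y = \<zero>\<^sub>V0" using b0(6)[of y] y(1) by simp
   hence "x : ?W" using x by (simp add: a_kernel_eq)
   thus "y : d ` car (restr V1 ?W)" using x(2) by simp
  qed
 qed
 obtain P1 Z where s1: "decomposes A (restr V1 ?W) P1 Z" "Z <= a_kernel (restr V1 ?W) (restr (restr V0 P0) ?L) d"
  "pcov A (restr (restr V1 ?W) P1) d (restr (restr V0 P0) ?L)" "projective A (restr (restr V1 ?W) Z)"
  by (rule split_cover[OF W' fmods_restr[OF P0f Lsub] dWhom dWs])
 let ?P1 = "restr (restr V1 ?W) P1" and ?Z = "restr (restr V1 ?W) Z"
 have m: "mpres A ?P1 d (restr V0 P0) q N" unfolding mpres_def using s0(3) s1(3) by simp
 obtain a2 b2 where bi2: "biprod A (restr V1 ?W) ?P1 ?Z (%x. x) (%x. x) a2 b2"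
  by (rule decomposes_biprod[OF projD(3)[OF W'] s1(1)])
 show thesis
 proof (rule that[OF s1(4)])
  fix Y assume Y: "Y : fmods A"
  have "hdim K A V0 Y = hdim K A (restr V0 P0) Y + hdim K A (restr V0 R) Y"
   by (rule hdim_biprod[OF projD(2)[OF vd(2)] fmD(1)[OF P0f] projD(2)[OF s0(4)] fmD(1)[OF Y] bi0])
  moreover have "hdim K A V1 Y = hdim K A (restr V1 (\<sigma> ` car (restr V0 R))) Y + hdim K A (restr V1 ?W) Y"
   by (rule hdim_biprod[OF projD(2)[OF vd(1)] fmD(1)[OF fmods_restr[OF projD(1)[OF vd(1)] sub1]] projD(2)[OF W'] fmD(1)[OF Y] bi1])
  moreover have "hdim K A (restr V0 R) Y = hdim K A (restr V1 (\<sigma> ` car (restr V0 R))) Y"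
   by (rule hdim_iso_dom[OF projD(2)[OF s0(4)] fmD(1)[OF fmods_restr[OF projD(1)[OF vd(1)] sub1]] fmD(1)[OF Y] isR])
  moreover have "hdim K A (restr V1 ?W) Y = hdim K A ?P1 Y + hdim K A ?Z Y"
   by (rule hdim_biprod[OF projD(2)[OF W'] projD(2)[OF pcovD(1)[OF s1(3)]] projD(2)[OF s1(4)] fmD(1)[OF Y] bi2])
  ultimately show "real (hdim K A V0 Y) - real (hdim K A V1 Y) = theta K A N Y - real (hdim K A ?Z Y)"
   using theta_eq[OF N m Y] by simp
  assume e: "extl A V1 d V0 Y"
  \<comment> \<open>A map on Z, extended by zero to V1, factors through d; but d vanishes on
    Z.\<close>
  show "hdim K A ?Z Y = 0" unfolding hdim_eq_0_iff[OF projD(2)[OF s1(4)] fmD(1)[OF Y]]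
  proof (intro allI impI ballI)
   fix z x assume z: "is_hom A ?Z Y z" and x: "x : car ?Z"
   have "is_hom A V1 Y (%x. z (b2 (b1 x)))" by (rule hom_comp[OF biprodD(4)[OF bi1] hom_comp[OF biprodD(4)[OF bi2] z]])
   then obtain v where v: "is_hom A V0 Y v" "ALL x: car V1. v (d x) = z (b2 (b1 x))" using e unfolding extl_def by blast
   have xZ: "x : ?W" "d x = \<zero>\<^sub>V0" using x s1(2) by (auto simp: a_kernel_eq)
   have "b1 x = x" using biprodD(7)[OF bi1, of x] xZ by simp
   moreover have "b2 x = x" using biprodD(7)[OF bi2 x] .
   ultimately have "z x = v (d x)" using v(2) xZ(1) by (simp add: a_kernel_eq)
   thus "z x = \<zero>\<^sub>Y" using xZ(2) hom_zero[OF rV0 fmD(2)[OF Y] v(1)] by simp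
  qed
 qed
qed

lemma pres_biprod:
 fixes D :: "('k, 'a) fmod"
 assumes V: "V : fmods A" and W: "W : fmods A" and D: "D : fmods A" and b: "biprod A D V W i j p q"
  and m: "pres A P1 f P0 r V" and n: "pres A Q1 g Q0 t W"
 obtains E1 d E0 e where "pres A E1 d E0 e D"
  "!!Y. Y : fmods A ==> hdim K A E0 Y = hdim K A P0 Y + hdim K A Q0 Y"
  "!!Y. Y : fmods A ==> hdim K A E1 Y = hdim K A P1 Y + hdim K A Q1 Y"
  "!!Y. Y : fmods A ==> extl A P1 f P0 Y ==> extl A Q1 g Q0 Y ==> extl A E1 d E0 Y"
proof -
 note pd = presD[OF m] and qd = presD[OF n]
 note rV = fmD(2)[OF V] and rW = fmD(2)[OF W] and rD = fmD(2)[OF D]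
 note r = projD(3)[OF pd(1)] projD(3)[OF pd(2)] projD(3)[OF qd(1)] projD(3)[OF qd(2)]
 obtain E0 :: "('k, 'a) fmod" and i0 j0 p0 q0 where E0: "E0 : fmods A" "biprod A E0 P0 Q0 i0 j0 p0 q0"
  by (rule biprod_exists[OF projD(1)[OF pd(2)] projD(1)[OF qd(2)]])
 obtain E1 :: "('k, 'a) fmod" and i1 j1 p1 q1 where E1: "E1 : fmods A" "biprod A E1 P1 Q1 i1 j1 p1 q1"
  by (rule biprod_exists[OF projD(1)[OF pd(1)] projD(1)[OF qd(1)]])
 note b0 = biprodD[OF E0(2)] and b1 = biprodD[OF E1(2)] and bd = biprodD[OF b]
 note rE0 = fmD(2)[OF E0(1)] and rE1 = fmD(2)[OF E1(1)]
 interpret E0: right_module A E0 by (rule rE0)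
 interpret E1: right_module A E1 by (rule rE1)
 interpret D: right_module A D by (rule rD)
 interpret V: right_module A V by (rule rV)
 interpret W: right_module A W by (rule rW)
 interpret P0: right_module A P0 by (rule r(2))
 interpret Q0: right_module A Q0 by (rule r(4))
 define d where "d = (%x. i0 (f (p1 x)) \<oplus>\<^sub>E0 j0 (g (q1 x)))"
 define e where "e = (%x. i (r (p0 x)) \<oplus>\<^sub>D j (t (q0 x)))"
 note c = hom_closed[OF b0(1)] hom_closed[OF b0(2)] hom_closed[OF b0(3)] hom_closed[OF b0(4)]
  hom_closed[OF b1(1)] hom_closed[OF b1(2)] hom_closed[OF b1(3)] hom_closed[OF b1(4)]
  hom_closed[OF bd(1)] hom_closed[OF bd(2)] hom_closed[OF bd(3)] hom_closed[OF bd(4)]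
  hom_closed[OF pd(3)] hom_closed[OF pd(4)] hom_closed[OF qd(3)] hom_closed[OF qd(4)]
 have d: "is_hom A E1 E0 d" unfolding d_def
  by (rule hom_to_biprod[OF rE0 E0(2) hom_comp[OF b1(3) pd(3)] hom_comp[OF b1(4) qd(3)]])
 have e: "is_hom A E0 D e" unfolding e_def
  by (rule hom_to_biprod[OF rD b hom_comp[OF b0(3) pd(4)] hom_comp[OF b0(4) qd(4)]])
 have p0d: "p0 (d x) = f (p1 x)" "q0 (d x) = g (q1 x)" if "x : car E1" for x
  unfolding d_def using that c by (simp_all add: hom_add[OF b0(3)] hom_add[OF b0(4)] b0(5-8))
 have pe: "p (e x) = r (p0 x)" "q (e x) = t (q0 x)" if "x : car E0" for x
  unfolding e_def using that c by (simp_all add: hom_add[OF bd(3)] hom_add[OF bd(4)] bd(5-8))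
 have es: "e ` car E0 = car D"
 proof
  show "e ` car E0 <= car D" using hom_closed[OF e] by auto
  show "car D <= e ` car E0"
  proof
   fix y assume y: "y : car D"
   have "p y : r ` car P0" "q y : t ` car Q0" using y c(11,12) pd(5) qd(5) by auto
   then obtain u w where uw: "u : car P0" "p y = r u" "w : car Q0" "q y = t w" by auto
   let ?x = "i0 u \<oplus>\<^sub>E0 j0 w"
   have x: "?x : car E0" using uw c by simp
   have "p0 ?x = u" "q0 ?x = w" using uw c by (simp_all add: hom_add[OF b0(3)] hom_add[OF b0(4)] b0(5-8))
   hence "e ?x = y" unfolding e_def using uw bd(9)[OF y] by simp
   thus "y : e ` car E0" using x by blast
  qed
 qed
 have k: "a_kernel E0 D e = d ` car E1"
 proof
  show "d ` car E1 <= a_kernel E0 D e"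
  proof
   fix y assume "y : d ` car E1"
   then obtain x where x: "x : car E1" "y = d x" by auto
   have dx: "d x : car E0" by (rule hom_closed[OF d x(1)])
   have "p (e (d x)) = \<zero>\<^sub>V" "q (e (d x)) = \<zero>\<^sub>W" using pe[OF dx] p0d[OF x(1)] pd(7) qd(7) x c by auto
   hence "e (d x) = \<zero>\<^sub>D"
    using bd(9)[OF hom_closed[OF e dx]] hom_zero[OF rV rD bd(1)] hom_zero[OF rW rD bd(2)] by simp
   thus "y : a_kernel E0 D e" using dx x by (simp add: a_kernel_eq)
  qed
  show "a_kernel E0 D e <= d ` car E1"
  proof
   fix y assume "y : a_kernel E0 D e"
   hence y: "y : car E0" "e y = \<zero>\<^sub>D" by (auto simp: a_kernel_eq)
   have "r (p0 y) = \<zero>\<^sub>V" "t (q0 y) = \<zero>\<^sub>W"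
    using pe[OF y(1)] y(2) hom_zero[OF rD rV bd(3)] hom_zero[OF rD rW bd(4)] by auto
   hence "p0 y : f ` car P1" "q0 y : g ` car Q1" using pd(8) qd(8) c y(1) by auto
   then obtain u w where uw: "u : car P1" "p0 y = f u" "w : car Q1" "q0 y = g w" by auto
   let ?x = "i1 u \<oplus>\<^sub>E1 j1 w"
   interpret P1: right_module A P1 by (rule r(1))
   interpret Q1: right_module A Q1 by (rule r(3))
   have x: "?x : car E1" using uw c by simp
   have "p1 ?x = u" "q1 ?x = w" using uw c by (simp_all add: hom_add[OF b1(3)] hom_add[OF b1(4)] b1(5-8))
   hence "d ?x = y" unfolding d_def using uw b0(9)[OF y(1)] by simp
   thus "y : d ` car E1" using x by blast
  qed
 qed
 have pr: "pres A E1 d E0 e D" unfolding pres_def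
  using proj_biprod[OF pd(1) qd(1) E1] proj_biprod[OF pd(2) qd(2) E0] d e es k by auto
 show thesis
 proof (rule that[OF pr])
  fix Y assume Y: "Y : fmods A"
  show "hdim K A E0 Y = hdim K A P0 Y + hdim K A Q0 Y"
   by (rule hdim_biprod[OF fmD(1)[OF E0(1)] projD(2)[OF pd(2)] projD(2)[OF qd(2)] fmD(1)[OF Y] E0(2)])
  show "hdim K A E1 Y = hdim K A P1 Y + hdim K A Q1 Y"
   by (rule hdim_biprod[OF fmD(1)[OF E1(1)] projD(2)[OF pd(1)] projD(2)[OF qd(1)] fmD(1)[OF Y] E1(2)])
  assume ex: "extl A P1 f P0 Y" "extl A Q1 g Q0 Y"
  show "extl A E1 d E0 Y" unfolding extl_def
  proof (intro allI impI)
   fix u assume u: "is_hom A E1 Y u"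
   obtain v where v: "is_hom A P0 Y v" "ALL x: car P1. v (f x) = u (i1 x)"
    using ex(1) hom_comp[OF b1(1) u] unfolding extl_def by blast
   obtain w where w: "is_hom A Q0 Y w" "ALL x: car Q1. w (g x) = u (j1 x)"
    using ex(2) hom_comp[OF b1(2) u] unfolding extl_def by blast
   have "v (p0 (d x)) \<oplus>\<^sub>Y w (q0 (d x)) = u x" if x: "x : car E1" for x
   proof -
    have "v (p0 (d x)) \<oplus>\<^sub>Y w (q0 (d x)) = u (i1 (p1 x)) \<oplus>\<^sub>Y u (j1 (q1 x))"
     using v(2) w(2) p0d[OF x] c x by simp
    also have "... = u (i1 (p1 x) \<oplus>\<^sub>E1 j1 (q1 x))" using c x by (simp add: hom_add[OF u])
    finally show ?thesis using b1(9)[OF x] by simp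
   qed
   thus "EX v. is_hom A E0 Y v & (ALL x: car E1. v (d x) = u x)"
    using hom_of_biprod[OF rE0 E0(2) fmD(2)[OF Y] v(1) w(1)] by blast
  qed
 qed
qed

text \<open>The direct sum of two minimal presentations is a presentation of the sum, so additivity
  holds up to the excess summand Z of \<open>presentation_excess\<close>. Z has no maps to modules
  in the common torsion class.\<close>

lemma theta_biprod:
 assumes V: "V : fmods A" and W: "W : fmods A" and D: "D : fmods A" and b: "biprod A D V W i j p q"
 obtains Z where "projective A Z"
  "!!Y. Y : fmods A ==> theta K A V Y + theta K A W Y = theta K A D Y - real (hdim K A Z Y)"
  "!!Y. Y : fmods A ==> ext0 A V Y ==> ext0 A W Y ==> hdim K A Z Y = 0"
proof -
 obtain P1 f P0 r where m: "mpres A P1 f P0 r V" "pres A P1 f P0 r V" by (rule ext0E[OF V])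
 obtain Q1 g Q0 t where n: "mpres A Q1 g Q0 t W" "pres A Q1 g Q0 t W" by (rule ext0E[OF W])
 obtain E1 d E0 e where E: "pres A E1 d E0 e D"
  "!!Y. Y : fmods A ==> hdim K A E0 Y = hdim K A P0 Y + hdim K A Q0 Y"
  "!!Y. Y : fmods A ==> hdim K A E1 Y = hdim K A P1 Y + hdim K A Q1 Y"
  "!!Y. Y : fmods A ==> extl A P1 f P0 Y ==> extl A Q1 g Q0 Y ==> extl A E1 d E0 Y"
  using pres_biprod[OF V W D b m(2) n(2)] by blast
 obtain Z where Z: "projective A Z"
  "!!Y. Y : fmods A ==> real (hdim K A E0 Y) - real (hdim K A E1 Y) = theta K A D Y - real (hdim K A Z Y)"
  "!!Y. Y : fmods A ==> extl A E1 d E0 Y ==> hdim K A Z Y = 0"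
  using presentation_excess[OF D E(1)] by blast
 show thesis
 proof (rule that[OF Z(1)])
  fix Y assume Y: "Y : fmods A"
  show "theta K A V Y + theta K A W Y = theta K A D Y - real (hdim K A Z Y)"
   using Z(2)[OF Y] E(2,3)[OF Y] theta_eq[OF V m(1) Y] theta_eq[OF W n(1) Y] by simp
  show "hdim K A Z Y = 0" if "ext0 A V Y" "ext0 A W Y"
   using Z(3)[OF Y E(4)[OF Y]] ext0_iff[OF V m(1), of Y] ext0_iff[OF W n(1), of Y] that by auto
 qed
qed

end

section \<open>Approximations, and functionals that determine a rigid collection\<close>

context fd_algebra
begin

lemma addc_fmods: "addc A U D ==> D : fmods A"
 by (induction rule: addc.induct) auto

lemma hom_from_zero:
 assumes "right_module A D" "right_module A N" "car D = {\<zero>\<^sub>D}" "is_hom A D N f" "x : car D"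
 shows "f x = \<zero>\<^sub>N"
 using assms hom_zero[OF assms(1,2,4)] by auto

lemma addc_tors:
 assumes r: "rigid_set K A U P" and d: "addc A U D" shows "tors K A U P D"
 using d
proof (induction rule: addc.induct)
 case (zero D)
 have "ext0 A M D" if M: "M : fmods A" for M
 proof -
  obtain P1 f P0 p where m: "mpres A P1 f P0 p M" "pres A P1 f P0 p M" by (rule ext0E[OF M])
  have "extl A P1 f P0 D" unfolding extl_def
  proof (intro allI impI)
   fix u assume u: "is_hom A P1 D u"
   thus "EX v. is_hom A P0 D v & (ALL x: car P1. v (f x) = u x)"
    using zero hom_zero_fun[OF fmD(2)[OF zero(1)]] hom_closed[OF u] by (intro exI[of _ "%_. \<zero>\<^sub>D"]) auto
  qed
  thus ?thesis using ext0_iff[OF M m(1), of D] by simp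
 qed
 moreover have "hdim K A Q D = 0" if Q: "Q : fmods A" for Q
  unfolding hdim_eq_0_iff[OF fmD(1)[OF Q] fmD(1)[OF zero(1)]] using zero(2) hom_closed by fastforce
 ultimately show ?case using r projD(1) unfolding tors_def rigid_set_def by blast
next
 case (step D M E i j p q)
 note F = addc_fmods[OF step(1)]
 have M: "M : fmods A" using r step(2) by (auto simp: rigid_set_def)
 have "ext0 A N E" if "N : U" for N
  using ext0_biprod_cod[OF _ step(3,4), of N] step that r unfolding tors_def rigid_set_def by blast
 moreover have "hdim K A Q E = 0" if "Q : P" for Q
 proof -
  have Qf: "Q : fmods A" using r projD(1) that by (auto simp: rigid_set_def)
  have "hdim K A Q D = 0" "hdim K A Q M = 0" using step that r by (auto simp: tors_def rigid_set_def)
  thus ?thesis by (rule hdim_biprod_cod_zero[OF Qf step(3) F M step(4)])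
 qed
 ultimately show ?case unfolding tors_def by blast
qed

lemma addc_retract:
 assumes d: "addc A U D" and U: "U <= fmods A" and N: "N : fmods A" and i: "indecomposable A N" and r: "retract A N D"
 shows "EX M:U. retract A N M"
 using d r
proof (induction rule: addc.induct)
 case (zero D)
 obtain s t where st: "is_hom A N D s" "is_hom A D N t" "ALL x: car N. t (s x) = x"
  using zero(3) unfolding retract_def by auto
 have "x = \<zero>\<^sub>N" if "x : car N" for x
  using st(3) that hom_closed[OF st(1) that] hom_from_zero[OF fmD(2)[OF zero(1)] fmD(2)[OF N] zero(2) st(2)] by metis
 moreover interpret N: right_module A N by (rule fmD(2)[OF N])
 have "\<zero>\<^sub>N : car N" by simp
 ultimately show ?case using indec_nonzero[OF i] by blast
next
 case (step D M E i' j p q)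
 thus ?case using indec_retract_biprod[OF fmD(1)[OF N] i fmD(2)[OF step(3)] step(4)] by auto
qed

text \<open>Choose D -> N so that the total dimension of the spaces of maps M -> N factoring through
  D is as large as possible. If some h: M -> N did not factor, adding a copy of M to D and h to the
  map would increase this total.\<close>

lemma addc_approx:
 fixes N :: "('k, 'a) fmod"
 assumes fin: "finite U" and U: "U <= fmods A" and N: "N : fmods A"
 obtains D g where "addc A U D" "is_hom A D N g"
  "!!M h. M : U ==> is_hom A M N h ==> EX k. is_hom A M D k & (ALL x: car M. g (k x) = h x)"
proof -
 let ?post = "%M g h. \<lambda>x\<in> car M. g (h x)"
 \<comment> \<open>The maps M -> N that factor through D -> N.\<close>
 define I where "I = (%(D :: ('k, 'a) fmod, g :: (nat => 'k) => nat => 'k) (M :: ('k, 'a) fmod). ?post M g ` Hom A M D)"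
 define F where "F = (%z. \<Sum>M\<in>U. len (Ka K) (restr (HK A M N) (I z M)))"
 define G where "G = (%(D :: ('k, 'a) fmod, g). addc A U D & is_hom A D N g)"
 have rN: "right_module A N" by (rule fmD(2)[OF N])
 have Is: "submodule (I (D, g) M) (Ka K) (HK A M N)" if "G (D, g)" "M : U" for D g M
 proof -
  have *: "M : fmods A" "D : fmods A" "is_hom A D N g" using that U addc_fmods by (auto simp: G_def)
  note r = fmD(2)[OF *(1)] fmD(2)[OF *(2)]
  interpret H: right_module "Ka K" "HK A M D" by (rule right_module_HK[OF r])
  show ?thesis
   using submodule_image[OF H.right_module_axioms right_module_HK[OF r(1) rN] HK_hom_post[OF r rN *(3)] H.submodule_carrier]
   by (simp add: I_def)
 qed
 obtain Z :: "('k, 'a) fmod" where Z: "Z : fmods A" "car Z = {\<zero>\<^sub>Z}" by (rule zero_fmod_exists)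
 have G0: "G (Z, %_. \<zero>\<^sub>N)" using addc.zero[OF Z] hom_zero_fun[OF rN] by (simp add: G_def)
 have "EX z. G z & (ALL y. G y --> F y <= F z)"
 proof (rule ex_has_greatest_nat[of G, OF G0])
  show "ALL y. G y --> F y < Suc (\<Sum>M\<in>U. hdim K A M N)"
  proof (intro allI impI)
   fix y assume y: "G y"
   obtain D g where yy: "y = (D, g)" by fastforce
   have "F y <= (\<Sum>M\<in>U. hdim K A M N)" unfolding F_def
   proof (rule sum_mono)
    fix M assume M: "M : U"
    hence Mf: "M : fmods A" using U by auto
    show "len (Ka K) (restr (HK A M N) (I y M)) <= hdim K A M N"
     unfolding hdim_def yy
     by (rule len_restr_le[OF right_module_HK[OF fmD(2)[OF Mf] rN] Is flen_HK[OF fmD(1)[OF Mf] fmD(1)[OF N]]])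
      (use y yy M in auto)
   qed
   thus "F y < Suc (\<Sum>M\<in>U. hdim K A M N)" by simp
  qed
 qed
 then obtain D g where Dg: "G (D, g)" "!!y. G y ==> F y <= F (D, g)" by auto
 have D: "addc A U D" "is_hom A D N g" "D : fmods A" using Dg(1) addc_fmods by (auto simp: G_def)
 have "EX k. is_hom A M D k & (ALL x: car M. g (k x) = h x)" if M: "M : U" and h: "is_hom A M N h" for M h
 proof (rule ccontr)
  assume no: "~ ?thesis"
  have Mf: "M : fmods A" using M U by auto
  obtain E :: "('k, 'a) fmod" and i j p q where E: "E : fmods A" "biprod A E D M i j p q" by (rule biprod_exists[OF D(3) Mf])
  note bd = biprodD[OF E(2)] and rD = fmD(2)[OF D(3)] and rM = fmD(2)[OF Mf] and rE = fmD(2)[OF E(1)]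
  interpret N: right_module A N by (rule rN)
  let ?g = "%x. g (p x) \<oplus>\<^sub>N h (q x)"
  have g': "is_hom A E N ?g" by (rule hom_of_biprod[OF rE E(2) rN D(2) h])
  have GE: "G (E, ?g)" using addc.step[OF D(1) M E] g' by (simp add: G_def)
  have gi: "?g (i x) = g x" if "x : car D" for x
   using that hom_closed[OF D(2)] hom_zero[OF rM rN h] by (simp add: bd(5,6))
  have gj: "?g (j x) = h x" if "x : car M" for x
   using that hom_closed[OF h] hom_zero[OF rD rN D(2)] by (simp add: bd(7,8))
  have mono: "I (D, g) L <= I (E, ?g) L" if L: "L : U" for L
  proof
   fix y assume "y : I (D, g) L"
   then obtain k where k: "k : Hom A L D" "y = ?post L g k" by (auto simp: I_def)
   have rL: "right_module A L" using L U fmD(2) by auto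
   let ?k = "\<lambda>x\<in> car L. i (k x)"
   have kE: "?k : Hom A L E" by (rule HomI[OF rL hom_comp[OF HomD[OF k(1)] bd(1)]])
   have yk: "y = ?post L ?g ?k"
    unfolding k(2) by (rule restrict_ext) (use gi hom_closed[OF HomD[OF k(1)]] in auto)
   show "y : I (E, ?g) L" unfolding I_def prod.case by (rule image_eqI[where x="?k"]) (fact yk, fact kE)
  qed
  have hI: "restrict h (car M) : I (E, ?g) M"
  proof -
   let ?k = "restrict j (car M)"
   have kE: "?k : Hom A M E" by (rule HomI[OF rM bd(2)])
   have yk: "restrict h (car M) = ?post M ?g ?k" by (rule restrict_ext) (use gj in auto)
   show ?thesis unfolding I_def prod.case by (rule image_eqI[where x="?k"]) (fact yk, fact kE)
  qed
  have hI': "restrict h (car M) ~: I (D, g) M"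
  proof
   assume "restrict h (car M) : I (D, g) M"
   then obtain k where k: "k : Hom A M D" "restrict h (car M) = ?post M g k" by (auto simp: I_def)
   have "g (k x) = h x" if "x : car M" for x using fun_cong[OF k(2), of x] that by simp
   thus False using no HomD[OF k(1)] by blast
  qed
  have "F (D, g) < F (E, ?g)" unfolding F_def
  proof (rule sum_strict_mono_ex1[OF fin])
   have rH: "right_module (Ka K) (HK A L N)" "flen (Ka K) (HK A L N)" if "L : U" for L
    using that U right_module_HK[OF fmD(2) rN] flen_HK[OF fmD(1) fmD(1)[OF N]] by auto
   show "ALL L:U. len (Ka K) (restr (HK A L N) (I (D, g) L)) <= len (Ka K) (restr (HK A L N) (I (E, ?g) L))"
   proof
    fix L assume L: "L : U"
    show "len (Ka K) (restr (HK A L N) (I (D, g) L)) <= len (Ka K) (restr (HK A L N) (I (E, ?g) L))"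
    proof (cases "I (D, g) L = I (E, ?g) L")
     case False
     hence "I (D, g) L < I (E, ?g) L" using mono[OF L] by auto
     thus ?thesis using len_restr_mono[OF rH[OF L] Is[OF Dg(1) L] Is[OF GE L]] by simp
    qed simp
   qed
   have "I (D, g) M < I (E, ?g) M" using mono[OF M] hI hI' by auto
   thus "EX L:U. len (Ka K) (restr (HK A L N) (I (D, g) L)) < len (Ka K) (restr (HK A L N) (I (E, ?g) L))"
    using len_restr_mono[OF rH[OF M] Is[OF Dg(1) M] Is[OF GE M]] M by blast
  qed
  thus False using Dg(2)[OF GE] by simp
 qed
 thus thesis using that D(1,2) by blast
qed

lemma tors_quotient:
 assumes r: "rigid_set K A U P" and Y: "Y : fmods A" and Q: "Q : fmods A" and q: "is_hom A Y Q q" "q ` car Y = car Q"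
  and t: "tors K A U P Y"
 shows "tors K A U P Q"
 using t r ext0_cod_surj[OF _ Y Q q] proj_hdim_surj[OF _ Y Q q] unfolding tors_def rigid_set_def by blast

text \<open>\<open>X\<close> modulo the trace of \<open>U\<close> in \<open>X\<close> is \<open>U\<close>-torsion-free.\<close>

lemma trace_quotient:
 fixes N :: "('k, 'a) fmod"
 assumes fin: "finite U" and r: "rigid_set K A U P" and N: "N : fmods A"
 obtains D g Q q where "addc A U D" "is_hom A D N g" "Q : fmods A" "is_hom A N Q q" "q ` car N = car Q"
  "a_kernel N Q q = g ` car D" "!!M. M : U ==> hdim K A M Q = 0" "tors K A U P (restr N (g ` car D))"
  "!!M h. M : U ==> is_hom A M N h ==> EX k. is_hom A M D k & (ALL x: car M. g (k x) = h x)"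
proof -
 have U: "U <= fmods A" using r by (simp add: rigid_set_def)
 obtain D g where D: "addc A U D" "is_hom A D N g"
  "!!M h. M : U ==> is_hom A M N h ==> EX k. is_hom A M D k & (ALL x: car M. g (k x) = h x)"
  using addc_approx[OF fin U N] by blast
 note Df = addc_fmods[OF D(1)] and rN = fmD(2)[OF N]
 let ?T = "g ` car D"
 have T: "submodule ?T A N" "restr N ?T : fmods A" using fmods_image[OF Df N D(2)] by auto
 obtain Q :: "('k, 'a) fmod" and q where Q: "Q : fmods A" "is_hom A N Q q" "q ` car N = car Q" "a_kernel N Q q = ?T"
  by (rule fmods_quotient[OF N T(1)])
 have tT: "tors K A U P (restr N ?T)"
  by (rule tors_quotient[OF r Df T(2) hom_to_image[OF D(2)] _ addc_tors[OF r D(1)]]) simp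
 interpret N: right_module A N by (rule rN)
 note Tc = N.submoduleD(1)[OF T(1)]
 have z: "hdim K A M Q = 0" if M: "M : U" for M
 proof -
  have Mf: "M : fmods A" using M U by auto
  show ?thesis unfolding hdim_eq_0_iff[OF fmD(1)[OF Mf] fmD(1)[OF Q(1)]]
  proof (intro allI impI ballI)
   fix \<phi> y assume ph: "is_hom A M Q \<phi>" and y: "y : car M"
   \<comment> \<open>Lift \<phi> to a: P0 -> N. On the relations a lands in the trace, where it
     agrees with the restriction of some b: P0 -> trace. The difference a - b descends to M -> N,
     whose image lies in the trace; so a itself lands in the trace and \<phi> is zero.\<close>
   obtain P1 f P0 p where m: "mpres A P1 f P0 p M" "pres A P1 f P0 p M" by (rule ext0E[OF Mf])
   note pd = presD[OF m(2)]
   obtain a where a: "is_hom A P0 N a" "!!x. x : car P0 ==> q (a x) = \<phi> (p x)"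
    using proj_lift[OF pd(2) N Q(1-3) hom_comp[OF pd(4) ph]] by metis
   have ph0: "\<phi> \<zero>\<^sub>M = \<zero>\<^sub>Q" by (rule hom_zero[OF fmD(2)[OF Mf] fmD(2)[OF Q(1)] ph])
   have af: "is_hom A P1 (restr N ?T) (%x. a (f x))"
   proof (rule hom_restr_cod[OF hom_comp[OF pd(3) a(1)]])
    have "a (f x) : a_kernel N Q q" if "x : car P1" for x
     using that hom_closed[OF pd(3) that] hom_closed[OF a(1)] a(2) pd(7) ph0 by (auto simp: a_kernel_eq)
    thus "(%x. a (f x)) ` car P1 <= ?T" using Q(4) by auto
   qed
   have "ext0 A M (restr N ?T)" using tT M by (simp add: tors_def)
   hence "extl A P1 f P0 (restr N ?T)" using ext0_iff[OF Mf m(1), of "restr N ?T"] by simp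
   then obtain b where b: "is_hom A P0 (restr N ?T) b" "ALL x: car P1. b (f x) = a (f x)"
    using af unfolding extl_def by blast
   have bN: "is_hom A P0 N b" by (rule hom_restr_cod_D[OF b(1) Tc])
   obtain h where h: "is_hom A M N h" "!!x. x : car P0 ==> h (p x) = a x \<ominus>\<^sub>N b x"
   proof (rule hom_factor[OF projD(3)[OF pd(2)] fmD(2)[OF Mf] rN pd(4,5) hom_minus[OF rN a(1) bN]])
    fix x assume "x : car P0" "p x = \<zero>\<^sub>M"
    then obtain w where "w : car P1" "x = f w" using pd(8) by auto
    thus "a x \<ominus>\<^sub>N b x = \<zero>\<^sub>N" using b(2) hom_closed[OF bN] hom_closed[OF a(1)] hom_closed[OF pd(3)] by (simp add: N.diff_eq_zero)
   qed auto
   obtain k where k: "is_hom A M D k" "ALL x: car M. g (k x) = h x" using D(3)[OF M h(1)] by auto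
   obtain x where x: "x : car P0" "y = p x" using y pd(5) by blast
   have "h y : ?T" using k hom_closed[OF k(1) y] y by (metis imageI)
   hence "a x \<ominus>\<^sub>N b x : ?T" using h(2)[OF x(1)] x(2) by simp
   moreover have bx: "b x : ?T" using hom_closed[OF b(1) x(1)] by simp
   ultimately have "b x \<oplus>\<^sub>N (a x \<ominus>\<^sub>N b x) : ?T" using N.submoduleD(3)[OF T(1)] by blast
   hence "a x : ?T" using N.add_diff_cancel[OF hom_closed[OF a(1) x(1)]] hom_closed[OF bN x(1)] by simp
   hence "q (a x) = \<zero>\<^sub>Q" using Q(4) by (auto simp: a_kernel_eq)
   thus "\<phi> y = \<zero>\<^sub>Q" using a(2)[OF x(1)] x(2) by simp
  qed
 qed
 show thesis by (rule that[OF D(1,2) Q z tT]) (use D(3) in auto)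
qed

text \<open>The torsion class is recovered from t alone. If all quotients of N have t >= 0, then N
  modulo its trace Q has t(Q) = 0, since Q receives no maps from \<open>U\<close>; the strict part
  of \<open>compat\<close> puts Q into the torsion class, and so N is an extension of two of its
  members.\<close>

lemma tors_iff_theta:
 assumes fin: "finite U" and r: "rigid_set K A U P" and c: "compat K A t U P" and N: "N : fmods A"
 shows "tors K A U P N \<longleftrightarrow> (ALL Q:fmods A. ALL q. is_hom A N Q q --> q ` car N = car Q --> t Q >= 0)"
proof
 assume "tors K A U P N"
 thus "ALL Q:fmods A. ALL q. is_hom A N Q q --> q ` car N = car Q --> t Q >= 0"
  using tors_quotient[OF r N] c unfolding compat_def by blast
next
 assume t: "ALL Q:fmods A. ALL q. is_hom A N Q q --> q ` car N = car Q --> t Q >= 0"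
 obtain D g Q q where d: "addc A U D" "is_hom A D N g" "Q : fmods A" "is_hom A N Q q" "q ` car N = car Q"
  "a_kernel N Q q = g ` car D" "!!M. M : U ==> hdim K A M Q = 0" "tors K A U P (restr N (g ` car D))"
  using trace_quotient[OF fin r N] by metis
 have "t Q >= 0" using t d(3,4,5) by blast
 hence tQ: "tors K A U P Q" using c d(3,7) unfolding compat_def by force
 have "ext0 A M N" if M: "M : U" for M
 proof (rule ext0_extension[OF _ N d(3,4,5)])
  show "M : fmods A" using r M by (auto simp: rigid_set_def)
 qed (use d(6,8) tQ M in \<open>auto simp: tors_def\<close>)
 moreover have "hdim K A R N = 0" if R: "R : P" for R
 proof -
  have pR: "R : fmods A" using r R projD(1) by (auto simp: rigid_set_def)
  have sub: "restr N (g ` car D) : fmods A" by (rule fmods_image(2)[OF addc_fmods[OF d(1)] N d(2)])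
  have 1: "ALL f. is_hom A R Q f --> (ALL x: car R. f x = \<zero>\<^sub>Q)"
   using tQ R hdim_eq_0_iff[OF fmD(1)[OF pR] fmD(1)[OF d(3)]] by (auto simp: tors_def)
  have 2: "ALL f. is_hom A R (restr N (g ` car D)) f --> (ALL x: car R. f x = \<zero>\<^sub>N)"
  proof -
   have "hdim K A R (restr N (g ` car D)) = 0" using d(8) R by (simp add: tors_def)
   hence "ALL f. is_hom A R (restr N (g ` car D)) f --> (ALL x: car R. f x = zero (restr N (g ` car D)))"
    by (rule iffD1[OF hdim_eq_0_iff[OF fmD(1)[OF pR] fmD(1)[OF sub]]])
   thus ?thesis by (simp only: restr_simps)
  qed
  show ?thesis unfolding hdim_eq_0_iff[OF fmD(1)[OF pR] fmD(1)[OF N]]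
  proof (intro allI impI)
   fix f assume f: "is_hom A R N f"
   have "f x : a_kernel N Q q" if "x : car R" for x
    using 1 hom_comp[OF f d(4)] hom_closed[OF f] that by (auto simp: a_kernel_eq)
   hence "is_hom A R (restr N (g ` car D)) f" using d(6) by (intro hom_restr_cod[OF f]) auto
   thus "ALL x: car R. f x = \<zero>\<^sub>N" using 2 by blast
  qed
 qed
 ultimately show "tors K A U P N" by (simp add: tors_def)
qed

text \<open>A functional determines the module part of a rigid collection compatible with it: the relative
  \<open>Ext\<close>-projectivity of \<open>N\<close> splits a right approximation \<open>D \<rightarrow> N\<close> by sums of members of \<open>U\<close>.\<close>

theorem compat_determines:
 assumes fU: "finite U" and rU: "rigid_set K A U P" and cU: "compat K A t U P"
  and fV: "finite V" and rV: "rigid_set K A V R" and cV: "compat K A t V R"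
  and NV: "N : V" and i: "indecomposable A N"
 shows "EX M:U. retract A N M"
proof -
 have N: "N : fmods A" using NV rV by (auto simp: rigid_set_def)
 have U: "U <= fmods A" using rU by (simp add: rigid_set_def)
 have eq: "tors K A U P Y \<longleftrightarrow> tors K A V R Y" if "Y : fmods A" for Y
  using tors_iff_theta[OF fU rU cU that] tors_iff_theta[OF fV rV cV that] by simp
 obtain D g Q q where d: "addc A U D" "is_hom A D N g" "Q : fmods A" "is_hom A N Q q" "q ` car N = car Q"
  "a_kernel N Q q = g ` car D" "!!M. M : U ==> hdim K A M Q = 0"
  and app: "!!M h. M : U ==> is_hom A M N h ==> EX k. is_hom A M D k & (ALL x: car M. g (k x) = h x)"
  using trace_quotient[OF fU rU N] by metis
 note D = addc_fmods[OF d(1)] and rN = fmD(2)[OF N]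
 note rD = fmD(2)[OF D]
 interpret N: right_module A N by (rule rN)
 interpret D: right_module A D by (rule rD)
 have "R' : R ==> hdim K A R' N = 0" "M : V ==> ext0 A M N" for R' M
  using rV NV by (auto simp: rigid_set_def)
 hence "tors K A V R N" by (simp add: tors_def)
 hence tQ: "tors K A V R Q" by (rule tors_quotient[OF rV N d(3-5)])
 \<comment> \<open>Q receives no maps from \<open>U\<close>, while a nonzero map from N would make
   t(Q) positive because Q lies in the torsion class of \<open>V\<close>. So the projection N -> Q
   is zero and the approximation D -> N is onto.\<close>
 have "t Q <= 0" using cU d(3,7) by (auto simp: compat_def)
 hence "hdim K A N Q = 0" using cV d(3) tQ NV unfolding compat_def by force
 hence "q x = \<zero>\<^sub>Q" if "x : car N" for x
  using that d(4) hdim_eq_0_iff[OF fmD(1)[OF N] fmD(1)[OF d(3)]] by blast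
 hence gs: "g ` car D = car N" using d(6) by (auto simp: a_kernel_eq)
 let ?K = "a_kernel D N g"
 have Ks: "submodule ?K A D" "restr D ?K : fmods A" using fmods_kernel[OF D N d(2)] by auto
 note tD = addc_tors[OF rU d(1)]
 \<comment> \<open>The argument of Wakamatsu's lemma: extend u to v: P0 -> D, factor the induced M
   -> N through the approximation, and subtract; the result takes values in the kernel and still
   extends u.\<close>
 have eK: "ext0 A M (restr D ?K)" if M: "M : U" for M
 proof -
  have Mf: "M : fmods A" using M U by auto
  obtain P1 f P0 p where m: "mpres A P1 f P0 p M" "pres A P1 f P0 p M" by (rule ext0E[OF Mf])
  note pd = presD[OF m(2)]
  have eD: "extl A P1 f P0 D" using tD M ext0_iff[OF Mf m(1), of D] by (auto simp: tors_def)
  have "extl A P1 f P0 (restr D ?K)" unfolding extl_def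
  proof (intro allI impI)
   fix u assume u: "is_hom A P1 (restr D ?K) u"
   have uD: "is_hom A P1 D u" by (rule hom_restr_cod_D[OF u a_kernel_subset])
   obtain v where v: "is_hom A P0 D v" "ALL x: car P1. v (f x) = u x" using eD uD unfolding extl_def by blast
   obtain h where h: "is_hom A M N h" "!!x. x : car P0 ==> h (p x) = g (v x)"
   proof (rule hom_factor[OF projD(3)[OF pd(2)] fmD(2)[OF Mf] rN pd(4,5) hom_comp[OF v(1) d(2)]])
    fix x assume "x : car P0" "p x = \<zero>\<^sub>M"
    then obtain w where "w : car P1" "x = f w" using pd(8) by auto
    thus "g (v x) = \<zero>\<^sub>N" using v(2) hom_closed[OF u, of w] by (simp add: a_kernel_eq)
   qed auto
   obtain k where k: "is_hom A M D k" "ALL x: car M. g (k x) = h x" using app[OF M h(1)] by auto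
   have kp: "is_hom A P0 D (%x. k (p x))" by (rule hom_comp[OF pd(4) k(1)])
   have "is_hom A P0 (restr D ?K) (%x. v x \<ominus>\<^sub>D k (p x))"
   proof (rule hom_restr_cod[OF hom_minus[OF rD v(1) kp]])
    show "(%x. v x \<ominus>\<^sub>D k (p x)) ` car P0 <= ?K"
     using hom_closed[OF v(1)] hom_closed[OF kp] hom_closed[OF pd(4)] hom_closed[OF d(2)] k(2) h(2)
     by (auto simp: a_kernel_eq hom_diff[OF rD rN d(2)] N.diff_eq_zero)
   qed
   moreover have "v (f x) \<ominus>\<^sub>D k (p (f x)) = u x" if x: "x : car P1" for x
    using pd(7)[OF x] hom_zero[OF fmD(2)[OF Mf] rD k(1)] v(2) x hom_closed[OF uD x]
     D.diff_add_cancel[of "u x" "\<zero>\<^sub>D"] by simp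
   ultimately show "EX v. is_hom A P0 (restr D ?K) v & (ALL x: car P1. v (f x) = u x)" by blast
  qed
  thus ?thesis using ext0_iff[OF Mf m(1), of "restr D ?K"] by simp
 qed
 have "tors K A U P (restr D ?K)"
  using eK hdim_zero_sub[OF _ D Ks(1)] tD rU projD(1) unfolding tors_def rigid_set_def by blast
 hence eN: "ext0 A N (restr D ?K)" using eq[OF Ks(2)] NV by (simp add: tors_def)
 obtain P1 f P0 p where m: "mpres A P1 f P0 p N" "pres A P1 f P0 p N" by (rule ext0E[OF N])
 note pd = presD[OF m(2)]
 have el: "extl A P1 f P0 (restr D ?K)" using eN ext0_iff[OF N m(1), of "restr D ?K"] by simp
 \<comment> \<open>Since the kernel lies in the torsion class, a lift v of p: P0 -> N can be
   corrected by a map w into the kernel so that v - w descends to a section of D -> N.\<close>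
 obtain v where v: "is_hom A P0 D v" "!!x. x : car P0 ==> g (v x) = p x"
  using proj_lift[OF pd(2) D N d(2) gs pd(4)] by metis
 have "is_hom A P1 (restr D ?K) (%x. v (f x))"
  by (rule hom_restr_cod[OF hom_comp[OF pd(3) v(1)]])
   (use v hom_closed[OF v(1)] hom_closed[OF pd(3)] pd(7) in \<open>auto simp: a_kernel_eq\<close>)
 then obtain w where w: "is_hom A P0 (restr D ?K) w" "ALL x: car P1. w (f x) = v (f x)" using el unfolding extl_def by blast
 have wD: "is_hom A P0 D w" by (rule hom_restr_cod_D[OF w(1) a_kernel_subset])
 obtain s where s: "is_hom A N D s" "!!x. x : car P0 ==> s (p x) = v x \<ominus>\<^sub>D w x"
 proof (rule hom_factor[OF projD(3)[OF pd(2)] rN rD pd(4,5) hom_minus[OF rD v(1) wD]])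
  fix x assume "x : car P0" "p x = \<zero>\<^sub>N"
  then obtain z where "z : car P1" "x = f z" using pd(8) by auto
  thus "v x \<ominus>\<^sub>D w x = \<zero>\<^sub>D" using w(2) hom_closed[OF v(1)] hom_closed[OF pd(3)] by (simp add: D.diff_eq_zero)
 qed auto
 have "g (s y) = y" if "y : car N" for y
 proof -
  obtain x where x: "x : car P0" "y = p x" using \<open>y : car N\<close> pd(5) by blast
  have wk: "g (w x) = \<zero>\<^sub>N" using hom_closed[OF w(1) x(1)] by (simp add: a_kernel_eq)
  have "g (s y) = g (v x) \<ominus>\<^sub>N g (w x)"
   using s(2)[OF x(1)] x(2) hom_diff[OF rD rN d(2) hom_closed[OF v(1) x(1)] hom_closed[OF wD x(1)]] by simp
  thus ?thesis using wk v(2)[OF x(1)] x(2) that N.diff_add_cancel[of y "\<zero>\<^sub>N"] by simp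
 qed
 hence "retract A N D" unfolding retract_def using s(1) d(2) by blast
 thus ?thesis by (rule addc_retract[OF d(1) U N i])
qed

text \<open>On the torsion class every theta equals the corresponding dim Hom and the projective
  terms vanish. On modules without maps from the M i all terms are nonpositive, and they vanish
  together only on the torsion class. Families instead of sets are used so that repetitions of
  modules cause no loss.\<close>

lemma compat_weighted:
 assumes fI: "finite I" and fJ: "finite J" and M: "M ` I <= fmods A" and P: "P ` J <= fmods A"
  and c: "!!i. i : I ==> c i > 0" and e: "!!j. j : J ==> e j > 0"
  and t: "!!Y. Y : fmods A ==> t Y = (\<Sum>i\<in>I. c i * theta K A (M i) Y) - (\<Sum>j\<in>J. e j * real (hdim K A (P j) Y))"
 shows "compat K A t (M ` I) (P ` J)"
 unfolding compat_def
proof (intro ballI conjI impI)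
 fix Y assume Y: "Y : fmods A"
 note le = theta_le[OF _ Y]
 { assume d: "tors K A (M ` I) (P ` J) Y"
  have "(\<Sum>j\<in>J. e j * real (hdim K A (P j) Y)) = 0" using d by (intro sum.neutral) (auto simp: tors_def)
  moreover have "theta K A (M i) Y = real (hdim K A (M i) Y)" if "i : I" for i
   using le(2)[of "M i"] d that M unfolding tors_def by blast
  ultimately have tY: "t Y = (\<Sum>i\<in>I. c i * real (hdim K A (M i) Y))" using t[OF Y] by simp
  show "t Y >= 0" unfolding tY using c by (intro sum_nonneg) (simp add: less_imp_le)
  assume "EX N:M ` I. hdim K A N Y ~= 0"
  then obtain i where "i : I" "hdim K A (M i) Y ~= 0" by auto
  thus "t Y > 0" unfolding tY using c by (intro sum_pos2[OF fI]) (auto simp: less_imp_le) }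
 { assume z: "ALL N:M ` I. hdim K A N Y = 0"
  have th: "theta K A (M i) Y <= 0" "theta K A (M i) Y = 0 \<longleftrightarrow> ext0 A (M i) Y" if "i : I" for i
   using le[of "M i"] z that M by auto
  have n1: "(\<Sum>i\<in>I. c i * - theta K A (M i) Y) >= 0" using c th by (intro sum_nonneg) (simp add: less_imp_le mult_nonneg_nonpos)
  have n2: "(\<Sum>j\<in>J. e j * real (hdim K A (P j) Y)) >= 0" using e by (intro sum_nonneg) (simp add: less_imp_le)
  have tY: "t Y = - (\<Sum>i\<in>I. c i * - theta K A (M i) Y) - (\<Sum>j\<in>J. e j * real (hdim K A (P j) Y))"
   using t[OF Y] by (simp add: sum_negf)
  show t0: "t Y <= 0" using tY n1 n2 by simp
  assume nt: "~ tors K A (M ` I) (P ` J) Y"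
  show "t Y < 0"
  proof (rule ccontr)
   assume "~ t Y < 0"
   hence "(\<Sum>i\<in>I. c i * - theta K A (M i) Y) = 0" "(\<Sum>j\<in>J. e j * real (hdim K A (P j) Y)) = 0" using tY n1 n2 t0 by linarith+
   hence "ALL i:I. c i * - theta K A (M i) Y = 0" "ALL j:J. e j * real (hdim K A (P j) Y) = 0"
    using sum_nonneg_eq_0_iff[OF fI, of "%i. c i * - theta K A (M i) Y"] sum_nonneg_eq_0_iff[OF fJ, of "%j. e j * real (hdim K A (P j) Y)"] c e th
    by (auto simp: less_imp_le mult_nonneg_nonpos)
   hence "ALL i:I. theta K A (M i) Y = 0" "ALL j:J. hdim K A (P j) Y = 0" using c e by fastforce+
   thus False using nt th by (simp add: tors_def)
  qed }
qed

text \<open>Moving the negative coefficients to the other side writes one functional in two ways, by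
  disjoint subcollections with positive weights. By \<open>compat_determines\<close> a member of one
  would be isomorphic to a member of the other.\<close>

lemma theta_independent_modules:
 assumes fU: "finite U" and fP: "finite P" and r: "rigid_set K A U P"
  and i: "!!M. M : U ==> indecomposable A M"
  and ni: "!!M N. M : U ==> N : U ==> mod_iso A M N ==> M = N"
  and z: "!!Y. Y : fmods A ==> (\<Sum>M\<in>U. c M * theta K A M Y) = (\<Sum>Q\<in>P. e Q * real (hdim K A Q Y))"
  and M: "M : U"
 shows "c M = 0"
proof -
 have U: "U <= fmods A" and P: "P <= fmods A" using r projD(1) by (auto simp: rigid_set_def)
 let ?U = "{M\<in>U. c M > 0}" and ?V = "{M\<in>U. c M < 0}" and ?P = "{Q\<in>P. e Q > 0}" and ?R = "{Q\<in>P. e Q < 0}"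
 have rs: "rigid_set K A ?U ?P" "rigid_set K A ?V ?R" using r unfolding rigid_set_def by auto
 have fin: "finite ?U" "finite ?V" "finite ?P" "finite ?R" using fU fP by auto
 have sub: "?U <= fmods A" "?V <= fmods A" "?P <= fmods A" "?R <= fmods A" using U P by auto
 define t where "t = (%Y. (\<Sum>M\<in>?U. c M * theta K A M Y) - (\<Sum>Q\<in>?P. e Q * real (hdim K A Q Y)))"
 have split: "(\<Sum>x\<in>S. f x * g x) = (\<Sum>x\<in>{x\<in>S. f x > 0}. f x * g x) + (\<Sum>x\<in>{x\<in>S. f x < 0}. f x * g x)"
  if "finite S" for S :: "('k, 'a) fmod set" and f g :: "('k, 'a) fmod => real"
 proof -
  have "(\<Sum>x\<in>{x\<in>S. f x > 0} \<union> {x\<in>S. f x < 0}. f x * g x) = (\<Sum>x\<in>S. f x * g x)"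
   by (rule sum.mono_neutral_left) (use that in auto)
  thus ?thesis using that by (subst (asm) sum.union_disjoint) auto
 qed
 have t2: "t Y = (\<Sum>M\<in>?V. (- c M) * theta K A M Y) - (\<Sum>Q\<in>?R. (- e Q) * real (hdim K A Q Y))" if "Y : fmods A" for Y
  using z[OF that] split[OF fU, of c "%M. theta K A M Y"] split[OF fP, of e "%Q. real (hdim K A Q Y)"]
  by (simp add: t_def sum_negf)
 have c1: "compat K A t ?U ?P"
  by (rule compat_weighted[OF fin(1,3), of "%M. M" "%Q. Q" c e, unfolded image_ident, OF sub(1,3)]) (auto simp: t_def)
 have c2: "compat K A t ?V ?R"
  by (rule compat_weighted[OF fin(2,4), of "%M. M" "%Q. Q" "%M. - c M" "%Q. - e Q", unfolded image_ident, OF sub(2,4)]) (auto simp: t2)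
 have same: "N = L" if "N : U" "L : U" "retract A N L" for N L
  using ni[OF that(1,2)] retract_of_indec[OF fmD(2) fmD(2) i[OF that(2)] indec_nonzero[OF i[OF that(1)]] that(3)] that U by blast
 show ?thesis
 proof (rule ccontr)
  assume "c M ~= 0"
  then consider "M : ?V" | "M : ?U" using M by fastforce
  thus False
  proof cases
   case 1
   then obtain L where "L : ?U" "retract A M L" using compat_determines[OF fin(1) rs(1) c1 fin(2) rs(2) c2 1 i[OF M]] by auto
   thus False using same[OF M] 1 by fastforce
  next
   case 2
   then obtain L where "L : ?V" "retract A M L" using compat_determines[OF fin(2) rs(2) c2 fin(1) rs(1) c1 2 i[OF M]] by auto
   thus False using same[OF M] 2 by fastforce
  qed
 qed
qed

text \<open>Once the module coefficients vanish, the projectives in \<open>P\<close> are themselves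
  a rigid collection of modules with theta equal to dim Hom, so the previous lemma applies to
  them.\<close>

theorem theta_independent:
 assumes fU: "finite U" and fP: "finite P" and r: "rigid_set K A U P"
  and i: "!!M. M : U ==> indecomposable A M" and iP: "!!Q. Q : P ==> indecomposable A Q"
  and ni: "!!M N. M : U ==> N : U ==> mod_iso A M N ==> M = N"
  and niP: "!!M N. M : P ==> N : P ==> mod_iso A M N ==> M = N"
  and z: "!!Y. Y : fmods A ==> (\<Sum>M\<in>U. c M * theta K A M Y) = (\<Sum>Q\<in>P. e Q * real (hdim K A Q Y))"
 shows "ALL M:U. c M = 0" "ALL Q:P. e Q = 0"
proof -
 show c0: "ALL M:U. c M = 0" using theta_independent_modules[OF fU fP r i ni z] by blast
 have pr: "projective A Q" if "Q : P" for Q using r that by (simp add: rigid_set_def)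
 have r': "rigid_set K A P {}"
  unfolding rigid_set_def using pr projD(1) ext0_projective[OF pr projD(3)[OF pr]] by auto
 show "ALL Q:P. e Q = 0"
 proof
  fix Q assume Q: "Q : P"
  show "e Q = 0"
  proof (rule theta_independent_modules[OF fP finite.emptyI r' iP niP _ Q, of e "%_. 0"])
   fix Y assume Y: "Y : fmods A"
   have "(\<Sum>M\<in>P. e M * theta K A M Y) = (\<Sum>Q\<in>P. e Q * real (hdim K A Q Y))"
    by (rule sum.cong) (use theta_projective[OF pr Y] in auto)
   also have "... = 0" using z[OF Y] c0 by simp
   finally show "(\<Sum>M\<in>P. e M * theta K A M Y) = (\<Sum>Q\<in>{}. 0 * real (hdim K A Q Y))" by simp
  qed
 qed
qed

end

section \<open>Duality, the transpose, and Hom into the Auslander-Reiten translate\<close>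

lemma opp_simps [simp]: "car (opp A) = car A" "mult (opp A) = (%x y. y \<otimes>\<^sub>A x)" "one (opp A) = one A"
 "zero (opp A) = zero A" "add (opp A) = add A" "smult (opp A) = smult A"
 by (simp_all add: opp_def)

lemma ring_opp: assumes "ring A" shows "ring (opp A)"
proof -
 interpret ring A by fact
 show ?thesis
  by (intro ringI abelian_groupI monoidI)
   (auto simp: m_assoc l_distr r_distr a_ac intro: bexI[of _ "\<ominus>\<^sub>A x" for x] l_neg)
qed

lemma A_dual_simps [simp]: "car (A_dual A M) = Hom A M (regular A)" "zero (A_dual A M) = (\<lambda>x\<in> car M. \<zero>\<^sub>A)"
 "add (A_dual A M) = (%f g. \<lambda>x\<in> car M. f x \<oplus>\<^sub>A g x)" "smult (A_dual A M) = (%a f. \<lambda>x\<in> car M. a \<otimes>\<^sub>A f x)"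
 by (simp_all add: A_dual_def)

lemma K_dual_simps [simp]: "zero (K_dual K R M) = (\<lambda>x\<in> car M. \<zero>\<^sub>K)"
 "add (K_dual K R M) = (%h h'. \<lambda>x\<in> car M. h x \<oplus>\<^sub>K h' x)" "smult (K_dual K R M) = (%a h. \<lambda>x\<in> car M. h (a \<odot>\<^sub>M x))"
 by (simp_all add: K_dual_def)

lemma K_dual_carrier: "h : car (K_dual K R M) \<longleftrightarrow> h : car M \<rightarrow>\<^sub>E car K &
   (ALL x: car M. ALL y: car M. h (x \<oplus>\<^sub>M y) = h x \<oplus>\<^sub>K h y) &
   (ALL c: car K. ALL x: car M. h ((c \<odot>\<^sub>R \<one>\<^sub>R) \<odot>\<^sub>M x) = c \<otimes>\<^sub>K h x)"
 by (simp add: K_dual_def)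

context fd_algebra
begin

lemma regular_hom_iff: "is_hom A M (regular A) h \<longleftrightarrow> h : car M \<rightarrow> car A &
 (ALL x: car M. ALL y: car M. h (x \<oplus>\<^sub>M y) = h x \<oplus>\<^sub>A h y) &
 (ALL a: car A. ALL x: car M. h (a \<odot>\<^sub>M x) = h x \<otimes>\<^sub>A a)"
 by (simp add: is_hom_def)

lemma right_module_A_dual:
 assumes M: "right_module A M" shows "right_module (opp A) (A_dual A M)"
proof -
 interpret MM: right_module A M by fact
 note rA = right_module_regular[OF ring_A]
 have c: "f x : car A" if "f : Hom A M (regular A)" "x : car M" for f x
  using hom_closed[OF HomD[OF that(1)] that(2)] by simp
 have und: "f x = undefined" if "f : Hom A M (regular A)" "x ~: car M" for f x
  using that by (auto simp: Hom_def PiE_iff extensional_def)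
 have pl: "(\<lambda>x\<in> car M. f x \<oplus>\<^sub>A g x) : Hom A M (regular A)" if "f : Hom A M (regular A)" "g : Hom A M (regular A)" for f g
  using HomI[OF M hom_plus[OF rA HomD[OF that(1)] HomD[OF that(2)]]] by simp
 have ze: "(\<lambda>x\<in> car M. \<zero>\<^sub>A) : Hom A M (regular A)" using HomI[OF M hom_zero_fun[OF rA]] by simp
 have ng: "(\<lambda>x\<in> car M. \<ominus>\<^sub>A f x) : Hom A M (regular A)" if "f : Hom A M (regular A)" for f
 proof -
  have "\<ominus>\<^sub>(regular A) z = \<ominus>\<^sub>A z" for z by (simp add: a_inv_def m_inv_def)
  thus ?thesis using HomI[OF M hom_uminus[OF rA HomD[OF that]]] by simp
 qed
 have sc: "(\<lambda>x\<in> car M. a \<otimes>\<^sub>A f x) : Hom A M (regular A)" if a: "a : car A" and f: "f : Hom A M (regular A)" for a f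
 proof (rule HomI[OF M])
  have "is_hom A M (regular A) f" by (rule HomD[OF f])
  thus "is_hom A M (regular A) (%x. a \<otimes>\<^sub>A f x)"
   unfolding regular_hom_iff using a by (auto simp: A.r_distr A.m_assoc Pi_iff)
 qed
 show ?thesis
 proof (rule right_moduleI)
  show "ring (opp A)" by (rule ring_opp[OF ring_A])
  fix f assume f: "f : car (A_dual A M)"
  show "EX y: car (A_dual A M). y \<oplus>\<^sub>(A_dual A M) f = \<zero>\<^sub>(A_dual A M)"
   using f ng[of f] c[of f] by (intro bexI[of _ "\<lambda>x\<in> car M. \<ominus>\<^sub>A f x"]) (auto simp: A.l_neg fun_eq_iff)
  show "\<zero>\<^sub>(A_dual A M) \<oplus>\<^sub>(A_dual A M) f = f" "\<one>\<^sub>(opp A) \<odot>\<^sub>(A_dual A M) f = f" using f c[of f] und[of f] by (auto simp: fun_eq_iff)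
  show "(a \<oplus>\<^sub>(opp A) b) \<odot>\<^sub>(A_dual A M) f = a \<odot>\<^sub>(A_dual A M) f \<oplus>\<^sub>(A_dual A M) b \<odot>\<^sub>(A_dual A M) f"
   "(a \<otimes>\<^sub>(opp A) b) \<odot>\<^sub>(A_dual A M) f = b \<odot>\<^sub>(A_dual A M) (a \<odot>\<^sub>(A_dual A M) f)"
   if "a : car (opp A)" "b : car (opp A)" for a b
   using f c[of f] that by (auto simp: fun_eq_iff A.l_distr A.m_assoc)
  fix g assume g: "g : car (A_dual A M)"
  show "f \<oplus>\<^sub>(A_dual A M) g = g \<oplus>\<^sub>(A_dual A M) f" using f g c[of f] c[of g] by (auto simp: fun_eq_iff A.a_comm)
  show "a \<odot>\<^sub>(A_dual A M) (f \<oplus>\<^sub>(A_dual A M) g) = a \<odot>\<^sub>(A_dual A M) f \<oplus>\<^sub>(A_dual A M) a \<odot>\<^sub>(A_dual A M) g"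
   if "a : car (opp A)" for a
   using f g c[of f] c[of g] that by (auto simp: fun_eq_iff A.r_distr)
  fix h assume h: "h : car (A_dual A M)"
  show "(f \<oplus>\<^sub>(A_dual A M) g) \<oplus>\<^sub>(A_dual A M) h = f \<oplus>\<^sub>(A_dual A M) (g \<oplus>\<^sub>(A_dual A M) h)"
   using f g h c[of f] c[of g] c[of h] by (auto simp: fun_eq_iff A.a_assoc)
 qed (use pl sc ze in auto)
qed

lemma A_dual_map:
 assumes U: "right_module A U" and M: "right_module A M" and d: "is_hom A U M d"
 shows "is_hom (opp A) (A_dual A M) (A_dual A U) (%k. \<lambda>x\<in> car U. k (d x))"
 by (rule is_homI) (auto simp: HomI[OF U hom_comp[OF d HomD]] hom_closed[OF d] fun_eq_iff)

text \<open>The elementary homomorphisms \<open>P \<rightarrow> A \<rightarrow> Y\<close> through the regular module; they span \<open>Hom(P, Y)\<close> if \<open>P\<close> is projective.\<close>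

definition tens :: "('a, 'v) module => ('a, 'w) module => 'w => ('v => 'a) => 'v => 'w" where
 "tens P Y m h = (\<lambda>x\<in> car P. h x \<odot>\<^sub>Y m)"

text \<open>Spanning is phrased dually, by functionals. Together with \<open>tens_dual\<close> it
  expresses that Hom(P,Y) is the tensor product of Y with Hom(P,A), without constructing a tensor
  product.\<close>

definition tens_span :: "('a, 'v) module => ('a, 'w) module => bool" where
 "tens_span P Y \<longleftrightarrow> (ALL l. is_hom (Ka K) (HK A P Y) (regular (Ka K)) l -->
  (ALL m: car Y. ALL h:Hom A P (regular A). l (tens P Y m h) = \<zero>\<^sub>K) --> (ALL u:Hom A P Y. l u = \<zero>\<^sub>K))"

text \<open>Functionals on the tensor product of Y with Hom(P,A), written as A-balanced K-bilinear
  forms.\<close>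

definition balanced :: "('a, 'v) module => ('a, 'w) module => ('w => ('v => 'a) => 'k) => bool" where
 "balanced P Y b \<longleftrightarrow> (ALL m: car Y. ALL h:Hom A P (regular A). b m h : car K &
  (ALL m': car Y. b (m \<oplus>\<^sub>Y m') h = b m h \<oplus>\<^sub>K b m' h) &
  (ALL k:Hom A P (regular A). b m (h \<oplus>\<^sub>(A_dual A P) k) = b m h \<oplus>\<^sub>K b m k) &
  (ALL a: car A. b (a \<odot>\<^sub>Y m) h = b m (a \<odot>\<^sub>(A_dual A P) h)) &
  (ALL c: car K. b m ((c \<odot>\<^sub>A \<one>\<^sub>A) \<odot>\<^sub>(A_dual A P) h) = c \<otimes>\<^sub>K b m h))"

definition tens_dual :: "('a, 'v) module => ('a, 'w) module => bool" where
 "tens_dual P Y \<longleftrightarrow> (ALL b. balanced P Y b -->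
  (EX l. is_hom (Ka K) (HK A P Y) (regular (Ka K)) l & (ALL m: car Y. ALL h:Hom A P (regular A). l (tens P Y m h) = b m h)))"

lemma balancedD:
 assumes "balanced P Y b" "m : car Y" "h : Hom A P (regular A)"
 shows "b m h : car K" "m' : car Y ==> b (m \<oplus>\<^sub>Y m') h = b m h \<oplus>\<^sub>K b m' h"
  "k : Hom A P (regular A) ==> b m (h \<oplus>\<^sub>(A_dual A P) k) = b m h \<oplus>\<^sub>K b m k"
  "a : car A ==> b (a \<odot>\<^sub>Y m) h = b m (a \<odot>\<^sub>(A_dual A P) h)"
  "c : car K ==> b m ((c \<odot>\<^sub>A \<one>\<^sub>A) \<odot>\<^sub>(A_dual A P) h) = c \<otimes>\<^sub>K b m h"
 using assms unfolding balanced_def by blast+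

lemma tens_Hom:
 assumes "right_module A P" "right_module A Y" "m : car Y" "h : Hom A P (regular A)"
 shows "tens P Y m h : Hom A P Y"
 unfolding tens_def by (rule HomI[OF assms(1) hom_comp[OF HomD[OF assms(4)] act_hom[OF assms(2,3)]]])

lemma tens_comp:
 assumes "is_hom A U P s" shows "(\<lambda>x\<in> car U. tens P Y m h (s x)) = tens U Y m (\<lambda>x\<in> car U. h (s x))"
 by (auto simp: tens_def fun_eq_iff hom_closed[OF assms])

lemma Hom_restrict_self: "u : Hom A M N ==> (\<lambda>x\<in> car M. u x) = u"
 by (auto simp: Hom_def PiE_iff extensional_restrict)

lemma tens_span_regular:
 assumes Y: "right_module A Y" shows "tens_span (regular A) Y"
 unfolding tens_span_def
proof (intro allI impI ballI)
 fix l u assume l: "ALL m: car Y. ALL h:Hom A (regular A) (regular A). l (tens (regular A) Y m h) = \<zero>\<^sub>K"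
  and u: "u : Hom A (regular A) Y"
 note rA = right_module_regular[OF ring_A]
 let ?h = "\<lambda>x\<in> car (regular A). x"
 have h: "?h : Hom A (regular A) (regular A)" by (rule HomI[OF rA hom_id])
 have m: "u \<one>\<^sub>A : car Y" using hom_closed[OF HomD[OF u]] by simp
 have eq: "u x = x \<odot>\<^sub>Y u \<one>\<^sub>A" if "x : car A" for x
  using hom_act[OF HomD[OF u] that, of "\<one>\<^sub>A"] that by simp
 have "tens (regular A) Y (u \<one>\<^sub>A) ?h = (\<lambda>x\<in> car (regular A). u x)"
  unfolding tens_def
 proof (rule restrict_ext)
  fix x assume "x : car (regular A)"
  thus "?h x \<odot>\<^sub>Y u \<one>\<^sub>A = u x" using eq[of x] by simp
 qed
 hence "u = tens (regular A) Y (u \<one>\<^sub>A) ?h" using Hom_restrict_self[OF u] by simp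
 thus "l u = \<zero>\<^sub>K" using l m h by metis
qed

text \<open>Precomposition with s sends elementary maps to elementary maps, so a functional
  vanishing on them restricts to one of the same kind on Hom(S,Y).\<close>

lemma tens_span_pull:
 assumes D: "right_module A D" and S: "right_module A S" "tens_span S Y" and Y: "right_module A Y" and s: "is_hom A D S s" and w: "w : Hom A S Y"
  and l: "is_hom (Ka K) (HK A D Y) (regular (Ka K)) l" "ALL m: car Y. ALL h:Hom A D (regular A). l (tens D Y m h) = \<zero>\<^sub>K"
 shows "l (\<lambda>x\<in> car D. w (s x)) = \<zero>\<^sub>K"
proof -
 let ?l = "%w. l (\<lambda>x\<in> car D. w (s x))"
 have "is_hom (Ka K) (HK A S Y) (regular (Ka K)) ?l" by (rule hom_comp[OF HK_hom_pre[OF D S(1) Y s] l(1)])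
 moreover have "?l (tens S Y m h) = \<zero>\<^sub>K" if "m : car Y" "h : Hom A S (regular A)" for m h
  unfolding tens_comp[OF s] using l(2) that(1) HomI[OF D hom_comp[OF s HomD[OF that(2)]]] by blast
 ultimately show ?thesis using S(2) w unfolding tens_span_def by blast
qed

lemma tens_span_retract:
 assumes P: "right_module A P" and P': "right_module A P'" and Y: "right_module A Y"
  and r: "retract A P P'" and t: "tens_span P' Y"
 shows "tens_span P Y"
 unfolding tens_span_def
proof (intro allI impI ballI)
 fix l u assume l: "is_hom (Ka K) (HK A P Y) (regular (Ka K)) l"
  "ALL m: car Y. ALL h:Hom A P (regular A). l (tens P Y m h) = \<zero>\<^sub>K" and u: "u : Hom A P Y"
 obtain s q where sq: "is_hom A P P' s" "is_hom A P' P q" "!!x. x : car P ==> q (s x) = x"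
  using r unfolding retract_def by auto
 let ?w = "\<lambda>x\<in> car P'. u (q x)"
 have "(\<lambda>x\<in> car P. ?w (s x)) = (\<lambda>x\<in> car P. u x)"
  by (rule restrict_ext) (simp add: hom_closed[OF sq(1)] sq(3))
 thus "l u = \<zero>\<^sub>K"
  using tens_span_pull[OF P P' t Y sq(1) HomI[OF P' hom_comp[OF sq(2) HomD[OF u]]] l] Hom_restrict_self[OF u] by simp
qed

lemma tens_span_biprod:
 assumes D: "right_module A D" and V: "right_module A V" and W: "right_module A W" and Y: "right_module A Y"
  and b: "biprod A D V W i j p q" and t: "tens_span V Y" "tens_span W Y"
 shows "tens_span D Y"
 unfolding tens_span_def
proof (intro allI impI ballI)
 fix l u assume l: "is_hom (Ka K) (HK A D Y) (regular (Ka K)) l"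
  "ALL m: car Y. ALL h:Hom A D (regular A). l (tens D Y m h) = \<zero>\<^sub>K" and u: "u : Hom A D Y"
 note bd = biprodD[OF b]
 note c = hom_closed[OF bd(1)] hom_closed[OF bd(2)] hom_closed[OF bd(3)] hom_closed[OF bd(4)]
 let ?v = "\<lambda>x\<in> car V. u (i x)" and ?w = "\<lambda>x\<in> car W. u (j x)"
 let ?pv = "\<lambda>x\<in> car D. ?v (p x)" and ?qw = "\<lambda>x\<in> car D. ?w (q x)"
 have v: "?v : Hom A V Y" by (rule HomI[OF V hom_comp[OF bd(1) HomD[OF u]]])
 have w: "?w : Hom A W Y" by (rule HomI[OF W hom_comp[OF bd(2) HomD[OF u]]])
 have m: "?pv : Hom A D Y" "?qw : Hom A D Y"
  by (rule HomI[OF D hom_comp[OF bd(3) HomD[OF v]]], rule HomI[OF D hom_comp[OF bd(4) HomD[OF w]]])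
 have "u (i (p x)) \<oplus>\<^sub>Y u (j (q x)) = u x" if x: "x : car D" for x
  using hom_add[OF HomD[OF u], of "i (p x)" "j (q x)"] bd(9)[OF x] x c by simp
 hence "?pv \<oplus>\<^sub>(HK A D Y) ?qw = (\<lambda>x\<in> car D. u x)" using c by (auto simp: fun_eq_iff)
 hence lu: "l u = l ?pv \<oplus>\<^sub>K l ?qw" using hom_add[OF l(1), of ?pv ?qw] m Hom_restrict_self[OF u] by simp
 show "l u = \<zero>\<^sub>K" unfolding lu tens_span_pull[OF D V t(1) Y bd(3) v l] tens_span_pull[OF D W t(2) Y bd(4) w l] by simp
qed

text \<open>For P = A a homomorphism u is determined by u(1), and the functional is b evaluated at
  u(1) and the identity; every k is k(1) times the identity.\<close>

lemma tens_dual_regular: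
 assumes Y: "right_module A Y" shows "tens_dual (regular A) Y"
 unfolding tens_dual_def
proof (intro allI impI)
 fix b assume b: "balanced (regular A) Y b"
 note rA = right_module_regular[OF ring_A] and bD = balancedD[OF b]
 interpret Y: right_module A Y by (rule Y)
 let ?h = "\<lambda>x\<in> car (regular A). x"
 have h: "?h : Hom A (regular A) (regular A)" by (rule HomI[OF rA hom_id])
 let ?l = "%u. b (u \<one>\<^sub>A) ?h"
 have u1: "u \<one>\<^sub>A : car Y" if "u : car (HK A (regular A) Y)" for u
  using that hom_closed[OF HomD, of u A "regular A" Y "\<one>\<^sub>A"] by simp
 have l: "is_hom (Ka K) (HK A (regular A) Y) (regular (Ka K)) ?l"
 proof (rule is_homI)
  fix u assume u: "u : car (HK A (regular A) Y)"
  show "?l u : car (regular (Ka K))" using bD(1)[OF u1[OF u] h] by simp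
  show "?l (c \<odot>\<^sub>(HK A (regular A) Y) u) = c \<odot>\<^sub>(regular (Ka K)) ?l u" if "c : car (Ka K)" for c
   using that bD(1)[OF u1[OF u] h] bD(4)[OF u1[OF u] h kap_closed, of c] bD(5)[OF u1[OF u] h, of c] by (simp add: K.m_comm)
  show "?l (u \<oplus>\<^sub>(HK A (regular A) Y) v) = ?l u \<oplus>\<^sub>(regular (Ka K)) ?l v" if "v : car (HK A (regular A) Y)" for v
   using bD(2)[OF u1[OF u] h u1[OF that]] by simp
 qed
 have "?l (tens (regular A) Y m k) = b m k" if m: "m : car Y" and k: "k : Hom A (regular A) (regular A)" for m k
 proof -
  have k1: "k \<one>\<^sub>A : car A" using hom_closed[OF HomD[OF k]] by simp
  have kx: "k x = k \<one>\<^sub>A \<otimes>\<^sub>A x" if "x : car A" for x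
   using hom_act[OF HomD[OF k] that, of "\<one>\<^sub>A"] that by simp
  have "(\<lambda>x\<in> car (regular A). k \<one>\<^sub>A \<otimes>\<^sub>A ?h x) = (\<lambda>x\<in> car (regular A). k x)"
   by (rule restrict_ext) (simp flip: kx)
  thus ?thesis using bD(4)[OF m h k1] Hom_restrict_self[OF k] by (simp add: tens_def)
 qed
 thus "EX l. is_hom (Ka K) (HK A (regular A) Y) (regular (Ka K)) l &
  (ALL m: car Y. ALL h:Hom A (regular A) (regular A). l (tens (regular A) Y m h) = b m h)" using l by blast
qed

lemma tens_dual_pull:
 assumes P: "right_module A P" and P': "right_module A P'" and Y: "right_module A Y" and s: "is_hom A P' P s"
  and t: "tens_dual P' Y" and b: "balanced P Y b" and q: "is_hom A P P' q"
 obtains l where "is_hom (Ka K) (HK A P Y) (regular (Ka K)) l"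
  "!!m h. m : car Y ==> h : Hom A P (regular A) ==> l (tens P Y m h) = b m (\<lambda>x\<in> car P. h (s (q x)))"
proof -
 let ?q = "%k. \<lambda>x\<in> car P. k (q x)" and ?b = "%m k. b m (\<lambda>x\<in> car P. k (q x))"
 have qH: "?q k : Hom A P (regular A)" if "k : Hom A P' (regular A)" for k by (rule HomI[OF P hom_comp[OF q HomD[OF that]]])
 have qa: "?q (h \<oplus>\<^sub>(A_dual A P') k) = ?q h \<oplus>\<^sub>(A_dual A P) ?q k" "?q (a \<odot>\<^sub>(A_dual A P') h) = a \<odot>\<^sub>(A_dual A P) ?q h" for h k a
  using hom_closed[OF q] by (auto simp: fun_eq_iff)
 have "balanced P' Y ?b" unfolding balanced_def qa using qH balancedD[OF b] by (simp del: A_dual_simps)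
 then obtain l' where l': "is_hom (Ka K) (HK A P' Y) (regular (Ka K)) l'"
  "!!m h. m : car Y ==> h : Hom A P' (regular A) ==> l' (tens P' Y m h) = ?b m h"
  using t unfolding tens_dual_def by blast
 show thesis
 proof (rule that[OF hom_comp[OF HK_hom_pre[OF P' P Y s] l'(1)]])
  fix m h assume m: "m : car Y" and h: "h : Hom A P (regular A)"
  let ?k = "\<lambda>x\<in> car P'. h (s x)"
  have k: "?k : Hom A P' (regular A)" by (rule HomI[OF P' hom_comp[OF s HomD[OF h]]])
  have "?q ?k = (\<lambda>x\<in> car P. h (s (q x)))" by (rule restrict_ext) (simp add: hom_closed[OF q])
  thus "l' (\<lambda>x\<in> car P'. tens P Y m h (s x)) = b m (\<lambda>x\<in> car P. h (s (q x)))"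
   unfolding tens_comp[OF s] l'(2)[OF m k] by simp
 qed
qed

lemma tens_dual_retract:
 assumes P: "right_module A P" and P': "right_module A P'" and Y: "right_module A Y"
  and r: "retract A P P'" and t: "tens_dual P' Y"
 shows "tens_dual P Y"
 unfolding tens_dual_def
proof (intro allI impI)
 fix b assume b: "balanced P Y b"
 obtain s q where sq: "is_hom A P P' s" "is_hom A P' P q" "!!x. x : car P ==> q (s x) = x"
  using r unfolding retract_def by auto
 obtain l where l: "is_hom (Ka K) (HK A P Y) (regular (Ka K)) l"
  "!!m h. m : car Y ==> h : Hom A P (regular A) ==> l (tens P Y m h) = b m (\<lambda>x\<in> car P. h (q (s x)))"
  using tens_dual_pull[OF P P' Y sq(2) t b sq(1)] by blast
 have "(\<lambda>x\<in> car P. h (q (s x))) = h" if "h : Hom A P (regular A)" for h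
  using Hom_restrict_self[OF that] sq(3) by (metis (no_types, lifting) restrict_ext)
 thus "EX l. is_hom (Ka K) (HK A P Y) (regular (Ka K)) l & (ALL m: car Y. ALL h:Hom A P (regular A). l (tens P Y m h) = b m h)"
  using l by (intro exI[of _ l]) simp
qed

lemma tens_dual_biprod:
 assumes D: "right_module A D" and V: "right_module A V" and W: "right_module A W" and Y: "right_module A Y"
  and b: "biprod A D V W i j p q" and t: "tens_dual V Y" "tens_dual W Y"
 shows "tens_dual D Y"
 unfolding tens_dual_def
proof (intro allI impI)
 fix \<beta> assume be: "balanced D Y \<beta>"
 note bd = biprodD[OF b]
 obtain l where l: "is_hom (Ka K) (HK A D Y) (regular (Ka K)) l"
  "!!m h. m : car Y ==> h : Hom A D (regular A) ==> l (tens D Y m h) = \<beta> m (\<lambda>x\<in> car D. h (i (p x)))"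
  using tens_dual_pull[OF D V Y bd(1) t(1) be bd(3)] by blast
 obtain l' where l': "is_hom (Ka K) (HK A D Y) (regular (Ka K)) l'"
  "!!m h. m : car Y ==> h : Hom A D (regular A) ==> l' (tens D Y m h) = \<beta> m (\<lambda>x\<in> car D. h (j (q x)))"
  using tens_dual_pull[OF D W Y bd(2) t(2) be bd(4)] by blast
 have rK: "right_module (Ka K) (regular (Ka K))" by (rule right_module_regular[OF ring_Ka])
 let ?l = "%u. l u \<oplus>\<^sub>(regular (Ka K)) l' u"
 have "?l (tens D Y m h) = \<beta> m h" if m: "m : car Y" and h: "h : Hom A D (regular A)" for m h
 proof -
  let ?a = "\<lambda>x\<in> car D. h (i (p x))" and ?c = "\<lambda>x\<in> car D. h (j (q x))"
  have ac: "?a : Hom A D (regular A)" "?c : Hom A D (regular A)"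
   by (rule HomI[OF D hom_comp[OF bd(3) hom_comp[OF bd(1) HomD[OF h]]]], rule HomI[OF D hom_comp[OF bd(4) hom_comp[OF bd(2) HomD[OF h]]]])
  have "h (i (p x)) \<oplus>\<^sub>A h (j (q x)) = h x" if x: "x : car D" for x
   using hom_add[OF HomD[OF h], of "i (p x)" "j (q x)"] bd(9)[OF x] x
    hom_closed[OF bd(1)] hom_closed[OF bd(2)] hom_closed[OF bd(3)] hom_closed[OF bd(4)] by simp
  hence "?a \<oplus>\<^sub>(A_dual A D) ?c = (\<lambda>x\<in> car D. h x)" by (auto simp: fun_eq_iff)
  hence "?a \<oplus>\<^sub>(A_dual A D) ?c = h" using Hom_restrict_self[OF h] by simp
  thus ?thesis using balancedD(3)[OF be m ac] l(2)[OF m h] l'(2)[OF m h] by simp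
 qed
 thus "EX l. is_hom (Ka K) (HK A D Y) (regular (Ka K)) l & (ALL m: car Y. ALL h:Hom A D (regular A). l (tens D Y m h) = \<beta> m h)"
  using hom_plus[OF rK l(1) l'(1)] by (intro exI[of _ ?l]) blast
qed

text \<open>Both properties hold for the regular module and pass to direct sums and retracts, hence
  hold for all projectives by \<open>projective_induct\<close>.\<close>

lemma tens_projective:
 fixes P :: "('k, 'a) fmod" and Y :: "('a, 'w) module"
 assumes P: "projective A P" and Y: "right_module A Y"
 shows "tens_span P Y" "tens_dual P Y"
proof -
 note rA = right_module_regular[OF ring_A]
 have "tens_span P Y & tens_dual P Y"
 proof (rule projective_induct[OF P])
  fix Z :: "('k, 'a) fmod" assume Z: "Z : fmods A" "car Z = {\<zero>\<^sub>Z}"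
  have "retract A Z (regular A)"
   unfolding retract_def using hom_zero_fun[OF rA] hom_zero_fun[OF fmD(2)[OF Z(1)]] Z(2)
   by (intro exI[of _ "%_. \<zero>\<^sub>(regular A)"] exI[of _ "%_. \<zero>\<^sub>Z"]) auto
  thus "tens_span Z Y & tens_dual Z Y"
   using tens_span_retract[OF fmD(2)[OF Z(1)] rA Y] tens_dual_retract[OF fmD(2)[OF Z(1)] rA Y]
    tens_span_regular[OF Y] tens_dual_regular[OF Y] by blast
 next
  fix R :: "('k, 'a) fmod" assume R: "projective A R" "mod_iso A (regular A) R"
  thus "tens_span R Y & tens_dual R Y"
   using tens_span_retract[OF projD(3)[OF R(1)] rA Y] tens_dual_retract[OF projD(3)[OF R(1)] rA Y]
    tens_span_regular[OF Y] tens_dual_regular[OF Y] mod_iso_retract(2)[OF rA R(2)] by blast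
 next
  fix D V W :: "('k, 'a) fmod" and i j p q
  assume "tens_span V Y & tens_dual V Y" "tens_span W Y & tens_dual W Y" "V : fmods A" "W : fmods A" "D : fmods A" "biprod A D V W i j p q"
  thus "tens_span D Y & tens_dual D Y"
   using tens_span_biprod[OF fmD(2) fmD(2) fmD(2) Y] tens_dual_biprod[OF fmD(2) fmD(2) fmD(2) Y] by blast
 next
  fix V W :: "('k, 'a) fmod"
  assume "tens_span W Y & tens_dual W Y" "V : fmods A" "W : fmods A" "retract A V W"
  thus "tens_span V Y & tens_dual V Y"
   using tens_span_retract[OF fmD(2) fmD(2) Y] tens_dual_retract[OF fmD(2) fmD(2) Y] by blast
 qed
 thus "tens_span P Y" "tens_dual P Y" by auto
qed

end

context fd_algebra
begin

lemma kernel_superfluous_iff: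
 assumes P: "P : fmods A" and M: "M : fmods A" and p: "is_hom A P M p" "p ` car P = car M" and N: "submodule N A P"
 shows "N <+>\<^sub>P a_kernel P M p = car P \<longleftrightarrow> p ` N = car M"
proof -
 interpret P: right_module A P by (rule fmD(2)[OF P])
 interpret MM: right_module A M by (rule fmD(2)[OF M])
 note Nd = P.submoduleD[OF N] and pc = hom_closed[OF p(1)]
 show ?thesis
 proof
  assume e: "N <+>\<^sub>P a_kernel P M p = car P"
  show "p ` N = car M"
  proof
   show "p ` N <= car M" using Nd(1) pc by auto
   show "car M <= p ` N"
   proof
    fix y assume "y : car M"
    then obtain x where x: "x : car P" "y = p x" using p(2) by blast
    hence "x : N <+>\<^sub>P a_kernel P M p" using e by simp
    then obtain n k where "n : N" "k : car P" "p k = \<zero>\<^sub>M" "x = n \<oplus>\<^sub>P k"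
     unfolding P.set_add_eq a_kernel_eq by auto
    thus "y : p ` N" using x(2) Nd(1) pc by (auto simp: hom_add[OF p(1)] subset_iff)
   qed
  qed
 next
  assume e: "p ` N = car M"
  show "N <+>\<^sub>P a_kernel P M p = car P"
  proof
   show "N <+>\<^sub>P a_kernel P M p <= car P" using Nd(1) by (auto simp: P.set_add_eq a_kernel_eq)
   show "car P <= N <+>\<^sub>P a_kernel P M p"
   proof
    fix x assume x: "x : car P"
    hence "p x : p ` N" using e pc by simp
    then obtain n where n: "n : N" "p x = p n" by auto
    have nc: "n : car P" using n(1) Nd(1) by auto
    have "p (x \<ominus>\<^sub>P n) = \<zero>\<^sub>M"
     using x nc n(2) pc by (simp add: hom_diff[OF P.right_module_axioms MM.right_module_axioms p(1)] MM.diff_eq_zero)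
    hence "x \<ominus>\<^sub>P n : a_kernel P M p" using x nc by (simp add: a_kernel_eq)
    moreover have "x = n \<oplus>\<^sub>P (x \<ominus>\<^sub>P n)" using x nc by (simp add: P.add_diff_cancel)
    ultimately show "x : N <+>\<^sub>P a_kernel P M p" unfolding P.set_add_eq using n(1) by blast
   qed
  qed
 qed
qed

lemma projective_cover_pcov: "M : fmods A ==> projective_cover A P p M ==> pcov A P p M"
 unfolding projective_cover_def pcov_def using kernel_superfluous_iff projD(1) HomD by metis

lemma pcov_projective_cover:
 assumes M: "M : fmods A" and c: "pcov A P p M" shows "projective_cover A P (restrict p (car P)) M"
proof -
 note d = pcovD[OF c]
 have r: "restrict p (car P) : Hom A P M" by (rule HomI[OF projD(3)[OF d(1)] d(2)])
 have im: "restrict p (car P) ` car P = car M" using d(3) by simp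
 have "N = car P" if "submodule N A P" "N <+>\<^sub>P a_kernel P M (restrict p (car P)) = car P" for N
 proof -
  have "N <= car P" using right_module.submoduleD(1)[OF projD(3)[OF d(1)] that(1)] .
  hence "restrict p (car P) ` N = p ` N" by (auto simp: subset_iff)
  thus ?thesis
   using kernel_superfluous_iff[OF projD(1)[OF d(1)] M HomD[OF r] im that(1)] that(2) d(4)[OF that(1)] by simp
 qed
 thus ?thesis unfolding projective_cover_def using d(1) r im by blast
qed

lemma min_proj_presentation_mpres:
 assumes M: "M : fmods A" and m: "min_proj_presentation A P1 f P0 p M" shows "mpres A P1 f P0 p M"
proof -
 have 0: "pcov A P0 p M" using m projective_cover_pcov[OF M] by (simp add: min_proj_presentation_def)
 thus ?thesis
  using m projective_cover_pcov[OF fmods_kernel(2)[OF projD(1)[OF pcovD(1)[OF 0]] M pcovD(2)[OF 0]]]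
  by (simp add: min_proj_presentation_def mpres_def)
qed

lemma min_proj_presentation_exists:
 assumes M: "M : fmods A"
 obtains P1 f P0 p where "min_proj_presentation A P1 f P0 p M"
proof -
 obtain P1 f P0 p where m: "mpres A P1 f P0 p M" by (rule mpres_exists[OF M])
 have c: "pcov A P0 p M" "pcov A P1 f (restr P0 (a_kernel P0 M p))" using m by (auto simp: mpres_def)
 have k: "a_kernel P0 M (restrict p (car P0)) = a_kernel P0 M p" by (auto simp: a_kernel_eq)
 have "projective_cover A P1 (restrict f (car P1)) (restr P0 (a_kernel P0 M p))"
  by (rule pcov_projective_cover[OF fmods_kernel(2)[OF projD(1)[OF pcovD(1)[OF c(1)]] M pcovD(2)[OF c(1)]] c(2)])
 thus thesis using that[of P1 "restrict f (car P1)" P0 "restrict p (car P0)"] pcov_projective_cover[OF M c(1)] k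
  by (simp add: min_proj_presentation_def)
qed

text \<open>A homomorphism Y -> D Tr M is a balanced form on Y and Hom(P1,A) that vanishes on the
  image of Hom(P0,A). By \<open>tens_projective\<close> this is a functional on Hom(P1,Y) vanishing
  on the image of Hom(P0,Y). So nonzero homomorphisms exist exactly when Hom(P0,Y) -> Hom(P1,Y) is
  not onto.\<close>

theorem tau_hom_zero_iff:
 fixes M :: "('k, 'a) fmod"
 assumes M: "M : fmods A" and fY: "fdm K A Y"
 shows "Hom_zero A Y (tau K A M) \<longleftrightarrow> ext0 A M Y"
proof -
 note Y = fdmD(1)[OF fY]
 interpret Y: right_module A Y by (rule Y)
 \<comment> \<open>The very presentation selected inside \<open>Tr\<close>; since
   \<open>ext0\<close> may be tested on any minimal presentation, it is tested on this one.\<close>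
 let ?S = "SOME (P1, f, P0, p). min_proj_presentation A P1 f P0 p M"
 obtain P1 f P0 p where S: "?S = (P1, f, P0, p)" by (metis prod_cases4)
 have "EX z. case z of (P1, f, P0, p) => min_proj_presentation A P1 f P0 p M"
  using min_proj_presentation_exists[OF M] by (metis (mono_tags, lifting) case_prod_conv)
 from someI_ex[OF this] have "min_proj_presentation A P1 f P0 p M" unfolding S by simp
 hence m: "mpres A P1 f P0 p M" by (rule min_proj_presentation_mpres[OF M])
 note pd = presD[OF mpres_pres[OF M m]]
 note r1 = projD(3)[OF pd(1)] and r0 = projD(3)[OF pd(2)]
 let ?D = "A_dual A P1" and ?E = "A_dual A P0"
 let ?pre = "%k. \<lambda>x\<in> car P1. k (f x)"
 define I where "I = ?pre ` car ?E"
 have "(%h. compose (car P1) h f) ` car ?E = I" by (simp add: I_def compose_def)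
 hence Tr: "Tr A M = quot_module ?D I" unfolding Tr_def S by simp
 define V where "V = quot_module ?D I"
 note D = right_module_A_dual[OF r1] and D0 = right_module_A_dual[OF r0]
 interpret D: right_module "opp A" ?D by (rule D)
 interpret D0: right_module "opp A" ?E by (rule D0)
 have Is: "submodule I (opp A) ?D" unfolding I_def by (rule submodule_image[OF D0 D A_dual_map[OF r1 r0 pd(3)] D0.submodule_carrier])
 define c where "c = (%x. I +>\<^sub>?D x)"
 have q: "right_module (opp A) V" "is_hom (opp A) ?D V c" "car V = c ` car ?D" "a_kernel ?D V c = I"
  using D.quot_module_right_module[OF Is] by (simp_all only: V_def c_def)
 interpret V: right_module "opp A" V by (rule q(1))
 have tau: "tau K A M = K_dual K (opp A) V" by (simp add: tau_def Tr V_def)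
 have Vc: "a \<odot>\<^sub>V Z : car V" if "a : car A" "Z : car V" for a Z using V.act_closed that by simp
 have zh: "is_hom A Y (tau K A M) (%_. \<zero>\<^sub>(tau K A M))"
  by (rule is_homI) (auto simp: tau K_dual_carrier fun_eq_iff Vc)
 have cI: "c k = \<zero>\<^sub>V" "k : car ?D" if "k : I" for k using q(4) that by (auto simp: a_kernel_eq)
 have kc: "a \<odot>\<^sub>A \<one>\<^sub>A : car A" if "a : car K" for a using that by simp
 show "Hom_zero A Y (tau K A M) \<longleftrightarrow> ext0 A M Y"
  unfolding Hom_zero_iff[OF Y zh] ext0_iff[OF M m]
 proof
  assume e: "extl A P1 f P0 Y"
  show "ALL \<phi>. is_hom A Y (tau K A M) \<phi> --> (ALL x: car Y. \<phi> x = \<zero>\<^sub>(tau K A M))"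
  proof (intro allI impI ballI)
   fix \<phi> m' assume ph: "is_hom A Y (tau K A M) \<phi>" and m': "m' : car Y"
   have phd: "\<phi> m : car (K_dual K (opp A) V)" if "m : car Y" for m
    using hom_closed[OF ph that] by (simp add: tau)
   note pd' = phd[unfolded K_dual_carrier]
   let ?b = "%m k. \<phi> m (c k)"
   have cV: "c h : car V" if "h : car ?D" for h using q(3) that by simp
   \<comment> \<open>\<phi> read as a form on Y and Hom(P1,A), through the projection c onto the
     transpose.\<close>
   have "balanced P1 Y ?b" unfolding balanced_def A_dual_simps(1)[symmetric]
   proof (intro ballI conjI)
    fix m h assume mh: "m : car Y" "h : car ?D"
    show "\<phi> m (c h) : car K" using pd'[OF mh(1)] cV[OF mh(2)] by blast
    show "\<phi> (m \<oplus>\<^sub>Y m') (c h) = \<phi> m (c h) \<oplus>\<^sub>K \<phi> m' (c h)" if "m' : car Y" for m'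
     using hom_add[OF ph mh(1) that] cV[OF mh(2)] by (simp add: tau)
    show "\<phi> m (c (h \<oplus>\<^sub>?D k)) = \<phi> m (c h) \<oplus>\<^sub>K \<phi> m (c k)" if "k : car ?D" for k
     unfolding hom_add[OF q(2) mh(2) that] using pd'[OF mh(1)] cV mh(2) that by blast
    show "\<phi> (a \<odot>\<^sub>Y m) (c h) = \<phi> m (c (a \<odot>\<^sub>?D h))" if "a : car A" for a
     using hom_act[OF ph that mh(1)] hom_act[OF q(2) _ mh(2), of a] cV[OF mh(2)] that by (simp add: tau del: A_dual_simps)
    show "\<phi> m (c ((a \<odot>\<^sub>A \<one>\<^sub>A) \<odot>\<^sub>?D h)) = a \<otimes>\<^sub>K \<phi> m (c h)" if "a : car K" for a
     using hom_act[OF q(2) _ mh(2), of "a \<odot>\<^sub>A \<one>\<^sub>A"] pd'[OF mh(1)] cV[OF mh(2)] that kc by (simp del: A_dual_simps)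
   qed
   then obtain l where l: "is_hom (Ka K) (HK A P1 Y) (regular (Ka K)) l"
    "!!m h. m : car Y ==> h : Hom A P1 (regular A) ==> l (tens P1 Y m h) = ?b m h"
    using tens_projective(2)[OF pd(1) Y] unfolding tens_dual_def by blast
   have ph0: "\<phi> m \<zero>\<^sub>V = \<zero>\<^sub>K" if "m : car Y" for m
   proof -
    have "\<phi> m ((\<zero>\<^sub>K \<odot>\<^sub>(opp A) \<one>\<^sub>(opp A)) \<odot>\<^sub>V \<zero>\<^sub>V) = \<zero>\<^sub>K \<otimes>\<^sub>K \<phi> m \<zero>\<^sub>V" "\<phi> m \<zero>\<^sub>V : car K"
     using pd'[OF that] by blast+
    thus ?thesis using V.act_zero_right[of "\<zero>\<^sub>K \<odot>\<^sub>A \<one>\<^sub>A"] kc by simp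
   qed
   let ?l = "%v. l (\<lambda>x\<in> car P1. v (f x))"
   have l': "is_hom (Ka K) (HK A P0 Y) (regular (Ka K)) ?l" by (rule hom_comp[OF HK_hom_pre[OF r1 r0 Y pd(3)] l(1)])
   \<comment> \<open>An elementary map on P0 restricts along f to an elementary map built from an
     element of the image \<open>I\<close>, and c kills \<open>I\<close>.\<close>
   have "?l (tens P0 Y m k) = \<zero>\<^sub>K" if mk: "m : car Y" "k : Hom A P0 (regular A)" for m k
   proof -
    have kI: "?pre k : I" unfolding I_def using mk(2) by simp
    hence "?pre k : Hom A P1 (regular A)" using cI(2) by simp
    thus ?thesis unfolding tens_comp[OF pd(3)] using l(2)[OF mk(1)] cI(1)[OF kI] ph0[OF mk(1)] by simp
   qed
   hence z: "ALL v:Hom A P0 Y. ?l v = \<zero>\<^sub>K" using tens_projective(1)[OF pd(2) Y] l' unfolding tens_span_def by blast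
   have bz: "\<phi> m' (c h) = \<zero>\<^sub>K" if h: "h : Hom A P1 (regular A)" for h
   proof -
    have T: "tens P1 Y m' h : Hom A P1 Y" by (rule tens_Hom[OF r1 Y m' h])
    obtain v where v: "is_hom A P0 Y v" "ALL x: car P1. v (f x) = tens P1 Y m' h x"
     using e HomD[OF T] unfolding extl_def by blast
    let ?v = "restrict v (car P0)"
    have "(\<lambda>x\<in> car P1. ?v (f x)) = (\<lambda>x\<in> car P1. tens P1 Y m' h x)"
     by (rule restrict_ext) (use v(2) hom_closed[OF pd(3)] in simp)
    hence "l (tens P1 Y m' h) = ?l ?v" using Hom_restrict_self[OF T] by simp
    also have "... = \<zero>\<^sub>K" using z HomI[OF r0 v(1)] by blast
    finally show ?thesis using l(2)[OF m' h] h by simp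
   qed
   have "\<phi> m' Z = (\<lambda>x\<in> car V. \<zero>\<^sub>K) Z" for Z
   proof (cases "Z : car V")
    case True
    then obtain h where "h : Hom A P1 (regular A)" "Z = c h" using q(3) by auto
    thus ?thesis using bz True by simp
   next
    case False
    thus ?thesis using phd[OF m'] by (auto simp: K_dual_carrier PiE_iff extensional_def)
   qed
   thus "\<phi> m' = \<zero>\<^sub>(tau K A M)" by (auto simp: tau fun_eq_iff)
  qed
 next
  assume h0: "ALL \<phi>. is_hom A Y (tau K A M) \<phi> --> (ALL x: car Y. \<phi> x = \<zero>\<^sub>(tau K A M))"
  note H1 = right_module_HK[OF r1 Y] and H0 = right_module_HK[OF r0 Y]
  interpret H1: right_module "Ka K" "HK A P1 Y" by (rule H1)
  interpret H0: right_module "Ka K" "HK A P0 Y" by (rule H0)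
  have J: "submodule (?pre ` car (HK A P0 Y)) (Ka K) (HK A P1 Y)"
   by (rule submodule_image[OF H0 H1 HK_hom_pre[OF r1 r0 Y pd(3)] H0.submodule_carrier])
  show "extl A P1 f P0 Y"
  proof (rule ccontr)
   assume ne: "~ extl A P1 f P0 Y"
   have "?pre ` car (HK A P0 Y) ~= car (HK A P1 Y)"
   proof
    assume s: "?pre ` car (HK A P0 Y) = car (HK A P1 Y)"
    have "EX v. is_hom A P0 Y v & (ALL x: car P1. v (f x) = u x)" if u: "is_hom A P1 Y u" for u
    proof -
     have "restrict u (car P1) : ?pre ` car (HK A P0 Y)" using s HomI[OF r1 u] by simp
     then obtain v where v: "v : Hom A P0 Y" "restrict u (car P1) = ?pre v" by auto
     have "v (f x) = u x" if "x : car P1" for x using fun_cong[OF v(2), of x] that by simp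
     thus ?thesis using HomD[OF v(1)] by blast
    qed
    thus False using ne unfolding extl_def by blast
   qed
   then obtain l u where l: "is_hom (Ka K) (HK A P1 Y) (regular (Ka K)) l"
    "!!x. x : ?pre ` car (HK A P0 Y) ==> l x = \<zero>\<^sub>K" "u : car (HK A P1 Y)" "l u = \<one>\<^sub>K"
    by (rule functional_exists[OF H1 flen_HK[OF projD(2)[OF pd(1)] fY] J]) (rule that, assumption, blast, assumption+)
   have lu: "l u ~= \<zero>\<^sub>K" unfolding l(4) by (rule K.one_not_zero)
   have "~ (ALL m: car Y. ALL h:Hom A P1 (regular A). l (tens P1 Y m h) = \<zero>\<^sub>K)"
    using tens_projective(1)[OF pd(1) Y] l(1,3) lu unfolding tens_span_def HK_simps by blast
   then obtain m0 k0 where mk: "m0 : car Y" "k0 : Hom A P1 (regular A)" "l (tens P1 Y m0 k0) ~= \<zero>\<^sub>K"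
    by blast
   \<comment> \<open>The form belonging to l. It vanishes on \<open>I\<close> by the choice of l,
     hence descends to the transpose and yields a nonzero homomorphism into the translate.\<close>
   define g where "g = (%m h. l (tens P1 Y m h))"
   note TH = tens_Hom[OF r1 Y]
   have hc: "h x : car A" if "h : Hom A P1 (regular A)" "x : car P1" for h x
    using hom_closed[OF HomD[OF that(1)] that(2)] by simp
   have gc: "g m h : car K" if "m : car Y" "h : Hom A P1 (regular A)" for m h
    unfolding g_def using hom_closed[OF l(1)] TH[OF that] by simp
   have g1: "g m (h \<oplus>\<^sub>?D k) = g m h \<oplus>\<^sub>K g m k"
    if "m : car Y" "h : Hom A P1 (regular A)" "k : Hom A P1 (regular A)" for m h k
   proof -
    have "tens P1 Y m (h \<oplus>\<^sub>?D k) = tens P1 Y m h \<oplus>\<^sub>(HK A P1 Y) tens P1 Y m k"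
     using that hc by (auto simp: tens_def fun_eq_iff Y.act_add_left)
    thus ?thesis unfolding g_def using hom_add[OF l(1)] TH that by simp
   qed
   have g2: "g (m \<oplus>\<^sub>Y m') h = g m h \<oplus>\<^sub>K g m' h"
    if "m : car Y" "m' : car Y" "h : Hom A P1 (regular A)" for m m' h
   proof -
    have "tens P1 Y (m \<oplus>\<^sub>Y m') h = tens P1 Y m h \<oplus>\<^sub>(HK A P1 Y) tens P1 Y m' h"
     using that hc by (auto simp: tens_def fun_eq_iff Y.act_add_right)
    thus ?thesis unfolding g_def using hom_add[OF l(1)] TH that by simp
   qed
   have g3: "g (a \<odot>\<^sub>Y m) h = g m (a \<odot>\<^sub>?D h)"
    if "m : car Y" "a : car A" "h : Hom A P1 (regular A)" for m a h
   proof -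
    have "tens P1 Y (a \<odot>\<^sub>Y m) h = tens P1 Y m (a \<odot>\<^sub>?D h)"
     using that hc by (auto simp: tens_def fun_eq_iff Y.act_mult)
    thus ?thesis unfolding g_def by simp
   qed
   have g4: "g m ((a \<odot>\<^sub>A \<one>\<^sub>A) \<odot>\<^sub>?D h) = a \<otimes>\<^sub>K g m h"
    if "m : car Y" "a : car K" "h : Hom A P1 (regular A)" for m a h
   proof -
    have "((a \<odot>\<^sub>A \<one>\<^sub>A) \<otimes>\<^sub>A h x) \<odot>\<^sub>Y m = (a \<odot>\<^sub>A \<one>\<^sub>A) \<odot>\<^sub>Y (h x \<odot>\<^sub>Y m)" if x: "x : car P1" for x
     using Y.act_mult[of "h x" "a \<odot>\<^sub>A \<one>\<^sub>A" m] hc[OF \<open>h : Hom A P1 (regular A)\<close> x] \<open>m : car Y\<close> kc \<open>a : car K\<close>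
     by (simp add: kap_left kap_right)
    hence "tens P1 Y m ((a \<odot>\<^sub>A \<one>\<^sub>A) \<odot>\<^sub>?D h) = a \<odot>\<^sub>(HK A P1 Y) tens P1 Y m h"
     by (auto simp: tens_def fun_eq_iff)
    hence "g m ((a \<odot>\<^sub>A \<one>\<^sub>A) \<odot>\<^sub>?D h) = g m h \<otimes>\<^sub>K a"
     unfolding g_def using hom_act[OF l(1), of a "tens P1 Y m h"] TH that by simp
    thus ?thesis using gc that by (simp add: K.m_comm)
   qed
   have g0: "g m k = \<zero>\<^sub>K" if mm: "m : car Y" and kI: "k : I" for m k
   proof -
    obtain k' where k': "k' : Hom A P0 (regular A)" "k = ?pre k'" using kI by (auto simp: I_def)
    have "tens P1 Y m k = ?pre (tens P0 Y m k')" unfolding k'(2) tens_comp[OF pd(3)] by simp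
    thus ?thesis unfolding g_def using l(2) tens_Hom[OF r0 Y mm k'(1)] by simp
   qed
   \<comment> \<open>Representatives of the cosets; \<open>gr\<close> shows that g does not see the
     choice.\<close>
   define \<rho> where "\<rho> = inv_into (car ?D) c"
   have rho: "\<rho> Z : Hom A P1 (regular A)" "c (\<rho> Z) = Z" if "Z : car V" for Z
    using that q(3) inv_into_into[of Z c "car ?D"] f_inv_into_f[of Z c "car ?D"] by (auto simp: \<rho>_def)
   have gr: "g m (\<rho> (c h)) = g m h" if mm: "m : car Y" and h: "h : Hom A P1 (regular A)" for m h
   proof -
    have cV: "c h : car V" using q(3) h by auto
    let ?r = "\<rho> (c h)"
    have r: "?r : car ?D" "h : car ?D" using rho(1)[OF cV] h by auto
    have "?r \<ominus>\<^sub>?D h : a_kernel ?D V c"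
     using r rho(2)[OF cV] cV by (simp add: a_kernel_eq hom_diff[OF D q(1,2)] V.diff_eq_zero del: A_dual_simps)
    hence "?r \<ominus>\<^sub>?D h : I" using q(4) by simp
    hence "g m (h \<oplus>\<^sub>?D (?r \<ominus>\<^sub>?D h)) = g m h \<oplus>\<^sub>K \<zero>\<^sub>K"
     using g1[OF mm h] g0[OF mm] cI(2) by (simp del: A_dual_simps(2,3,4))
    thus ?thesis using D.add_diff_cancel[OF r] gc[OF mm h] by (simp del: A_dual_simps)
   qed
   define \<phi> where "\<phi> = (%m. \<lambda>Z\<in> car V. g m (\<rho> Z))"
   have phc: "\<phi> m (c h) = g m h" if "m : car Y" "h : Hom A P1 (regular A)" for m h
    using that gr q(3) by (auto simp: \<phi>_def)
   have Dadd: "h \<oplus>\<^sub>?D k : Hom A P1 (regular A)" if "h : Hom A P1 (regular A)" "k : Hom A P1 (regular A)" for h k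
    using D.M.a_closed[of h k] that by simp
   have Dact: "a \<odot>\<^sub>?D h : Hom A P1 (regular A)" if "a : car A" "h : Hom A P1 (regular A)" for a h
    using D.act_closed[of a h] that by simp
   have ch: "EX h. h : Hom A P1 (regular A) & Z = c h" if "Z : car V" for Z using that q(3) by auto
   have phK: "\<phi> m : car (K_dual K (opp A) V)" if mm: "m : car Y" for m
    unfolding K_dual_carrier
   proof (intro conjI ballI)
    show "\<phi> m : car V \<rightarrow>\<^sub>E car K" using gc[OF mm] rho by (auto simp: \<phi>_def)
    fix Z assume "Z : car V"
    then obtain h where h: "h : Hom A P1 (regular A)" "Z = c h" using ch by blast
    { fix Z' assume "Z' : car V"
     then obtain k where k: "k : Hom A P1 (regular A)" "Z' = c k" using ch by blast
     have "Z \<oplus>\<^sub>V Z' = c (h \<oplus>\<^sub>?D k)" using hom_add[OF q(2), of h k] h k by (simp del: A_dual_simps(3))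
     thus "\<phi> m (Z \<oplus>\<^sub>V Z') = \<phi> m Z \<oplus>\<^sub>K \<phi> m Z'"
      using phc[OF mm] Dadd h k g1[OF mm] by (simp del: A_dual_simps(3)) }
    fix a assume a: "a : car K"
    have "(a \<odot>\<^sub>A \<one>\<^sub>A) \<odot>\<^sub>V Z = c ((a \<odot>\<^sub>A \<one>\<^sub>A) \<odot>\<^sub>?D h)"
     using hom_act[OF q(2), of "a \<odot>\<^sub>A \<one>\<^sub>A" h] h kc[OF a] by (simp del: A_dual_simps(4))
    thus "\<phi> m ((a \<odot>\<^sub>(opp A) \<one>\<^sub>(opp A)) \<odot>\<^sub>V Z) = a \<otimes>\<^sub>K \<phi> m Z"
     using phc[OF mm] Dact[OF kc[OF a]] h g4[OF mm a] by (simp del: A_dual_simps(4))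
   qed
   have "is_hom A Y (tau K A M) \<phi>" unfolding tau
   proof (rule is_homI[OF phK])
    fix m m' assume mm: "m : car Y" "m' : car Y"
    show "\<phi> (m \<oplus>\<^sub>Y m') = \<phi> m \<oplus>\<^sub>(K_dual K (opp A) V) \<phi> m'"
     using g2[OF mm] rho(1) by (auto simp: \<phi>_def fun_eq_iff)
   next
    fix a m assume am: "a : car A" "m : car Y"
    show "\<phi> (a \<odot>\<^sub>Y m) = a \<odot>\<^sub>(K_dual K (opp A) V) \<phi> m"
    proof (rule ext)
     fix Z show "\<phi> (a \<odot>\<^sub>Y m) Z = (a \<odot>\<^sub>(K_dual K (opp A) V) \<phi> m) Z"
     proof (cases "Z : car V")
      case True
      then obtain h where h: "h : Hom A P1 (regular A)" "Z = c h" using ch by blast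
      have "a \<odot>\<^sub>V Z = c (a \<odot>\<^sub>?D h)" using hom_act[OF q(2), of a h] h am(1) by (simp del: A_dual_simps(4))
      thus ?thesis
       using True phc[OF Y.act_closed[OF am] h(1)] phc[OF am(2) Dact[OF am(1) h(1)]] g3[OF am(2,1) h(1)] h(2)
       by (simp del: A_dual_simps(4))
     qed (simp add: \<phi>_def)
    qed
   qed auto
   hence "\<phi> m0 = \<zero>\<^sub>(tau K A M)" using h0 mk(1) by blast
   hence "\<phi> m0 (c k0) = \<zero>\<^sub>K" using q(3) mk(2) by (auto simp: tau)
   thus False using phc[OF mk(1,2)] mk(3) by (simp add: g_def)
  qed
 qed
qed

lemma tau_rigid_iff: "tau_rigid K A M \<longleftrightarrow> M : fmods A & ext0 A M M"
 unfolding tau_rigid_def using tau_hom_zero_iff fmD(1) by blast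

end

section \<open>Indecomposable summands, basic modules and Krull-Schmidt counting\<close>

definition ind :: "('k, 'a) module => ('a, 'v) module => ('k, 'a) fmod set" where
 "ind A M = {N : fmods A. indecomposable A N & retract A N M}"

definition reps :: "('k, 'a) module => ('a, 'v) module => ('k, 'a) fmod set => bool" where
 "reps A M S \<longleftrightarrow> finite S & S <= ind A M & (ALL N:S. ALL L:S. mod_iso A N L --> N = L) & (ALL N:ind A M. EX L:S. mod_iso A N L)"

lemma card_quotient_eq:
 assumes g: "g ` E = S" and R: "R = {(x, y). x : E & y : E & g x = g y}"
 shows "card (E // R) = card S"
proof -
 have "R `` {x} = {y : E. g y = g x}" if "x : E" for x using that R by auto
 hence "E // R = (%s. {x : E. g x = s}) ` S"
  unfolding quotient_def g[symmetric] by auto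
 moreover have "inj_on (%s. {x : E. g x = s}) S" unfolding inj_on_def g[symmetric] by blast
 ultimately show ?thesis by (simp add: card_image)
qed

lemma iso_imp_retract_eq:
 assumes "right_module A M" "right_module A M'" "mod_iso A M M'"
 shows "retract A N M \<longleftrightarrow> retract A N M'"
 using retract_trans[of A N M M', OF _ mod_iso_retract(1)[OF assms(1,3)]]
  retract_trans[of A N M' M, OF _ mod_iso_retract(2)[OF assms(1,3)]] by blast

context fd_algebra
begin

lemma indD: "N : ind A M ==> N : fmods A" "N : ind A M ==> indecomposable A N" "N : ind A M ==> retract A N M"
 by (auto simp: ind_def)

lemma ind_mono: "retract A M M' ==> ind A M <= ind A M'"
 unfolding ind_def using retract_trans by blast

lemma retract_zero:
 assumes "right_module A N" "right_module A M" "car M = {\<zero>\<^sub>M}" "retract A N M"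
 shows "car N = {\<zero>\<^sub>N}"
proof -
 obtain s t where st: "is_hom A N M s" "is_hom A M N t" "ALL x: car N. t (s x) = x"
  using assms(4) unfolding retract_def by auto
 have "x = \<zero>\<^sub>N" if "x : car N" for x
  using st(3) that hom_closed[OF st(1) that] hom_from_zero[OF assms(2,1,3) st(2)] by metis
 moreover interpret N: right_module A N by fact
 have "\<zero>\<^sub>N : car N" by simp
 ultimately show ?thesis by blast
qed

lemma ind_zero: "right_module A M ==> car M = {\<zero>\<^sub>M} ==> ind A M = {}"
 using retract_zero[OF fmD(2), of _ M] indec_nonzero by (fastforce simp: ind_def)

text \<open>One half of Krull-Schmidt: an indecomposable retract of a sum is a retract of a
  summand.\<close>

lemma ind_biprod:
 assumes D: "right_module A D" and b: "biprod A D V W i j p q"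
 shows "ind A D = ind A V \<union> ind A W"
proof
 show "ind A D <= ind A V \<union> ind A W"
  using indec_retract_biprod[OF fmD(1) _ D b] by (auto simp: ind_def)
 show "ind A V \<union> ind A W <= ind A D"
  using ind_mono[OF biprod_retract(1)[OF b]] ind_mono[OF biprod_retract(2)[OF b]] by blast
qed

lemma ind_indec: "M : fmods A ==> indecomposable A M ==> N : ind A M \<longleftrightarrow> N : fmods A & mod_iso A N M"
proof
 assume M: "M : fmods A" "indecomposable A M" and "N : ind A M"
 thus "N : fmods A & mod_iso A N M"
  using retract_of_indec[OF fmD(2) fmD(2)[OF M(1)] M(2)] indD indec_nonzero by metis
next
 assume M: "M : fmods A" "indecomposable A M" and N: "N : fmods A & mod_iso A N M"
 thus "N : ind A M"
  using indec_iso[OF fmD(2)[OF M(1)] fmD(2)] mod_iso_sym[OF fmD(2) fmD(2)[OF M(1)]] mod_iso_retract(1)[OF fmD(2)]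
  by (auto simp: ind_def)
qed

lemma ind_iso_closed:
 assumes "N : ind A M" "N' : fmods A" "mod_iso A N N'" shows "N' : ind A M"
 using assms indec_iso[OF fmD(2) fmD(2), of N N'] mod_iso_retract(2)[OF fmD(2), of N N'] retract_trans
 by (auto simp: ind_def)

lemma ind_nonempty:
 assumes "fdm K A M" "car M ~= {\<zero>\<^sub>M}" shows "ind A M ~= {}"
 using assms
proof (induction "dm K A M" arbitrary: M rule: less_induct)
 case (less M)
 note rM = fdmD(1)[OF less(2)]
 show ?case
 proof (cases "indecomposable A M")
  case True
  obtain N :: "('k, 'a) fmod" where N: "N : fmods A" "mod_iso A M N" by (rule copy_exists[OF less(2)])
  hence "N : ind A M"
   using indec_iso[OF rM fmD(2)[OF N(1)] N(2) True] mod_iso_retract(2)[OF rM N(2)] by (simp add: ind_def)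
  thus ?thesis by blast
 next
  case False
  obtain N L p q where d: "decomposes A M N L" "biprod A M (restr M N) (restr M L) (%x. x) (%x. x) p q"
   "fdm K A (restr M N)" "fdm K A (restr M L)" "dm K A (restr M N) < dm K A M" "dm K A (restr M L) < dm K A M"
   by (rule decompose_step[OF less(2,3) False])
  have i: "ind A M = ind A (restr M N) \<union> ind A (restr M L)" by (rule ind_biprod[OF rM d(2)])
  show ?thesis
  proof (cases "N = {\<zero>\<^sub>M}")
   case False
   thus ?thesis using less(1)[OF d(5,3)] i by simp
  next
   case True
   have "L ~= {\<zero>\<^sub>M}"
   proof
    assume "L = {\<zero>\<^sub>M}"
    hence "car M = {\<zero>\<^sub>M \<oplus>\<^sub>M \<zero>\<^sub>M}" using True d(1) right_module.set_add_eq[OF rM, of N L] by (auto simp: decomposes_def)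
    moreover interpret MM: right_module A M by (rule rM)
    show False using calculation less(3) by simp
   qed
   thus ?thesis using less(1)[OF d(6,4)] i by simp
  qed
 qed
qed

text \<open>Induction along decompositions. Every module met on the way is a retract of the given
  one, so conditions inherited by retracts stay available in the sum step.\<close>

lemma fmod_induct:
 fixes M :: "('k, 'a) fmod"
 assumes M: "M : fmods A"
  and zero: "!!Z. Z : fmods A ==> car Z = {\<zero>\<^sub>Z} ==> S Z"
  and indec: "!!N. N : ind A M ==> S N"
  and bip: "!!D V W i j p q. D : fmods A ==> V : fmods A ==> W : fmods A ==> biprod A D V W i j p q ==>
   retract A D M ==> retract A V M ==> retract A W M ==> S V ==> S W ==> S D"
 shows "S M"
proof -
 have "S N" if "N : fmods A" "retract A N M" for N
  using that
 proof (induction "dm K A N" arbitrary: N rule: less_induct)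
  case (less N)
  show ?case
  proof (cases "car N = {\<zero>\<^sub>N} | indecomposable A N")
   case True thus ?thesis using zero[OF less(2)] indec[of N] less(2,3) by (auto simp: ind_def)
  next
   case False
   hence nz: "car N ~= {\<zero>\<^sub>N}" "~ indecomposable A N" by auto
   obtain V W p q where d: "decomposes A N V W" "biprod A N (restr N V) (restr N W) (%x. x) (%x. x) p q"
    "fdm K A (restr N V)" "fdm K A (restr N W)" "dm K A (restr N V) < dm K A N" "dm K A (restr N W) < dm K A N"
    by (rule decompose_step[OF fmD(1)[OF less(2)] nz])
   have f: "restr N V : fmods A" "restr N W : fmods A" using d(3,4) fmods_iff by auto
   have r: "retract A (restr N V) M" "retract A (restr N W) M"
    using retract_trans[OF biprod_retract(1)[OF d(2)] less(3)] retract_trans[OF biprod_retract(2)[OF d(2)] less(3)] by auto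
   show ?thesis by (rule bip[OF less(2) f d(2) less(3) r less(1)[OF d(5) f(1) r(1)] less(1)[OF d(6) f(2) r(2)]])
  qed
 qed
 thus ?thesis using M retract_refl by blast
qed

lemma finite_ind_cover:
 assumes "fdm K A M"
 shows "EX S. finite S & S <= ind A M & (ALL N:ind A M. EX L:S. mod_iso A N L)"
 using assms
proof (induction "dm K A M" arbitrary: M rule: less_induct)
 case (less M)
 note rM = fdmD(1)[OF less(2)]
 consider "car M = {\<zero>\<^sub>M}" | "indecomposable A M" | "car M ~= {\<zero>\<^sub>M}" "~ indecomposable A M" by blast
 thus ?case
 proof cases
  case 1 thus ?thesis using ind_zero[OF rM] by (intro exI[of _ "{}"]) auto
 next
  case 2
  obtain N :: "('k, 'a) fmod" where N: "N : fmods A" "mod_iso A M N" by (rule copy_exists[OF less(2)])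
  have iN: "indecomposable A N" by (rule indec_iso[OF rM fmD(2)[OF N(1)] N(2) 2])
  have e: "ind A M = ind A N" using iso_imp_retract_eq[OF rM fmD(2)[OF N(1)] N(2)] by (auto simp: ind_def)
  have "N : ind A N" using N iN retract_refl by (auto simp: ind_def)
  thus ?thesis unfolding e using ind_indec[OF N(1) iN] by (intro exI[of _ "{N}"]) auto
 next
  case 3
  obtain N L p q where d: "decomposes A M N L" "biprod A M (restr M N) (restr M L) (%x. x) (%x. x) p q"
   "fdm K A (restr M N)" "fdm K A (restr M L)" "dm K A (restr M N) < dm K A M" "dm K A (restr M L) < dm K A M"
   by (rule decompose_step[OF less(2) 3])
  have i: "ind A M = ind A (restr M N) \<union> ind A (restr M L)" by (rule ind_biprod[OF rM d(2)])
  obtain S T where "finite S & S <= ind A (restr M N) & (ALL Z:ind A (restr M N). EX L:S. mod_iso A Z L)"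
   "finite T & T <= ind A (restr M L) & (ALL Z:ind A (restr M L). EX L:T. mod_iso A Z L)"
   using less(1)[OF d(5,3)] less(1)[OF d(6,4)] by blast
  thus ?thesis unfolding i by (intro exI[of _ "S \<union> T"]) blast
 qed
qed

lemma fmod_iso_refl: "M : fmods A ==> mod_iso A M M"
 by (rule mod_iso_refl[OF fmD(2)])

lemma fmod_iso_sym: "M : fmods A ==> N : fmods A ==> mod_iso A M N ==> mod_iso A N M"
 by (rule mod_iso_sym[OF fmD(2) fmD(2)])

lemma fmod_iso_trans: "M : fmods A ==> N : fmods A ==> mod_iso A M N ==> mod_iso A N L ==> mod_iso A M L"
 by (rule mod_iso_trans[OF fmD(2) fmD(2)])

lemma finite_iso_reps:
 assumes S: "finite S" "S <= fmods A"
 obtains T where "T <= S" "!!N L. N : T ==> L : T ==> mod_iso A N L ==> N = L" "!!N. N : S ==> EX L:T. mod_iso A N L"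
proof -
 define f where "f = (%N :: ('k, 'a) fmod. SOME L. L : S & mod_iso A N L)"
 have f: "f N : S & mod_iso A N (f N)" if "N : S" for N
  unfolding f_def by (rule someI[of _ N]) (use that S fmod_iso_refl in auto)
 have feq: "f N = f L" if "N : S" "L : S" "mod_iso A N L" for N L
 proof -
  have NL: "N : fmods A" "L : fmods A" using that S by auto
  have "(T : S & mod_iso A N T) = (T : S & mod_iso A L T)" for T
   using fmod_iso_trans[OF NL(2,1) fmod_iso_sym[OF NL that(3)]] fmod_iso_trans[OF NL that(3)] by blast
  thus ?thesis unfolding f_def by simp
 qed
 show thesis
 proof (rule that[of "f ` S"])
  fix N L assume "N : f ` S" "L : f ` S" "mod_iso A N L"
  then obtain N' L' where *: "N' : S" "N = f N'" "L' : S" "L = f L'" by auto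
  have F: "N' : fmods A" "L' : fmods A" "N : fmods A" "L : fmods A" using * f S by auto
  have "mod_iso A N' L"
   using fmod_iso_trans[OF F(1,3) _ \<open>mod_iso A N L\<close>] f[OF *(1)] *(2) by simp
  hence "mod_iso A N' L'"
   using fmod_iso_trans[OF F(1,4)] fmod_iso_sym[OF F(2,4)] f[OF *(3)] *(4) by simp
  thus "N = L" using feq *(1,3) * by simp
 qed (use f in auto)
qed

lemma reps_exists:
 assumes M: "fdm K A M" obtains S where "reps A M S"
proof -
 obtain S where S: "finite S" "S <= ind A M" "ALL N:ind A M. EX L:S. mod_iso A N L" using finite_ind_cover[OF M] by auto
 have SF: "S <= fmods A" using S(2) indD(1) by blast
 obtain T where T: "T <= S" "!!N L. N : T ==> L : T ==> mod_iso A N L ==> N = L" "!!N. N : S ==> EX L:T. mod_iso A N L"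
  using finite_iso_reps[OF S(1) SF] by blast
 have "EX L:T. mod_iso A N L" if N: "N : ind A M" for N
 proof -
  obtain L L' where "L : S" "mod_iso A N L" "L' : T" "mod_iso A L L'" using S(3) T(3) N by blast
  thus ?thesis using fmod_iso_trans[OF indD(1)[OF N], of L L'] SF by blast
 qed
 moreover have "finite T" "T <= ind A M" using finite_subset[OF T(1) S(1)] T(1) S(2) by auto
 ultimately have "reps A M T" unfolding reps_def using T(2) by simp
 thus thesis by (rule that)
qed

text \<open>The specification counts internal indecomposable summands modulo isomorphism; sending
  each to its representative identifies the classes with the members of \<open>S\<close>.\<close>

lemma num_summands_reps:
 assumes M: "fdm K A M" and r: "reps A M S" shows "num_summands A M = card S"
proof -
 note rM = fdmD(1)[OF M]
 let ?E = "indec_summands A M"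
 have E: "submodule N A M" "retract A (restr M N) M" "indecomposable A (restr M N)" "fdm K A (restr M N)" if NE: "N : ?E" for N
 proof -
  obtain L where d: "decomposes A M N L" and i: "indecomposable A (restr M N)" using NE by (auto simp: indec_summands_def)
  show s: "submodule N A M" using d by (simp add: decomposes_def)
  show "retract A (restr M N) M" using decomposes_biprod[OF rM d] biprod_retract(1) by metis
  show "indecomposable A (restr M N)" "fdm K A (restr M N)" using i fdm_restr(1)[OF M s] by auto
 qed
 have S: "S <= ind A M" "!!N L. N : S ==> L : S ==> mod_iso A N L ==> N = L" "!!N. N : ind A M ==> EX L:S. mod_iso A N L"
  using r by (auto simp: reps_def)
 have ex: "EX L. L : S & mod_iso A (restr M N) L" if N: "N : ?E" for N
 proof -
  obtain N' :: "('k, 'a) fmod" where N': "N' : fmods A" "mod_iso A (restr M N) N'" by (rule copy_exists[OF E(4)[OF N]])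
  note rN = fdmD(1)[OF E(4)[OF N]]
  have "N' : ind A M"
   using indec_iso[OF rN fmD(2)[OF N'(1)] N'(2) E(3)[OF N]] retract_trans[OF mod_iso_retract(2)[OF rN N'(2)] E(2)[OF N]] N'(1)
   by (simp add: ind_def)
  then obtain L where "L : S" "mod_iso A N' L" using S(3) by blast
  thus ?thesis using mod_iso_trans[OF rN fmD(2)[OF N'(1)] N'(2)] by blast
 qed
 define g where "g = (%N. SOME L. L : S & mod_iso A (restr M N) L)"
 have g: "g N : S & mod_iso A (restr M N) (g N)" if "N : ?E" for N
  unfolding g_def by (rule someI_ex[OF ex[OF that]])
 have gS: "fdm K A L" "right_module A L" if "L : S" for L using subsetD[OF S(1) that] fmD[of L] by (simp_all add: ind_def)
 have gu: "g N = L" if "N : ?E" "L : S" "mod_iso A (restr M N) L" for N L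
 proof -
  note rN = fdmD(1)[OF E(4)[OF that(1)]]
  have "mod_iso A (g N) (restr M N)" using mod_iso_sym[OF rN gS(2)] g[OF that(1)] by blast
  hence "mod_iso A (g N) L" using mod_iso_trans[OF gS(2) rN _ that(3)] g[OF that(1)] by blast
  thus ?thesis using S(2) g[OF that(1)] that(2) by blast
 qed
 have "g ` ?E = S"
 proof
  show "g ` ?E <= S" using g by auto
  show "S <= g ` ?E"
  proof
   fix L assume L: "L : S"
   hence Li: "L : fmods A" "indecomposable A L" "retract A L M" using S(1) indD by blast+
   note rL = fmD(2)[OF Li(1)]
   obtain s t where st: "is_hom A L M s" "is_hom A M L t" "!!x. x : car L ==> t (s x) = x"
    using Li(3) unfolding retract_def by auto
   note d = retract_decomposes[where s=s and r=t, OF rM rL st]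
   have sub: "submodule (s ` car L) A M" using d(1) by (simp add: decomposes_def)
   have iso: "mod_iso A L (restr M (s ` car L))" using d(2,3) by (auto simp: mod_iso_iff[OF rL])
   have "s ` car L : ?E"
    unfolding indec_summands_def using d(1) indec_iso[OF rL right_module_restr[OF rM sub] iso Li(2)] by blast
   thus "L : g ` ?E"
    using gu[OF _ L mod_iso_sym[OF rL right_module_restr[OF rM sub] iso]] by (metis imageI)
  qed
 qed
 moreover have "(N : ?E & L : ?E & mod_iso A (restr M N) (restr M L)) = (N : ?E & L : ?E & g N = g L)" for N L
 proof -
  have "mod_iso A (restr M N) (restr M L) \<longleftrightarrow> g N = g L" if NL: "N : ?E" "L : ?E"
  proof
   note r = fdmD(1)[OF E(4)[OF NL(1)]] fdmD(1)[OF E(4)[OF NL(2)]]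
   assume "mod_iso A (restr M N) (restr M L)"
   hence "mod_iso A (restr M N) (g L)" using mod_iso_trans[OF r] g[OF NL(2)] by blast
   thus "g N = g L" using gu[OF NL(1)] g[OF NL(2)] by blast
  next
   note r = fdmD(1)[OF E(4)[OF NL(1)]] fdmD(1)[OF E(4)[OF NL(2)]]
   assume "g N = g L"
   hence "mod_iso A (restr M N) (g L)" using g[OF NL(1)] by simp
   moreover have "mod_iso A (g L) (restr M L)" using mod_iso_sym[OF r(2) gS(2)] g[OF NL(2)] by blast
   ultimately show "mod_iso A (restr M N) (restr M L)" using mod_iso_trans[OF r(1) gS(2)] g[OF NL(2)] by blast
  qed
  thus ?thesis by blast
 qed
 ultimately show ?thesis unfolding num_summands_def using card_quotient_eq[of g ?E S] by simp
qed

text \<open>In the sum of \<open>N\<close>, \<open>V\<close> and \<open>W\<close> the projection to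
  \<open>W\<close> restricts to the submodule spanned by \<open>W\<close> and \<open>N\<close> and
  is the identity on \<open>W\<close>.\<close>

lemma decomposes_set_add_retract:
 assumes M: "right_module A M" and d: "decomposes A M N L" and e: "decomposes A (restr M L) V W"
 shows "retract A (restr M W) (restr M (W <+>\<^sub>M N))"
proof -
 interpret MM: right_module A M by (rule M)
 have s: "submodule N A M" "submodule L A M" using d by (auto simp: decomposes_def)
 have W: "submodule W A M" "submodule V A M" using e submodule_restr_iff[OF M s(2)] by (auto simp: decomposes_def)
 note e' = decomposes_swap[OF right_module_restr[OF M s(2)] e]
 have "decomposes A M W (V <+>\<^sub>M N)" by (rule decomposes_assoc[OF M decomposes_swap[OF M d] e'])
 then obtain p q where b: "biprod A M (restr M W) (restr M (V <+>\<^sub>M N)) (%x. x) (%x. x) p q" by (rule decomposes_biprod[OF M])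
 have WN: "submodule (W <+>\<^sub>M N) A M" "W <= W <+>\<^sub>M N"
  using MM.submodule_set_add[OF W(1) s(1)] MM.set_add_mono1[OF MM.submoduleD(1)[OF W(1)] s(1)] by auto
 show ?thesis unfolding retract_def
  using hom_restr_dom[OF biprodD(3)[OF b] MM.submoduleD(1)[OF WN(1)]] biprodD(5)[OF b] WN(2)
  by (intro exI[of _ "%x. x"] exI[of _ p]) (auto simp: is_hom_def)
qed

lemma basic_summand:
 assumes M: "fdm K A M" and b: "basic A M" and d: "decomposes A M N L"
 shows "basic A (restr M L)"
 unfolding basic_def
proof (intro allI impI notI)
 note rM = fdmD(1)[OF M]
 interpret MM: right_module A M by (rule rM)
 fix V W assume vw: "decomposes A (restr M L) V W & indecomposable A (restr (restr M L) V)"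
  and sm: "is_summand A (restr (restr M L) V) (restr (restr M L) W)"
 have s: "submodule N A M" "submodule L A M" using d by (auto simp: decomposes_def)
 have VW: "submodule V A M" "submodule W A M" using vw submodule_restr_iff[OF rM s(2)] by (auto simp: decomposes_def)
 have WN: "submodule (W <+>\<^sub>M N) A M" by (rule MM.submodule_set_add[OF VW(2) s(1)])
 note r = right_module_restr[OF rM VW(1)] right_module_restr[OF rM VW(2)] right_module_restr[OF rM WN]
 have "retract A (restr M V) (restr M W)" using sm is_summand_iff_retract[OF r(2,1)] by simp
 hence "retract A (restr M V) (restr M (W <+>\<^sub>M N))"
  by (rule retract_trans[OF _ decomposes_set_add_retract[OF rM d conjunct1[OF vw]]])
 hence "is_summand A (restr M V) (restr M (W <+>\<^sub>M N))" using is_summand_iff_retract[OF r(3,1)] by simp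
 moreover have "decomposes A M V (W <+>\<^sub>M N)"
  by (rule decomposes_assoc[OF rM decomposes_swap[OF rM d] conjunct1[OF vw]])
 ultimately show False using b vw unfolding basic_def by simp
qed

lemma biprod_left_inverse:
 assumes D': "right_module A D'" and b: "biprod A D V W i j p q" and b': "biprod A D' V' W' i' j' p' q'"
  and V': "right_module A V'" and W': "right_module A W'" and h: "is_hom A V V' s" "is_hom A W W' u"
  and l: "!!x. x : car V ==> t (s x) = x" "!!x. x : car W ==> v (u x) = x" and x: "x : car D"
 shows "i (t (p' (i' (s (p x)) \<oplus>\<^sub>D' j' (u (q x))))) \<oplus>\<^sub>D j (v (q' (i' (s (p x)) \<oplus>\<^sub>D' j' (u (q x))))) = x"
proof -
 note bd = biprodD[OF b] and bd' = biprodD[OF b']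
 interpret D': right_module A D' by (rule D')
 interpret V': right_module A V' by (rule V')
 interpret W': right_module A W' by (rule W')
 have c: "p x : car V" "q x : car W" using hom_closed[OF bd(3) x] hom_closed[OF bd(4) x] by auto
 have c': "s (p x) : car V'" "u (q x) : car W'" using hom_closed[OF h(1) c(1)] hom_closed[OF h(2) c(2)] by auto
 have c'': "i' (s (p x)) : car D'" "j' (u (q x)) : car D'" using hom_closed[OF bd'(1) c'(1)] hom_closed[OF bd'(2) c'(2)] by auto
 show ?thesis using c' c'' l(1)[OF c(1)] l(2)[OF c(2)] bd(9)[OF x] by (simp add: hom_add[OF bd'(3)] hom_add[OF bd'(4)] bd'(5-8))
qed

lemma retract_biprod:
 assumes D: "right_module A D" and D': "right_module A D'" and b: "biprod A D V W i j p q" and b': "biprod A D' V' W' i' j' p' q'"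
  and V': "right_module A V'" and W': "right_module A W'"
  and W: "right_module A W" and V: "right_module A V"
  and r: "retract A V V'" "retract A W W'"
 shows "retract A D D'"
proof -
 note bd = biprodD[OF b] and bd' = biprodD[OF b']
 obtain s t where st: "is_hom A V V' s" "is_hom A V' V t" "!!x. x : car V ==> t (s x) = x"
  using r(1) unfolding retract_def by auto
 obtain u v where uv: "is_hom A W W' u" "is_hom A W' W v" "!!x. x : car W ==> v (u x) = x"
  using r(2) unfolding retract_def by auto
 let ?f = "%x. i' (s (p x)) \<oplus>\<^sub>D' j' (u (q x))" and ?g = "%x. i (t (p' x)) \<oplus>\<^sub>D j (v (q' x))"
 have f: "is_hom A D D' ?f" by (rule hom_to_biprod[OF D' b' hom_comp[OF bd(3) st(1)] hom_comp[OF bd(4) uv(1)]])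
 have g: "is_hom A D' D ?g" by (rule hom_to_biprod[OF D b hom_comp[OF bd'(3) st(2)] hom_comp[OF bd'(4) uv(2)]])
 have "?g (?f x) = x" if "x : car D" for x
  by (rule biprod_left_inverse[OF D' b b' V' W' st(1) uv(1) st(3) uv(3) that])
 thus ?thesis unfolding retract_def using f g by blast
qed

text \<open>Split one common indecomposable off both modules and recurse on the complements.
  Consequently a basic module is determined up to isomorphism by its set \<open>ind\<close>, which
  makes set equalities usable as isomorphism criteria (\<open>basic_unique\<close>).\<close>

lemma basic_retract:
 fixes V M :: "('k, 'a) fmod"
 assumes "V : fmods A" "M : fmods A" "basic A V" "ind A V <= ind A M"
 shows "retract A V M"
 using assms
proof (induction "dm K A V" arbitrary: V M rule: less_induct)
 case (less V M)
 note rV = fmD(2)[OF less(2)] and rM = fmD(2)[OF less(3)]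
 interpret V: right_module A V by (rule rV)
 interpret MM: right_module A M by (rule rM)
 show ?case
 proof (cases "car V = {\<zero>\<^sub>V}")
  case True
  thus ?thesis unfolding retract_def using hom_zero_fun[OF rV] hom_zero_fun[OF rM]
   by (intro exI[of _ "%_. \<zero>\<^sub>M"] exI[of _ "%_. \<zero>\<^sub>V"]) auto
 next
  case False
  then obtain N where N: "N : ind A V" using ind_nonempty[OF fmD(1)[OF less(2)]] by blast
  note Nd = indD[OF N] and NM = indD[OF subsetD[OF less(5) N]]
  note rN = fmD(2)[OF Nd(1)]
  obtain s t where st: "is_hom A N V s" "is_hom A V N t" "!!x. x : car N ==> t (s x) = x"
   using Nd(3) unfolding retract_def by auto
  obtain s' t' where st': "is_hom A N M s'" "is_hom A M N t'" "!!x. x : car N ==> t' (s' x) = x"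
   using NM(3) unfolding retract_def by auto
  note d = retract_decomposes[where s=s and r=t, OF rV rN st] and d' = retract_decomposes[where s=s' and r=t', OF rM rN st']
  let ?N = "s ` car N" and ?L = "a_kernel V N t" and ?N' = "s' ` car N" and ?L' = "a_kernel M N t'"
  have sub: "submodule ?N A V" "submodule ?L A V" "submodule ?N' A M" "submodule ?L' A M"
   using d(1) d'(1) by (auto simp: decomposes_def)
  note r = right_module_restr[OF rV sub(1)] right_module_restr[OF rV sub(2)] right_module_restr[OF rM sub(3)] right_module_restr[OF rM sub(4)]
  have F: "restr V ?L : fmods A" "restr M ?L' : fmods A" "restr V ?N : fmods A" "restr M ?N' : fmods A"
   using fmods_restr[OF less(2) sub(2)] fmods_restr[OF less(3) sub(4)] fmods_restr[OF less(2) sub(1)] fmods_restr[OF less(3) sub(3)] by auto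
  obtain p q where b: "biprod A V (restr V ?N) (restr V ?L) (%x. x) (%x. x) p q" by (rule decomposes_biprod[OF rV d(1)])
  obtain p' q' where b': "biprod A M (restr M ?N') (restr M ?L') (%x. x) (%x. x) p' q'" by (rule decomposes_biprod[OF rM d'(1)])
  have iso: "mod_iso A N (restr V ?N)" "mod_iso A N (restr M ?N')" using d(2,3) d'(2,3) by (auto simp: mod_iso_iff[OF rN])
  have iN: "indecomposable A (restr V ?N)" "indecomposable A (restr M ?N')"
   using indec_iso[OF rN r(1) iso(1) Nd(2)] indec_iso[OF rN r(3) iso(2) Nd(2)] by auto
  have "?L ~= car V"
  proof
   assume e: "?L = car V"
   have "?N = {\<zero>\<^sub>V}" using d(1) e V.submoduleD(1)[OF sub(1)] by (auto simp: decomposes_def)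
   thus False using indec_nonzero[OF iN(1)] by simp
  qed
  hence less': "dm K A (restr V ?L) < dm K A V" by (rule fdm_restr(3)[OF fmD(1)[OF less(2)] sub(2)])
  have "ind A (restr V ?L) <= ind A (restr M ?L')"
  proof
   fix Z assume Z: "Z : ind A (restr V ?L)"
   hence "Z : ind A M" using less(5) ind_biprod[OF rV b] by blast
   hence "Z : ind A (restr M ?N') | Z : ind A (restr M ?L')" using ind_biprod[OF rM b'] by blast
   \<comment> \<open>If Z were isomorphic to the summand just split off, that summand would occur
     again in its complement in V, contrary to V being basic.\<close>
   moreover have "Z ~: ind A (restr M ?N')"
   proof
    assume "Z : ind A (restr M ?N')"
    hence "mod_iso A Z (restr M ?N')" using ind_indec[OF F(4) iN(2)] by blast
    hence "mod_iso A Z N" using fmod_iso_trans[OF indD(1)[OF Z] F(4)] fmod_iso_sym[OF Nd(1) F(4) iso(2)] by blast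
    hence "retract A (restr V ?N) Z"
     using retract_trans[OF mod_iso_retract(2)[OF rN iso(1)] mod_iso_retract(2)[OF fmD(2)[OF indD(1)[OF Z]]]] by blast
    hence "retract A (restr V ?N) (restr V ?L)" using indD(3)[OF Z] retract_trans by blast
    hence "is_summand A (restr V ?N) (restr V ?L)" using is_summand_iff_retract[OF r(2,1)] by simp
    thus False using less(4) d(1) iN(1) unfolding basic_def by blast
   qed
   ultimately show "Z : ind A (restr M ?L')" by blast
  qed
  moreover have "basic A (restr V ?L)" by (rule basic_summand[OF fmD(1)[OF less(2)] less(4) d(1)])
  ultimately have "retract A (restr V ?L) (restr M ?L')" using less(1)[OF less' F(1,2)] by blast
  moreover have "retract A (restr V ?N) (restr M ?N')"
   using retract_trans[OF mod_iso_retract(2)[OF rN iso(1)] mod_iso_retract(1)[OF rN iso(2)]] .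
  ultimately show ?thesis by (intro retract_biprod[OF rV rM b b' r(3,4,2,1)])
 qed
qed

text \<open>The two sections give injections in both directions, so the dimensions agree and each
  injection is bijective.\<close>

lemma mutual_retract_iso:
 assumes V: "V : fmods A" and M: "M : fmods A" and "retract A V M" "retract A M V"
 shows "mod_iso A V M"
proof -
 obtain s t where st: "is_hom A V M s" "!!x. x : car V ==> t (s x) = x" using assms(3) unfolding retract_def by auto
 obtain s' t' where st': "is_hom A M V s'" "!!x. x : car M ==> t' (s' x) = x" using assms(4) unfolding retract_def by auto
 have i: "inj_on s (car V)" "inj_on s' (car M)" using st(2) st'(2) by (metis inj_on_inverseI)+
 have le: "dm K A M <= dm K A V" by (rule dm_retract_le[OF fmD(1)[OF V] fmD(1)[OF M] st'(1) i(2)])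
 note f = fmD(1)[OF V] fmD(1)[OF M]
 have "s ` car (Kr A V) = car (Kr A M)"
  using inj_imp_surj[OF fdmD(3)[OF f(1)] fdmD(3)[OF f(2)] hom_Kr[OF st(1)] fdmD(2)[OF f(1)] fdmD(2)[OF f(2)]] i(1) le by (simp add: dm_def)
 thus ?thesis using i(1) st(1) by (auto simp: mod_iso_iff[OF fmD(2)[OF V]] bij_betw_def)
qed

lemma basic_unique:
 "V : fmods A ==> M : fmods A ==> basic A V ==> basic A M ==> ind A V = ind A M ==> mod_iso A V M"
 using mutual_retract_iso basic_retract by blast

lemma ind_cong_iso: "M : fmods A ==> M' : fmods A ==> mod_iso A M M' ==> ind A M = ind A M'"
 using mod_iso_retract[OF fmD(2)] ind_mono by blast

text \<open>A module of minimal dimension with prescribed indecomposable summands is basic.\<close>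

lemma basic_exists:
 assumes S: "finite S" "S <= fmods A" "!!N. N : S ==> indecomposable A N"
 obtains M :: "('k, 'a) fmod" where "M : fmods A" "basic A M" "!!N. N : ind A M \<longleftrightarrow> N : fmods A & (EX L:S. mod_iso A N L)"
proof -
 let ?T = "{N : fmods A. EX L:S. mod_iso A N L}"
 have "EX D:fmods A. ind A D = {N : fmods A. EX L:S. mod_iso A N L}"
  using S
 proof (induction S)
  case empty
  obtain Z :: "('k, 'a) fmod" where "Z : fmods A" "car Z = {\<zero>\<^sub>Z}" by (rule zero_fmod_exists)
  thus ?case using ind_zero[OF fmD(2)] by blast
 next
  case (insert N S)
  then obtain D where D: "D : fmods A" "ind A D = {N : fmods A. EX L:S. mod_iso A N L}" by auto
  have N: "N : fmods A" "indecomposable A N" using insert by auto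
  obtain E :: "('k, 'a) fmod" and i j p q where E: "E : fmods A" "biprod A E D N i j p q" by (rule biprod_exists[OF D(1) N(1)])
  have "ind A E = {M : fmods A. EX L:insert N S. mod_iso A M L}"
   unfolding ind_biprod[OF fmD(2)[OF E(1)] E(2)] D(2) using ind_indec[OF N] by blast
  thus ?case using E(1) by blast
 qed
 then obtain D where D: "D : fmods A" "ind A D = ?T" by auto
 define Q where "Q = (%M. M : fmods A & ind A M = ?T)"
 obtain M where M: "Q M" "!!L. Q L ==> dm K A M <= dm K A L" using ex_has_least_nat[of Q D "dm K A"] D by (auto simp: Q_def)
 have Mf: "M : fmods A" "ind A M = ?T" using M(1) by (auto simp: Q_def)
 note rM = fmD(2)[OF Mf(1)]
 have "basic A M" unfolding basic_def
 proof (intro allI impI notI)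
  fix N L assume d: "decomposes A M N L & indecomposable A (restr M N)" and sm: "is_summand A (restr M N) (restr M L)"
  have s: "submodule N A M" "submodule L A M" using d by (auto simp: decomposes_def)
  note r = right_module_restr[OF rM s(1)] right_module_restr[OF rM s(2)]
  have F: "restr M N : fmods A" "restr M L : fmods A" using fmods_restr[OF Mf(1)] s by auto
  obtain p q where b: "biprod A M (restr M N) (restr M L) (%x. x) (%x. x) p q" by (rule decomposes_biprod[OF rM conjunct1[OF d]])
  have "ind A (restr M N) <= ind A (restr M L)" using ind_mono sm is_summand_iff_retract[OF r(2,1)] by blast
  hence "ind A (restr M L) = ?T" using ind_biprod[OF rM b] Mf(2) by blast
  hence "dm K A M <= dm K A (restr M L)" using M(2) F(2) by (simp add: Q_def)
  moreover have "L ~= car M"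
  proof
   assume e: "L = car M"
   interpret MM: right_module A M by (rule rM)
   have "N = {\<zero>\<^sub>M}" using d e MM.submoduleD(1)[OF s(1)] by (auto simp: decomposes_def)
   thus False using indec_nonzero[OF conjunct2[OF d]] by simp
  qed
  ultimately show False using fdm_restr(3)[OF fmD(1)[OF Mf(1)] s(2)] by simp
 qed
 thus thesis using that[OF Mf(1)] Mf(2) by blast
qed

lemma ext0_retract_cod:
 assumes M: "M : fmods A" and Y: "Y : fmods A" "Y' : fmods A" "retract A Y' Y" "ext0 A M Y"
 shows "ext0 A M Y'"
proof -
 obtain s t where st: "is_hom A Y' Y s" "is_hom A Y Y' t" "!!x. x : car Y' ==> t (s x) = x"
  using Y(3) unfolding retract_def by auto
 have "t ` car Y = car Y'"
 proof
  show "t ` car Y <= car Y'" using hom_closed[OF st(2)] by auto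
  show "car Y' <= t ` car Y" using st(3) hom_closed[OF st(1)] by (metis image_eqI subsetI)
 qed
 thus ?thesis using ext0_cod_surj[OF M Y(1,2) st(2)] Y(4) by blast
qed

text \<open>All Hom spaces into zero vanish, so theta and dim Hom are both 0 and the equality case
  of \<open>theta_le\<close> applies.\<close>

lemma ext0_zero_cod:
 assumes N: "N : fmods A" and Z: "Z : fmods A" "car Z = {\<zero>\<^sub>Z}" shows "ext0 A N Z"
proof -
 have "hdim K A M Z = 0" if "M : fmods A" for M
  unfolding hdim_eq_0_iff[OF fmD(1)[OF that] fmD(1)[OF Z(1)]] using Z(2) hom_closed by fastforce
 moreover obtain P1 f P0 p where m: "mpres A P1 f P0 p N" by (rule mpres_exists[OF N])
 ultimately have "theta K A N Z = real (hdim K A N Z)"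
  using theta_eq[OF N m Z(1)] N projD(1) presD(1,2)[OF mpres_pres[OF N m]] by simp
 thus ?thesis using theta_le(2)[OF N Z(1)] by simp
qed

lemma hdim_zero_of_ind:
 assumes M: "M : fmods A" and Y: "Y : fmods A" and e: "!!N. N : ind A M ==> hdim K A N Y = 0"
 shows "hdim K A M Y = 0"
proof (rule fmod_induct[OF M])
 fix Z :: "('k, 'a) fmod" assume Z: "Z : fmods A" "car Z = {\<zero>\<^sub>Z}"
 thus "hdim K A Z Y = 0"
  using hom_from_zero[OF fmD(2)[OF Z(1)] fmD(2)[OF Y] Z(2)] hdim_eq_0_iff[OF fmD(1)[OF Z(1)] fmD(1)[OF Y]] by blast
next
 fix D V W :: "('k, 'a) fmod" and i j p q
 assume "D : fmods A" "V : fmods A" "W : fmods A" "biprod A D V W i j p q" "hdim K A V Y = 0" "hdim K A W Y = 0"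
 thus "hdim K A D Y = 0" using hdim_biprod[OF fmD(1) fmD(1) fmD(1) fmD(1)[OF Y], of D V W] by simp
qed (use e in auto)

lemma hdim_zero_of_ind_cod:
 assumes M: "M : fmods A" and Y: "Y : fmods A" and e: "!!N. N : ind A Y ==> hdim K A M N = 0"
 shows "hdim K A M Y = 0"
proof (rule fmod_induct[OF Y])
 fix Z :: "('k, 'a) fmod" assume Z: "Z : fmods A" "car Z = {\<zero>\<^sub>Z}"
 thus "hdim K A M Z = 0"
  unfolding hdim_eq_0_iff[OF fmD(1)[OF M] fmD(1)[OF Z(1)]] using hom_closed by fastforce
next
 fix D V W :: "('k, 'a) fmod" and i j p q
 assume "D : fmods A" "V : fmods A" "W : fmods A" "biprod A D V W i j p q" "hdim K A M V = 0" "hdim K A M W = 0"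
 thus "hdim K A M D = 0" using hdim_biprod_cod_zero[OF M] by blast
qed (use e in auto)

lemma projective_of_ind:
 assumes M: "M : fmods A" and e: "!!N. N : ind A M ==> projective A N"
 shows "projective A M"
proof (rule fmod_induct[OF M])
 fix D V W :: "('k, 'a) fmod" and i j p q
 assume "D : fmods A" "biprod A D V W i j p q" "projective A V" "projective A W"
 thus "projective A D" using proj_biprod by blast
qed (use e proj_zero in auto)

text \<open>P is a retract of a finite sum of copies of the regular module, and by the exchange
  property of one of these copies.\<close>

lemma indec_projective_regular:
 assumes P: "projective A P" and i: "indecomposable A P"
 shows "retract A P (regular A)"
proof -
 define S where "S = (%F :: ('k, 'a) fmod. retract A P F --> retract A P (regular A))"
 note Pf = projD(1)[OF P] and rA = right_module_regular[OF ring_A]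
 have "EX (F :: ('k, 'a) fmod) g. F : fmods A & S F & is_hom A F P g & g ` car F = car P"
 proof (rule surj_exists[where S=S, OF Pf])
  fix Z :: "('k, 'a) fmod" assume "Z : fmods A" "car Z = {\<zero>\<^sub>Z}"
  thus "S Z" using retract_zero[OF fmD(2)[OF Pf] fmD(2)] indec_nonzero[OF i] by (auto simp: S_def)
 next
  fix R :: "('k, 'a) fmod" assume "projective A R" "mod_iso A (regular A) R"
  thus "S R" using retract_trans[OF _ mod_iso_retract(2)[OF rA], of P R] by (auto simp: S_def)
 next
  fix D V W :: "('k, 'a) fmod" and i' j p q
  assume "S V" "S W" "D : fmods A" "biprod A D V W i' j p q"
  thus "S D" using indec_retract_biprod[OF fmD(1)[OF Pf] i fmD(2)] unfolding S_def by blast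
 qed blast
 then obtain F :: "('k, 'a) fmod" and g where F: "F : fmods A" "S F" "is_hom A F P g" "g ` car F = car P" by blast
 obtain s where "is_hom A P F s" "!!x. x : car P ==> g (s x) = x"
  using proj_lift[OF P F(1) Pf F(3,4) hom_id] by metis
 hence "retract A P F" unfolding retract_def using F(3) by blast
 thus ?thesis using F(2) by (simp add: S_def)
qed

lemma ind_regular: "ind A (regular A) = {P. projective A P & indecomposable A P}"
proof
 show "{P. projective A P & indecomposable A P} <= ind A (regular A)"
  using indec_projective_regular projD(1) by (auto simp: ind_def)
 show "ind A (regular A) <= {P. projective A P & indecomposable A P}"
 proof
  fix P assume P: "P : ind A (regular A)"
  obtain R :: "('k, 'a) fmod" where R: "projective A R" "mod_iso A (regular A) R" by (rule regular_copy)
  have "retract A P R" using retract_trans[OF indD(3)[OF P] mod_iso_retract(1)[OF right_module_regular[OF ring_A] R(2)]] .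
  thus "P : {P. projective A P & indecomposable A P}" using proj_retract[OF R(1) indD(1)[OF P]] indD(2)[OF P] by simp
 qed
qed

end

section \<open>Linear algebra of the functions theta and dim Hom\<close>

definition fscale :: "real => ('x => real) => 'x => real" where
 "fscale c f = (%x. c * f x)"

interpretation Fn: vector_space fscale
 by unfold_locales (auto simp: fscale_def fun_eq_iff algebra_simps)

lemma fun_sum_apply: "(\<Sum>i\<in>I. F i) x = (\<Sum>i\<in>I. (F i x :: real))"
 by (induction I rule: infinite_finite_induct) auto

text \<open>The coefficient condition for families also excludes repetitions: equal members would
  give a relation with coefficients 1 and -1.\<close>

lemma independent_family:
 assumes I: "finite I" and z: "!!c. (!!y. (\<Sum>i\<in>I. c i * F i y) = 0) ==> ALL i:I. c i = 0"
 shows "inj_on F I" "Fn.independent (F ` I)"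
proof -
 show inj: "inj_on F I"
 proof (rule inj_onI, rule ccontr)
  fix i j assume ij: "i : I" "j : I" "F i = F j" "i ~= j"
  define c :: "'a => real" where "c = (%k. (if k = i then 1 else 0) - (if k = j then 1 else 0))"
  have "(\<Sum>k\<in>I. c k * F k y) = 0" for y
  proof -
   have "(\<Sum>k\<in>I. c k * F k y) = (\<Sum>k\<in>I. if k = i then F k y else 0) - (\<Sum>k\<in>I. if k = j then F k y else 0)"
    unfolding sum_subtractf[symmetric] by (rule sum.cong) (auto simp: c_def)
   thus ?thesis using ij I by simp
  qed
  hence "c i = 0" using z ij(1) by blast
  thus False using ij(4) by (simp add: c_def)
 qed
 show "Fn.independent (F ` I)"
 proof (rule Fn.independent_if_scalars_zero)
  show "finite (F ` I)" using I by simp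
  fix f x assume s: "(\<Sum>x\<in>F ` I. fscale (f x) x) = 0" and x: "x : F ` I"
  have "(\<Sum>i\<in>I. f (F i) * F i y) = 0" for y
  proof -
   have "(\<Sum>x\<in>F ` I. fscale (f x) x) y = (\<Sum>i\<in>I. f (F i) * F i y)"
    unfolding fun_sum_apply sum.reindex[OF inj] by (simp add: fscale_def)
   thus ?thesis using s by simp
  qed
  hence "ALL i:I. f (F i) = 0" by (rule z)
  thus "f x = 0" using x by auto
 qed
qed

text \<open>Cutting off to 0 outside \<open>fmods A\<close> makes equality of functions the same as
  equality on modules; likewise for \<open>pf\<close>.\<close>

definition tf :: "'k ring => ('k, 'a) module => ('k, 'a) fmod => ('k, 'a) fmod => real" where
 "tf K A M = (%Y. if Y : fmods A then theta K A M Y else 0)"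

definition pf :: "'k ring => ('k, 'a) module => ('k, 'a) fmod => ('k, 'a) fmod => real" where
 "pf K A M = (%Y. if Y : fmods A then real (hdim K A M Y) else 0)"

definition gens :: "'k ring => ('k, 'a) module => ('k, 'a) fpair => (('k, 'a) fmod => real) set" where
 "gens K A T = tf K A ` ind A (fst T) \<union> pf K A ` ind A (snd T)"

text \<open>The indecomposable projectives without maps to members of \<open>S\<close>: the largest
  possible projective part of a tau-rigid pair whose module part lies in \<open>S\<close>.\<close>

definition nul :: "'k ring => ('k, 'a) module => ('k, 'a) fmod set => ('k, 'a) fmod set" where
 "nul K A S = {Q. projective A Q & indecomposable A Q & (ALL Y:S. hdim K A Q Y = 0)}"

context fd_algebra
begin

text \<open>An isomorphic copy is viewed as a biproduct with the zero module, so that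
  \<open>theta_biprod\<close> gives the inequality.\<close>

lemma theta_iso_le:
 assumes V: "V : fmods A" and D: "D : fmods A" and i: "mod_iso A V D" and Y: "Y : fmods A"
 shows "theta K A V Y <= theta K A D Y"
proof -
 obtain W :: "('k, 'a) fmod" where W: "W : fmods A" "car W = {\<zero>\<^sub>W}" by (rule zero_fmod_exists)
 obtain f where f: "is_hom A V D f" "bij_betw f (car V) (car D)" using i by (auto simp: mod_iso_iff[OF fmD(2)[OF V]])
 note g = hom_inverse[OF fmD(2)[OF V] f]
 interpret D: right_module A D by (rule fmD(2)[OF D])
 interpret V: right_module A V by (rule fmD(2)[OF V])
 have f0: "f \<zero>\<^sub>V = \<zero>\<^sub>D" by (rule hom_zero[OF fmD(2)[OF V] fmD(2)[OF D] f(1)])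
 have b: "biprod A D V W f (%_. \<zero>\<^sub>D) (inv_into (car V) f) (%_. \<zero>\<^sub>W)"
  unfolding biprod_def using f(1) g(1) hom_zero_fun[OF fmD(2)[OF W(1)]] hom_zero_fun[OF fmD(2)[OF D]]
   hom_zero_fun[OF fmD(2)[OF D], of W] hom_zero_fun[OF fmD(2)[OF W(1)], of D] W(2) f(2) f0
   bij_betw_inv_into_left[OF f(2)] bij_betw_inv_into_right[OF f(2)]
   bij_betw_inv_into_left[OF f(2) V.M.zero_closed]
  by (auto simp: hom_closed[OF f(1)])
 obtain Z where Z: "projective A Z" "!!Y. Y : fmods A ==> theta K A V Y + theta K A W Y = theta K A D Y - real (hdim K A Z Y)"
  using theta_biprod[OF V W(1) D b] by metis
 have "theta K A W Y = real (hdim K A W Y)" by (rule theta_projective[OF proj_zero[OF W] Y])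
 thus ?thesis using Z(2)[OF Y] by simp
qed

lemma tf_iso: "M : fmods A ==> N : fmods A ==> mod_iso A M N ==> tf K A M = tf K A N"
 unfolding tf_def using theta_iso_le[of M N] theta_iso_le[of N M] fmod_iso_sym[of M N] by (auto simp: fun_eq_iff intro!: antisym)

lemma pf_iso: "M : fmods A ==> N : fmods A ==> mod_iso A M N ==> pf K A M = pf K A N"
 unfolding pf_def using hdim_iso_dom[OF fmD(1) fmD(1) fmD(1)] by (auto simp: fun_eq_iff)

lemma pf_zero: "Z : fmods A ==> car Z = {\<zero>\<^sub>Z} ==> pf K A Z = 0"
 unfolding pf_def zero_fun_def using hom_from_zero[OF fmD(2) fmD(2)] hdim_eq_0_iff[OF fmD(1) fmD(1)] by fastforce

lemma pf_biprod:
 "D : fmods A ==> V : fmods A ==> W : fmods A ==> biprod A D V W i j p q ==> pf K A D = pf K A V + pf K A W"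
 unfolding pf_def using hdim_biprod[OF fmD(1) fmD(1) fmD(1) fmD(1)] by (auto simp: fun_eq_iff)

lemma tf_projective: "projective A P ==> tf K A P = pf K A P"
 unfolding tf_def pf_def using theta_projective by auto

lemma pf_span:
 assumes "P : fmods A" shows "pf K A P : Fn.span (pf K A ` ind A P)"
proof (rule fmod_induct[where S = "%V. pf K A V : Fn.span (pf K A ` ind A P)", OF assms])
 fix Z :: "('k, 'a) fmod" assume "Z : fmods A" "car Z = {\<zero>\<^sub>Z}"
 thus "pf K A Z : Fn.span (pf K A ` ind A P)" using pf_zero Fn.span_zero by simp
qed (auto simp: pf_biprod Fn.span_add intro: Fn.span_base)

lemma nulD: "Q : nul K A S ==> projective A Q" "Q : nul K A S ==> indecomposable A Q" "Q : nul K A S ==> Y : S ==> hdim K A Q Y = 0"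
 by (auto simp: nul_def)

lemma ind_projective: "projective A P ==> Q : ind A P ==> projective A Q"
 using proj_retract by (auto simp: ind_def)

lemma ind_sub_nul:
 assumes P: "projective A P" and S: "S <= fmods A" "!!Y. Y : S ==> hdim K A P Y = 0"
 shows "ind A P <= nul K A S"
proof
 fix Q assume Q: "Q : ind A P"
 have "hdim K A Q Y = 0" if "Y : S" for Y
  using hdim_retract_dom[OF fmD(1)[OF indD(1)[OF Q]] projD(2)[OF P] fmD(1) indD(3)[OF Q], of Y] S that by auto
 thus "Q : nul K A S" using ind_projective[OF P Q] indD(2)[OF Q] by (simp add: nul_def)
qed

lemma ind_sub_regular: "projective A P ==> ind A P <= ind A (regular A)"
 unfolding ind_regular using ind_projective indD(2) by blast

lemma pf_span_nul:
 assumes P: "projective A P" and S: "S <= fmods A" "!!Y. Y : S ==> hdim K A P Y = 0"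
 shows "pf K A P : Fn.span (pf K A ` nul K A S)"
 using pf_span[OF projD(1)[OF P]] Fn.span_mono[OF image_mono[OF ind_sub_nul[OF assms]]] by blast

text \<open>Decompose M step by step. Each step is additive up to dim Hom(Z,-), where Z is
  projective without maps to the members of \<open>S\<close>, hence has all its summands in
  \<open>nul\<close>.\<close>

lemma tf_span_nul:
 assumes M: "M : fmods A" and S: "S <= fmods A" and e: "!!Y. Y : S ==> ext0 A M Y"
 shows "tf K A M : Fn.span (tf K A ` ind A M \<union> pf K A ` nul K A S)" (is "_ : Fn.span ?G")
proof (rule fmod_induct[where S = "%V. tf K A V : Fn.span ?G", OF M])
 fix Z :: "('k, 'a) fmod" assume "Z : fmods A" "car Z = {\<zero>\<^sub>Z}"
 thus "tf K A Z : Fn.span ?G" using pf_zero Fn.span_zero tf_projective[OF proj_zero] by simp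
next
 fix N assume "N : ind A M" thus "tf K A N : Fn.span ?G" by (intro Fn.span_base) auto
next
 fix D V W :: "('k, 'a) fmod" and i j p q
 assume D: "D : fmods A" "V : fmods A" "W : fmods A" "biprod A D V W i j p q"
  and r: "retract A V M" "retract A W M" and s: "tf K A V : Fn.span ?G" "tf K A W : Fn.span ?G"
 obtain Z where Z: "projective A Z" "!!Y. Y : fmods A ==> theta K A V Y + theta K A W Y = theta K A D Y - real (hdim K A Z Y)"
  "!!Y. Y : fmods A ==> ext0 A V Y ==> ext0 A W Y ==> hdim K A Z Y = 0"
  using theta_biprod[OF D(2,3,1,4)] by metis
 have "hdim K A Z Y = 0" if "Y : S" for Y
  using Z(3)[of Y] ext0_retract[OF D(2) M r(1) e[OF that]] ext0_retract[OF D(3) M r(2) e[OF that]] S that by blast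
 hence "pf K A Z : Fn.span (pf K A ` nul K A S)" by (intro pf_span_nul[OF Z(1) S])
 moreover have "Fn.span (pf K A ` nul K A S) <= Fn.span ?G" by (rule Fn.span_mono) auto
 ultimately have "pf K A Z : Fn.span ?G" by blast
 moreover have "tf K A D = tf K A V + tf K A W + pf K A Z"
  using Z(2) by (auto simp: tf_def pf_def fun_eq_iff)
 ultimately show "tf K A D : Fn.span ?G" using s by (simp add: Fn.span_add)
qed

text \<open>By definition theta is a difference of two functions dim Hom(P,-) with P
  projective.\<close>

lemma tf_span_regular:
 assumes M: "M : fmods A" shows "tf K A M : Fn.span (pf K A ` ind A (regular A))"
proof -
 obtain P1 f P0 p where m: "mpres A P1 f P0 p M" by (rule mpres_exists[OF M])
 note pd = presD[OF mpres_pres[OF M m]]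
 have "tf K A M = pf K A P0 - pf K A P1" using theta_eq[OF M m] by (auto simp: tf_def pf_def fun_eq_iff)
 moreover have "pf K A P : Fn.span (pf K A ` ind A (regular A))" if "projective A P" for P
  using pf_span[OF projD(1)[OF that]] Fn.span_mono[OF image_mono[OF ind_sub_regular[OF that]]] by blast
 ultimately show ?thesis using pd(1,2) by (simp add: Fn.span_diff)
qed

text \<open>The notion \<open>tau_rigid_pair\<close> rewritten through \<open>ext0\<close> and
  \<open>hdim\<close> (see \<open>tau_rigid_pair_iff\<close>); the translate is out of sight from
  here on.\<close>

definition rp :: "('k, 'a) fpair => bool" where
 "rp T \<longleftrightarrow> fst T : fmods A & ext0 A (fst T) (fst T) & projective A (snd T) & hdim K A (snd T) (fst T) = 0"

lemma rpD: "rp T ==> fst T : fmods A" "rp T ==> ext0 A (fst T) (fst T)" "rp T ==> projective A (snd T)" "rp T ==> hdim K A (snd T) (fst T) = 0"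
 "rp T ==> snd T : fmods A"
 using projD(1) by (auto simp: rp_def)

lemma tau_rigid_pair_iff: "tau_rigid_pair K A T \<longleftrightarrow> rp T"
proof (cases T)
 case (Pair M P)
 show ?thesis unfolding Pair rp_def
  using Hom_zero_iff[OF projD(3) hom_zero_fun[OF fmD(2)], of P M] hdim_eq_0_iff[OF projD(2) fmD(1), of P M] by (auto simp: tau_rigid_iff)
qed

lemma ext0_retract_both:
 assumes M: "M : fmods A" and "ext0 A M M" "V : fmods A" "W : fmods A" "retract A V M" "retract A W M"
 shows "ext0 A V W"
 using ext0_retract[OF assms(3) M assms(5)] ext0_retract_cod[OF M M assms(4,6,2)] by blast

lemma hdim_retract_both:
 assumes "P : fmods A" "M : fmods A" "hdim K A P M = 0" "Q : fmods A" "V : fmods A" "retract A Q P" "retract A V M"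
 shows "hdim K A Q V = 0"
 using hdim_retract_dom[OF fmD(1) fmD(1) fmD(1), of Q P V] hdim_retract_cod[OF fmD(1) fmD(1) fmD(1), of P V M] assms by simp

lemma rigid_set_ind:
 assumes "rp T" "S <= ind A (fst T)" "R <= ind A (snd T)" shows "rigid_set K A S R"
 unfolding rigid_set_def
proof (intro conjI ballI)
 note r = rpD[OF assms(1)]
 show "S <= fmods A" using assms(2) indD(1) by blast
 show "projective A Q" if "Q : R" for Q using ind_projective[OF r(3)] assms(3) that by blast
 show "ext0 A M N" if "M : S" "N : S" for M N
  using ext0_retract_both[OF r(1,2)] indD(1,3) assms(2) that by blast
 show "hdim K A Q M = 0" if "Q : R" "M : S" for Q M
  using hdim_retract_both[OF r(5,1,4)] indD(1,3) assms(2,3) that by blast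
qed

lemma tf_reps:
 assumes "reps A M S" shows "tf K A ` ind A M = tf K A ` S"
proof
 have sub: "S <= ind A M" using assms by (simp add: reps_def)
 thus "tf K A ` S <= tf K A ` ind A M" by (rule image_mono)
 show "tf K A ` ind A M <= tf K A ` S"
 proof (rule image_subsetI)
  fix N assume N: "N : ind A M"
  then obtain L where L: "L : S" "mod_iso A N L" using assms unfolding reps_def by blast
  hence "tf K A N = tf K A L" using tf_iso[OF indD(1)[OF N] indD(1)] sub by blast
  thus "tf K A N : tf K A ` S" using L(1) by simp
 qed
qed

lemma pf_reps:
 assumes "reps A M S" shows "pf K A ` ind A M = pf K A ` S"
proof
 have sub: "S <= ind A M" using assms by (simp add: reps_def)
 thus "pf K A ` S <= pf K A ` ind A M" by (rule image_mono)
 show "pf K A ` ind A M <= pf K A ` S"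
 proof (rule image_subsetI)
  fix N assume N: "N : ind A M"
  then obtain L where L: "L : S" "mod_iso A N L" using assms unfolding reps_def by blast
  hence "pf K A N = pf K A L" using pf_iso[OF indD(1)[OF N] indD(1)] sub by blast
  thus "pf K A N : pf K A ` S" using L(1) by simp
 qed
qed

text \<open>Modules and projectives are indexed by a disjoint sum so that one coefficient family
  covers both; the relation is brought into the shape of \<open>theta_independent\<close> by
  changing the sign of the projective coefficients.\<close>

lemma rp_family:
 assumes T: "rp T" and S: "reps A (fst T) S" and R: "reps A (snd T) R"
 shows "inj_on (case_sum (tf K A) (pf K A)) (S <+> R)" "Fn.independent (case_sum (tf K A) (pf K A) ` (S <+> R))"
  and "!!c. (!!Y. (\<Sum>i\<in>S <+> R. c i * case_sum (tf K A) (pf K A) i Y) = 0) ==> ALL i:S <+> R. c i = 0"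
  and "gens K A T = case_sum (tf K A) (pf K A) ` (S <+> R)"
proof -
 have fin: "finite S" "finite R" and sub: "S <= ind A (fst T)" "R <= ind A (snd T)" using S R by (auto simp: reps_def)
 define F where "F = case_sum (tf K A) (pf K A)"
 have z: "ALL i:S <+> R. c i = 0" if c: "!!y. (\<Sum>i\<in>S <+> R. c i * F i y) = 0" for c
 proof -
  have "(\<Sum>M\<in>S. c (Inl M) * theta K A M Y) = (\<Sum>Q\<in>R. (- c (Inr Q)) * real (hdim K A Q Y))" if "Y : fmods A" for Y
   using c[of Y] that unfolding sum.Plus[OF fin] by (simp add: F_def tf_def pf_def sum_negf)
  note th = theta_independent[OF fin rigid_set_ind[OF T sub] _ _ _ _ this]
  have "ALL M:S. c (Inl M) = 0" "ALL Q:R. - c (Inr Q) = 0"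
   by (rule th; use sub indD(2) S R in \<open>auto simp: reps_def\<close>)+
  thus ?thesis by auto
 qed
 have FI: "F ` (S <+> R) = tf K A ` S \<union> pf K A ` R" unfolding F_def by (force simp: image_iff)
 note f = independent_family[OF finite_Plus[OF fin], of F, OF z]
 show "inj_on (case_sum (tf K A) (pf K A)) (S <+> R)" "Fn.independent (case_sum (tf K A) (pf K A) ` (S <+> R))"
  using f unfolding F_def by simp_all
 show "ALL i:S <+> R. c i = 0" if "!!Y. (\<Sum>i\<in>S <+> R. c i * case_sum (tf K A) (pf K A) i Y) = 0" for c
  by (rule z) (use that in \<open>simp add: F_def\<close>)
 show "gens K A T = case_sum (tf K A) (pf K A) ` (S <+> R)"
  unfolding gens_def tf_reps[OF S] pf_reps[OF R] using FI by (simp add: F_def)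
qed

lemma rp_basis:
 assumes T: "rp T"
 obtains B where "finite B" "Fn.independent B" "card B = pair_size A T" "Fn.span B = Fn.span (gens K A T)"
proof -
 note r = rpD[OF T]
 obtain S where S: "reps A (fst T) S" by (rule reps_exists[OF fmD(1)[OF r(1)]])
 obtain R where R: "reps A (snd T) R" by (rule reps_exists[OF fmD(1)[OF r(5)]])
 have fin: "finite S" "finite R" using S R by (auto simp: reps_def)
 note f = rp_family[OF T S R]
 have "card (S <+> R) = num_summands A (fst T) + num_summands A (snd T)"
  using card_Plus[OF fin] num_summands_reps[OF fmD(1)[OF r(1)] S] num_summands_reps[OF fmD(1)[OF r(5)] R] by simp
 hence "card (gens K A T) = pair_size A T" unfolding f(4) using card_image[OF f(1)] by (cases T) simp
 thus thesis using that[of "gens K A T"] f(2) fin unfolding f(4) by simp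
qed

lemma num_summands_zero:
 assumes "M : fmods A" "car M = {\<zero>\<^sub>M}" shows "num_summands A M = 0"
 using num_summands_reps[OF fmD(1)[OF assms(1)], of "{}"] ind_zero[OF fmD(2)[OF assms(1)] assms(2)] by (simp add: reps_def)

lemma algebra_rank_copy:
 assumes "projective A R" "mod_iso A (regular A) R" shows "algebra_rank A = num_summands A R" "ind A R = ind A (regular A)"
proof -
 show e: "ind A R = ind A (regular A)"
  unfolding ind_def using iso_imp_retract_eq[OF right_module_regular[OF ring_A] projD(3)[OF assms(1)] assms(2)] by blast
 obtain S where S: "reps A (regular A) S" by (rule reps_exists[OF fdm_regular])
 hence "reps A R S" unfolding reps_def e .
 thus "algebra_rank A = num_summands A R"
  unfolding algebra_rank_def using num_summands_reps[OF fdm_regular S] num_summands_reps[OF projD(2)[OF assms(1)]] by simp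
qed

text \<open>Apply \<open>rp_basis\<close> to the pair (0, A): the functions of the indecomposable
  projectives are independent and their number is the rank.\<close>

lemma regular_basis:
 obtains B where "finite B" "Fn.independent B" "card B = algebra_rank A" "Fn.span B = Fn.span (pf K A ` ind A (regular A))"
proof -
 obtain R :: "('k, 'a) fmod" where R: "projective A R" "mod_iso A (regular A) R" by (rule regular_copy)
 obtain Z :: "('k, 'a) fmod" where Z: "Z : fmods A" "car Z = {\<zero>\<^sub>Z}" by (rule zero_fmod_exists)
 have h: "hdim K A R Z = 0"
  unfolding hdim_eq_0_iff[OF projD(2)[OF R(1)] fmD(1)[OF Z(1)]] using Z(2) hom_closed by fastforce
 have "rp (Z, R)" unfolding rp_def using Z R h ext0_zero_cod by simp
 from rp_basis[OF this] obtain B where "finite B" "Fn.independent B" "card B = pair_size A (Z, R)" "Fn.span B = Fn.span (gens K A (Z, R))" by metis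
 moreover have "gens K A (Z, R) = pf K A ` ind A (regular A)" by (simp add: gens_def ind_zero[OF fmD(2)[OF Z(1)] Z(2)] algebra_rank_copy(2)[OF R])
 ultimately show thesis using that[of B] algebra_rank_copy(1)[OF R] num_summands_zero[OF Z] by simp
qed

lemma gens_sub_regular:
 assumes "rp T" shows "gens K A T <= Fn.span (pf K A ` ind A (regular A))"
proof -
 have "tf K A ` ind A (fst T) <= Fn.span (pf K A ` ind A (regular A))" using tf_span_regular indD(1) by blast
 moreover have "pf K A ` ind A (snd T) <= Fn.span (pf K A ` ind A (regular A))"
  using image_mono[OF ind_sub_regular[OF rpD(3)[OF assms]], of "pf K A"] Fn.span_superset by (rule order_trans)
 ultimately show ?thesis by (simp add: gens_def)
qed

text \<open>The functions of the pair lie in the span belonging to the regular module, so their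
  basis extends to a basis of that span. Bounds on the size of a pair and the statements on full and
  almost full pairs are read off from the two cardinalities.\<close>

lemma rp_basis_extend:
 assumes T: "rp T"
 obtains B C where "finite C" "B <= C" "card B = pair_size A T" "card C = algebra_rank A"
  "Fn.span B = Fn.span (gens K A T)" "Fn.span C = Fn.span (pf K A ` ind A (regular A))"
proof -
 obtain B where B: "finite B" "Fn.independent B" "card B = pair_size A T" "Fn.span B = Fn.span (gens K A T)" by (rule rp_basis[OF T])
 obtain R where R: "finite R" "Fn.independent R" "card R = algebra_rank A" "Fn.span R = Fn.span (pf K A ` ind A (regular A))" by (rule regular_basis)
 have BR: "B <= Fn.span R" using Fn.span_superset[of B] B(4) R(4) Fn.span_minimal[OF gens_sub_regular[OF T] Fn.subspace_span] by simp
 obtain C where C: "B <= C" "C <= Fn.span R" "Fn.independent C" "Fn.span R <= Fn.span C"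
  using Fn.maximal_independent_subset_extend[OF BR B(2)] by metis
 have c: "finite C" "card C <= card R" using Fn.independent_span_bound[OF R(1) C(3,2)] by auto
 have "card R <= card C" using Fn.independent_span_bound[OF c(1) R(2)] C(4) Fn.span_superset[of R] by blast
 moreover have "Fn.span C <= Fn.span R" by (rule Fn.span_minimal[OF C(2) Fn.subspace_span])
 ultimately show thesis using that[OF c(1) C(1) B(3) _ B(4)] c(2) C(4) R(3,4) by simp
qed

lemma pair_size_le:
 assumes T: "rp T" shows "pair_size A T <= algebra_rank A"
 by (rule rp_basis_extend[OF T]) (metis card_mono)

lemma span_full:
 assumes T: "rp T" and "pair_size A T = algebra_rank A"
 shows "Fn.span (gens K A T) = Fn.span (pf K A ` ind A (regular A))"
 by (rule rp_basis_extend[OF T]) (metis assms(2) card_subset_eq)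

lemma span_almost:
 assumes T: "rp T" and s: "pair_size A T + 1 = algebra_rank A"
 obtains x where "pf K A ` ind A (regular A) <= Fn.span (insert x (gens K A T))"
proof -
 obtain B C where BC: "finite C" "B <= C" "card B = pair_size A T" "card C = algebra_rank A"
  "Fn.span B = Fn.span (gens K A T)" "Fn.span C = Fn.span (pf K A ` ind A (regular A))" by (rule rp_basis_extend[OF T])
 have "card (C - B) = 1" using card_Diff_subset[OF finite_subset[OF BC(2,1)] BC(2)] BC(3,4) s by simp
 then obtain x where "C - B = {x}" by (auto simp: card_1_singleton_iff)
 hence "C = insert x B" using BC(2) by blast
 hence "Fn.span (insert x (gens K A T)) = Fn.span C" by (simp add: Fn.span_insert BC(5))
 thus thesis using that BC(6) Fn.span_superset by metis
qed

lemma rank_le_card: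
 assumes "finite C" "pf K A ` ind A (regular A) <= Fn.span C"
 shows "algebra_rank A <= card C"
 by (rule regular_basis) (metis Fn.dim_eq_card Fn.dim_le_card assms)

lemma rank_le_pair_size:
 assumes T: "rp T" and s: "pf K A ` ind A (regular A) <= Fn.span (gens K A T)"
 shows "algebra_rank A <= pair_size A T"
 by (rule rp_basis[OF T]) (metis rank_le_card s)

lemma rank_le_Suc_pair_size:
 assumes T: "rp T" and s: "pf K A ` ind A (regular A) <= Fn.span (insert x (gens K A T))"
 shows "algebra_rank A <= Suc (pair_size A T)"
proof (rule rp_basis[OF T])
 fix B assume B: "finite B" "card B = pair_size A T" "Fn.span B = Fn.span (gens K A T)"
 have "algebra_rank A <= card (insert x B)" using s by (intro rank_le_card) (simp_all add: B Fn.span_insert)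
 also have "... <= Suc (card B)" using B(1) by (simp add: card_insert_if)
 finally show ?thesis by (simp add: B)
qed

text \<open>Representatives of the smaller set inject into those of the larger one up to
  isomorphism. Equality of the counts makes this injection onto, and \<open>ind\<close> is closed
  under isomorphism.\<close>

lemma num_summands_mono:
 assumes M: "M : fmods A" and N: "N : fmods A" and s: "ind A M <= ind A N"
 shows "num_summands A M <= num_summands A N" "num_summands A M = num_summands A N ==> ind A M = ind A N"
proof -
 obtain S where S: "reps A M S" by (rule reps_exists[OF fmD(1)[OF M]])
 obtain R where R: "reps A N R" by (rule reps_exists[OF fmD(1)[OF N]])
 note nS = num_summands_reps[OF fmD(1)[OF M] S] and nR = num_summands_reps[OF fmD(1)[OF N] R]
 have "ALL L:ind A N. EX L':R. mod_iso A L L'" using R by (simp add: reps_def)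
 then obtain h where h: "!!L. L : ind A N ==> h L : R & mod_iso A L (h L)" by metis
 have Sd: "finite S" "S <= ind A M" "!!N L. N : S ==> L : S ==> mod_iso A N L ==> N = L" "!!N. N : ind A M ==> EX L:S. mod_iso A N L"
  and Rd: "finite R" "R <= ind A N"
  using S R by (auto simp: reps_def)
 have iso: "mod_iso A L L'" if "L : ind A N" "L' : ind A N" "h L = h L'" for L L'
 proof -
  have F: "L : fmods A" "L' : fmods A" "h L : fmods A" using that h Rd(2) indD(1) by blast+
  show ?thesis using fmod_iso_trans[OF F(1,3)] fmod_iso_sym[OF F(2,3)] h[OF that(1)] h[OF that(2)] that(3) by metis
 qed
 have inj: "inj_on h S" by (rule inj_onI) (use Sd(2,3) iso s in blast)
 have im: "h ` S <= R" using h Sd(2) s by blast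
 show le: "num_summands A M <= num_summands A N" unfolding nS nR using card_inj_on_le[OF inj im Rd(1)] .
 assume "num_summands A M = num_summands A N"
 hence "h ` S = R" using card_subset_eq[OF Rd(1) im] card_image[OF inj] nS nR by simp
 hence "L : ind A M" if L: "L : ind A N" for L
 proof -
  obtain L' where L': "L' : S" "h L' = h L" using h[OF L] \<open>h ` S = R\<close> by (metis imageE)
  hence "mod_iso A L' L" using iso L Sd(2) s by blast
  thus ?thesis using ind_iso_closed[of L' M L] L' Sd(2) indD(1)[OF L] by blast
 qed
 thus "ind A M = ind A N" using s by blast
qed

lemma finite_cover_subset:
 assumes M: "M : fmods A" and S: "S <= ind A M"
 obtains R where "finite R" "R <= S" "!!N. N : S ==> EX L:R. mod_iso A N L"
proof -
 obtain R where R: "reps A M R" by (rule reps_exists[OF fmD(1)[OF M]])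
 define pick where "pick = (%L :: ('k, 'a) fmod. SOME N. N : S & mod_iso A N L)"
 let ?R = "pick ` {L : R. EX N:S. mod_iso A N L}"
 have p: "pick L : S & mod_iso A (pick L) L" if "EX N:S. mod_iso A N L" for L
  unfolding pick_def by (rule someI_ex) (use that in blast)
 show thesis
 proof (rule that[of ?R])
  show "finite ?R" using R by (simp add: reps_def)
  show "?R <= S" using p by auto
  fix N assume N: "N : S"
  then obtain L where L: "L : R" "mod_iso A N L" using R S unfolding reps_def by blast
  hence pl: "pick L : S" "mod_iso A (pick L) L" using p N by blast+
  have F: "N : fmods A" "L : fmods A" "pick L : fmods A" using N S pl(1) indD(1) L(1) R unfolding reps_def by blast+
  have "mod_iso A N (pick L)" using fmod_iso_trans[OF F(1,2) L(2)] fmod_iso_sym[OF F(3,2) pl(2)] by blast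
  thus "EX L:?R. mod_iso A N L" using L N by blast
 qed
qed

lemma basic_with_ind:
 assumes M: "M : fmods A" and S: "S <= ind A M" and c: "!!N N'. N : S ==> N' : fmods A ==> mod_iso A N N' ==> N' : S"
 obtains D :: "('k, 'a) fmod" where "D : fmods A" "basic A D" "ind A D = S"
proof -
 obtain R where R: "finite R" "R <= S" "!!N. N : S ==> EX L:R. mod_iso A N L" by (rule finite_cover_subset[OF M S]) blast
 have RF: "R <= fmods A" "!!N. N : R ==> indecomposable A N" using R(2) S indD(1,2) by blast+
 obtain D :: "('k, 'a) fmod" where D: "D : fmods A" "basic A D" "!!N. N : ind A D \<longleftrightarrow> N : fmods A & (EX L:R. mod_iso A N L)"
  using basic_exists[OF R(1) RF] by blast
 have "ind A D = S"
 proof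
  show "ind A D <= S" using D(3) c R(2) RF(1) fmod_iso_sym by blast
  show "S <= ind A D" using D(3) R(3) S indD(1) by blast
 qed
 thus thesis using that D by blast
qed

lemma nul_iso_closed:
 assumes S: "S <= fmods A" and N: "N : nul K A S" "N' : fmods A" "mod_iso A N N'"
 shows "N' : nul K A S"
proof -
 note d = nulD[OF N(1)] and f = projD(1)[OF nulD(1)[OF N(1)]]
 have "projective A N'" by (rule proj_retract[OF d(1) N(2) mod_iso_retract(2)[OF fmD(2)[OF f] N(3)]])
 moreover have "indecomposable A N'" by (rule indec_iso[OF fmD(2)[OF f] fmD(2)[OF N(2)] N(3) d(2)])
 moreover have "hdim K A N' Y = 0" if "Y : S" for Y
  using hdim_iso_dom[OF fmD(1)[OF f] fmD(1)[OF N(2)] fmD(1) N(3), of Y] S that d(3) by auto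
 ultimately show ?thesis by (simp add: nul_def)
qed

lemma nul_basic:
 assumes S: "S <= fmods A"
 obtains P where "projective A P" "basic A P" "ind A P = nul K A S" "!!Y. Y : S ==> hdim K A P Y = 0"
proof -
 obtain R :: "('k, 'a) fmod" where R: "projective A R" "mod_iso A (regular A) R" by (rule regular_copy)
 have "nul K A S <= ind A R" unfolding algebra_rank_copy(2)[OF R] ind_regular nul_def by auto
 then obtain P :: "('k, 'a) fmod" where P: "P : fmods A" "basic A P" "ind A P = nul K A S"
  by (rule basic_with_ind[OF projD(1)[OF R(1)] _ nul_iso_closed[OF S]])
 moreover have "projective A P" by (rule projective_of_ind[OF P(1)]) (use P(3) nulD(1) in auto)
 moreover have "hdim K A P Y = 0" if "Y : S" for Y
  by (rule hdim_zero_of_ind[OF P(1)]) (use P(3) S that nulD(3) in auto)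
 ultimately show thesis by (intro that)
qed

lemma basic_version:
 assumes M: "M : fmods A"
 obtains M' :: "('k, 'a) fmod" where "M' : fmods A" "basic A M'" "ind A M' = ind A M"
 by (rule basic_with_ind[OF M subset_refl ind_iso_closed]) auto

text \<open>The Bongartz-type completion: the largest rigid pair with given first component.\<close>

lemma max_pair:
 assumes M: "M : fmods A" "ext0 A M M"
 obtains M' P' where "rp (M', P')" "basic A M'" "basic A P'" "ind A M' = ind A M" "ind A P' = nul K A {M}"
proof -
 obtain M' :: "('k, 'a) fmod" where M': "M' : fmods A" "basic A M'" "ind A M' = ind A M" by (rule basic_version[OF M(1)])
 obtain P' :: "('k, 'a) fmod" where P': "projective A P'" "basic A P'" "ind A P' = nul K A {M}" "!!Y. Y : {M} ==> hdim K A P' Y = 0"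
  by (rule nul_basic[of "{M}"]) (use M in auto)
 have r: "retract A M' M" by (rule basic_retract[OF M'(1) M(1) M'(2)]) (use M'(3) in auto)
 have "ext0 A M' M'" by (rule ext0_retract_both[OF M M'(1,1) r r])
 moreover have "hdim K A P' M' = 0"
  by (rule hdim_retract_both[OF projD(1)[OF P'(1)] M(1) _ projD(1)[OF P'(1)] M'(1) retract_refl r]) (use P'(4) in simp)
 ultimately show thesis using that[of M' P'] M' P' by (simp add: rp_def)
qed

lemma tilting_iff: "T : tau_tilting_pairs K A \<longleftrightarrow> rp T & basic A (fst T) & basic A (snd T) & pair_size A T = algebra_rank A"
 unfolding tau_tilting_pairs_def tau_rigid_pair_iff[symmetric] by (cases T) auto

lemma nul_ind:
 assumes M: "M : fmods A" "M' : fmods A" "ind A M' <= ind A M" shows "nul K A {M} <= nul K A {M'}"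
proof
 fix Q assume Q: "Q : nul K A {M}"
 note f = projD(1)[OF nulD(1)[OF Q]]
 have "hdim K A Q M' = 0"
 proof (rule hdim_zero_of_ind_cod[OF f M(2)])
  fix N assume "N : ind A M'"
  hence "N : ind A M" using M(3) by blast
  thus "hdim K A Q N = 0" using hdim_retract_both[OF f M(1) _ f indD(1) retract_refl indD(3)] nulD(3)[OF Q] by blast
 qed
 thus "Q : nul K A {M'}" using nulD[OF Q] by (simp add: nul_def)
qed

text \<open>Enlarging the projective part to everything permitted by \<open>nul\<close> still gives
  a tau-rigid pair, which cannot exceed the rank. Hence nothing was added, and a tau-tilting pair is
  determined by its module part.\<close>

lemma tilting_snd:
 assumes T: "T : tau_tilting_pairs K A"
 shows "ind A (snd T) = nul K A {fst T}"
proof -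
 have r: "rp T" and s: "pair_size A T = algebra_rank A" using T by (auto simp: tilting_iff)
 note rd = rpD[OF r]
 obtain M' P' where M': "rp (M', P')" "ind A M' = ind A (fst T)" "ind A P' = nul K A {fst T}"
  using max_pair[OF rd(1,2)] by metis
 note rd' = rpD[OF M'(1), simplified]
 have sub: "ind A (snd T) <= ind A P'" unfolding M'(3) by (rule ind_sub_nul[OF rd(3)]) (use rd in auto)
 have "num_summands A M' = num_summands A (fst T)"
  using num_summands_mono(1)[OF rd'(1) rd(1)] num_summands_mono(1)[OF rd(1) rd'(1)] M'(2) by simp
 hence "num_summands A P' <= num_summands A (snd T)" using pair_size_le[OF M'(1)] s by (cases T) simp
 hence "ind A (snd T) = ind A P'"
  using num_summands_mono[OF rd(5) rd'(5) sub] by simp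
 thus ?thesis using M'(3) by simp
qed

lemma tilting_isoI:
 assumes T: "T : tau_tilting_pairs K A" and U: "U : tau_tilting_pairs K A" and e: "ind A (fst T) = ind A (fst U)"
 shows "(T, U) : tau_tilting_iso K A"
proof -
 have t: "rp T" "basic A (fst T)" "basic A (snd T)" and u: "rp U" "basic A (fst U)" "basic A (snd U)" using T U by (auto simp: tilting_iff)
 note t' = rpD[OF t(1)] and u' = rpD[OF u(1)]
 have "nul K A {fst T} = nul K A {fst U}" using nul_ind[OF t'(1) u'(1)] nul_ind[OF u'(1) t'(1)] e by simp
 hence "ind A (snd T) = ind A (snd U)" using tilting_snd T U by simp
 thus ?thesis unfolding tau_tilting_iso_def using T U basic_unique[OF t'(1) u'(1) t(2) u(2) e] basic_unique[OF t'(5) u'(5) t(3) u(3)] by simp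
qed

end

section \<open>The quotient algebra as a finite-dimensional algebra\<close>

locale fd_quotient = fd_algebra K A for K :: "'k ring" and A :: "('k, 'a) module" +
 fixes I :: "'a set"
 assumes I_ideal: "ideal I A"
begin

abbreviation B :: "('k, 'a set) module" where "B \<equiv> quot_algebra A I"

abbreviation pr :: "'a => 'a set" where "pr a \<equiv> I +>\<^sub>A a"

lemma carrier_B: "car B = pr ` car A"
 by (auto simp: quot_algebra_def FactRing_simps)

lemma pr_closed: "a : car A ==> pr a : car B"
 by (simp add: carrier_B)

lemma
 shows pr_add: "a : car A ==> b : car A ==> pr a \<oplus>\<^sub>B pr b = pr (a \<oplus>\<^sub>A b)"
  and pr_mult: "a : car A ==> b : car A ==> pr a \<otimes>\<^sub>B pr b = pr (a \<otimes>\<^sub>A b)"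
  and pr_one: "\<one>\<^sub>B = pr \<one>\<^sub>A"
  and pr_zero: "\<zero>\<^sub>B = pr \<zero>\<^sub>A"
proof -
 interpret I: ideal I A by (rule I_ideal)
 interpret h: ring_hom_ring A "A Quot I" "pr" by (rule I.rcos_ring_hom_ring)
 show "a : car A ==> b : car A ==> pr a \<oplus>\<^sub>B pr b = pr (a \<oplus>\<^sub>A b)"
  "a : car A ==> b : car A ==> pr a \<otimes>\<^sub>B pr b = pr (a \<otimes>\<^sub>A b)" "\<one>\<^sub>B = pr \<one>\<^sub>A" "\<zero>\<^sub>B = pr \<zero>\<^sub>A"
  using h.hom_add h.hom_mult h.hom_one h.hom_zero by (auto simp: quot_algebra_def)
qed

lemma mem_pr: "a : car A ==> x : pr a \<longleftrightarrow> (EX i:I. x = i \<oplus>\<^sub>A a)"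
 by (auto simp: a_r_coset_def')

lemma I_sub: "i : I ==> i : car A"
 using I_ideal ideal.Icarr by metis

lemma I_zero: "\<zero>\<^sub>A : I"
 using additive_subgroup.zero_closed[OF ideal.axioms(1)[OF I_ideal]] .

lemma pr_add_I: "a : car A ==> i : I ==> pr (i \<oplus>\<^sub>A a) = pr a"
proof -
 interpret I: ideal I A by (rule I_ideal)
 assume a: "a : car A" "i : I"
 hence "i \<oplus>\<^sub>A a : pr a" by (auto simp: mem_pr)
 thus ?thesis using I.a_repr_independence' a(1) by metis
qed

lemma pr_smult:
 assumes c: "c : car K" and a: "a : car A" shows "c \<odot>\<^sub>B pr a = pr (c \<odot>\<^sub>A a)"
proof -
 interpret I: ideal I A by (rule I_ideal)
 have e: "pr (c \<odot>\<^sub>A x) = pr (c \<odot>\<^sub>A a)" if xa: "x : pr a" for x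
 proof -
  obtain i where i: "i : I" "x = i \<oplus>\<^sub>A a" using xa unfolding mem_pr[OF a] by blast
  have "c \<odot>\<^sub>A i : I"
   using I.I_r_closed[OF i(1) kap_closed[OF c]] kap_right[OF c I_sub[OF i(1)]] by simp
  moreover have "c \<odot>\<^sub>A x = c \<odot>\<^sub>A i \<oplus>\<^sub>A c \<odot>\<^sub>A a" using i I_sub a c by (simp add: smult_r_distr)
  ultimately show ?thesis using pr_add_I[of "c \<odot>\<^sub>A a"] a c by simp
 qed
 have n: "a : pr a" using mem_pr[OF a] I_zero a by (intro iffD2[OF mem_pr[OF a]] bexI[of _ "\<zero>\<^sub>A"]) auto
 have "c \<odot>\<^sub>B pr a = (\<Union>x\<in>pr a. pr (c \<odot>\<^sub>A x))" by (simp add: quot_algebra_def)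
 moreover have "(\<Union>x\<in>pr a. pr (c \<odot>\<^sub>A x)) = pr (c \<odot>\<^sub>A a)" 
 proof (rule SUP_eq_const)
  show "pr a ~= {}" using n by blast
 qed (rule e)
 ultimately show ?thesis by simp
qed

lemma ring_B: "ring B"
proof -
 interpret I: ideal I A by (rule I_ideal)
 interpret Q: ring "A Quot I" by (rule I.quotient_is_ring)
 have s: "car B = car (A Quot I)" "mult B = mult (A Quot I)" "one B = one (A Quot I)" "zero B = zero (A Quot I)" "add B = add (A Quot I)"
  by (simp_all add: quot_algebra_def)
 show ?thesis
  by (intro ringI abelian_groupI monoidI; unfold s)
   (auto simp: Q.m_assoc Q.l_distr Q.r_distr Q.a_ac intro: bexI[of _ "\<ominus>\<^sub>(A Quot I) x" for x] Q.l_neg)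
qed

lemma module_B: "Module.module K B"
proof -
 interpret B: ring B by (rule ring_B)
 have g: "abelian_group B" by (rule B.abelian_group_axioms)
 show ?thesis
 proof (rule Module.moduleI[OF K.is_cring g])
  fix a x y assume *: "a : car K" "x : car B" "y : car B"
  show "a \<odot>\<^sub>B x : car B" using *(1,2) by (auto simp: carrier_B pr_smult)
  show "a \<odot>\<^sub>B (x \<oplus>\<^sub>B y) = a \<odot>\<^sub>B x \<oplus>\<^sub>B a \<odot>\<^sub>B y"
   using * by (auto simp: carrier_B pr_smult pr_add smult_r_distr)
 next
  fix a b x assume *: "a : car K" "b : car K" "x : car B"
  show "(a \<oplus>\<^sub>K b) \<odot>\<^sub>B x = a \<odot>\<^sub>B x \<oplus>\<^sub>B b \<odot>\<^sub>B x"
   using * by (auto simp: carrier_B pr_smult pr_add smult_l_distr)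
  show "(a \<otimes>\<^sub>K b) \<odot>\<^sub>B x = a \<odot>\<^sub>B (b \<odot>\<^sub>B x)"
   using * by (auto simp: carrier_B pr_smult smult_assoc1)
 next
  fix x assume "x : car B" thus "\<one>\<^sub>K \<odot>\<^sub>B x = x" by (auto simp: carrier_B pr_smult)
 qed
qed

lemma fin_gen_B: "fin_gen K B"
proof -
 obtain S where S: "finite S" "S <= car A" "!!N. submodule N K A ==> S <= N ==> N = car A"
  using finite_dimensional unfolding fin_gen_def by auto
 interpret B: Module.module K B by (rule module_B)
 show ?thesis unfolding fin_gen_def
 proof (intro exI[of _ "pr ` S"] conjI allI impI)
  show "finite (pr ` S)" "pr ` S <= car B" using S by (auto simp: carrier_B)
  fix N assume N: "submodule N K B & pr ` S <= N"
  then interpret N: submodule N K B by simp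
  let ?N = "{a : car A. pr a : N}"
  have inv: "pr (\<ominus>\<^sub>A a) = \<ominus>\<^sub>B pr a" if "a : car A" for a
   using B.minus_equality[of "pr (\<ominus>\<^sub>A a)" "pr a"] that by (simp add: pr_add pr_zero A.l_neg pr_closed)
  have "submodule ?N K A"
  proof (rule submoduleI)
   show "\<zero>\<^sub>A : ?N" using N.one_closed by (simp add: pr_zero)
   show "\<ominus>\<^sub>A a : ?N" if "a : ?N" for a
    using that N.m_inv_closed[of "pr a"] inv by (simp add: a_inv_def)
   show "a \<oplus>\<^sub>A b : ?N" if "a : ?N" "b : ?N" for a b
    using that N.m_closed[of "pr a" "pr b"] by (simp add: pr_add)
   show "c \<odot>\<^sub>A b : ?N" if "c : car K" "b : ?N" for c b
    using that N.smult_closed[of c "pr b"] by (simp add: pr_smult)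
  qed auto
  hence "?N = car A" by (rule S(3)) (use N S(2) in auto)
  hence "car B <= N" by (auto simp: carrier_B)
  thus "N = car B" using N.subset by auto
 qed
qed

lemma fd_algebra_B: "fd_algebra K B"
proof -
 have 1: "fd_algebra_axioms K B"
 proof
  fix c x y assume *: "c : car K" "x : car B" "y : car B"
  show "(c \<odot>\<^sub>B x) \<otimes>\<^sub>B y = c \<odot>\<^sub>B (x \<otimes>\<^sub>B y)"
   using * by (auto simp: carrier_B pr_smult pr_mult smult_mult_left)
  show "x \<otimes>\<^sub>B (c \<odot>\<^sub>B y) = c \<odot>\<^sub>B (x \<otimes>\<^sub>B y)"
   using * by (auto simp: carrier_B pr_smult pr_mult smult_mult_right)
 qed (rule fin_gen_B)
 show ?thesis by (rule fd_algebra.intro[OF K.algebraically_closed_axioms ring_B module_B 1])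
qed

end

sublocale fd_quotient \<subseteq> Q: fd_algebra K "quot_algebra A I" by (rule fd_algebra_B)

section \<open>Restriction of B-modules to A and induction of A-modules to B\<close>

context fd_quotient
begin

definition ofB :: "('a set, 'v) module => ('a, 'v) module" where
 "ofB Y = \<lparr>carrier = car Y, mult = undefined, one = undefined, zero = zero Y, add = add Y,
  smult = (%a x. pr a \<odot>\<^sub>Y x)\<rparr>"

lemma ofB_simps [simp]: "car (ofB Y) = car Y" "zero (ofB Y) = zero Y" "add (ofB Y) = add Y" "smult (ofB Y) = (%a x. pr a \<odot>\<^sub>Y x)"
 by (simp_all add: ofB_def)

lemma right_module_ofB: assumes "right_module B Y" shows "right_module A (ofB Y)"
proof -
 interpret Y: right_module B Y by fact
 show ?thesis
  by (rule right_moduleI[OF ring_A])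
   (auto simp: Y.M.a_ac pr_closed Y.act_closed Y.act_add_right Y.act_add_left[symmetric] Y.act_mult[symmetric] Y.act_one
    pr_add pr_mult pr_one[symmetric] intro: bexI[of _ "\<ominus>\<^sub>Y x" for x] Y.M.l_neg)
qed

lemma hom_ofB: "is_hom A (ofB M) (ofB N) f \<longleftrightarrow> is_hom B M N f"
 unfolding is_hom_def by (auto simp: carrier_B)

lemma submodule_ofB:
 assumes "right_module B Y" shows "submodule N A (ofB Y) \<longleftrightarrow> submodule N B Y"
proof -
 interpret Y: right_module B Y by fact
 interpret O: right_module A "ofB Y" by (rule right_module_ofB[OF assms])
 show ?thesis
 proof
  assume "submodule N A (ofB Y)"
  note d = O.submoduleD[OF this, simplified]
  show "submodule N B Y" by (rule Y.submoduleI) (use d(1-3,6) in \<open>auto simp: carrier_B\<close>)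
 next
  assume "submodule N B Y"
  note d = Y.submoduleD[OF this]
  show "submodule N A (ofB Y)" by (rule O.submoduleI) (use d(1-3,6) in \<open>auto simp: pr_closed\<close>)
 qed
qed

lemma fmods_ofB: assumes "Y : fmods B" shows "ofB Y : fmods A"
proof -
 have r: "right_module B Y" and f: "fin_gen B Y" using assms by (auto simp: fmods_def)
 have "submodule N A (ofB Y) = submodule N B Y" for N by (rule submodule_ofB[OF r])
 thus ?thesis using f right_module_ofB[OF r] by (simp add: fmods_def fin_gen_def)
qed

text \<open>N is the tensor product of M with B, equivalently M/MI, with q the projection. Only the
  universal property for maps into B-modules is recorded, so any representative of the isomorphism
  class qualifies.\<close>

definition isbar :: "('k, 'a) fmod => ('k, 'a set) fmod => ((nat => 'k) => (nat => 'k)) => bool" where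
 "isbar M N q \<longleftrightarrow> M : fmods A & N : fmods B & is_hom A M (ofB N) q & q ` car M = car N &
  (ALL Y :: ('k, 'a set) fmod. ALL f. Y : fmods B --> is_hom A M (ofB Y) f -->
   (EX g. is_hom B N Y g & (ALL x: car M. g (q x) = f x)))"

lemma isbarD:
 assumes "isbar M N q"
 shows "M : fmods A" "N : fmods B" "is_hom A M (ofB N) q" "q ` car M = car N"
 using assms by (auto simp: isbar_def)

lemma isbar_factor:
 assumes "isbar M N q" "Y : fmods B" "is_hom A M (ofB Y) f"
 obtains g where "is_hom B N Y g" "!!x. x : car M ==> g (q x) = f x"
proof -
 have "ALL Y :: ('k, 'a set) fmod. ALL f. Y : fmods B --> is_hom A M (ofB Y) f -->
   (EX g. is_hom B N Y g & (ALL x: car M. g (q x) = f x))"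
  using assms(1) unfolding isbar_def by (elim conjE)
 hence "EX g. is_hom B N Y g & (ALL x: car M. g (q x) = f x)" using assms(2,3) by simp
 thus thesis using that by (elim exE conjE) simp
qed

lemma bar_exists:
 fixes M :: "('k, 'a) fmod"
 assumes M: "M : fmods A"
 obtains N q where "isbar M N q"
proof -
 note rM = fmD(2)[OF M]
 interpret MM: right_module A M by (rule rM)
 interpret II: ideal I A by (rule I_ideal)
 \<comment> \<open>All submodules containing the products of M with I; their intersection is
   MI.\<close>
 define C where "C = {N. submodule N A M & (ALL i:I. ALL x: car M. i \<odot>\<^sub>M x : N)}"
 have Cc: "car M : C" unfolding C_def using MM.submodule_carrier MM.act_closed I_sub by blast
 have CD: "submodule N A M" if "N : C" for N using that by (simp add: C_def)
 have sC: "submodule (\<Inter>C) A M"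
 proof (rule MM.submoduleI)
  show "\<Inter>C <= car M" using Cc by blast
  show "\<zero>\<^sub>M : \<Inter>C" using MM.submoduleD(2)[OF CD] by (intro InterI)
  show "x \<oplus>\<^sub>M y : \<Inter>C" if "x : \<Inter>C" "y : \<Inter>C" for x y
   by (rule InterI, rule MM.submoduleD(3)[OF CD]) (use that in auto)
  show "a \<odot>\<^sub>M x : \<Inter>C" if "a : car A" "x : \<Inter>C" for a x
   by (rule InterI, rule MM.submoduleD(6)[OF CD]) (use that in auto)
 qed
 obtain R :: "('k, 'a) fmod" and q where R: "R : fmods A" "is_hom A M R q" "q ` car M = car R" "a_kernel M R q = \<Inter>C"
  by (rule fmods_quotient[OF M sC])
 interpret R: right_module A R by (rule fmD(2)[OF R(1)])
 have act0: "i \<odot>\<^sub>R y = \<zero>\<^sub>R" if i: "i : I" and y: "y : car R" for i y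
 proof -
  obtain x where x: "x : car M" "y = q x" using y R(3) by blast
  have "i \<odot>\<^sub>M x : \<Inter>C" using i x(1) by (auto simp: C_def)
  hence "q (i \<odot>\<^sub>M x) = \<zero>\<^sub>R" unfolding R(4)[symmetric] by (simp add: a_kernel_eq)
  thus ?thesis using hom_act[OF R(2) I_sub[OF i] x(1)] x(2) by simp
 qed
 have act_eq: "a \<odot>\<^sub>R y = b \<odot>\<^sub>R y" if "a : pr b" "b : car A" "y : car R" for a b y
  using that mem_pr[OF that(2), of a] act0 I_sub by (auto simp: R.act_add_left R.act_closed)
 \<comment> \<open>A coset acts through any of its representatives; \<open>act_eq\<close> shows that
   the choice does not matter because I acts as zero on M/MI.\<close>
 define N :: "('k, 'a set) fmod" where "N = \<lparr>carrier = car R, mult = undefined, one = undefined, zero = zero R, add = add R,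
  smult = (%Z y. (SOME a. a : Z) \<odot>\<^sub>R y)\<rparr>"
 have self: "a : pr a" if "a : car A" for a
  using that I_zero by (intro iffD2[OF mem_pr[OF that]] bexI[of _ "\<zero>\<^sub>A"]) auto
 have Ns: "car N = car R" "zero N = zero R" "add N = add R" by (simp_all add: N_def)
 have Na: "pr a \<odot>\<^sub>N y = a \<odot>\<^sub>R y" if "a : car A" "y : car R" for a y
  using act_eq[OF someI[of "%b. b : pr a", OF self] that] that by (simp add: N_def)
 have rN: "right_module B N"
  by (rule right_moduleI[OF ring_B])
   (auto simp: Ns carrier_B pr_add pr_mult pr_one Na R.M.a_ac R.act_closed R.act_add_right R.act_add_left R.act_mult R.act_one
    intro: bexI[of _ "\<ominus>\<^sub>R x" for x] R.M.l_neg)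
 have sub: "submodule S B N \<longleftrightarrow> submodule S A R" for S
 proof -
  interpret N: right_module B N by (rule rN)
  show ?thesis
  proof
   assume "submodule S A R"
   note d = R.submoduleD[OF this]
   show "submodule S B N" by (rule N.submoduleI) (use d(1-3,6) in \<open>auto simp: carrier_B Ns Na subset_iff\<close>)
  next
   assume "submodule S B N"
   note d = N.submoduleD[OF this]
   have "a \<odot>\<^sub>R y : S" if "a : car A" "y : S" for a y
    using d(6)[OF pr_closed[OF that(1)] that(2)] Na[OF that(1)] d(1) that(2) by (auto simp: Ns subset_iff)
   thus "submodule S A R" by (intro R.submoduleI) (use d(1-3) in \<open>auto simp: Ns\<close>)
  qed
 qed
 have Nf: "N : fmods B"
  using R(1) rN unfolding fmods_def fin_gen_def by (simp add: sub Ns)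
 have q: "is_hom A M (ofB N) q"
  by (rule is_homI) (auto simp: Ns Na hom_closed[OF R(2)] hom_add[OF R(2)] hom_act[OF R(2)])
 have fac: "EX g. is_hom B N Y g & (ALL x: car M. g (q x) = f x)" if Y: "Y : fmods B" and f: "is_hom A M (ofB Y) f" for Y :: "('k, 'a set) fmod" and f
 proof -
  interpret Y: right_module B Y by (rule Q.fmD(2)[OF Y])
  have rY: "right_module A (ofB Y)" by (rule right_module_ofB[OF Y.right_module_axioms])
  have "a_kernel M (ofB Y) f : C"
  proof -
   have "f (i \<odot>\<^sub>M x) = \<zero>\<^sub>Y" if i: "i : I" and x: "x : car M" for i x
   proof -
    have "pr i = \<zero>\<^sub>B" using pr_add_I[of "\<zero>\<^sub>A" i] i I_sub by (simp add: pr_zero)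
    thus ?thesis using hom_act[OF f I_sub[OF i] x] hom_closed[OF f x] Y.act_zero_left by simp
   qed
   thus ?thesis using submodule_kernel[OF rM rY f] MM.act_closed I_sub by (auto simp: C_def a_kernel_eq)
  qed
  hence k: "\<Inter>C <= a_kernel M (ofB Y) f" by blast
  have rNo: "right_module A (ofB N)" by (rule right_module_ofB[OF rN])
  obtain g where g: "is_hom A (ofB N) (ofB Y) g" "!!x. x : car M ==> g (q x) = f x"
  proof (rule hom_factor[OF rM rNo rY q _ f])
   show "q ` car M = car (ofB N)" using R(3) by (simp add: Ns)
   show "f x = \<zero>\<^sub>(ofB Y)" if "x : car M" "q x = \<zero>\<^sub>(ofB N)" for x
   proof -
    have "x : a_kernel M R q" using that by (simp add: a_kernel_eq Ns)
    thus ?thesis using k R(4) by (auto simp: a_kernel_eq)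
   qed
  qed blast
  thus ?thesis unfolding hom_ofB by blast
 qed
 show thesis by (rule that[of N q]) (use M Nf q R(3) fac Ns in \<open>auto simp: isbar_def\<close>)
qed

text \<open>The adjunction between induction and restriction: composition with q is a K-linear
  bijection of the two Hom spaces.\<close>

lemma bar_hdim:
 assumes b: "isbar M N q" and Y: "Y : fmods B"
 shows "hdim K A M (ofB Y) = hdim K B N Y"
proof -
 note bd = isbarD[OF b]
 note rM = fmD(2)[OF bd(1)] and rY = Q.fmD(2)[OF Y] and rN = Q.fmD(2)[OF bd(2)]
 interpret Y: right_module B Y by (rule rY)
 let ?H = "HK A M (ofB Y)" and ?G = "HK B N Y"
 have kap: "c \<odot>\<^sub>B \<one>\<^sub>B = pr (c \<odot>\<^sub>A \<one>\<^sub>A)" if "c : car K" for c using pr_smult[OF that] by (simp add: pr_one)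
 let ?f = "%h. \<lambda>x\<in> car M. h (q x)"
 have h: "is_hom (Ka K) ?G ?H ?f"
 proof (rule is_homI)
  fix h assume "h : car ?G"
  hence "is_hom A (ofB N) (ofB Y) h" unfolding hom_ofB by (simp add: HomD)
  thus "?f h : car ?H" using HomI[OF rM hom_comp[OF bd(3)]] by simp
 qed (auto simp: fun_eq_iff kap intro: hom_closed[OF bd(3), simplified])
 have qc: "q x : car N" if "x : car M" for x using bd(4) that by blast
 have inj: "inj_on ?f (car ?G)"
 proof (rule inj_onI)
  fix f g assume fg: "f : car ?G" "g : car ?G" "?f f = ?f g"
  have "f y = g y" if yN: "y : car N" for y
  proof -
   obtain x where x: "x : car M" "y = q x" using yN bd(4) by blast
   thus ?thesis using fun_cong[OF fg(3), of x] by simp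
  qed
  thus "f = g" using fg Hom_ext[of f B N Y g] by simp
 qed
 have sur: "?f ` car ?G = car ?H"
 proof
  show "?f ` car ?G <= car ?H" using hom_closed[OF h] by blast
  show "car ?H <= ?f ` car ?G"
  proof
   fix f assume f: "f : car ?H"
   then obtain g where g: "is_hom B N Y g" "!!x. x : car M ==> g (q x) = f x"
    using isbar_factor[OF b Y HomD, of f] by auto
   have "?f (restrict g (car N)) = f"
   proof
    fix x show "?f (restrict g (car N)) x = f x"
     using g(2) qc f by (cases "x : car M") (auto simp: Hom_def)
   qed
   thus "f : ?f ` car ?G" using HomI[OF rN g(1)] by (intro image_eqI[where x="restrict g (car N)"]) simp_all
  qed
 qed
 have fl: "flen (Ka K) ?G" "flen (Ka K) ?H" using Q.flen_HK[OF Q.fmD(1)[OF bd(2)] Q.fmD(1)[OF Y]] flen_HK[OF fmD(1)[OF bd(1)] fmD(1)[OF fmods_ofB[OF Y]]] by auto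
 note rr = Q.right_module_HK[OF rN rY] right_module_HK[OF rM right_module_ofB[OF rY]]
 show ?thesis unfolding hdim_def
  using inj_len_le[OF rr h fl inj] surj_len_le[OF rr h fl sur] by simp
qed

lemma bar_hom:
 assumes b: "isbar M N q" and b': "isbar M' N' q'" and f: "is_hom A M M' f"
 obtains g where "is_hom B N N' g" "!!x. x : car M ==> g (q x) = q' (f x)"
 using isbar_factor[OF b isbarD(2)[OF b'] hom_comp[OF f isbarD(3)[OF b']]] by metis

lemma bar_retract:
 assumes b: "isbar M N q" and b': "isbar M' N' q'" and r: "retract A M M'"
 shows "retract B N N'"
proof -
 obtain s t where st: "is_hom A M M' s" "is_hom A M' M t" "!!x. x : car M ==> t (s x) = x"
  using r unfolding retract_def by auto
 obtain g where g: "is_hom B N N' g" "!!x. x : car M ==> g (q x) = q' (s x)" using bar_hom[OF b b' st(1)] by metis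
 obtain h where h: "is_hom B N' N h" "!!x. x : car M' ==> h (q' x) = q (t x)" using bar_hom[OF b' b st(2)] by metis
 have "h (g y) = y" if y: "y : car N" for y
 proof -
  obtain x where x: "x : car M" "y = q x" using y isbarD(4)[OF b] by blast
  thus ?thesis using g(2) h(2) hom_closed[OF st(1)] st(3) by simp
 qed
 thus ?thesis unfolding retract_def using g(1) h(1) by blast
qed

lemma bar_projective:
 assumes b: "isbar P N q" and P: "projective A P"
 shows "projective B N"
proof (rule Q.projI[OF isbarD(2)[OF b]])
 fix Z Y :: "('k, 'a set) fmod" and g h
 assume *: "Z : fmods B" "Y : fmods B" "is_hom B Z Y g" "g ` car Z = car Y" "is_hom B N Y h"
 note bd = isbarD[OF b]
 have g: "is_hom A (ofB Z) (ofB Y) g" "g ` car (ofB Z) = car (ofB Y)" using *(3,4) by (simp_all add: hom_ofB)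
 have h: "is_hom A (ofB N) (ofB Y) h" using *(5) by (simp add: hom_ofB)
 obtain k where k: "is_hom A P (ofB Z) k" "!!x. x : car P ==> g (k x) = h (q x)"
  using proj_lift[OF P fmods_ofB[OF *(1)] fmods_ofB[OF *(2)] g hom_comp[OF bd(3) h]] by metis
 obtain l where l: "is_hom B N Z l" "!!x. x : car P ==> l (q x) = k x" using isbar_factor[OF b *(1) k(1)] by metis
 have "g (l y) = h y" if "y : car N" for y
 proof -
  obtain x where "x : car P" "y = q x" using \<open>y : car N\<close> bd(4) by blast
  thus ?thesis using l(2) k(2) by simp
 qed
 thus "EX h'. is_hom B N Z h' & (ALL x: car N. g (h' x) = h x)" using l(1) by blast
qed

text \<open>Induction is right exact and preserves projectives, so a presentation over A becomes one
  over B; extension of maps carries over by the universal property.\<close>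

lemma bar_pres:
 assumes v: "pres A P1 f P0 p M" and M: "isbar M N q" and b0: "isbar P0 N0 q0" and b1: "isbar P1 N1 q1"
 obtains f' p' where "pres B N1 f' N0 p' N" "!!Y. Y : fmods B ==> extl A P1 f P0 (ofB Y) ==> extl B N1 f' N0 Y"
proof -
 note pd = presD[OF v]
 note bd = isbarD[OF M] and bd0 = isbarD[OF b0] and bd1 = isbarD[OF b1]
 obtain f' where f': "is_hom B N1 N0 f'" "!!x. x : car P1 ==> f' (q1 x) = q0 (f x)" using bar_hom[OF b1 b0 pd(3)] by metis
 obtain p' where p': "is_hom B N0 N p'" "!!x. x : car P0 ==> p' (q0 x) = q (p x)" using bar_hom[OF b0 M pd(4)] by metis
 have fc: "f x : car P0" if "x : car P1" for x using hom_closed[OF pd(3) that] .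
 have pc: "p x : car M" if "x : car P0" for x using hom_closed[OF pd(4) that] .
 have q0c: "q0 x : car N0" if "x : car P0" for x using bd0(4) that by blast
 have q1c: "q1 x : car N1" if "x : car P1" for x using bd1(4) that by blast
 have zM: "q \<zero>\<^sub>M = \<zero>\<^sub>N" using hom_zero[OF fmD(2)[OF bd(1)] right_module_ofB[OF Q.fmD(2)[OF bd(2)]] bd(3)] by simp
 have "p' ` car N0 = q ` p ` car P0" unfolding bd0(4)[symmetric] image_image using p'(2) by auto
 hence ps: "p' ` car N0 = car N" using pd(5) bd(4) by simp
 have im: "submodule (f' ` car N1) B N0" by (rule Q.fmods_image(1)[OF bd1(2) bd0(2) f'(1)])
 have "p' (f' y) = \<zero>\<^sub>N" if y: "y : car N1" for y
 proof -
  obtain x where x: "x : car P1" "y = q1 x" using y bd1(4) by blast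
  thus ?thesis using f'(2) p'(2) fc pd(7) zM by simp
 qed
 hence k1: "f' ` car N1 <= a_kernel N0 N p'" using hom_closed[OF f'(1)] by (auto simp: a_kernel_eq)
 \<comment> \<open>The cokernel map c of f' vanishes on the relations of M, so it factors through M
   and then through N. Thus c = h' p', and everything killed by p' is killed by c.\<close>
 have k2: "a_kernel N0 N p' <= f' ` car N1"
 proof -
  obtain R :: "('k, 'a set) fmod" and c where R: "R : fmods B" "is_hom B N0 R c" "c ` car N0 = car R" "a_kernel N0 R c = f' ` car N1"
   by (rule Q.fmods_quotient[OF bd0(2) im])
  have cz: "c (q0 (f x)) = \<zero>\<^sub>R" if x: "x : car P1" for x
  proof -
   have "q0 (f x) : f' ` car N1" using f'(2)[OF x] q1c[OF x] by (metis imageI)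
   thus ?thesis using R(4) by (auto simp: a_kernel_eq)
  qed
  have cA: "is_hom A (ofB N0) (ofB R) c" using R(2) by (simp add: hom_ofB)
  obtain h where h: "is_hom A M (ofB R) h" "!!x. x : car P0 ==> h (p x) = c (q0 x)"
  proof (rule hom_factor[OF projD(3)[OF pd(2)] fmD(2)[OF bd(1)] right_module_ofB[OF Q.fmD(2)[OF R(1)]] pd(4,5) hom_comp[OF bd0(3) cA]])
   show "c (q0 x) = \<zero>\<^sub>(ofB R)" if "x : car P0" "p x = \<zero>\<^sub>M" for x
    using pd(8)[OF that] cz by auto
  qed blast
  obtain h' where h': "is_hom B N R h'" "!!x. x : car M ==> h' (q x) = h x" using isbar_factor[OF M R(1) h(1)] by metis
  have z': "h' \<zero>\<^sub>N = \<zero>\<^sub>R" by (rule hom_zero[OF Q.fmD(2)[OF bd(2)] Q.fmD(2)[OF R(1)] h'(1)])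
  show ?thesis
  proof
   fix y assume y: "y : a_kernel N0 N p'"
   hence yc: "y : car N0" "p' y = \<zero>\<^sub>N" by (auto simp: a_kernel_eq)
   obtain x where x: "x : car P0" "y = q0 x" using yc(1) bd0(4) by blast
   have "c y = h' (p' y)" using x h(2) h'(2) p'(2) pc by simp
   hence "y : a_kernel N0 R c" using yc z' by (simp add: a_kernel_eq)
   thus "y : f' ` car N1" using R(4) by simp
  qed
 qed
 have pr: "pres B N1 f' N0 p' N"
  unfolding pres_def using bar_projective[OF b1 pd(1)] bar_projective[OF b0 pd(2)] f'(1) p'(1) ps k1 k2 by blast
 have "extl B N1 f' N0 Y" if Y: "Y : fmods B" and e: "extl A P1 f P0 (ofB Y)" for Y
  unfolding extl_def
 proof (intro allI impI)
  fix u assume u: "is_hom B N1 Y u"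
  hence "is_hom A (ofB N1) (ofB Y) u" by (simp add: hom_ofB)
  then obtain v where v: "is_hom A P0 (ofB Y) v" "!!x. x : car P1 ==> v (f x) = u (q1 x)"
   using e hom_comp[OF bd1(3)] unfolding extl_def by metis
  obtain w where w: "is_hom B N0 Y w" "!!x. x : car P0 ==> w (q0 x) = v x" using isbar_factor[OF b0 Y v(1)] by metis
  have "w (f' y) = u y" if "y : car N1" for y
  proof -
   obtain x where "x : car P1" "y = q1 x" using \<open>y : car N1\<close> bd1(4) by blast
   thus ?thesis using f'(2) w(2) v(2) fc by simp
  qed
  thus "EX v. is_hom B N0 Y v & (ALL x: car N1. v (f' x) = u x)" using w(1) by blast
 qed
 thus thesis using that[OF pr] by blast
qed

text \<open>The induced minimal presentation need not be minimal over B; by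
  \<open>presentation_excess\<close> the discrepancy is dim Hom(Z,-) for a projective Z, which
  vanishes on the B-modules of the torsion class of M.\<close>

lemma bar_theta:
 assumes b: "isbar M N q"
 obtains Z where "projective B Z"
  "!!Y. Y : fmods B ==> theta K A M (ofB Y) = theta K B N Y - real (hdim K B Z Y)"
  "!!Y. Y : fmods B ==> ext0 A M (ofB Y) ==> hdim K B Z Y = 0"
  "!!Y. Y : fmods B ==> ext0 A M (ofB Y) ==> ext0 B N Y"
proof -
 note bd = isbarD[OF b]
 obtain P1 f P0 p where m: "mpres A P1 f P0 p M" by (rule mpres_exists[OF bd(1)])
 note v = mpres_pres[OF bd(1) m]
 obtain N0 q0 where b0: "isbar P0 N0 q0" by (rule bar_exists[OF projD(1)[OF presD(2)[OF v]]])
 obtain N1 q1 where b1: "isbar P1 N1 q1" by (rule bar_exists[OF projD(1)[OF presD(1)[OF v]]])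
 obtain f' p' where v': "pres B N1 f' N0 p' N" "!!Y. Y : fmods B ==> extl A P1 f P0 (ofB Y) ==> extl B N1 f' N0 Y"
  using bar_pres[OF v b b0 b1] by metis
 obtain Z where Z: "projective B Z" "!!Y. Y : fmods B ==> real (hdim K B N0 Y) - real (hdim K B N1 Y) = theta K B N Y - real (hdim K B Z Y)"
  "!!Y. Y : fmods B ==> extl B N1 f' N0 Y ==> hdim K B Z Y = 0"
  using Q.presentation_excess[OF bd(2) v'(1)] by metis
 show thesis
 proof (rule that[OF Z(1)])
  fix Y :: "('k, 'a set) fmod" assume Y: "Y : fmods B"
  show "theta K A M (ofB Y) = theta K B N Y - real (hdim K B Z Y)"
   unfolding theta_eq[OF bd(1) m fmods_ofB[OF Y]] bar_hdim[OF b0 Y] bar_hdim[OF b1 Y] Z(2)[OF Y] ..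
  assume "ext0 A M (ofB Y)"
  hence e: "extl B N1 f' N0 Y" using v'(2)[OF Y] ext0_iff[OF bd(1) m] by blast
  thus "hdim K B Z Y = 0" by (rule Z(3)[OF Y])
  show "ext0 B N Y" by (rule Q.ext0_pres[OF bd(2) bd(2) retract_refl v'(1) e])
 qed
qed

text \<open>The source M is the projective cover over A of N. The map from the induced module L of M
  onto N splits by projectivity of N, and minimality of the cover forces the splitting to be
  onto.\<close>

lemma projective_is_bar:
 assumes P: "projective B N"
 obtains M q where "projective A M" "isbar M N q"
proof -
 note Nf = Q.projD(1)[OF P]
 obtain M p where c: "pcov A M p (ofB N)" by (rule pcov_exists[OF fmods_ofB[OF Nf]])
 note cd = pcovD[OF c]
 note Mf = projD(1)[OF cd(1)]
 obtain L q where b: "isbar M L q" by (rule bar_exists[OF Mf])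
 note bd = isbarD[OF b]
 obtain g where g: "is_hom B L N g" "!!x. x : car M ==> g (q x) = p x" using isbar_factor[OF b Nf cd(2)] by metis
 have gs: "g ` car L = car N" unfolding bd(4)[symmetric] image_image using cd(3) g(2) by auto
 obtain s where s: "is_hom B N L s" "!!y. y : car N ==> g (s y) = y"
  using Q.proj_lift[OF P bd(2) Nf g(1) gs hom_id] by metis
 interpret L: right_module B L by (rule Q.fmD(2)[OF bd(2)])
 interpret LO: right_module A "ofB L" by (rule right_module_ofB[OF L.right_module_axioms])
 have sim: "submodule (s ` car N) A (ofB L)"
  using Q.fmods_image(1)[OF Nf bd(2) s(1)] submodule_ofB[OF L.right_module_axioms] by simp
 \<comment> \<open>This preimage of the section already maps onto N, so it is all of M by
   minimality; hence s g is the identity on the image of q.\<close>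
 let ?M = "{x : car M. q x : s ` car N}"
 have "submodule ?M A M" by (rule submodule_vimage[OF fmD(2)[OF Mf] LO.right_module_axioms bd(3) sim])
 moreover have "p ` ?M = car (ofB N)"
 proof
  show "p ` ?M <= car (ofB N)" using cd(3) by auto
  show "car (ofB N) <= p ` ?M"
  proof
   fix y assume "y : car (ofB N)"
   hence y: "y : car N" by simp
   obtain x where x: "x : car M" "s y = q x" using bd(4) hom_closed[OF s(1) y] by (metis imageE)
   have "p x = y" using g(2)[OF x(1)] x(2) s(2)[OF y] by simp
   thus "y : p ` ?M" using x y by force
  qed
 qed
 ultimately have eM: "?M = car M" by (rule cd(4))
 have sg: "s (g (q x)) = q x" if x: "x : car M" for x
 proof -
  obtain y where "y : car N" "q x = s y" using eM x by blast
  thus ?thesis using s(2) by simp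
 qed
 have "isbar M N p" unfolding isbar_def
 proof (intro conjI allI impI)
  show "M : fmods A" "N : fmods B" "is_hom A M (ofB N) p" "p ` car M = car N" using Mf Nf cd(2,3) by auto
  fix Y :: "('k, 'a set) fmod" and f assume Y: "Y : fmods B" and f: "is_hom A M (ofB Y) f"
  obtain h where h: "is_hom B L Y h" "!!x. x : car M ==> h (q x) = f x" using isbar_factor[OF b Y f] by metis
  have "h (s (p x)) = f x" if x: "x : car M" for x using sg[OF x] g(2)[OF x] h(2)[OF x] by simp
  thus "EX g. is_hom B N Y g & (ALL x: car M. g (p x) = f x)" using hom_comp[OF s(1) h(1)] by blast
 qed
 thus thesis using that cd(1) by blast
qed

end

context fd_algebra
begin

text \<open>Adding a summand of a member changes neither the torsion class nor the class of modules
  without maps from \<open>U\<close>. This makes indecomposable summands of the members accessible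
  to \<open>compat_determines\<close>.\<close>

lemma compat_insert_retract:
 assumes c: "compat K A t U P" and M: "M : U" "M : fmods A" and N: "N : fmods A" "retract A N M"
 shows "compat K A t (insert N U) P"
proof -
 have e: "ext0 A N Y" if "ext0 A M Y" for Y :: "('k, 'a) fmod" using ext0_retract[OF N(1) M(2) N(2) that] .
 have h: "hdim K A N Y = 0" if "hdim K A M Y = 0" "Y : fmods A" for Y
  using hdim_retract_dom[OF fmD(1)[OF N(1)] fmD(1)[OF M(2)] fmD(1)[OF that(2)] N(2)] that(1) by simp
 have "tors K A (insert N U) P Y = tors K A U P Y" for Y unfolding tors_def using e[of Y] M(1) by auto
 moreover have "(EX L:insert N U. hdim K A L Y ~= 0) \<longleftrightarrow> (EX L:U. hdim K A L Y ~= 0)" if "Y : fmods A" for Y using h[OF _ that] M(1) by (metis insert_iff)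
 moreover have "(ALL L:insert N U. hdim K A L Y = 0) \<longleftrightarrow> (ALL L:U. hdim K A L Y = 0)" if "Y : fmods A" for Y using h[OF _ that] M(1) by auto
 ultimately show ?thesis using c unfolding compat_def by simp
qed

lemma rigid_set_retracts:
 assumes "rp T" "S <= fmods A" "!!N. N : S ==> retract A N (fst T)" "!!Q. Q : R ==> projective A Q" "!!Q. Q : R ==> hdim K A Q (fst T) = 0"
 shows "rigid_set K A S R"
 unfolding rigid_set_def
proof (intro conjI ballI)
 note r = rpD[OF assms(1)]
 show "projective A Q" if "Q : R" for Q using assms(4) that by auto
 show "ext0 A M N" if "M : S" "N : S" for M N
  using ext0_retract_both[OF r(1,2)] assms(2,3) that by blast
 show "hdim K A Q M = 0" if "Q : R" "M : S" for Q M
  using hdim_retract_both[OF projD(1)[OF assms(4)] r(1) assms(5) projD(1)[OF assms(4)] _ retract_refl assms(3)] assms(2) that by blast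
qed (use assms(2) in auto)

lemma tiltingD:
 assumes "T : tau_tilting_pairs K A"
 shows "rp T" "basic A (fst T)" "basic A (snd T)" "pair_size A T = algebra_rank A"
 using assms by (auto simp: tilting_iff)

text \<open>Both pairs have the same total count, and each part of \<open>U\<close> is contained in
  the corresponding part of \<open>T\<close>; so both counts agree separately.\<close>

lemma tilting_fst_eq:
 assumes T: "T : tau_tilting_pairs K A" and r: "rp U" and s: "pair_size A U = algebra_rank A"
  and i: "ind A (fst U) <= ind A (fst T)" "ind A (snd U) <= ind A (snd T)"
 shows "ind A (fst U) = ind A (fst T)"
proof -
 note t = rpD[OF tiltingD(1)[OF T]] and u = rpD[OF r]
 have "num_summands A (fst U) + num_summands A (snd U) = num_summands A (fst T) + num_summands A (snd T)"
  using s tiltingD(4)[OF T] by (cases U; cases T) simp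
 hence "num_summands A (fst U) = num_summands A (fst T)"
  using num_summands_mono(1)[OF u(1) t(1) i(1)] num_summands_mono(1)[OF u(5) t(5) i(2)] by simp
 thus ?thesis by (rule num_summands_mono(2)[OF u(1) t(1) i(1)])
qed

end

section \<open>The map from tau-tilting pairs of A to those of B\<close>

context fd_quotient
begin

definition rho :: "(('k, 'a) fmod => real) => ('k, 'a set) fmod => real" where
 "rho F = (%Y. if Y : fmods B then F (ofB Y) else 0)"

lemma rho_span:
 assumes "F : Fn.span G" shows "rho F : Fn.span (rho ` G)"
proof -
 have "Fn.subspace {F. rho F : Fn.span (rho ` G)}"
 proof (rule Fn.subspaceI)
  have "rho 0 = 0" by (auto simp: rho_def)
  thus "0 : {F. rho F : Fn.span (rho ` G)}" by (simp add: Fn.span_zero)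
  fix F H assume "F : {F. rho F : Fn.span (rho ` G)}" "H : {F. rho F : Fn.span (rho ` G)}"
  moreover have "rho (F + H) = rho F + rho H" by (auto simp: rho_def)
  ultimately show "F + H : {F. rho F : Fn.span (rho ` G)}" by (simp add: Fn.span_add)
 next
  fix c F assume "F : {F. rho F : Fn.span (rho ` G)}"
  moreover have "rho (fscale c F) = fscale c (rho F)" by (auto simp: rho_def fscale_def)
  ultimately show "fscale c F : {F. rho F : Fn.span (rho ` G)}" by (simp add: Fn.span_scale)
 qed
 moreover have "G <= {F. rho F : Fn.span (rho ` G)}" 
 proof
  fix F assume "F : G"
  hence "rho F : rho ` G" by simp
  thus "F : {F. rho F : Fn.span (rho ` G)}" using Fn.span_base by simp
 qed
 ultimately have "Fn.span G <= {F. rho F : Fn.span (rho ` G)}" using Fn.span_minimal by simp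
 thus ?thesis using assms by auto
qed

lemma rho_pf: "isbar P N q ==> rho (pf K A P) = pf K B N"
 using bar_hdim fmods_ofB by (auto simp: rho_def pf_def)

text \<open>Every projective B-module is induced from a projective A-module, so restriction of
  functions to B-modules maps the span for A onto a space containing the one for B.\<close>

lemma regular_B_span:
 assumes G: "pf K A ` ind A (regular A) <= Fn.span G"
 shows "pf K B ` ind B (regular B) <= Fn.span (rho ` G)"
proof
 fix F assume "F : pf K B ` ind B (regular B)"
 then obtain N where N: "projective B N" "F = pf K B N" unfolding Q.ind_regular by blast
 obtain M q where M: "projective A M" "isbar M N q" by (rule projective_is_bar[OF N(1)])
 have "pf K A M : Fn.span (pf K A ` ind A (regular A))"
  using pf_span[OF projD(1)[OF M(1)]] Fn.span_mono[OF image_mono[OF ind_sub_regular[OF M(1)]]] by blast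
 hence "pf K A M : Fn.span G" using Fn.span_minimal[OF G Fn.subspace_span] by blast
 thus "F : Fn.span (rho ` G)" using rho_span rho_pf[OF M(2)] N(2) by metis
qed

text \<open>By \<open>bar_theta\<close> a summand of the module part restricts to theta of its
  induced module minus a dim Hom(Z,-), and both kinds of correction terms come from projectives
  without maps to \<open>S\<close>. The set \<open>S\<close> is a parameter because adjacent pairs
  have to be treated simultaneously.\<close>

lemma rho_gens:
 assumes T: "rp T" and b: "isbar (fst T) N q" and S: "S <= fmods B"
  and e: "!!Y. Y : S ==> ext0 A (fst T) (ofB Y)" and h: "!!Y. Y : S ==> hdim K A (snd T) (ofB Y) = 0"
 shows "rho ` gens K A T <= Fn.span (tf K B ` ind B N \<union> pf K B ` nul K B S)" (is "_ <= Fn.span ?G")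
proof -
 note r = rpD[OF T]
 have nG: "Fn.span (pf K B ` nul K B S) <= Fn.span ?G" by (rule Fn.span_mono) auto
 have 1: "rho (tf K A L) : Fn.span ?G" if L: "L : ind A (fst T)" for L
 proof -
  note Ld = indD[OF L]
  obtain N' q' where b': "isbar L N' q'" by (rule bar_exists[OF Ld(1)])
  obtain Z where Z: "projective B Z" "!!Y. Y : fmods B ==> theta K A L (ofB Y) = theta K B N' Y - real (hdim K B Z Y)"
   "!!Y. Y : fmods B ==> ext0 A L (ofB Y) ==> hdim K B Z Y = 0"
   "!!Y. Y : fmods B ==> ext0 A L (ofB Y) ==> ext0 B N' Y"
   using bar_theta[OF b'] by metis
  have eL: "ext0 A L (ofB Y)" if "Y : S" for Y using ext0_retract[OF Ld(1) r(1) Ld(3) e[OF that]] .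
  have "rho (tf K A L) = tf K B N' - pf K B Z" using Z(2) fmods_ofB by (auto simp: rho_def tf_def pf_def)
  moreover have "tf K B N' : Fn.span (tf K B ` ind B N' \<union> pf K B ` nul K B S)"
   by (rule Q.tf_span_nul[OF isbarD(2)[OF b'] S]) (use Z(4) eL S in blast)
  moreover have "Fn.span (tf K B ` ind B N' \<union> pf K B ` nul K B S) <= Fn.span ?G"
   using Q.ind_mono[OF bar_retract[OF b' b Ld(3)]] by (intro Fn.span_mono) blast
  moreover have "pf K B Z : Fn.span ?G"
   using Q.pf_span_nul[OF Z(1) S] Z(3) eL S nG by blast
  ultimately show ?thesis using Fn.span_diff by auto
 qed
 have 2: "rho (pf K A L) : Fn.span ?G" if L: "L : ind A (snd T)" for L
 proof -
  note Ld = indD[OF L]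
  obtain N' q' where b': "isbar L N' q'" by (rule bar_exists[OF Ld(1)])
  have P: "projective B N'" by (rule bar_projective[OF b' ind_projective[OF r(3) L]])
  have "hdim K B N' Y = 0" if "Y : S" for Y
   using hdim_retract_dom[OF fmD(1)[OF Ld(1)] fmD(1)[OF r(5)] fmD(1)[OF fmods_ofB] Ld(3), of Y] h[OF that] bar_hdim[OF b', of Y] S that by auto
  thus ?thesis using Q.pf_span_nul[OF P S] nG rho_pf[OF b'] by auto
 qed
 show ?thesis unfolding gens_def using 1 2 by blast
qed

text \<open>As a quotient of M, the induced module lies in the torsion class of the pair;
  \<open>bar_theta\<close> turns this into tau-rigidity over B.\<close>

lemma bar_tors:
 assumes T: "rp T" and b: "isbar (fst T) N q"
 shows "ext0 A (fst T) (ofB N)" "hdim K A (snd T) (ofB N) = 0" "ext0 B N N"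
proof -
 note r = rpD[OF T] and bd = isbarD[OF b]
 have s: "q ` car (fst T) = car (ofB N)" using bd(4) by simp
 show e: "ext0 A (fst T) (ofB N)" by (rule ext0_cod_surj[OF r(1) r(1) fmods_ofB[OF bd(2)] bd(3) s r(2)])
 show "hdim K A (snd T) (ofB N) = 0" by (rule proj_hdim_surj[OF r(3,1) fmods_ofB[OF bd(2)] bd(3) s r(4)])
 show "ext0 B N N" using bar_theta[OF b] e bd(2) by metis
qed

text \<open>A relation on representatives, well defined on isomorphism classes by
  \<open>Phi_unique\<close>. The module part of S has the indecomposable summands of the induced
  module; its projective part is then forced by \<open>tilting_snd\<close>.\<close>

definition Phi :: "('k, 'a) fpair => ('k, 'a set) fpair => bool" where
 "Phi T S \<longleftrightarrow> T : tau_tilting_pairs K A & S : tau_tilting_pairs K B & (EX N q. isbar (fst T) N q & ind B (fst S) = ind B N)"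

lemma PhiD: "Phi T S ==> T : tau_tilting_pairs K A" "Phi T S ==> S : tau_tilting_pairs K B"
 by (auto simp: Phi_def)

text \<open>Complete the induced module to a pair by all projectives without maps to it. The
  restricted functions of T span everything for B and lie in the span of this pair, which therefore
  has full size.\<close>

lemma Phi_exists:
 assumes T: "T : tau_tilting_pairs K A"
 obtains S where "Phi T S"
proof -
 note r = tiltingD(1)[OF T] and s = tiltingD(4)[OF T]
 obtain N q where b: "isbar (fst T) N q" by (rule bar_exists[OF rpD(1)[OF r]])
 note bt = bar_tors[OF r b] and bd = isbarD[OF b]
 obtain M' P' where M': "Q.rp (M', P')" "basic B M'" "basic B P'" "ind B M' = ind B N" "ind B P' = nul K B {N}"
  using Q.max_pair[OF bd(2) bt(3)] by metis
 have g: "gens K B (M', P') = tf K B ` ind B N \<union> pf K B ` nul K B {N}" by (simp add: gens_def M'(4,5))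
 have "rho ` gens K A T <= Fn.span (gens K B (M', P'))" unfolding g
  by (rule rho_gens[OF r b]) (use bd(2) bt in auto)
 moreover have "pf K A ` ind A (regular A) <= Fn.span (gens K A T)" using span_full[OF r s] Fn.span_superset by simp
 ultimately have "pf K B ` ind B (regular B) <= Fn.span (gens K B (M', P'))"
  using order_trans[OF regular_B_span[of "gens K A T"] Fn.span_minimal[OF _ Fn.subspace_span]] by simp
 hence "pair_size B (M', P') = algebra_rank B"
  using Q.rank_le_pair_size[OF M'(1)] Q.pair_size_le[OF M'(1)] by simp
 hence "(M', P') : tau_tilting_pairs K B" using M' by (simp add: Q.tilting_iff)
 thus thesis using that[of "(M', P')"] T b M'(4) by (auto simp: Phi_def)
qed

lemma bar_ind_mono:
 assumes "isbar M N q" "isbar M' N' q'" "basic A M" "ind A M <= ind A M'"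
 shows "ind B N <= ind B N'"
 using Q.ind_mono[OF bar_retract[OF assms(1,2) basic_retract[OF isbarD(1)[OF assms(1)] isbarD(1)[OF assms(2)] assms(3,4)]]] .

lemma Phi_ind:
 assumes "Phi T S" "isbar (fst T) N q" shows "ind B (fst S) = ind B N"
proof -
 obtain N' q' where b: "isbar (fst T) N' q'" "ind B (fst S) = ind B N'" using assms(1) by (auto simp: Phi_def)
 have "basic A (fst T)" using tiltingD(2)[OF PhiD(1)[OF assms(1)]] .
 thus ?thesis using bar_ind_mono[OF b(1) assms(2)] bar_ind_mono[OF assms(2) b(1)] b(2) by auto
qed

lemma Phi_unique:
 assumes 1: "Phi T S" and 2: "Phi T' S'" and e: "mod_iso A (fst T) (fst T')"
 shows "(S, S') : tau_tilting_iso K B"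
proof -
 note t = tiltingD[OF PhiD(1)[OF 1]] and t' = tiltingD[OF PhiD(1)[OF 2]]
 have i: "ind A (fst T) = ind A (fst T')" by (rule ind_cong_iso[OF rpD(1)[OF t(1)] rpD(1)[OF t'(1)] e])
 obtain N q where b: "isbar (fst T) N q" by (rule bar_exists[OF rpD(1)[OF t(1)]])
 obtain N' q' where b': "isbar (fst T') N' q'" by (rule bar_exists[OF rpD(1)[OF t'(1)]])
 have "ind B N = ind B N'" using bar_ind_mono[OF b b' t(2)] bar_ind_mono[OF b' b t'(2)] i by auto
 thus ?thesis using Q.tilting_isoI[OF PhiD(2)[OF 1] PhiD(2)[OF 2]] Phi_ind[OF 1 b] Phi_ind[OF 2 b'] by simp
qed

lemma pair_summandD:
 assumes "tau_rigid_pair K A U" "tau_rigid_pair K A T" "pair_summand A U T"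
 shows "retract A (fst U) (fst T)" "retract A (snd U) (snd T)"
 using assms is_summand_iff_retract[OF fmD(2) fmD(2), of "fst T" "fst U"] is_summand_iff_retract[OF fmD(2) fmD(2), of "snd T" "snd U"]
  rpD(1,5)[of U] rpD(1,5)[of T] unfolding tau_rigid_pair_iff by (cases U; cases T; simp)+

text \<open>The almost complete pair U common to T and T' is induced to B and completed by the
  projectives vanishing on both induced modules. Its functions together with the restriction of one
  further function span everything for B, so it lacks at most one summand.\<close>

lemma Phi_mutation:
 assumes m: "mutation K A T T'" and 1: "Phi T S" and 2: "Phi T' S'"
 shows "(S, S') : tau_tilting_iso K B | mutation K B S S'"
proof -
 note t = tiltingD[OF PhiD(1)[OF 1]] and t' = tiltingD[OF PhiD(1)[OF 2]]
 note s = Q.tiltingD[OF PhiD(2)[OF 1]] and s' = Q.tiltingD[OF PhiD(2)[OF 2]]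
 obtain U where U: "rp U" "basic_pair A U" "pair_size A U + 1 = algebra_rank A" "pair_summand A U T" "pair_summand A U T'"
  using m unfolding mutation_def tau_rigid_pair_iff by auto
 note u = rpD[OF U(1)]
 have ru: "retract A (fst U) (fst T)" "retract A (snd U) (snd T)" "retract A (fst U) (fst T')" "retract A (snd U) (snd T')"
  using pair_summandD[of U T] pair_summandD[of U T'] U t(1) t'(1) unfolding tau_rigid_pair_iff by auto
 obtain N q where b: "isbar (fst T) N q" by (rule bar_exists[OF rpD(1)[OF t(1)]])
 obtain N' q' where b': "isbar (fst T') N' q'" by (rule bar_exists[OF rpD(1)[OF t'(1)]])
 obtain L l where bl: "isbar (fst U) L l" by (rule bar_exists[OF u(1)])
 note bd = isbarD[OF b] and bd' = isbarD[OF b'] and ld = isbarD[OF bl]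
 note bt = bar_tors[OF t(1) b] and bt' = bar_tors[OF t'(1) b']
 let ?S = "{N, N'}"
 have Sf: "?S <= fmods B" using bd bd' by auto
 have e: "ext0 A (fst U) (ofB Y)" if "Y : ?S" for Y
  using that ext0_retract[OF u(1) rpD(1)[OF t(1)] ru(1) bt(1)] ext0_retract[OF u(1) rpD(1)[OF t'(1)] ru(3) bt'(1)] by auto
 have h: "hdim K A (snd U) (ofB Y) = 0" if "Y : ?S" for Y
  using that hdim_retract_dom[OF fmD(1)[OF u(5)] fmD(1)[OF rpD(5)[OF t(1)]] fmD(1)[OF fmods_ofB[OF bd(2)]] ru(2)] bt(2)
   hdim_retract_dom[OF fmD(1)[OF u(5)] fmD(1)[OF rpD(5)[OF t'(1)]] fmD(1)[OF fmods_ofB[OF bd'(2)]] ru(4)] bt'(2) by auto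
 have rL: "retract B L N" "retract B L N'" using bar_retract[OF bl b ru(1)] bar_retract[OF bl b' ru(3)] by auto
 obtain M0 where M0: "M0 : fmods B" "basic B M0" "ind B M0 = ind B L" by (rule Q.basic_version[OF ld(2)])
 \<comment> \<open>Vanishing on both N and N' ensures that P0 belongs to the projective parts of S
   and of S'.\<close>
 obtain P0 where P0: "projective B P0" "basic B P0" "ind B P0 = nul K B ?S" "!!Y. Y : ?S ==> hdim K B P0 Y = 0"
  using Q.nul_basic[OF Sf] by metis
 have r0: "retract B M0 L" by (rule Q.basic_retract[OF M0(1) ld(2) M0(2)]) (use M0(3) in simp)
 have r0N: "retract B M0 N" by (rule retract_trans[OF r0 rL(1)])
 have V: "Q.rp (M0, P0)"
  unfolding Q.rp_def using M0(1) P0(1) Q.ext0_retract_both[OF bd(2) bt(3) M0(1,1) r0N r0N]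
   Q.hdim_retract_both[OF Q.projD(1)[OF P0(1)] bd(2) P0(4) Q.projD(1)[OF P0(1)] M0(1) retract_refl r0N] by simp
 obtain x where x: "pf K A ` ind A (regular A) <= Fn.span (insert x (gens K A U))" by (rule span_almost[OF U(1,3)])
 have g: "gens K B (M0, P0) = tf K B ` ind B L \<union> pf K B ` nul K B ?S" by (simp add: gens_def M0(3) P0(3))
 have "rho ` gens K A U <= Fn.span (gens K B (M0, P0))" unfolding g by (rule rho_gens[OF U(1) bl Sf e h])
 hence "rho ` insert x (gens K A U) <= Fn.span (insert (rho x) (gens K B (M0, P0)))"
  using Fn.span_mono[of "gens K B (M0, P0)" "insert (rho x) (gens K B (M0, P0))"] Fn.span_base[of "rho x" "insert (rho x) (gens K B (M0, P0))"] by blast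
 hence "pf K B ` ind B (regular B) <= Fn.span (insert (rho x) (gens K B (M0, P0)))"
  by (rule order_trans[OF regular_B_span[OF x] Fn.span_minimal[OF _ Fn.subspace_span]])
 hence sz: "algebra_rank B <= Suc (pair_size B (M0, P0))" by (rule Q.rank_le_Suc_pair_size[OF V])
 have le: "pair_size B (M0, P0) <= algebra_rank B" by (rule Q.pair_size_le[OF V])
 note iS = Phi_ind[OF 1 b] and iS' = Phi_ind[OF 2 b']
 have nS: "ind B (snd S) = nul K B {N}"
  using Q.tilting_snd[OF PhiD(2)[OF 1]] Q.nul_ind[OF Q.rpD(1)[OF s(1)] bd(2)] Q.nul_ind[OF bd(2) Q.rpD(1)[OF s(1)]] iS by auto
 have nS': "ind B (snd S') = nul K B {N'}"
  using Q.tilting_snd[OF PhiD(2)[OF 2]] Q.nul_ind[OF Q.rpD(1)[OF s'(1)] bd'(2)] Q.nul_ind[OF bd'(2) Q.rpD(1)[OF s'(1)]] iS' by auto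
 have sub: "ind B M0 <= ind B (fst S)" "ind B P0 <= ind B (snd S)" "ind B M0 <= ind B (fst S')" "ind B P0 <= ind B (snd S')"
  using Q.ind_mono[OF rL(1)] Q.ind_mono[OF rL(2)] unfolding M0(3) P0(3) iS iS' nS nS' by (auto simp: nul_def)
 \<comment> \<open>If nothing is lacking, S and S' both coincide with this pair; if one summand is
   lacking, it is the common summand required for a mutation.\<close>
 show ?thesis
 proof (cases "pair_size B (M0, P0) = algebra_rank B")
  case True
  have "ind B M0 = ind B (fst S)" "ind B M0 = ind B (fst S')"
   using Q.tilting_fst_eq[OF PhiD(2)[OF 1] V True] Q.tilting_fst_eq[OF PhiD(2)[OF 2] V True] sub by simp_all
  thus ?thesis using Q.tilting_isoI[OF PhiD(2)[OF 1] PhiD(2)[OF 2]] by simp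
 next
  case False
  hence sz': "pair_size B (M0, P0) + 1 = algebra_rank B" using sz le by simp
  have sm: "is_summand B M0 (fst Z)" "is_summand B P0 (snd Z)" if "Q.rp Z" "ind B M0 <= ind B (fst Z)" "ind B P0 <= ind B (snd Z)" for Z
  proof -
   note z = Q.rpD[OF that(1)]
   show "is_summand B M0 (fst Z)"
    using is_summand_iff_retract[OF Q.fmD(2)[OF z(1)] Q.fmD(2)[OF M0(1)]] Q.basic_retract[OF M0(1) z(1) M0(2) that(2)] by blast
   show "is_summand B P0 (snd Z)"
    using is_summand_iff_retract[OF Q.fmD(2)[OF z(5)] Q.projD(3)[OF P0(1)]] Q.basic_retract[OF Q.projD(1)[OF P0(1)] z(5) P0(2) that(3)] by blast
  qed
  have "pair_summand B (M0, P0) S" "pair_summand B (M0, P0) S'"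
   using sm[OF s(1)] sm[OF s'(1)] sub by (cases S; cases S'; simp)+
  thus ?thesis
   unfolding mutation_def Q.tau_rigid_pair_iff using PhiD(2)[OF 1] PhiD(2)[OF 2] V M0(2) P0(2) sz'
   by (intro disjCI conjI exI[of _ "(M0, P0)"]) auto
 qed
qed

text \<open>One functional on B-modules has two descriptions: by the induced summands of T with
  weights k, minus projective corrections, and by the summands of S with strictly positive weights.
  The first may miss summands of T with weight zero, so comparing module parts gives inclusions
  only; the projective parts and a count of summands complete the identification.\<close>

lemma Phi_surj_core:
 fixes k :: "nat => real"
 assumes S: "S : tau_tilting_pairs K B" and T: "T : tau_tilting_pairs K A"
  and J: "finite J" and k: "!!i. i : J ==> k i > 0"
  and M: "!!i. i : J ==> M i : fmods A" "!!i. i : J ==> retract A (M i) (fst T)"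
  and P: "!!i. i : J ==> P i : fmods A" "!!i. i : J ==> retract A (P i) (snd T)"
  and V: "reps B (fst S) V" and R: "reps B (snd S) R" and c: "!!N. N : V ==> c N > 0" and e: "!!N. N : R ==> e N > 0"
  and eq: "!!Y. Y : fmods B ==> (\<Sum>i\<in>J. k i * (theta K A (M i) (ofB Y) - real (hdim K A (P i) (ofB Y)))) =
   (\<Sum>N\<in>V. c N * theta K B N Y) - (\<Sum>N\<in>R. e N * real (hdim K B N Y))"
 shows "Phi T S"
proof -
 note t = tiltingD[OF T] and s = Q.tiltingD[OF S]
 note tr = rpD[OF t(1)] and sr = Q.rpD[OF s(1)]
 obtain L l where bL: "isbar (fst T) L l" by (rule bar_exists[OF tr(1)])
 note bt = bar_tors[OF t(1) bL] and Lf = isbarD(2)[OF bL]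
 have "EX N q. isbar (M i) N q" if "i : J" for i using bar_exists[OF M(1)[OF that]] by metis
 then obtain N where N: "!!i. i : J ==> EX q. isbar (M i) (N i) q" by metis
 have "EX N q. isbar (P i) N q" if "i : J" for i using bar_exists[OF P(1)[OF that]] by metis
 then obtain P' where P': "!!i. i : J ==> EX q. isbar (P i) (P' i) q" by metis
 have "EX Z. projective B Z & (ALL Y:fmods B. theta K A (M i) (ofB Y) = theta K B (N i) Y - real (hdim K B Z Y)) &
   (ALL Y:fmods B. ext0 A (M i) (ofB Y) --> hdim K B Z Y = 0)" if "i : J" for i
 proof -
  obtain q where "isbar (M i) (N i) q" using N \<open>i : J\<close> by blast
  from bar_theta[OF this] show ?thesis by metis
 qed
 then obtain Z where Z: "!!i. i : J ==> projective B (Z i)"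
  "!!i Y. i : J ==> Y : fmods B ==> theta K A (M i) (ofB Y) = theta K B (N i) Y - real (hdim K B (Z i) Y)"
  "!!i Y. i : J ==> Y : fmods B ==> ext0 A (M i) (ofB Y) ==> hdim K B (Z i) Y = 0" by metis
 have Nf: "N i : fmods B" and Nr: "retract B (N i) L" if "i : J" for i
  using N[OF that] isbarD(2) bar_retract[OF _ bL M(2)[OF that]] by blast+
 have Pp: "projective A (P i)" if "i : J" for i using proj_retract[OF tr(3) P(1)[OF that] P(2)[OF that]] .
 have P'p: "projective B (P' i)" if "i : J" for i using P'[OF that] bar_projective Pp[OF that] by blast
 have P'h: "hdim K B (P' i) Y = hdim K A (P i) (ofB Y)" if "i : J" "Y : fmods B" for i Y using P'[OF that(1)] bar_hdim[OF _ that(2)] by metis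
 define tt where "tt = (%Y. (\<Sum>i\<in>J. k i * (theta K A (M i) (ofB Y) - real (hdim K A (P i) (ofB Y)))))"
 have tt: "tt Y = (\<Sum>i\<in>J. k i * (theta K B (N i) Y - real (hdim K B (Z i) Y) - real (hdim K B (P' i) Y)))" if "Y : fmods B" for Y
  unfolding tt_def by (rule sum.cong) (use Z(2) P'h that in auto)
 let ?U = "N ` J" and ?P = "Z ` J \<union> P' ` J"
 \<comment> \<open>Each index contributes two projectives, the excess \<open>Z i\<close> and the
   induced \<open>P' i\<close>, hence the doubled index set.\<close>
 have "compat K B tt ?U (case_sum Z P' ` (J <+> J))"
  by (rule Q.compat_weighted[where c=k and e="case_sum k k", OF J finite_Plus[OF J J]])
   (use Nf Q.projD(1)[OF Z(1)] Q.projD(1)[OF P'p] k in \<open>auto simp: tt sum.Plus[OF J J] algebra_simps sum.distrib sum_subtractf\<close>)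
 hence cU: "compat K B tt ?U ?P" by (simp add: Plus_def image_Un image_image)
 obtain M1 P1 where M1: "Q.rp (M1, P1)" "ind B M1 = ind B L" using Q.max_pair[OF Lf bt(3)] by metis
 have zP: "projective B D" "hdim K B D L = 0" if "D : ?P" for D
 proof -
  show "projective B D" using that Z(1) P'p by blast
  consider i where "i : J" "D = Z i" | i where "i : J" "D = P' i" using \<open>D : ?P\<close> by blast
  thus "hdim K B D L = 0"
  proof cases
   case 1
   thus ?thesis using Z(3)[OF 1(1) Lf] ext0_retract[OF M(1)[OF 1(1)] tr(1) M(2)[OF 1(1)] bt(1)] by simp
  next
   case 2
   thus ?thesis using P'h[OF 2(1) Lf] hdim_retract_dom[OF fmD(1)[OF P(1)[OF 2(1)]] fmD(1)[OF tr(5)] fmD(1)[OF fmods_ofB[OF Lf]] P(2)[OF 2(1)]] bt(2) by simp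
  qed
 qed
 \<comment> \<open>The zero module as projective part turns the induced module L into a pair to
   which \<open>rigid_set_retracts\<close> applies.\<close>
 obtain Z0 where Z0: "Z0 : fmods B" "car Z0 = {\<zero>\<^sub>Z0}" by (rule Q.zero_fmod_exists)
 have "hdim K B Z0 L = 0" using Q.hdim_eq_0_iff[OF Q.fmD(1)[OF Z0(1)] Q.fmD(1)[OF Lf]] Q.hom_from_zero[OF Q.fmD(2)[OF Z0(1)] Q.fmD(2)[OF Lf] Z0(2)] by blast
 hence rL: "Q.rp (L, Z0)" using Lf bt(3) Q.proj_zero[OF Z0] by (simp add: Q.rp_def)
 have rU: "rigid_set K B U ?P" if "U <= fmods B" "!!D. D : U ==> retract B D L" for U
  by (rule Q.rigid_set_retracts[OF rL that(1)]) (use that(2) zP in auto)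
 have Vd: "finite V" "V <= ind B (fst S)" "finite R" "R <= ind B (snd S)" using V R by (auto simp: reps_def)
 have rV: "rigid_set K B V R" by (rule Q.rigid_set_ind[OF s(1) Vd(2,4)])
 have Vf: "V <= fmods B" "R <= fmods B" using Vd(2,4) Q.indD(1) by blast+
 have cV: "compat K B tt V R"
  by (rule Q.compat_weighted[where M="%x. x" and P="%x. x" and c=c and e=e, OF Vd(1,3), unfolded image_ident, OF Vf c e]) (use eq in \<open>simp_all add: tt_def\<close>)
 have sub1: "ind B (fst S) <= ind B L"
 proof
  fix D assume D: "D : ind B (fst S)"
  then obtain D' where D': "D' : V" "mod_iso B D D'" using V by (auto simp: reps_def)
  hence i: "indecomposable B D'" using Vd(2) Q.indD(2) by blast
  obtain D2 where "D2 : ?U" "retract B D' D2"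
   using Q.compat_determines[OF finite_imageI[OF J] rU[of ?U] cU Vd(1) rV cV D'(1) i] Nf Nr by blast
  hence "retract B D' L" using Nr retract_trans by blast
  hence "retract B D L" using retract_trans[OF mod_iso_retract(1)[OF Q.fmD(2)[OF Q.indD(1)[OF D]] D'(2)]] by blast
  thus "D : ind B L" using Q.indD(1,2)[OF D] by (simp add: ind_def)
 qed
 have sub2: "ind B (N i) <= ind B (fst S)" if i: "i : J" for i
 proof
  fix D assume D: "D : ind B (N i)"
  note Dd = Q.indD[OF D]
  have "compat K B tt (insert D ?U) ?P" by (rule Q.compat_insert_retract[OF cU _ Nf[OF i] Dd(1,3)]) (use i in blast)
  moreover have "rigid_set K B (insert D ?U) ?P"
   by (rule rU) (use Nf Nr Dd(1) retract_trans[OF Dd(3) Nr[OF i]] in auto)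
  ultimately obtain D2 where "D2 : V" "retract B D D2"
   using Q.compat_determines[OF Vd(1) rV cV _ _ _ _ Dd(2), of "insert D ?U" ?P] J by blast
  hence "retract B D (fst S)" using Vd(2) Q.indD(3) retract_trans by blast
  thus "D : ind B (fst S)" using Dd(1,2) by (simp add: ind_def)
 qed
 obtain S' where S': "Phi T S'" by (rule Phi_exists[OF T])
 note s' = Q.tiltingD[OF PhiD(2)[OF S']] and iS' = Phi_ind[OF S' bL]
 have nS: "ind B (snd S) = nul K B {fst S}" by (rule Q.tilting_snd[OF S])
 have nS': "ind B (snd S') = nul K B {L}"
  using Q.tilting_snd[OF PhiD(2)[OF S']] Q.nul_ind[OF Q.rpD(1)[OF s'(1)] Lf] Q.nul_ind[OF Lf Q.rpD(1)[OF s'(1)]] iS' by auto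
 have n1: "nul K B {L} <= nul K B {fst S}" by (rule Q.nul_ind[OF Lf sr(1) sub1])
 \<comment> \<open>Otherwise a summand D' of the projective part of S has a map to L. The first
   description of the functional uses only functions spanned by the basis of S without D', whereas
   in the second D' has the nonzero coefficient -e D'; this contradicts independence.\<close>
 have "nul K B {fst S} <= nul K B {L}"
 proof
  fix D assume D: "D : nul K B {fst S}"
  show "D : nul K B {L}"
  proof (rule ccontr)
   assume nD: "D ~: nul K B {L}"
   obtain D' where D': "D' : R" "mod_iso B D D'" using D R unfolding nS[symmetric] reps_def by blast
   have D'f: "D' : fmods B" using Vf(2) D'(1) by blast
   have nD': "D' ~: nul K B {L}"
    using Q.nul_iso_closed[of "{L}" D' D] Lf nD Q.projD(1)[OF Q.nulD(1)[OF D]] Q.fmod_iso_sym[OF Q.projD(1)[OF Q.nulD(1)[OF D]] D'f D'(2)] by blast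
   let ?F = "case_sum (tf K B) (pf K B)" and ?I = "V <+> (R - {D'})"
   note fam = Q.rp_family[OF s(1) V R]
   have FI: "?F ` ?I = tf K B ` V \<union> pf K B ` (R - {D'})" by (force simp: image_iff)
   have VI: "tf K B ` V <= Fn.span (?F ` ?I)" and RI: "pf K B ` (R - {D'}) <= Fn.span (?F ` ?I)"
    unfolding FI using Fn.span_superset[of "tf K B ` V \<union> pf K B ` (R - {D'})"] by blast+
   have nI: "pf K B ` nul K B {L} <= Fn.span (?F ` ?I)"
   proof (rule image_subsetI)
    fix E assume E: "E : nul K B {L}"
    hence ES: "E : ind B (snd S)" using n1 nS by blast
    then obtain E' where E': "E' : R" "mod_iso B E E'" using R unfolding reps_def by blast
    have E'f: "E' : fmods B" using Vf(2) E'(1) by blast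
    have "E' : nul K B {L}" using Q.nul_iso_closed[OF _ E E'f E'(2)] Lf by blast
    hence "E' ~= D'" using nD' by blast
    moreover have "pf K B E = pf K B E'" by (rule Q.pf_iso[OF Q.indD(1)[OF ES] E'f E'(2)])
    ultimately show "pf K B E : Fn.span (?F ` ?I)" using RI E'(1) by auto
   qed
   let ?TT = "%Y. if Y : fmods B then tt Y else 0"
   have "?TT = (\<Sum>i\<in>J. fscale (k i) (tf K B (N i) - pf K B (Z i) - pf K B (P' i)))"
    by (auto simp: fun_eq_iff fun_sum_apply fscale_def tf_def pf_def tt)
   moreover have "tf K B (N i) : Fn.span (?F ` ?I)" if i: "i : J" for i
   proof -
    have "ext0 B (N i) L" using Q.ext0_retract[OF Nf[OF i] Lf Nr[OF i] bt(3)] .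
hence tfN: "tf K B (N i) : Fn.span (tf K B ` ind B (N i) \<union> pf K B ` nul K B {L})"
     by (intro Q.tf_span_nul[OF Nf[OF i]]) (use Lf in auto)
    have "tf K B ` ind B (N i) <= tf K B ` V" using sub2[OF i] Q.tf_reps[OF V] by blast
    hence "tf K B ` ind B (N i) \<union> pf K B ` nul K B {L} <= Fn.span (?F ` ?I)" using VI nI by auto
    from Fn.span_minimal[OF this Fn.subspace_span] show ?thesis using tfN by blast
   qed
   moreover have "pf K B E : Fn.span (?F ` ?I)" if E: "E : ?P" for E
   proof -
    have "pf K B E : Fn.span (pf K B ` nul K B {L})" by (rule Q.pf_span_nul[OF zP(1)[OF E]]) (use Lf zP(2)[OF E] in auto)
    thus ?thesis using Fn.span_minimal[OF nI Fn.subspace_span] by blast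
   qed
   ultimately have TT1: "?TT : Fn.span (?F ` ?I)"
    by (simp only:) (intro Fn.span_sum Fn.span_scale Fn.span_diff; blast)
   have "?TT = (\<Sum>N\<in>V. fscale (c N) (tf K B N)) - (\<Sum>N\<in>R. fscale (e N) (pf K B N))"
    using eq by (auto simp: fun_eq_iff fun_sum_apply fscale_def tf_def pf_def tt_def)
   also have "(\<Sum>N\<in>R. fscale (e N) (pf K B N)) = fscale (e D') (pf K B D') + (\<Sum>N\<in>R - {D'}. fscale (e N) (pf K B N))"
    by (rule sum.remove[OF Vd(3) D'(1)])
   finally have TTe: "?TT = (\<Sum>N\<in>V. fscale (c N) (tf K B N)) - (fscale (e D') (pf K B D') + (\<Sum>N\<in>R - {D'}. fscale (e N) (pf K B N)))" .
   have alg: "b = a - d - u" if "u = a - (b + d)" for a b d u :: "('k, 'a set) fmod => real"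
    using that by (auto simp: fun_eq_iff)
   have "fscale (e D') (pf K B D') = (\<Sum>N\<in>V. fscale (c N) (tf K B N)) - (\<Sum>N\<in>R - {D'}. fscale (e N) (pf K B N)) - ?TT"
    by (rule alg[OF TTe])
   moreover have "(\<Sum>N\<in>V. fscale (c N) (tf K B N)) : Fn.span (?F ` ?I)" using VI by (intro Fn.span_sum Fn.span_scale) blast
   moreover have "(\<Sum>N\<in>R - {D'}. fscale (e N) (pf K B N)) : Fn.span (?F ` ?I)" using RI by (intro Fn.span_sum Fn.span_scale) blast
   ultimately have "fscale (e D') (pf K B D') : Fn.span (?F ` ?I)" using TT1 by (simp add: Fn.span_diff)
   from Fn.span_scale[OF this, of "1 / e D'"] have "pf K B D' : Fn.span (?F ` ?I)"
    using e[OF D'(1)] by (simp add: fscale_def)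
   moreover have "?F ` (V <+> R) - {?F (Inr D')} = ?F ` ?I"
   proof -
    have "V <+> R - {Inr D'} = ?I" by auto
    thus ?thesis using inj_on_image_set_diff[OF fam(1), of "V <+> R" "{Inr D'}"] D'(1) by auto
   qed
   moreover have mem: "?F (Inr D') : ?F ` (V <+> R)" by (rule imageI) (use D'(1) in auto)
   ultimately have "Fn.dependent (?F ` (V <+> R))"
    unfolding Fn.dependent_def by (intro bexI[OF _ mem]) simp
   thus False using fam(2) by simp
  qed
 qed
 hence n2: "ind B (snd S) = ind B (snd S')" using n1 nS nS' by simp
 have "ind B (fst S) = ind B (fst S')"
  by (rule Q.tilting_fst_eq[OF PhiD(2)[OF S'] s(1) s(4)]) (use sub1 iS' n2 in auto)
 thus ?thesis using iS' bL S T by (auto simp: Phi_def)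
qed

end

section \<open>Coordinates and open cones in Euclidean space\<close>

lemma span_family:
 assumes "f : Fn.span (F ` I)" "finite I"
 obtains x where "f = (%Y. \<Sum>i\<in>I. x i * F i Y)"
proof -
 let ?S = "{f. EX x. f = (%Y. \<Sum>i\<in>I. x i * F i Y)}"
 have "Fn.subspace ?S"
 proof (rule Fn.subspaceI)
  show "0 : ?S" by (auto simp: fun_eq_iff intro!: exI[of _ "%_. 0"])
  fix f g assume "f : ?S" "g : ?S"
  then obtain x y where "f = (%Y. \<Sum>i\<in>I. x i * F i Y)" "g = (%Y. \<Sum>i\<in>I. y i * F i Y)" by blast
  hence "f + g = (%Y. \<Sum>i\<in>I. (x i + y i) * F i Y)" by (auto simp: fun_eq_iff distrib_right sum.distrib)
  thus "f + g : ?S" by (intro CollectI exI[of _ "%i. x i + y i"])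
 next
  fix c f assume "f : ?S"
  then obtain x where "f = (%Y. \<Sum>i\<in>I. x i * F i Y)" by blast
  hence "fscale c f = (%Y. \<Sum>i\<in>I. (c * x i) * F i Y)" by (auto simp: fun_eq_iff fscale_def sum_distrib_left mult.assoc)
  thus "fscale c f : ?S" by (intro CollectI exI[of _ "%i. c * x i"])
 qed
 moreover have "F ` I <= ?S"
 proof (rule image_subsetI)
  fix i assume "i : I"
  hence "F i = (%Y. \<Sum>k\<in>I. (if k = i then 1 else 0) * F k Y)"
   using assms(2) sum.delta[OF assms(2), of i "%k. F k Y" for Y]
   by (auto simp: fun_eq_iff if_distrib[of "%c. c * _"] cong: if_cong)
  thus "F i : ?S" by (intro CollectI exI[of _ "%k. if k = i then 1 else 0"])
 qed
 ultimately have "f : ?S" using Fn.span_minimal assms(1) by blast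
 thus thesis using that by blast
qed

text \<open>The interior of a cone described by finitely many strict linear inequalities is open;
  applied below to the coordinates with respect to the basis given by a pair over B.\<close>

lemma open_positive:
 assumes I: "finite I"
 shows "openin (Euclidean_space n) {v : topspace (Euclidean_space n). ALL i:I. 0 < (\<Sum>j<n. v j * x j i)}"
 using I
proof (induction I)
 case (insert i I)
 have "continuous_map (Euclidean_space n) euclideanreal (%v. v j)" for j
  unfolding Euclidean_space_def by (rule continuous_map_from_subtopology[OF continuous_map_product_projection]) simp
 hence "continuous_map (Euclidean_space n) euclideanreal (%v. \<Sum>j<n. v j * x j i)"
  by (intro continuous_map_sum continuous_map_real_mult_right) auto
 hence "openin (Euclidean_space n) {v : topspace (Euclidean_space n). (\<Sum>j<n. v j * x j i) : {0<..}}"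
  by (rule openin_continuous_map_preimage) auto
 from openin_Int[OF this insert.IH] show ?case by (rule back_subst[of "openin (Euclidean_space n)"]) auto
qed auto

section \<open>Finite direct sums and g-vectors\<close>

lemma direct_sum_simps [simp]:
 "car (direct_sum I F) = (\<Pi>\<^sub>E i\<in>I. car (F i))" "zero (direct_sum I F) = (\<lambda>i\<in>I. \<zero>\<^sub>(F i))"
 "add (direct_sum I F) = (%x y. \<lambda>i\<in>I. x i \<oplus>\<^sub>(F i) y i)" "smult (direct_sum I F) = (%a x. \<lambda>i\<in>I. a \<odot>\<^sub>(F i) x i)"
 by (simp_all add: direct_sum_def)

lemma direct_sum_right_module:
 assumes A: "ring A" and F: "!!i. i : I ==> right_module A (F i)"
 shows "right_module A (direct_sum I F)"
proof -
 have c: "x i : car (F i)" if "x : car (direct_sum I F)" "i : I" for x i using that by (auto simp: PiE_mem)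
 have g: "abelian_group (F i)" if "i : I" for i using right_module.axioms(2)[OF F[OF that]] .
 have eq: "(\<lambda>i\<in>I. f i) = x" if "x : car (direct_sum I F)" "!!i. i : I ==> f i = x i" for f x
  using that by (auto simp: PiE_iff extensional_def fun_eq_iff)
 show ?thesis
 proof (rule right_moduleI[OF A])
  fix x assume x: "x : car (direct_sum I F)"
  show "\<zero>\<^sub>(direct_sum I F) \<oplus>\<^sub>(direct_sum I F) x = x"
   unfolding direct_sum_simps by (rule eq[OF x]) (use abelian_group.axioms(1)[OF g] abelian_monoid.l_zero c[OF x] in \<open>fastforce\<close>)
  show "\<one>\<^sub>A \<odot>\<^sub>(direct_sum I F) x = x"
   unfolding direct_sum_simps by (rule eq[OF x]) (use right_module.act_one[OF F] c[OF x] in auto)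
  show "EX y: car (direct_sum I F). y \<oplus>\<^sub>(direct_sum I F) x = \<zero>\<^sub>(direct_sum I F)"
   by (rule bexI[of _ "\<lambda>i\<in>I. \<ominus>\<^sub>(F i) x i"])
    (use c[OF x] abelian_group.l_neg[OF g] abelian_group.a_inv_closed[OF g] in \<open>auto simp: fun_eq_iff\<close>)
  fix y assume y: "y : car (direct_sum I F)"
  show "x \<oplus>\<^sub>(direct_sum I F) y : car (direct_sum I F)"
   using c[OF x] c[OF y] abelian_monoid.a_closed[OF abelian_group.axioms(1)[OF g]] by auto
  show "x \<oplus>\<^sub>(direct_sum I F) y = y \<oplus>\<^sub>(direct_sum I F) x"
   using c[OF x] c[OF y] abelian_monoid.a_comm[OF abelian_group.axioms(1)[OF g]] by (auto simp: fun_eq_iff)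
  fix z assume z: "z : car (direct_sum I F)"
  show "x \<oplus>\<^sub>(direct_sum I F) y \<oplus>\<^sub>(direct_sum I F) z = x \<oplus>\<^sub>(direct_sum I F) (y \<oplus>\<^sub>(direct_sum I F) z)"
   using c[OF x] c[OF y] c[OF z] abelian_monoid.a_assoc[OF abelian_group.axioms(1)[OF g]] by (auto simp: fun_eq_iff)
 next
  show "\<zero>\<^sub>(direct_sum I F) : car (direct_sum I F)"
   using abelian_monoid.zero_closed[OF abelian_group.axioms(1)[OF g]] by auto
 next
  fix a x assume a: "a : car A" and x: "x : car (direct_sum I F)"
  show "a \<odot>\<^sub>(direct_sum I F) x : car (direct_sum I F)" using right_module.act_closed[OF F a c[OF x]] by auto
  { fix y assume y: "y : car (direct_sum I F)"
   show "a \<odot>\<^sub>(direct_sum I F) (x \<oplus>\<^sub>(direct_sum I F) y) = a \<odot>\<^sub>(direct_sum I F) x \<oplus>\<^sub>(direct_sum I F) a \<odot>\<^sub>(direct_sum I F) y"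
    using right_module.act_add_right[OF F a c[OF x] c[OF y]] by (auto simp: fun_eq_iff) }
  fix b assume b: "b : car A"
  show "(a \<oplus>\<^sub>A b) \<odot>\<^sub>(direct_sum I F) x = a \<odot>\<^sub>(direct_sum I F) x \<oplus>\<^sub>(direct_sum I F) b \<odot>\<^sub>(direct_sum I F) x"
   using right_module.act_add_left[OF F a b c[OF x]] by (auto simp: fun_eq_iff)
  show "(a \<otimes>\<^sub>A b) \<odot>\<^sub>(direct_sum I F) x = b \<odot>\<^sub>(direct_sum I F) (a \<odot>\<^sub>(direct_sum I F) x)"
   using right_module.act_mult[OF F a b c[OF x]] by (auto simp: fun_eq_iff)
 qed
qed

text \<open>Splits off one index, so that facts on biproducts extend to finite direct sums by
  induction on the index set.\<close>

lemma direct_sum_biprod: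
 assumes F: "!!k. k : insert i I ==> right_module A (F k)" and i: "i ~: I"
 shows "biprod A (direct_sum (insert i I) F) (F i) (direct_sum I F)
  (%v. \<lambda>k\<in>insert i I. if k = i then v else \<zero>\<^sub>(F k)) (%y. \<lambda>k\<in>insert i I. if k = i then \<zero>\<^sub>(F i) else y k)
  (%x. x i) (%x. restrict x I)"
proof -
 have m: "abelian_monoid (F k)" if "k : insert i I" for k
  using abelian_group.axioms(1)[OF right_module.axioms(2)[OF F[OF that]]] .
 have z: "\<zero>\<^sub>(F k) : car (F k)" if "k : insert i I" for k using abelian_monoid.zero_closed[OF m[OF that]] .
 have zz: "\<zero>\<^sub>(F k) \<oplus>\<^sub>(F k) x = x" "x \<oplus>\<^sub>(F k) \<zero>\<^sub>(F k) = x" if "k : insert i I" "x : car (F k)" for k x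
  using abelian_monoid.l_zero[OF m[OF that(1)] that(2)] abelian_monoid.r_zero[OF m[OF that(1)] that(2)] by auto
 have az: "a \<odot>\<^sub>(F k) \<zero>\<^sub>(F k) = \<zero>\<^sub>(F k)" if "k : insert i I" "a : car A" for k a
  using right_module.act_zero_right[OF F[OF that(1)] that(2)] .
 show ?thesis unfolding biprod_def
 proof (intro conjI ballI)
  show "is_hom A (F i) (direct_sum (insert i I) F) (%v. \<lambda>k\<in>insert i I. if k = i then v else \<zero>\<^sub>(F k))"
   by (rule is_homI) (auto simp: z zz az fun_eq_iff i)
  show "is_hom A (direct_sum I F) (direct_sum (insert i I) F) (%y. \<lambda>k\<in>insert i I. if k = i then \<zero>\<^sub>(F i) else y k)"
   by (rule is_homI) (use i in \<open>auto simp: z zz az fun_eq_iff PiE_mem\<close>)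
  show "is_hom A (direct_sum (insert i I) F) (F i) (%x. x i)"
   by (rule is_homI) (auto simp: PiE_mem)
  show "is_hom A (direct_sum (insert i I) F) (direct_sum I F) (%x. restrict x I)"
   by (rule is_homI) (auto simp: PiE_mem fun_eq_iff)
  fix v assume "v : car (F i)"
  thus "(\<lambda>k\<in>insert i I. if k = i then v else \<zero>\<^sub>(F k)) i = v"
   "restrict (\<lambda>k\<in>insert i I. if k = i then v else \<zero>\<^sub>(F k)) I = \<zero>\<^sub>(direct_sum I F)"
   using i by (auto simp: fun_eq_iff)
 next
  fix y assume "y : car (direct_sum I F)"
  thus "restrict (\<lambda>k\<in>insert i I. if k = i then \<zero>\<^sub>(F i) else y k) I = y"
   using i by (auto simp: fun_eq_iff PiE_iff extensional_def)
  show "(\<lambda>k\<in>insert i I. if k = i then \<zero>\<^sub>(F i) else y k) i = \<zero>\<^sub>(F i)" by simp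
 next
  fix d assume "d : car (direct_sum (insert i I) F)"
  thus "d = (\<lambda>k\<in>insert i I. if k = i then d i else \<zero>\<^sub>(F k)) \<oplus>\<^sub>(direct_sum (insert i I) F)
    (\<lambda>k\<in>insert i I. if k = i then \<zero>\<^sub>(F i) else restrict d I k)"
   using i by (auto simp: fun_eq_iff PiE_iff extensional_def zz)
 qed
qed

context fd_algebra
begin

lemma biprod_iso:
 assumes D: "right_module A D" and D': "right_module A D'" and b: "biprod A D V W i j p q" and b': "biprod A D' V' W' i' j' p' q'"
  and V: "right_module A V" and W: "right_module A W" and V': "right_module A V'" and W': "right_module A W'"
  and iV: "mod_iso A V V'" and iW: "mod_iso A W W'"
 shows "mod_iso A D D'"
proof -
 note bd = biprodD[OF b] and bd' = biprodD[OF b']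
 obtain s where s: "is_hom A V V' s" "bij_betw s (car V) (car V')" using iV by (auto simp: mod_iso_iff[OF V])
 obtain u where u: "is_hom A W W' u" "bij_betw u (car W) (car W')" using iW by (auto simp: mod_iso_iff[OF W])
 let ?t = "inv_into (car V) s" and ?v = "inv_into (car W) u"
 note t = hom_inverse[OF V s] and v = hom_inverse[OF W u]
 let ?f = "%x. i' (s (p x)) \<oplus>\<^sub>D' j' (u (q x))" and ?g = "%x. i (?t (p' x)) \<oplus>\<^sub>D j (?v (q' x))"
 have f: "is_hom A D D' ?f" by (rule hom_to_biprod[OF D' b' hom_comp[OF bd(3) s(1)] hom_comp[OF bd(4) u(1)]])
 have g: "is_hom A D' D ?g" by (rule hom_to_biprod[OF D b hom_comp[OF bd'(3) t] hom_comp[OF bd'(4) v]])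
 have gf: "?g (?f x) = x" if "x : car D" for x
  by (rule biprod_left_inverse[OF D' b b' V' W' s(1) u(1) bij_betw_inv_into_left[OF s(2)] bij_betw_inv_into_left[OF u(2)] that])
 have fg: "?f (?g x) = x" if "x : car D'" for x
  by (rule biprod_left_inverse[OF D b' b V W t v bij_betw_inv_into_right[OF s(2)] bij_betw_inv_into_right[OF u(2)] that])
 have "bij_betw ?f (car D) (car D')"
  by (rule bij_betw_byWitness[where f'="?g"]) (use gf fg hom_closed[OF f] hom_closed[OF g] in auto)
 thus ?thesis using f by (auto simp: mod_iso_iff[OF D])
qed

lemma fdm_biprod:
 assumes D: "right_module A D" and V: "fdm K A V" and W: "fdm K A W" and b: "biprod A D V W i j p q"
 shows "fdm K A D"
proof -
 note bd = biprodD[OF b] and rV = fdmD(1)[OF V] and rW = fdmD(1)[OF W]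
 interpret VV: right_module A V by (rule rV)
 have sub: "submodule (i ` car V) A D" by (rule submodule_image[OF rV D bd(1) VV.submodule_carrier])
 have "fdm K A (restr D (i ` car V))"
  by (rule fdm_surj(1)[OF V right_module_restr[OF D sub] hom_to_image[OF bd(1)]]) simp
 hence "flen (Ka K) (restr (Kr A D) (a_kernel (Kr A D) (Kr A W) q))"
  using biprod_ker_q[OF D rV b rW] by (simp add: fdm_def Kr_restr a_kernel_Kr)
 thus ?thesis
  using flen_exact[OF right_module_Kr[OF D] right_module_Kr[OF rW] hom_Kr[OF bd(4)]] biprod_surj_q[OF b] fdmD(2)[OF W] D
  by (simp add: fdm_def)
qed

lemma fdm_zero: assumes "right_module A M" "car M = {\<zero>\<^sub>M}" shows "fdm K A M"
 unfolding fdm_def using assms flen_zero[OF right_module_Kr[OF assms(1)]] by simp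

lemma direct_sum_empty: "car (direct_sum {} F) = {\<zero>\<^sub>(direct_sum {} F)}"
 by (auto simp: fun_eq_iff)

lemma direct_sum_fdm:
 assumes "finite I" "!!i. i : I ==> fdm K A (F i)"
 shows "fdm K A (direct_sum I F)"
 using assms
proof (induction I)
 case empty
 show ?case by (rule fdm_zero[OF direct_sum_right_module[OF ring_A] direct_sum_empty]) simp
next
 case (insert i I)
 have r: "right_module A (F k)" if "k : insert i I" for k using fdmD(1)[OF insert.prems[OF that]] .
 have "fdm K A (direct_sum I F)" by (rule insert.IH) (use insert.prems in auto)
 thus ?case by (intro fdm_biprod[OF direct_sum_right_module[OF ring_A] _ _ direct_sum_biprod[OF _ insert.hyps(2)]]) (use r insert.prems in auto)
qed

lemma direct_sum_hdim:
 assumes "finite I" "!!i. i : I ==> fdm K A (F i)" and Y: "fdm K A Y"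
 shows "hdim K A (direct_sum I F) Y = (\<Sum>i\<in>I. hdim K A (F i) Y)"
 using assms(1,2)
proof (induction I)
 case empty
 have r: "right_module A (direct_sum {} F)" by (rule direct_sum_right_module[OF ring_A]) simp
 show ?case using hdim_eq_0_iff[OF fdm_zero[OF r direct_sum_empty] Y] hom_from_zero[OF r fdmD(1)[OF Y] direct_sum_empty] by simp
next
 case (insert i I)
 have r: "right_module A (F k)" if "k : insert i I" for k using fdmD(1)[OF insert.prems[OF that]] .
 have f: "fdm K A (direct_sum (insert i I) F)" "fdm K A (direct_sum I F)" "fdm K A (F i)"
  using direct_sum_fdm[of "insert i I" F] direct_sum_fdm[of I F] insert.hyps(1) insert.prems by auto
 show ?case using hdim_biprod[OF f(1,3,2) Y direct_sum_biprod[OF r insert.hyps(2)]] insert by simp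
qed

lemma direct_sum_retract:
 assumes "!!k. k : I ==> right_module A (F k)" "i : I"
 shows "retract A (F i) (direct_sum I F)"
proof -
 have "insert i (I - {i}) = I" using assms(2) by blast
 thus ?thesis using biprod_retract(1)[OF direct_sum_biprod[of i "I - {i}" A F]] assms(1) by auto
qed

text \<open>Split off one indecomposable projective summand and induct on the dimension of the
  complement.\<close>

lemma proj_sum_exists:
 fixes R :: "('k, 'a) fmod"
 assumes P: "indec_projectives A P" and R: "projective A R"
 shows "EX a. mod_iso A R (proj_sum (algebra_rank A) P a)"
 using R
proof (induction "dm K A R" arbitrary: R rule: less_induct)
 case (less R)
 let ?n = "algebra_rank A"
 note Rf = projD[OF less(2)]
 have rP: "right_module A (P j)" if "j < ?n" for j using P that projD(3) by (auto simp: indec_projectives_def)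
 have rF: "right_module A ((%(i, j). P i) k)" if "k : (SIGMA i:{..<?n}. {..<a i})" for k and a :: "nat => nat"
  using that rP by auto
 show ?case
 proof (cases "car R = {\<zero>\<^sub>R}")
  case True
  let ?D = "proj_sum ?n P (%_. 0)"
  have D: "car ?D = {\<zero>\<^sub>?D}" unfolding proj_sum_def using direct_sum_empty by simp
  have rD: "right_module A ?D" unfolding proj_sum_def by (rule direct_sum_right_module[OF ring_A rF])
  have "bij_betw (%_. \<zero>\<^sub>?D) (car R) (car ?D)" unfolding True D by (auto simp: bij_betw_def)
  thus ?thesis using hom_zero_fun[OF rD, of R] by (auto simp: mod_iso_iff[OF Rf(3)])
 next
  case False
  then obtain N where N: "N : ind A R" using ind_nonempty[OF Rf(2)] by blast
  note Nd = indD[OF N] and rN = fmD(2)[OF indD(1)[OF N]]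
  obtain j where j: "j < ?n" "mod_iso A N (P j)" using P ind_projective[OF less(2) N] Nd(2) by (auto simp: indec_projectives_def)
  obtain s t where st: "is_hom A N R s" "is_hom A R N t" "!!x. x : car N ==> t (s x) = x"
   using Nd(3) unfolding retract_def by auto
  note d = retract_decomposes[where s=s and r=t, OF Rf(3) rN st]
  let ?N = "s ` car N" and ?L = "a_kernel R N t"
  have sub: "submodule ?N A R" "submodule ?L A R" using d(1) by (auto simp: decomposes_def)
  note r = right_module_restr[OF Rf(3) sub(1)] right_module_restr[OF Rf(3) sub(2)]
  obtain p q where b: "biprod A R (restr R ?N) (restr R ?L) (%x. x) (%x. x) p q" by (rule decomposes_biprod[OF Rf(3) d(1)])
  have iso: "mod_iso A N (restr R ?N)" using d(2,3) by (auto simp: mod_iso_iff[OF rN])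
  have isoP: "mod_iso A (restr R ?N) (P j)" by (rule mod_iso_trans[OF r(1) rN mod_iso_sym[OF rN r(1) iso] j(2)])
  have pL: "projective A (restr R ?L)"
   by (rule proj_retract[OF less(2) fmods_restr[OF Rf(1) sub(2)] biprod_retract(2)[OF b]])
  have "?L ~= car R"
  proof
   assume e: "?L = car R"
   have "?N <= car R" using hom_closed[OF st(1)] by blast
   hence "?N = {\<zero>\<^sub>R}" using d(1) e by (auto simp: decomposes_def)
   moreover have "car (restr R ?N) ~= {\<zero>\<^sub>(restr R ?N)}" by (rule indec_nonzero[OF indec_iso[OF rN r(1) iso Nd(2)]])
   ultimately show False by simp
  qed
  hence "dm K A (restr R ?L) < dm K A R" by (rule fdm_restr(3)[OF Rf(2) sub(2)])
  from less(1)[OF this pL] obtain a where a: "mod_iso A (restr R ?L) (proj_sum ?n P a)" by blast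
  \<comment> \<open>The summand just split off becomes the copy of \<open>P j\<close> with the new
    index (j, a j).\<close>
  let ?a = "a(j := Suc (a j))"
  let ?I = "SIGMA i:{..<?n}. {..<a i}"
  have I: "(SIGMA i:{..<?n}. {..<?a i}) = insert (j, a j) ?I" using j(1) by (auto split: if_splits)
  have nI: "(j, a j) ~: ?I" by simp
  have rI: "right_module A ((%(i, j). P i) k)" if "k : insert (j, a j) ?I" for k using rF[of k ?a] that unfolding I by blast
  have b': "biprod A (proj_sum ?n P ?a) (P j) (proj_sum ?n P a)
   (%v. \<lambda>k\<in>insert (j, a j) ?I. if k = (j, a j) then v else \<zero>\<^sub>((%(i, j). P i) k))
   (%y. \<lambda>k\<in>insert (j, a j) ?I. if k = (j, a j) then \<zero>\<^sub>((%(i, j). P i) (j, a j)) else y k)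
   (%x. x (j, a j)) (%x. restrict x ?I)"
   using direct_sum_biprod[of "(j, a j)" ?I A "%(i, j). P i", OF rI nI] unfolding proj_sum_def I by simp
  have rs: "right_module A (proj_sum ?n P c)" for c unfolding proj_sum_def by (rule direct_sum_right_module[OF ring_A rF])
  have "mod_iso A R (proj_sum ?n P ?a)"
   by (rule biprod_iso[OF Rf(3) rs b b' r rP[OF j(1)] rs isoP a])
  thus ?thesis by blast
 qed
qed

lemma proj_sum_hdim:
 assumes P: "indec_projectives A P" and R: "projective A R" and i: "mod_iso A R (proj_sum (algebra_rank A) P a)" and Y: "Y : fmods A"
 shows "real (hdim K A R Y) = (\<Sum>j<algebra_rank A. real (a j) * real (hdim K A (P j) Y))"
proof -
 let ?n = "algebra_rank A" and ?F = "%(i, j). P i"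
 have f: "fdm K A (?F k)" if "k : (SIGMA i:{..<?n}. {..<a i})" for k
  using that P projD(2) by (auto simp: indec_projectives_def)
 have fs: "fdm K A (proj_sum ?n P a)" unfolding proj_sum_def by (rule direct_sum_fdm) (use f in auto)
 have "hdim K A R Y = hdim K A (proj_sum ?n P a) Y" by (rule hdim_iso_dom[OF projD(2)[OF R] fs fmD(1)[OF Y] i])
 also have "... = (\<Sum>k\<in>(SIGMA i:{..<?n}. {..<a i}). hdim K A (?F k) Y)"
  unfolding proj_sum_def by (rule direct_sum_hdim[OF _ f fmD(1)[OF Y]]) auto
 also have "... = (\<Sum>(i, j)\<in>(SIGMA i:{..<?n}. {..<a i}). hdim K A (P i) Y)" by (rule sum.cong) auto
 also have "... = (\<Sum>i<?n. a i * hdim K A (P i) Y)" by (subst sum.Sigma[symmetric]) auto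
 finally show ?thesis by simp
qed

text \<open>The functions dim Hom(P(j),-) are independent by \<open>theta_independent\<close> with
  empty module part; this makes multiplicities, and hence g-vectors, unique.\<close>

lemma indec_projectives_independent:
 assumes P: "indec_projectives A P" and z: "!!Y. Y : fmods A ==> (\<Sum>j<algebra_rank A. d j * real (hdim K A (P j) Y)) = 0"
  and j: "j < algebra_rank A"
 shows "d j = 0"
proof -
 let ?n = "algebra_rank A" and ?Q = "P ` {..<algebra_rank A}"
 have Pd: "projective A (P i)" "indecomposable A (P i)" if "i < ?n" for i using P that by (auto simp: indec_projectives_def)
 have Pi: "i = k" if "i < ?n" "k < ?n" "mod_iso A (P i) (P k)" for i k using P that by (auto simp: indec_projectives_def)
 have inj: "inj_on P {..<?n}" by (rule inj_onI) (use Pi fmod_iso_refl projD(1) Pd(1) in auto)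
 let ?e = "%Q. d (inv_into {..<?n} P Q)"
 have "(\<Sum>M\<in>{}. (0::real) * theta K A M Y) = (\<Sum>Q\<in>?Q. ?e Q * real (hdim K A Q Y))" if "Y : fmods A" for Y
  unfolding sum.reindex[OF inj] using z[OF that] inv_into_f_f[OF inj] by simp
 moreover have "rigid_set K A {} ?Q" using Pd(1) by (auto simp: rigid_set_def)
 ultimately have "ALL Q:?Q. ?e Q = 0"
  by (intro theta_independent(2)[where U="{}" and P="?Q" and c="%_. 0" and e="?e"]) (use Pd(2) Pi in auto)
 hence "?e (P j) = 0" using j by blast
 thus ?thesis using j inv_into_f_f[OF inj, of j] by simp
qed

text \<open>Decomposing the terms of a minimal presentation into indecomposable projectives
  expresses the function of a pair through its g-vector. Independence of the dim Hom(P(j),-) shows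
  that the definite description in \<open>g_vector\<close> is satisfied.\<close>

lemma g_vector_theta:
 assumes P: "indec_projectives A P" and Z: "rp Z" and Y: "Y : fmods A"
 shows "theta K A (fst Z) Y - real (hdim K A (snd Z) Y) =
  (\<Sum>j<algebra_rank A. real_of_int (g_vector A P Z j) * real (hdim K A (P j) Y))"
proof -
 let ?n = "algebra_rank A"
 note r = rpD[OF Z]
 define Pr where "Pr = (%g :: nat => int. EX a b c P1 f P0 p.
  min_proj_presentation A P1 f P0 p (fst Z) & mod_iso A P0 (proj_sum ?n P a) &
  mod_iso A P1 (proj_sum ?n P b) & mod_iso A (snd Z) (proj_sum ?n P c) &
  g = (%i. if i < ?n then int (a i) - int (b i) - int (c i) else 0))"
 have id: "theta K A (fst Z) Y - real (hdim K A (snd Z) Y) = (\<Sum>j<?n. real_of_int (g j) * real (hdim K A (P j) Y))"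
  "!!i. i >= ?n ==> g i = 0" if g: "Pr g" and Y: "Y : fmods A" for g Y
 proof -
  obtain a b c P1 f P0 p where *: "min_proj_presentation A P1 f P0 p (fst Z)" "mod_iso A P0 (proj_sum ?n P a)"
   "mod_iso A P1 (proj_sum ?n P b)" "mod_iso A (snd Z) (proj_sum ?n P c)"
   "g = (%i. if i < ?n then int (a i) - int (b i) - int (c i) else 0)"
   using g unfolding Pr_def by blast
  note m = min_proj_presentation_mpres[OF r(1) *(1)]
  note pd = presD[OF mpres_pres[OF r(1) m]]
  show "!!i. i >= ?n ==> g i = 0" using *(5) by simp
  have "(\<Sum>j<?n. real_of_int (g j) * real (hdim K A (P j) Y)) = (\<Sum>j<?n. real (a j) * real (hdim K A (P j) Y)) -
   (\<Sum>j<?n. real (b j) * real (hdim K A (P j) Y)) - (\<Sum>j<?n. real (c j) * real (hdim K A (P j) Y))"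
   unfolding sum_subtractf[symmetric] by (rule sum.cong) (auto simp: *(5) algebra_simps)
  thus "theta K A (fst Z) Y - real (hdim K A (snd Z) Y) = (\<Sum>j<?n. real_of_int (g j) * real (hdim K A (P j) Y))"
   using proj_sum_hdim[OF P pd(2) *(2) Y] proj_sum_hdim[OF P pd(1) *(3) Y] proj_sum_hdim[OF P r(3) *(4) Y] theta_eq[OF r(1) m Y] by simp
 qed
 have ex: "EX g. Pr g"
 proof -
  obtain P1 f P0 p where m: "min_proj_presentation A P1 f P0 p (fst Z)" by (rule min_proj_presentation_exists[OF r(1)])
  note pd = presD[OF mpres_pres[OF r(1) min_proj_presentation_mpres[OF r(1) m]]]
  obtain a b c where "mod_iso A P0 (proj_sum ?n P a)" "mod_iso A P1 (proj_sum ?n P b)" "mod_iso A (snd Z) (proj_sum ?n P c)"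
   using proj_sum_exists[OF P pd(2)] proj_sum_exists[OF P pd(1)] proj_sum_exists[OF P r(3)] by blast
  thus ?thesis unfolding Pr_def using m by blast
 qed
 have un: "g = h" if g: "Pr g" and h: "Pr h" for g h
 proof
  fix i
  show "g i = h i"
  proof (cases "i < ?n")
   case True
   have "real_of_int (g i) - real_of_int (h i) = 0"
    by (rule indec_projectives_independent[OF P _ True, where d="%i. real_of_int (g i) - real_of_int (h i)"])
     (use id(1)[OF g] id(1)[OF h] in \<open>simp add: left_diff_distrib sum_subtractf\<close>)
   thus ?thesis by simp
  qed (use id(2)[OF g Y, of i] id(2)[OF h Y, of i] in simp)
 qed
 have "g_vector A P Z = (THE g. Pr g)" unfolding g_vector_def Pr_def ..
 moreover have "Pr (THE g. Pr g)" 
 proof (rule theI'[of Pr])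
  show "EX! g. Pr g" using ex un by blast
 qed
 ultimately show ?thesis using id(1)[OF _ Y] by simp
qed

end

section \<open>Surjectivity from density of the g-vector cones\<close>

context fd_quotient
begin

text \<open>In the coordinates of the basis given by S, restriction to B-modules is a surjective
  linear map from g-vectors. The open orthant of the cone of S has a nonempty open preimage, and by
  density of the cones over A this preimage meets the cone of some T.\<close>

theorem Phi_surj:
 assumes gt: "g_tame K A" and S: "S : tau_tilting_pairs K B"
 obtains T where "Phi T S"
proof -
 let ?n = "algebra_rank A"
 obtain P where P: "indec_projectives A P"
  and dense: "Euclidean_space ?n closure_of (\<Union>T\<in>tau_tilting_pairs K A. g_cone K A P T) = topspace (Euclidean_space ?n)"
  using gt unfolding g_tame_def by blast
 note s = Q.tiltingD[OF S] and sr = Q.rpD[OF Q.tiltingD(1)[OF S]]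
 obtain V where V: "reps B (fst S) V" by (rule Q.reps_exists[OF Q.fmD(1)[OF sr(1)]])
 obtain R where R: "reps B (snd S) R" by (rule Q.reps_exists[OF Q.fmD(1)[OF sr(5)]])
 have fin: "finite V" "finite R" using V R by (auto simp: reps_def)
 let ?I = "V <+> R" and ?F = "case_sum (tf K B) (pf K B)"
 have fI: "finite ?I" using fin by simp
 note fam = Q.rp_family[OF s(1) V R]
 have full: "Fn.span (?F ` ?I) = Fn.span (pf K B ` ind B (regular B))" using Q.span_full[OF s(1,4)] unfolding fam(4) .
 have Pd: "projective A (P j)" "indecomposable A (P j)" if "j < ?n" for j using P that by (auto simp: indec_projectives_def)
 have bp: "rho (pf K A (P j)) : Fn.span (?F ` ?I)" if j: "j < ?n" for j
 proof -
  obtain N q where b: "isbar (P j) N q" by (rule bar_exists[OF projD(1)[OF Pd(1)[OF j]]])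
  note pN = bar_projective[OF b Pd(1)[OF j]]
  have "pf K B N : Fn.span (pf K B ` ind B (regular B))"
   using Q.pf_span[OF Q.projD(1)[OF pN]] Fn.span_mono[OF image_mono[OF Q.ind_sub_regular[OF pN]]] by blast
  thus ?thesis using full rho_pf[OF b] by simp
 qed
 \<comment> \<open>The coordinates of the restricted dim Hom(P(j),-) in the basis of S;
   \<open>c v\<close> below is the image of the g-vector v in these coordinates.\<close>
 define x where "x = (%j. SOME x. rho (pf K A (P j)) = (%Y. \<Sum>i\<in>?I. x i * ?F i Y))"
 have x: "rho (pf K A (P j)) = (%Y. \<Sum>i\<in>?I. x j i * ?F i Y)" if j: "j < ?n" for j
 proof -
  obtain y where "rho (pf K A (P j)) = (%Y. \<Sum>i\<in>?I. y i * ?F i Y)" by (rule span_family[OF bp[OF j] fI])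
  thus ?thesis unfolding x_def by (rule someI[where P="%x. rho (pf K A (P j)) = (%Y. \<Sum>i\<in>?I. x i * ?F i Y)"])
 qed
 define c where "c = (%v i. \<Sum>j<?n. v j * x j i)"
 have cF: "(\<Sum>j<?n. v j * rho (pf K A (P j)) Y) = (\<Sum>i\<in>?I. c v i * ?F i Y)" for v :: "nat => real" and Y
 proof -
  have "(\<Sum>j<?n. v j * rho (pf K A (P j)) Y) = (\<Sum>j<?n. \<Sum>i\<in>?I. v j * x j i * ?F i Y)"
   by (rule sum.cong) (auto simp: x sum_distrib_left mult.assoc)
  also have "... = (\<Sum>i\<in>?I. \<Sum>j<?n. v j * x j i * ?F i Y)" by (rule sum.swap)
  finally show ?thesis by (simp add: c_def sum_distrib_right)
 qed
 \<comment> \<open>A projective summand enters a cone with a negative sign, since its g-vector is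
   minus its multiplicity vector.\<close>
 define sg :: "('k, 'a set) fmod + ('k, 'a set) fmod => real" where "sg = case_sum (%_. 1) (%_. - 1)"
 \<comment> \<open>A preimage of the sum of the rays of the cone of S; it exists because the
   restricted functions of the projectives of A span everything for B.\<close>
 obtain v0 where v0: "!!i. i : ?I ==> c v0 i = sg i"
 proof -
  let ?W = "\<Sum>i\<in>?I. fscale (sg i) (?F i)"
  have "?W : Fn.span (?F ` ?I)" by (intro Fn.span_sum Fn.span_scale Fn.span_base) blast
  hence W1: "?W : Fn.span (pf K B ` ind B (regular B))" unfolding full .
  have "pf K A ` ind A (regular A) <= (%j. pf K A (P j)) ` {..<?n}"
  proof (rule image_subsetI)
   fix N assume N: "N : ind A (regular A)"
   hence "projective A N" "indecomposable A N" unfolding ind_regular by auto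
   then obtain j where j: "j < ?n" "mod_iso A N (P j)" using P by (auto simp: indec_projectives_def)
   have "pf K A N = pf K A (P j)" by (rule pf_iso[OF indD(1)[OF N] projD(1)[OF Pd(1)[OF j(1)]] j(2)])
   thus "pf K A N : (%j. pf K A (P j)) ` {..<?n}" using j(1) by simp
  qed
  hence "pf K A ` ind A (regular A) <= Fn.span ((%j. pf K A (P j)) ` {..<?n})"
   using Fn.span_superset by (rule order_trans)
  from regular_B_span[OF this] have "Fn.span (pf K B ` ind B (regular B)) <= Fn.span ((%j. rho (pf K A (P j))) ` {..<?n})"
   unfolding image_image by (rule Fn.span_minimal[OF _ Fn.subspace_span])
  hence "?W : Fn.span ((%j. rho (pf K A (P j))) ` {..<?n})" using W1 by blast
  then obtain v where v: "?W = (%Y. \<Sum>j<?n. v j * rho (pf K A (P j)) Y)" by (rule span_family) simp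
  have "ALL i:?I. c v i - sg i = 0"
  proof (rule fam(3))
   fix Y
   have "?W Y = (\<Sum>i\<in>?I. sg i * ?F i Y)" by (simp add: fun_sum_apply fscale_def)
   thus "(\<Sum>i\<in>?I. (c v i - sg i) * ?F i Y) = 0"
    using fun_cong[OF v, of Y] cF[of v Y] by (simp add: left_diff_distrib sum_subtractf)
  qed
  thus thesis using that[of v] by simp
 qed
 \<comment> \<open>Coordinates beyond the rank are set to zero to obtain a point of the Euclidean
   space; \<open>c\<close> does not read them.\<close>
 let ?v = "%j. if j < ?n then v0 j else 0"
 let ?O = "{v : topspace (Euclidean_space ?n). ALL i:?I. 0 < (\<Sum>j<?n. v j * (sg i * x j i))}"
 have O: "openin (Euclidean_space ?n) ?O" by (rule open_positive[OF fI])
 have Oc: "(\<Sum>j<?n. v j * (sg i * x j i)) = sg i * c v i" for v i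
  by (simp add: c_def sum_distrib_left mult.left_commute)
 have "c ?v i = c v0 i" for i unfolding c_def by (rule sum.cong) auto
 hence "?v : ?O" unfolding Oc using v0 by (auto simp: topspace_Euclidean_space sg_def)
 moreover have "?v : Euclidean_space ?n closure_of (\<Union>T\<in>tau_tilting_pairs K A. g_cone K A P T)"
  unfolding dense by (simp add: topspace_Euclidean_space)
 ultimately have "EX v. v : (\<Union>T\<in>tau_tilting_pairs K A. g_cone K A P T) & v : ?O"
  using O unfolding in_closure_of by (elim conjE allE[of _ ?O] impE) simp_all
 then obtain v T where T: "v : ?O" "T : tau_tilting_pairs K A" "v : g_cone K A P T" by (elim exE conjE UN_E)
 have sc: "0 < sg i * c v i" if "i : ?I" for i using T(1) that unfolding Oc by blast
 have cp: "c v (Inl N) > 0" if "N : V" for N using sc[OF InlI[OF that]] by (simp add: sg_def)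
 have cn: "- c v (Inr N) > 0" if "N : R" for N using sc[OF InrI[OF that]] by (simp add: sg_def)
 obtain Z k where Z: "!!i. i < ?n ==> indec_tau_rigid_pair K A (Z i)" "!!i. i < ?n ==> 0 <= k i"
  "mod_iso A (fst T) (direct_sum {..<?n} (%i. fst (Z i)))" "mod_iso A (snd T) (direct_sum {..<?n} (%i. snd (Z i)))"
  "v = (%j. \<Sum>i<?n. k i * real_of_int (g_vector A P (Z i) j))"
  using T(3) unfolding g_cone_def by blast
 have Zr: "rp (Z i)" if "i < ?n" for i using Z(1)[OF that] unfolding indec_tau_rigid_pair_def tau_rigid_pair_iff by simp
 note t = rpD[OF tiltingD(1)[OF T(2)]]
 have Zf: "fst (Z i) : fmods A" "snd (Z i) : fmods A" if "i < ?n" for i using rpD(1,5)[OF Zr[OF that]] by auto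
 have ret: "retract A (fst (Z i)) (fst T)" "retract A (snd (Z i)) (snd T)" if "i < ?n" for i
  using retract_trans[OF direct_sum_retract[of "{..<?n}" "%i. fst (Z i)" i] mod_iso_retract(2)[OF fmD(2)[OF t(1)] Z(3)]]
   retract_trans[OF direct_sum_retract[of "{..<?n}" "%i. snd (Z i)" i] mod_iso_retract(2)[OF fmD(2)[OF t(5)] Z(4)]]
   Zf fmD(2) that by auto
 \<comment> \<open>Only summands of T with positive weight in v are kept, as \<open>compat\<close>
   demands strictly positive coefficients.\<close>
 let ?J = "{i. i < ?n & k i > 0}"
 have eq: "(\<Sum>i\<in>?J. k i * (theta K A (fst (Z i)) (ofB Y) - real (hdim K A (snd (Z i)) (ofB Y)))) =
   (\<Sum>N\<in>V. c v (Inl N) * theta K B N Y) - (\<Sum>N\<in>R. - c v (Inr N) * real (hdim K B N Y))" if Y: "Y : fmods B" for Y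
 proof -
  have "(\<Sum>i\<in>?J. k i * (theta K A (fst (Z i)) (ofB Y) - real (hdim K A (snd (Z i)) (ofB Y)))) =
    (\<Sum>i<?n. k i * (theta K A (fst (Z i)) (ofB Y) - real (hdim K A (snd (Z i)) (ofB Y))))"
   by (rule sum.mono_neutral_left) (use Z(2) in \<open>auto simp: less_le\<close>)
  also have "... = (\<Sum>i<?n. \<Sum>j<?n. k i * real_of_int (g_vector A P (Z i) j) * rho (pf K A (P j)) Y)"
   by (rule sum.cong) (use fmods_ofB[OF Y] Y in \<open>auto simp: g_vector_theta[OF P Zr] rho_def pf_def sum_distrib_left mult.assoc\<close>)
  also have "... = (\<Sum>j<?n. \<Sum>i<?n. k i * real_of_int (g_vector A P (Z i) j) * rho (pf K A (P j)) Y)" by (rule sum.swap)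
  also have "... = (\<Sum>j<?n. v j * rho (pf K A (P j)) Y)" unfolding Z(5) by (simp add: sum_distrib_right)
  also have "... = (\<Sum>i\<in>?I. c v i * ?F i Y)" by (rule cF)
  also have "... = (\<Sum>N\<in>V. c v (Inl N) * theta K B N Y) - (\<Sum>N\<in>R. - c v (Inr N) * real (hdim K B N Y))"
   unfolding sum.Plus[OF fin] using Y by (simp add: tf_def pf_def sum_negf)
  finally show ?thesis .
 qed
 have "Phi T S"
  by (rule Phi_surj_core[OF S T(2), where J="?J" and k=k and M="%i. fst (Z i)" and P="%i. snd (Z i)" and V=V and R=R
    and c="%N. c v (Inl N)" and e="%N. - c v (Inr N)"])
   (use Zf ret V R cp cn eq in auto)
 thus thesis by (rule that)
qed

end

section \<open>Transport of paths and connectedness\<close>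

context fd_algebra
begin

lemma tilting_iso_refl: "T : tau_tilting_pairs K A ==> (T, T) : tau_tilting_iso K A"
 unfolding tau_tilting_iso_def using fmod_iso_refl rpD(1,5) tiltingD(1) by blast

lemma tilting_isoD:
 assumes "(T, U) : tau_tilting_iso K A"
 shows "T : tau_tilting_pairs K A" "U : tau_tilting_pairs K A" "mod_iso A (fst T) (fst U)" "ind A (fst T) = ind A (fst U)"
proof -
 show *: "T : tau_tilting_pairs K A" "U : tau_tilting_pairs K A" "mod_iso A (fst T) (fst U)" using assms by (auto simp: tau_tilting_iso_def)
 thus "ind A (fst T) = ind A (fst U)" using ind_cong_iso rpD(1) tiltingD(1) by blast
qed

lemma tilting_iso_class_eq:
 assumes "(T, U) : tau_tilting_iso K A"
 shows "tau_tilting_iso K A `` {T} = tau_tilting_iso K A `` {U}"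
proof -
 note d = tilting_isoD[OF assms]
 have "(T, V) : tau_tilting_iso K A \<longleftrightarrow> (U, V) : tau_tilting_iso K A" for V
  using tilting_isoI[OF d(1), of V] tilting_isoI[OF d(2), of V] tilting_isoD(2,4) d(4) by metis
 thus ?thesis by auto
qed

lemma tilting_class_eq_iso:
 assumes "T : tau_tilting_pairs K A" "U : tau_tilting_pairs K A" "tau_tilting_iso K A `` {T} = tau_tilting_iso K A `` {U}"
 shows "(T, U) : tau_tilting_iso K A"
 using tilting_iso_refl[OF assms(2)] assms(3) by blast

abbreviation tclass :: "('k, 'a) fpair => ('k, 'a) fpair set" where "tclass T \<equiv> tau_tilting_iso K A `` {T}"

lemma graph_verts: "pverts (tau_tilting_graph K A) = tclass ` tau_tilting_pairs K A"
 by (auto simp: tau_tilting_graph_def quotient_def)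

lemma mutation_sym: "mutation K A T U ==> mutation K A U T"
proof -
 assume m: "mutation K A T U"
 hence "(U, T) ~: tau_tilting_iso K A"
  using tilting_isoI[of T U] tilting_isoD(4)[of U T] unfolding mutation_def by auto
 thus ?thesis using m unfolding mutation_def by blast
qed

text \<open>Connectedness is defined through the symmetric closure; mutation is already symmetric,
  so the closure adds no arcs.\<close>

lemma graph_sym_arcs:
 "parcs (mk_symmetric (with_proj (tau_tilting_graph K A))) = {(tclass T, tclass U) | T U. mutation K A T U}"
proof
 show "parcs (mk_symmetric (with_proj (tau_tilting_graph K A))) <= {(tclass T, tclass U) | T U. mutation K A T U}"
  unfolding parcs_mk_symmetric by (auto simp: tau_tilting_graph_def) (use mutation_sym in blast)+
 show "{(tclass T, tclass U) | T U. mutation K A T U} <= parcs (mk_symmetric (with_proj (tau_tilting_graph K A)))"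
 proof
  fix x assume "x : {(tclass T, tclass U) | T U. mutation K A T U}"
  hence "x : parcs (tau_tilting_graph K A)" by (auto simp: tau_tilting_graph_def)
  thus "x : parcs (mk_symmetric (with_proj (tau_tilting_graph K A)))"
   unfolding parcs_mk_symmetric by (intro UN_I[of x]) simp_all
 qed
qed

lemma connected_iff:
 "Digraph_Component.connected (with_proj (tau_tilting_graph K A)) \<longleftrightarrow> tau_tilting_pairs K A ~= {} &
  (ALL T:tau_tilting_pairs K A. ALL U:tau_tilting_pairs K A.
   (tclass T, tclass U) : rtrancl_on (tclass ` tau_tilting_pairs K A) {(tclass T, tclass U) | T U. mutation K A T U})"
 unfolding Digraph_Component.connected_def strongly_connected_def reachable_def
 by (simp add: graph_verts graph_sym_arcs)

end

context fd_quotient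
begin

text \<open>Each arc of the path over A is sent by \<open>Phi_mutation\<close> to an arc or to a
  repeated vertex. Images are chosen afresh for every representative, and \<open>Phi_unique\<close>
  reconciles the choices.\<close>

lemma Phi_reachable:
 assumes "(u, w) : rtrancl_on (tclass ` tau_tilting_pairs K A) {(tclass T, tclass U) | T U. mutation K A T U}"
  and "u = tclass T" "Phi T S" "w = tclass T'" "Phi T' S'"
 shows "(Q.tclass S, Q.tclass S') : rtrancl_on (Q.tclass ` tau_tilting_pairs K B) {(Q.tclass T, Q.tclass U) | T U. mutation K B T U}"
  (is "_ : ?R")
 using assms(1,4,5)
proof (induction arbitrary: T' S' rule: rtrancl_on_induct)
 case base
 have "(T, T') : tau_tilting_iso K A"
  using tilting_class_eq_iso[OF PhiD(1)[OF assms(3)] PhiD(1)[OF base.prems(2)]] base.prems(1) assms(2) by simp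
 hence "(S, S') : tau_tilting_iso K B" by (rule Phi_unique[OF assms(3) base.prems(2) tilting_isoD(3)])
 hence e: "Q.tclass S = Q.tclass S'" by (rule Q.tilting_iso_class_eq)
 have "Q.tclass S' : Q.tclass ` tau_tilting_pairs K B" using PhiD(2)[OF base.prems(2)] by blast
 thus ?case unfolding e by (rule rtrancl_on_refl)
next
 case (step b c)
 obtain T1 T2 where m: "b = tclass T1" "c = tclass T2" "mutation K A T1 T2" using step.hyps(2) by blast
 have tt: "T1 : tau_tilting_pairs K A" "T2 : tau_tilting_pairs K A" using m(3) by (auto simp: mutation_def)
 obtain S1 where S1: "Phi T1 S1" by (rule Phi_exists[OF tt(1)])
 obtain S2 where S2: "Phi T2 S2" by (rule Phi_exists[OF tt(2)])
 have "(T2, T') : tau_tilting_iso K A"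
  using tilting_class_eq_iso[OF tt(2) PhiD(1)[OF step.prems(2)]] step.prems(1) m(2) by simp
 hence "(S2, S') : tau_tilting_iso K B" by (rule Phi_unique[OF S2 step.prems(2) tilting_isoD(3)])
 hence e: "Q.tclass S2 = Q.tclass S'" by (rule Q.tilting_iso_class_eq)
 have r: "(Q.tclass S, Q.tclass S1) : ?R" by (rule step.IH[OF m(1) S1])
 show ?case
 proof (cases "(S1, S2) : tau_tilting_iso K B")
  case True
  thus ?thesis using r Q.tilting_iso_class_eq[OF True] e by simp
 next
  case False
  hence "mutation K B S1 S2" using Phi_mutation[OF m(3) S1 S2] by blast
  hence "(Q.tclass S1, Q.tclass S') : {(Q.tclass T, Q.tclass U) | T U. mutation K B T U}" unfolding e[symmetric] by blast
  thus ?thesis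
   by (rule rtrancl_on_into_rtrancl_on[OF r]) (use PhiD(2)[OF step.prems(2)] in blast)
 qed
qed

text \<open>Lift both end points by \<open>Phi_surj\<close>, join the lifts over A, and push the
  path down.\<close>

theorem quotient_connected:
 assumes gt: "g_tame K A" and c: "Digraph_Component.connected (with_proj (tau_tilting_graph K A))"
 shows "Digraph_Component.connected (with_proj (tau_tilting_graph K B))"
proof -
 obtain T where "T : tau_tilting_pairs K A" using c unfolding connected_iff by blast
 then obtain S where "Phi T S" by (rule Phi_exists)
 hence ne: "tau_tilting_pairs K B ~= {}" using PhiD(2) by blast
 show ?thesis unfolding Q.connected_iff
 proof (intro conjI ballI ne)
  fix S S' assume S: "S : tau_tilting_pairs K B" and S': "S' : tau_tilting_pairs K B"
  obtain T where T: "Phi T S" by (rule Phi_surj[OF gt S])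
  obtain T' where T': "Phi T' S'" by (rule Phi_surj[OF gt S'])
  have "(tclass T, tclass T') : rtrancl_on (tclass ` tau_tilting_pairs K A) {(tclass T, tclass U) | T U. mutation K A T U}"
   using c PhiD(1)[OF T] PhiD(1)[OF T'] unfolding connected_iff by blast
  thus "(Q.tclass S, Q.tclass S') : rtrancl_on (Q.tclass ` tau_tilting_pairs K B) {(Q.tclass T, Q.tclass U) | T U. mutation K B T U}"
   by (rule Phi_reachable[OF _ refl T refl T'])
 qed
qed

end

theorem theorem4p5:
  fixes K :: "'k ring" and A :: "('k, 'a) module" and I :: "'a set"
  assumes "fd_algebra K A"
    and "basic A (regular A)"
    and "g_tame K A"
    and "ideal I A"
    and "Digraph_Component.connected (with_proj (tau_tilting_graph K A))"
  shows "Digraph_Component.connected (with_proj (tau_tilting_graph K (quot_algebra A I)))"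
proof -
 interpret fd_quotient K A I using assms(1,4) by (intro fd_quotient.intro fd_quotient_axioms.intro)
 show ?thesis by (rule quotient_connected[OF assms(3,5)])
qed

end
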